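(* Let $(R,\mathfrak m)$ be a regular local ring with quotient field $F$ and $\dim R\ge 2$, let $\{(R_i,\mathfrak m_i)\}_{i\ge 0}$ be an infinite sequence of local quadratic transforms with $R_0=R$, let $S=\bigcup_{i\ge 0}R_i$ with maximal ideal $N=\bigcup_i\mathfrak m_i$, and let $T$ be the intersection of all discrete valuation rings with quotient field $F$ that properly contain $S$ (an empty intersection being $F$). Then: (1) $T=S[1/x]$ for any $x\in N$ such that $xS$ is $N$-primary; furthermore $T$ is a localization of $R_i$ for all $i\gg 0$; in particular $T$ is a UFD. (2) $T$ is the intersection of all the rings $R_P$, with $P$ a height $1$ prime ideal of $R$, that contain $S$, together with the (at most $\dim R-1$) order valuation rings $V_i$ that contain $S$. (3) $T$ is a Noetherian regular ring which is the unique minimal proper Noetherian overring of $S$ in $F$ (a field being regarded as a zero-dimensional regular ring).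
   Context: A local quadratic transform of a regular local ring $(A,\mathfrak n)$ is a local ring $A[\mathfrak n/x]_{\mathfrak q}$ with $x\in\mathfrak n\setminus\mathfrak n^2$ and $\mathfrak q$ a prime ideal of $A[\mathfrak n/x]$ containing $\mathfrak n$. The sequence satisfies: for each $i\ge 0$, $R_{i+1}$ is a local quadratic transform of $R_i$, $R_i\subsetneq R_{i+1}$, and each $R_i$ is a regular local ring of dimension at least $2$ with maximal ideal $\mathfrak m_i$. $V_i$ denotes the valuation ring of the order valuation $\mathrm{ord}_i$ of $R_i$ ($\mathrm{ord}_i(a)=\max\{n: a\in\mathfrak m_i^n\}$ for $0\ne a\in R_i$, extended to $F$ by $\mathrm{ord}_i(a/b)=\mathrm{ord}_i(a)-\mathrm{ord}_i(b)$). An overring of $S$ is a ring between $S$ and $F$. An ideal is $N$-primary if its radical is $N$. *)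

theory Defs
  imports Main
begin

text \<open>Convention: the quotient field F is the ambient type 'a (class field);
all rings considered (R, R_i, S, T, DVRs, localizations) are subrings of 'a,
represented as sets.\<close>

definition subring :: "'a::field set \<Rightarrow> bool" where
  "subring A \<longleftrightarrow> 0 \<in> A \<and> 1 \<in> A \<and> (\<forall>a\<in>A. \<forall>b\<in>A. a + b \<in> A \<and> a * b \<in> A) \<and> (\<forall>a\<in>A. - a \<in> A)"

definition quotient_field_is_ambient :: "'a::field set \<Rightarrow> bool" where
  "quotient_field_is_ambient A \<longleftrightarrow> (\<forall>z. \<exists>a\<in>A. \<exists>b\<in>A. b \<noteq> 0 \<and> z = a / b)"

definition ideal_in :: "'a::field set \<Rightarrow> 'a set \<Rightarrow> bool" where
  "ideal_in A I \<longleftrightarrow> I \<subseteq> A \<and> 0 \<in> I \<and> (\<forall>a\<in>I. \<forall>b\<in>I. a + b \<in> I) \<and> (\<forall>r\<in>A. \<forall>a\<in>I. r * a \<in> I)"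

definition prime_in :: "'a::field set \<Rightarrow> 'a set \<Rightarrow> bool" where
  "prime_in A P \<longleftrightarrow> ideal_in A P \<and> P \<noteq> A \<and> (\<forall>a\<in>A. \<forall>b\<in>A. a * b \<in> P \<longrightarrow> a \<in> P \<or> b \<in> P)"

definition ideal_span :: "'a::field set \<Rightarrow> 'a set \<Rightarrow> 'a set" where
  "ideal_span A X = {y. \<exists>G c. G \<subseteq> X \<and> finite G \<and> (\<forall>g\<in>G. c g \<in> A) \<and> y = (\<Sum>g\<in>G. c g * g)}"

definition noetherian :: "'a::field set \<Rightarrow> bool" where
  "noetherian A \<longleftrightarrow> subring A \<and> (\<forall>I. ideal_in A I \<longrightarrow> (\<exists>G. finite G \<and> G \<subseteq> I \<and> I = ideal_span A G))"

definition local_ring :: "'a::field set \<Rightarrow> 'a set \<Rightarrow> bool" where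
  "local_ring A m \<longleftrightarrow> subring A \<and> ideal_in A m \<and> m \<noteq> A \<and>
     (\<forall>I. ideal_in A I \<and> I \<noteq> A \<longrightarrow> I \<subseteq> m)"

definition prime_chain_to :: "'a::field set \<Rightarrow> 'a set \<Rightarrow> nat \<Rightarrow> bool" where
  "prime_chain_to A Q n \<longleftrightarrow> (\<exists>P :: nat \<Rightarrow> 'a set. (\<forall>i\<le>n. prime_in A (P i)) \<and>
      (\<forall>i<n. P i \<subset> P (Suc i)) \<and> P n = Q)"

definition krull_dim_is :: "'a::field set \<Rightarrow> nat \<Rightarrow> bool" where
  "krull_dim_is A d \<longleftrightarrow> (\<exists>Q. prime_chain_to A Q d) \<and> \<not> (\<exists>Q. prime_chain_to A Q (Suc d))"

definition height_one_prime :: "'a::field set \<Rightarrow> 'a set \<Rightarrow> bool" where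
  "height_one_prime A P \<longleftrightarrow> prime_in A P \<and> prime_chain_to A P 1 \<and> \<not> prime_chain_to A P 2"

definition regular_local_dim :: "'a::field set \<Rightarrow> 'a set \<Rightarrow> nat \<Rightarrow> bool" where
  "regular_local_dim A m d \<longleftrightarrow> noetherian A \<and> local_ring A m \<and> krull_dim_is A d \<and>
     (\<exists>xs. length xs = d \<and> set xs \<subseteq> m \<and> m = ideal_span A (set xs))"

definition regular_local :: "'a::field set \<Rightarrow> 'a set \<Rightarrow> bool" where
  "regular_local A m \<longleftrightarrow> (\<exists>d. regular_local_dim A m d)"

definition loc_at :: "'a::field set \<Rightarrow> 'a set \<Rightarrow> 'a set" where
  "loc_at B q = {a / b | a b. a \<in> B \<and> b \<in> B \<and> b \<notin> q}"

definition loc_mult :: "'a::field set \<Rightarrow> 'a set \<Rightarrow> 'a set" where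
  "loc_mult B U = {a / u | a u. a \<in> B \<and> u \<in> U}"

definition mult_closed_in :: "'a::field set \<Rightarrow> 'a set \<Rightarrow> bool" where
  "mult_closed_in B U \<longleftrightarrow> U \<subseteq> B \<and> 1 \<in> U \<and> 0 \<notin> U \<and> (\<forall>u\<in>U. \<forall>v\<in>U. u * v \<in> U)"

definition is_localization_of :: "'a::field set \<Rightarrow> 'a set \<Rightarrow> bool" where
  "is_localization_of T B \<longleftrightarrow> (\<exists>U. mult_closed_in B U \<and> T = loc_mult B U)"

definition ring_gen :: "'a::field set \<Rightarrow> 'a set" where
  "ring_gen X = \<Inter>{B. subring B \<and> X \<subseteq> B}"

definition blowup_ring :: "'a::field set \<Rightarrow> 'a set \<Rightarrow> 'a \<Rightarrow> 'a set" where
  "blowup_ring A n x = ring_gen (A \<union> {y / x | y. y \<in> n})"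

definition invert_elem :: "'a::field set \<Rightarrow> 'a \<Rightarrow> 'a set" where
  "invert_elem S x = {s / x ^ k | s k. s \<in> S}"

fun ideal_pow :: "'a::field set \<Rightarrow> 'a set \<Rightarrow> nat \<Rightarrow> 'a set" where
  "ideal_pow A I 0 = A"
| "ideal_pow A I (Suc k) = ideal_span A {a * b | a b. a \<in> ideal_pow A I k \<and> b \<in> I}"

definition local_quadratic_transform :: "'a::field set \<Rightarrow> 'a set \<Rightarrow> 'a set \<Rightarrow> bool" where
  "local_quadratic_transform A n B \<longleftrightarrow>
     (\<exists>x q. x \<in> n \<and> x \<notin> ideal_pow A n 2 \<and> prime_in (blowup_ring A n x) q \<and> n \<subseteq> q \<and>
            B = loc_at (blowup_ring A n x) q)"

text \<open>Order function ord(a) = max{k. a \<in> m^k} (for nonzero a).\<close>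
definition ord_fun :: "'a::field set \<Rightarrow> 'a set \<Rightarrow> 'a \<Rightarrow> nat" where
  "ord_fun A m a = (GREATEST k. a \<in> ideal_pow A m k)"

definition order_valuation_ring :: "'a::field set \<Rightarrow> 'a set \<Rightarrow> 'a set" where
  "order_valuation_ring A m = insert 0 {a / b | a b. a \<in> A \<and> b \<in> A \<and> a \<noteq> 0 \<and> b \<noteq> 0 \<and>
        ord_fun A m b \<le> ord_fun A m a}"

definition dvr :: "'a::field set \<Rightarrow> bool" where
  "dvr V \<longleftrightarrow> (\<exists>v :: 'a \<Rightarrow> int.
      (\<forall>x y. x \<noteq> 0 \<longrightarrow> y \<noteq> 0 \<longrightarrow> v (x * y) = v x + v y) \<and>
      (\<forall>x y. x \<noteq> 0 \<longrightarrow> y \<noteq> 0 \<longrightarrow> x + y \<noteq> 0 \<longrightarrow> min (v x) (v y) \<le> v (x + y)) \<and>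
      (\<exists>t. t \<noteq> 0 \<and> v t = 1) \<and>
      V = {x. x = 0 \<or> 0 \<le> v x})"

definition radical_in :: "'a::field set \<Rightarrow> 'a set \<Rightarrow> 'a set" where
  "radical_in A I = {a \<in> A. \<exists>k. a ^ k \<in> I}"

definition primary_to :: "'a::field set \<Rightarrow> 'a set \<Rightarrow> 'a set \<Rightarrow> bool" where
  "primary_to A N I \<longleftrightarrow> ideal_in A I \<and> radical_in A I = N"

definition unit_in :: "'a::field set \<Rightarrow> 'a \<Rightarrow> bool" where
  "unit_in A a \<longleftrightarrow> a \<in> A \<and> a \<noteq> 0 \<and> inverse a \<in> A"

definition irreducible_in :: "'a::field set \<Rightarrow> 'a \<Rightarrow> bool" where
  "irreducible_in A p \<longleftrightarrow> p \<in> A \<and> p \<noteq> 0 \<and> \<not> unit_in A p \<and>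
     (\<forall>a\<in>A. \<forall>b\<in>A. p = a * b \<longrightarrow> unit_in A a \<or> unit_in A b)"

definition associated_in :: "'a::field set \<Rightarrow> 'a \<Rightarrow> 'a \<Rightarrow> bool" where
  "associated_in A a b \<longleftrightarrow> (\<exists>u. unit_in A u \<and> a = u * b)"

definition ufd :: "'a::field set \<Rightarrow> bool" where
  "ufd A \<longleftrightarrow> subring A \<and>
     (\<forall>a\<in>A. a \<noteq> 0 \<and> \<not> unit_in A a \<longrightarrow>
        (\<exists>xs. xs \<noteq> [] \<and> (\<forall>p\<in>set xs. irreducible_in A p) \<and> a = prod_list xs)) \<and>
     (\<forall>xs ys. (\<forall>p\<in>set xs. irreducible_in A p) \<and> (\<forall>p\<in>set ys. irreducible_in A p) \<and>
        prod_list xs = prod_list ys \<longrightarrow>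
        length xs = length ys \<and>
        (\<exists>f. bij_betw f {..<length xs} {..<length ys} \<and>
             (\<forall>i<length xs. associated_in A (xs ! i) (ys ! f i))))"

text \<open>Regular ring: every localization at a prime is a regular local ring
  (a field is a 0-dimensional regular ring).\<close>
definition regular_ring :: "'a::field set \<Rightarrow> bool" where
  "regular_ring A \<longleftrightarrow> subring A \<and> (\<forall>P. prime_in A P \<longrightarrow>
      regular_local (loc_at A P) {a / b | a b. a \<in> P \<and> b \<in> A \<and> b \<notin> P})"

end

theory Submission imports Defs "Jordan_Normal_Form.Determinant" begin

text \<open>The order valuation ring \<open>V\<^sub>i\<close> is the localization of \<open>R\<^sub>i\<^sub>+\<^sub>1\<close> at a prime element \<open>x\<^sub>i\<close> generating the
  extension of \<open>m\<^sub>i\<close>. The centers on \<open>R\<^sub>j\<close> of the \<open>V\<^sub>k\<close>, \<open>k < j\<close>, containing \<open>R\<^sub>j\<close> are generated by part of a regular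
  system of parameters, so at most \<open>d - 1\<close> of the \<open>V\<^sub>k\<close> contain \<open>S\<close>. For \<open>i\<close> beyond their indices \<open>x\<^sub>i S\<close> is
  \<open>N\<close>-primary, and \<open>S[1/x\<^sub>i]\<close> is a localization of \<open>R\<^sub>i\<close>, hence a Noetherian regular UFD by the theorems of Serre
  and Auslander-Buchsbaum. A Noetherian ring properly containing \<open>S\<close> inverts some \<open>x\<^sub>j\<close> with \<open>j \<ge> i\<close>, so it
  contains \<open>S[1/x\<^sub>i]\<close>; conversely \<open>S[1/x\<^sub>i]\<close> is the intersection of its localizations at prime elements.\<close>

section \<open>Ideals of subrings of a field\<close>

text \<open>A regular local ring is handled as a list of generators of its maximal ideal together
  with a chain of primes of the same length. For one transform both can be constructed by hand,
  adjoining the quotients of the parameters to the ring one at a time. In a localization neither is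
  visible, and this is what forces resolutions and the Koszul complex into the proof. The same
  finite resolution serves again for factoriality: it makes a locally principal prime stably free,
  and a determinant then yields a generator. The bound \<open>d - 1\<close>, rather than
  \<open>d\<close>, comes from the newest divisor: at stage \<open>j + 1\<close> the element
  \<open>x j\<close> and the centers of the earlier valuation rings that survive belong to one
  regular system of parameters, so the permanent survivors always leave one place free, while the
  dimension never grows along the sequence. Beyond the last survivor the elements \<open>x i\<close>
  divide powers of each other in \<open>S\<close>, so inverting any of them gives the same
  ring.\<close>

lemma subring_zero: "subring A ==> 0 \<in> A"
  and subring_one: "subring A ==> 1 \<in> A"
  and subring_add: "subring A ==> a \<in> A ==> b \<in> A ==> a + b \<in> A"
  and subring_mult: "subring A ==> a \<in> A ==> b \<in> A ==> a * b \<in> A"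
  and subring_uminus: "subring A ==> a \<in> A ==> - a \<in> A"
  by (auto simp: subring_def)

lemma subring_diff: "subring A ==> a \<in> A ==> b \<in> A ==> a - b \<in> A"
  using subring_add[of A a "- b"] subring_uminus[of A b] by simp

lemma subring_power: "subring A ==> a \<in> A ==> a ^ k \<in> A"
  by (induction k) (auto simp: subring_one subring_mult)

lemma subring_sum: "subring A ==> (\<And>i. i \<in> I ==> f i \<in> A) ==> sum f I \<in> A"
  by (induction I rule: infinite_finite_induct) (auto simp: subring_zero subring_add)

lemma subring_prod: "subring A ==> (\<And>i. i \<in> I ==> f i \<in> A) ==> prod f I \<in> A"
  by (induction I rule: infinite_finite_induct) (auto simp: subring_one subring_mult)

lemma subring_prod_list: "subring A ==> set xs \<subseteq> A ==> prod_list xs \<in> A"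
  by (induction xs) (auto simp: subring_one subring_mult)

lemmas subring_closed = subring_zero subring_one subring_add subring_mult subring_uminus
  subring_diff subring_power

lemma ideal_sub: "ideal_in A I ==> a \<in> I ==> a \<in> A"
  and ideal_subset: "ideal_in A I ==> I \<subseteq> A"
  and ideal_zero: "ideal_in A I ==> 0 \<in> I"
  and ideal_add: "ideal_in A I ==> a \<in> I ==> b \<in> I ==> a + b \<in> I"
  and ideal_mult: "ideal_in A I ==> r \<in> A ==> a \<in> I ==> r * a \<in> I"
  by (auto simp: ideal_in_def)

lemma ideal_mult_right: "ideal_in A I ==> r \<in> A ==> a \<in> I ==> a * r \<in> I"
  using ideal_mult[of A I r a] by (simp add: mult.commute)

lemma ideal_uminus: "subring A ==> ideal_in A I ==> a \<in> I ==> - a \<in> I"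
  using ideal_mult[of A I "- 1" a] by (simp add: subring_closed)

lemma ideal_diff: "subring A ==> ideal_in A I ==> a \<in> I ==> b \<in> I ==> a - b \<in> I"
  using ideal_add[of A I a "- b"] ideal_uminus[of A I b] by simp

lemma ideal_sum: "ideal_in A I ==> (\<And>i. i \<in> K ==> f i \<in> I) ==> sum f K \<in> I"
  by (induction K rule: infinite_finite_induct) (auto simp: ideal_zero ideal_add)

lemma ideal_eq_ring: "ideal_in A I ==> 1 \<in> I ==> I = A"
  using ideal_mult[of A I _ 1] ideal_sub[of A I] by auto

lemma ideal_ring: "subring A ==> ideal_in A A"
  by (auto simp: ideal_in_def subring_closed)

lemma ideal_zero_ideal: "subring A ==> ideal_in A {0}"
  by (auto simp: ideal_in_def subring_closed)

lemma prime_ideal: "prime_in A P ==> ideal_in A P"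
  by (simp add: prime_in_def)

lemma prime_zero: "prime_in A P ==> 0 \<in> P"
  by (auto simp: prime_in_def ideal_in_def)

lemma prime_not_one: "prime_in A P ==> 1 \<notin> P"
  using ideal_eq_ring[of A P] by (auto simp: prime_in_def)

lemma prime_mult: "prime_in A P ==> a \<in> A ==> b \<in> A ==> a * b \<in> P ==> a \<in> P \<or> b \<in> P"
  by (simp add: prime_in_def)

lemma prime_power: "subring A ==> prime_in A P ==> a \<in> A ==> a ^ k \<in> P ==> a \<in> P"
proof (induction k)
  case (Suc k) then show ?case using prime_mult[of A P a "a ^ k"] by (auto simp: subring_closed)
qed (auto simp: prime_not_one)

lemma prime_prod:
  assumes sA: "subring A" and P: "prime_in A P"
  shows "(\<And>i. i < k ==> f i \<in> A) ==> (\<And>i. i < k ==> f i \<notin> P) ==> prod f {..<k::nat} \<notin> P"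
proof (induction k)
  case (Suc k)
  have "prod f {..<k} \<in> A" using Suc.prems by (intro subring_prod[OF sA]) simp
  then show ?case using Suc prime_mult[OF P, of "prod f {..<k}" "f k"] by (auto simp: mult.commute)
qed (use prime_not_one[OF P] in simp)

lemma prime_inI:
  assumes "ideal_in A P" "1 \<notin> P" "1 \<in> A"
    "\<And>a b. a \<in> A ==> b \<in> A ==> a * b \<in> P ==> a \<notin> P ==> b \<in> P"
  shows "prime_in A P"
  using assms by (auto simp: prime_in_def)

lemma prime_zero_ideal: "subring A ==> prime_in A {0}"
  by (rule prime_inI) (auto simp: ideal_zero_ideal subring_closed)

section \<open>Adjoining generators to an ideal\<close>

definition adj :: "'a::field set => 'a set => 'a => 'a set" where
  "adj A J x = {j + a * x | j a. j \<in> J \<and> a \<in> A}"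

lemma adj_memI: "j \<in> J ==> a \<in> A ==> z = j + a * x ==> z \<in> adj A J x"
  by (auto simp: adj_def)

lemma adj_memE:
  assumes "z \<in> adj A J x" obtains j a where "j \<in> J" "a \<in> A" "z = j + a * x"
  using assms by (auto simp: adj_def)

lemma adj_ideal:
  assumes "subring A" "ideal_in A J" "x \<in> A" shows "ideal_in A (adj A J x)"
  unfolding ideal_in_def
proof (intro conjI ballI subsetI)
  show "0 \<in> adj A J x"
    by (rule adj_memI[of 0 _ 0]) (auto simp: ideal_zero[OF assms(2)] subring_zero[OF assms(1)])
  fix z assume z: "z \<in> adj A J x"
  obtain j a where ja: "j \<in> J" "a \<in> A" "z = j + a * x" using z by (rule adj_memE)
  show "z \<in> A" using ja assms by (auto simp: subring_closed dest: ideal_sub)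
  { fix w assume w: "w \<in> adj A J x"
    obtain j' a' where ja': "j' \<in> J" "a' \<in> A" "w = j' + a' * x" using w by (rule adj_memE)
    show "z + w \<in> adj A J x"
      by (rule adj_memI[of "j + j'" _ "a + a'"])
        (use ja ja' assms in \<open>auto simp: subring_closed ideal_add algebra_simps\<close>) }
  fix r assume r: "r \<in> A"
  show "r * z \<in> adj A J x"
    by (rule adj_memI[of "r * j" _ "r * a"])
      (use ja(2,3) r assms ideal_mult[OF assms(2) r ja(1)] in \<open>auto simp: subring_closed distrib_left mult.assoc\<close>)
qed

lemma adj_sub: "subring A ==> J \<subseteq> adj A J x"
proof
  fix z assume "subring A" "z \<in> J"
  then show "z \<in> adj A J x" by (intro adj_memI[of z _ 0]) (auto simp: subring_closed)
qed

lemma adj_mem: "subring A ==> ideal_in A J ==> x \<in> adj A J x"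
  by (rule adj_memI[of 0 _ 1]) (auto simp: subring_closed ideal_zero[of A])

lemma adj_least: "ideal_in A I ==> J \<subseteq> I ==> x \<in> I ==> adj A J x \<subseteq> I"
  by (auto simp: adj_def intro!: ideal_add ideal_mult)

lemma adj_mono: "J \<subseteq> J' ==> adj A J x \<subseteq> adj A J' x"
  by (auto simp: adj_def)

text \<open>This is \<open>J + (y 0, ..., y (n - 1))\<close>. Keeping the start ideal
  \<open>J\<close> variable replaces the passage to the quotient by \<open>J\<close>, and generators
  can be removed from either end.\<close>

primrec gen :: "'a::field set => 'a set => (nat => 'a) => nat => 'a set" where
  "gen A J y 0 = J"
| "gen A J y (Suc n) = adj A (gen A J y n) (y n)"

abbreviation igen :: "'a::field set => (nat => 'a) => nat => 'a set" where
  "igen A \<equiv> gen A {0}"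

lemma gen_ideal:
  "subring A ==> ideal_in A J ==> (\<And>i. i < n ==> y i \<in> A) ==> ideal_in A (gen A J y n)"
  by (induction n) (auto intro!: adj_ideal)

lemma igen_ideal: "subring A ==> (\<And>i. i < n ==> y i \<in> A) ==> ideal_in A (igen A y n)"
  by (rule gen_ideal[OF _ ideal_zero_ideal])

lemma gen_mono_n: "subring A ==> k \<le> n ==> gen A J y k \<subseteq> gen A J y n"
  using adj_sub by (induction n) (fastforce simp: le_Suc_eq)+

lemma gen_mem:
  assumes "subring A" "ideal_in A J" "\<And>i. i < n ==> y i \<in> A" "i < n"
  shows "y i \<in> gen A J y n"
proof -
  have "y i \<in> gen A J y (Suc i)"
    using assms by (auto intro!: adj_mem gen_ideal)
  then show ?thesis using gen_mono_n[of A "Suc i" n J y] assms by auto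
qed

lemma gen_least:
  "ideal_in A I ==> J \<subseteq> I ==> (\<And>i. i < n ==> y i \<in> I) ==> gen A J y n \<subseteq> I"
proof (induction n)
  case (Suc n) then show ?case using adj_least[of A I "gen A J y n" "y n"] by simp
qed simp

lemma gen_mono: "J \<subseteq> J' ==> gen A J y n \<subseteq> gen A J' y n"
  by (induction n) (auto dest: adj_mono)

lemma gen_cong: "(\<And>i. i < n ==> y i = y' i) ==> gen A J y n = gen A J y' n"
  by (induction n) auto

text \<open>Absorbing \<open>y 0\<close> into the start ideal is the form needed by inductions that
  remove the first generator instead of the last.\<close>

lemma gen_Suc_shift: "gen A J y (Suc n) = gen A (adj A J (y 0)) (\<lambda>i. y (Suc i)) n"
  by (induction n) auto

lemma igen_iff:
  "subring A ==> z \<in> gen A J y n \<longleftrightarrow> (\<exists>j\<in>J. \<exists>c. (\<forall>l<n. c l \<in> A) \<and> z = j + (\<Sum>l<n. c l * y l))"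
proof (induction n arbitrary: z)
  case (Suc n)
  show ?case
  proof
    assume z: "z \<in> gen A J y (Suc n)"
    then obtain w a where "w \<in> gen A J y n" "a \<in> A" "z = w + a * y n" by (auto elim: adj_memE)
    moreover from this Suc obtain j c where "j \<in> J" "\<forall>l<n. c l \<in> A" "w = j + (\<Sum>l<n. c l * y l)"
      by blast
    ultimately show "\<exists>j\<in>J. \<exists>c. (\<forall>l<Suc n. c l \<in> A) \<and> z = j + (\<Sum>l<Suc n. c l * y l)"
      by (intro bexI[of _ j] exI[of _ "c(n := a)"]) (auto simp: less_Suc_eq add.assoc intro!: sum.cong)
  next
    assume "\<exists>j\<in>J. \<exists>c. (\<forall>l<Suc n. c l \<in> A) \<and> z = j + (\<Sum>l<Suc n. c l * y l)"
    then obtain j c where *: "j \<in> J" "\<forall>l<Suc n. c l \<in> A" "z = j + (\<Sum>l<Suc n. c l * y l)" by blast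
    have "j + (\<Sum>l<n. c l * y l) \<in> gen A J y n"
      unfolding Suc.IH[OF Suc.prems] using *(1,2) by (intro bexI[of _ j] exI[of _ c]) auto
    then show "z \<in> gen A J y (Suc n)"
      using * by (auto intro!: adj_memI[where a = "c n"] simp: add.assoc)
  qed
qed auto

lemma igen_sumE:
  assumes "subring A" "z \<in> igen A y n"
  obtains c where "\<forall>l<n. c l \<in> A" "z = (\<Sum>l<n. c l * y l)"
  using igen_iff[OF assms(1), of z "{0}" y n] assms(2) by auto

lemma igen_sumI: "subring A ==> \<forall>l<n. c l \<in> A ==> (\<Sum>l<n. c l * y l) \<in> igen A y n"
  using igen_iff[of A _ "{0}" y n] by auto

lemma ideal_span_least: "ideal_in A I ==> X \<subseteq> I ==> ideal_span A X \<subseteq> I"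
  by (auto simp: ideal_span_def intro!: ideal_sum ideal_mult)

lemma ideal_span_mem: "subring A ==> x \<in> X ==> x \<in> ideal_span A X"
  unfolding ideal_span_def
  by (auto intro!: exI[of _ "{x}"] exI[of _ "\<lambda>_. 1"] simp: subring_closed)

lemma ideal_span_ideal:
  assumes "subring A" "X \<subseteq> A" shows "ideal_in A (ideal_span A X)"
  unfolding ideal_in_def
proof (intro conjI ballI subsetI)
  show "0 \<in> ideal_span A X" unfolding ideal_span_def by (auto intro!: exI[of _ "{}"])
  fix z assume "z \<in> ideal_span A X"
  then obtain G c where z: "G \<subseteq> X" "finite G" "\<forall>g\<in>G. c g \<in> A" "z = (\<Sum>g\<in>G. c g * g)"
    by (auto simp: ideal_span_def)
  show "z \<in> A" using z assms by (auto intro!: subring_sum subring_mult)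
  { fix w assume "w \<in> ideal_span A X"
    then obtain H e where w: "H \<subseteq> X" "finite H" "\<forall>g\<in>H. e g \<in> A" "w = (\<Sum>g\<in>H. e g * g)"
      by (auto simp: ideal_span_def)
    let ?c = "\<lambda>g. (if g \<in> G then c g else 0) + (if g \<in> H then e g else 0)"
    have 1: "z = (\<Sum>g\<in>G \<union> H. (if g \<in> G then c g else 0) * g)"
      unfolding z(4) using z w by (intro sum.mono_neutral_cong_left) auto
    have 2: "w = (\<Sum>g\<in>G \<union> H. (if g \<in> H then e g else 0) * g)"
      unfolding w(4) using z w by (intro sum.mono_neutral_cong_left) auto
    have "z + w = (\<Sum>g\<in>G \<union> H. ?c g * g)"
      unfolding distrib_right sum.distrib 1[symmetric] 2[symmetric] ..
    moreover have "\<forall>g\<in>G \<union> H. ?c g \<in> A" using z w assms by (auto intro!: subring_add subring_zero)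
    ultimately show "z + w \<in> ideal_span A X" unfolding ideal_span_def using z w
      by (intro CollectI exI[of _ "G \<union> H"] exI[of _ ?c]) auto }
  fix r assume r: "r \<in> A"
  have "r * z = (\<Sum>g\<in>G. (r * c g) * g)" unfolding z(4) sum_distrib_left by (simp add: mult.assoc)
  then show "r * z \<in> ideal_span A X" unfolding ideal_span_def using z r assms
    by (intro CollectI exI[of _ G] exI[of _ "\<lambda>g. r * c g"]) (auto intro: subring_mult)
qed

text \<open>The bridge from the generating sets of the definitions to indexed generators.\<close>

lemma ideal_span_list:
  assumes "subring A" "set xs \<subseteq> A"
  shows "ideal_span A (set xs) = igen A (\<lambda>i. xs ! i) (length xs)"
proof
  have i: "ideal_in A (igen A (\<lambda>i. xs ! i) (length xs))"
    using assms by (intro igen_ideal) (auto dest: nth_mem)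
  show "ideal_span A (set xs) \<subseteq> igen A (\<lambda>i. xs ! i) (length xs)"
    using assms by (intro ideal_span_least[OF i])
      (auto simp: in_set_conv_nth intro!: gen_mem ideal_zero_ideal subsetD[OF assms(2) nth_mem])
  show "igen A (\<lambda>i. xs ! i) (length xs) \<subseteq> ideal_span A (set xs)"
    using assms ideal_span_ideal[OF assms]
    by (intro gen_least) (auto intro!: ideal_span_mem ideal_zero)
qed

section \<open>Noetherian rings and prime ideals\<close>

lemma noeth_subring: "noetherian A ==> subring A"
  by (simp add: noetherian_def)

lemma noeth_fg:
  assumes "noetherian A" "ideal_in A I"
  obtains n y where "\<And>i. i < n ==> y i \<in> I" "I = igen A y n"
proof -
  obtain G where G: "finite G" "G \<subseteq> I" "I = ideal_span A G"
    using assms by (auto simp: noetherian_def)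
  obtain xs where xs: "set xs = G" using G finite_list by blast
  show ?thesis
  proof (rule that[of "length xs" "\<lambda>i. xs ! i"])
    show "xs ! i \<in> I" if "i < length xs" for i using that xs G nth_mem by blast
    show "I = igen A (\<lambda>i. xs ! i) (length xs)"
      using ideal_span_list[of A xs] xs G ideal_subset[OF assms(2)] assms(1)
      by (simp add: noetherian_def)
  qed
qed

lemma noetherianI:
  assumes "subring A"
    "\<And>I. ideal_in A I ==> \<exists>n y. (\<forall>i<n. y i \<in> I) \<and> I \<subseteq> igen A y n"
  shows "noetherian A"
  unfolding noetherian_def
proof (intro conjI allI impI assms(1))
  fix I assume I: "ideal_in A I"
  then obtain n y where ny: "\<forall>i<n. y i \<in> I" "I \<subseteq> igen A y n" using assms by blast
  let ?G = "y ` {..<n}"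
  have G: "?G \<subseteq> I" using ny by auto
  then have "ideal_span A ?G \<subseteq> I" by (rule ideal_span_least[OF I])
  moreover have "ideal_in A (ideal_span A ?G)"
    using assms(1) G I by (intro ideal_span_ideal) (auto dest: ideal_sub)
  then have "igen A y n \<subseteq> ideal_span A ?G"
    using assms(1) by (intro gen_least) (auto intro!: ideal_span_mem ideal_zero)
  ultimately show "\<exists>G. finite G \<and> G \<subseteq> I \<and> I = ideal_span A G" using ny G by (intro exI[of _ ?G]) auto
qed

lemma noeth_acc:
  assumes "noetherian A" "\<And>i. ideal_in A (I i)" "\<And>i. I i \<subseteq> I (Suc i)"
  shows "\<exists>N. \<forall>i\<ge>N. I i = I N"
proof -
  have mono: "I i \<subseteq> I j" if "i \<le> j" for i j using lift_Suc_mono_le[of I] assms(3) that by blast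
  let ?U = "\<Union>i. I i"
  have U: "ideal_in A ?U"
    unfolding ideal_in_def
  proof (intro conjI ballI subsetI)
    fix a b assume "a \<in> ?U" "b \<in> ?U"
    then obtain i j where "a \<in> I i" "b \<in> I j" by auto
    then have "a \<in> I (max i j)" "b \<in> I (max i j)" using mono[of i "max i j"] mono[of j "max i j"] by auto
    then show "a + b \<in> ?U" using ideal_add[OF assms(2)] by blast
  next
    show "x \<in> A" if "x \<in> ?U" for x using that ideal_sub[OF assms(2)] by blast
    show "0 \<in> ?U" using ideal_zero[OF assms(2)] by blast
    show "r * a \<in> ?U" if "r \<in> A" "a \<in> ?U" for r a using that ideal_mult[OF assms(2)] by blast
  qed
  obtain n y where y: "\<And>i. i < n ==> y i \<in> ?U" "?U = igen A y n" using noeth_fg[OF assms(1) U] by blast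
  have "\<forall>i. \<exists>k. i < n --> y i \<in> I k" using y(1) by blast
  then obtain f where f: "\<And>i. i < n ==> y i \<in> I (f i)" by metis
  \<comment> \<open>Only an upper bound of all \<open>f i\<close> matters; a sum avoids the maximum
    of a possibly empty set.\<close>
  define N where "N = (\<Sum>i<n. f i)"
  have "f i \<le> N" if "i < n" for i unfolding N_def using that by (intro member_le_sum) auto
  then have "y i \<in> I N" if "i < n" for i using f mono that by blast
  then have "?U \<subseteq> I N" unfolding y(2) using assms(2) by (intro gen_least) (auto intro: ideal_zero)
  then show ?thesis using mono by blast
qed

lemma noeth_max:
  assumes "noetherian A" "P I" "\<And>I. P I ==> ideal_in A I"
  obtains J where "P J" "\<And>K. P K ==> J \<subseteq> K ==> K = J"
proof (rule ccontr)
  assume "\<not> thesis"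
  then have "\<And>J. P J ==> \<exists>K. P K \<and> J \<subset> K" using that by blast
  then have "\<exists>f. \<forall>n. P (f n) \<and> f n \<subset> f (Suc n)"
    using dependent_nat_choice[of "\<lambda>_. P" "\<lambda>_ J K. J \<subset> K"] assms(2) by metis
  then obtain f where f: "\<And>n. P (f n)" "\<And>n. f n \<subset> f (Suc n)" by blast
  then have "\<exists>N. \<forall>i\<ge>N. f i = f N" using assms by (intro noeth_acc[of A f]) auto
  then show False using f by (metis le_SucI order_refl psubset_eq)
qed

lemma noeth_induct:
  assumes "noetherian A" "ideal_in A I"
    "\<And>I. ideal_in A I ==> (\<And>J. ideal_in A J ==> I \<subset> J ==> P J) ==> P I"
  shows "P I"
proof (rule ccontr)
  assume "\<not> P I"
  then have "\<not> P I \<and> ideal_in A I" using assms by simp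
  from noeth_max[of A "\<lambda>I. \<not> P I \<and> ideal_in A I", OF assms(1) this]
  obtain J where J: "\<not> P J \<and> ideal_in A J"
    "\<And>K. \<not> P K \<and> ideal_in A K ==> J \<subseteq> K ==> K = J" by metis
  then show False using assms(3)[of J] by (metis psubset_eq)
qed

section \<open>Colon ideals and associated primes\<close>

definition colon :: "'a::field set => 'a set => 'a => 'a set" where
  "colon A J a = {z \<in> A. z * a \<in> J}"

lemma colon_ideal: "subring A ==> ideal_in A J ==> a \<in> A ==> ideal_in A (colon A J a)"
  by (auto simp: ideal_in_def colon_def subring_closed distrib_right mult.assoc)

lemma colon_sub: "ideal_in A J ==> a \<in> A ==> J \<subseteq> colon A J a"
  by (auto simp: colon_def intro: ideal_mult_right ideal_sub)

text \<open>A maximal member of the family of ideals \<open>colon A J c\<close> with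
  \<open>c\<close> outside \<open>J\<close> is prime, an associated prime of \<open>A / J\<close>;
  the search can start above any given \<open>colon A J a\<close>.\<close>

lemma assoc_prime_exists:
  assumes A: "noetherian A" and J: "ideal_in A J" and a: "a \<in> A" "a \<notin> J"
  obtains c where "c \<in> A" "c \<notin> J" "prime_in A (colon A J c)" "colon A J a \<subseteq> colon A J c"
proof -
  have sA: "subring A" using A by (rule noeth_subring)
  let ?P = "\<lambda>I. \<exists>c\<in>A. c \<notin> J \<and> I = colon A J c \<and> colon A J a \<subseteq> I"
  obtain I where I: "?P I" "\<And>K. ?P K ==> I \<subseteq> K ==> K = I"
    by (rule noeth_max[of A ?P "colon A J a"]) (use a A J sA in \<open>auto intro: colon_ideal\<close>)
  then obtain c where c: "c \<in> A" "c \<notin> J" "I = colon A J c" "colon A J a \<subseteq> I" by blast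
  have "prime_in A I"
  proof (rule prime_inI)
    show "ideal_in A I" unfolding c by (rule colon_ideal[OF sA J c(1)])
    show "1 \<notin> I" using c by (auto simp: colon_def)
    show "1 \<in> A" using sA by (rule subring_one)
    fix x y assume xy: "x \<in> A" "y \<in> A" "x * y \<in> I" "x \<notin> I"
    have "I \<subseteq> colon A J (x * c)"
      unfolding c colon_def using xy J by (auto simp: mult.left_commute[of _ x] intro: ideal_mult)
    moreover have "x * c \<in> A" "x * c \<notin> J" using xy c sA by (auto simp: subring_closed colon_def)
    ultimately have "colon A J (x * c) = I" using I(2)[of "colon A J (x * c)"] c by blast
    then show "y \<in> I" using xy c by (auto simp: colon_def mult_ac)
  qed
  then show ?thesis using that c by blast
qed

text \<open>An ideal maximal among those that contain \<open>I\<close> and miss all powers of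
  \<open>a\<close> is prime. With \<open>a = 1\<close> it yields a prime above a proper
  ideal.\<close>

lemma prime_avoiding_powers:
  assumes A: "noetherian A" and I: "ideal_in A I" and a: "a \<in> A" "\<And>k. a ^ k \<notin> I"
  obtains Q where "prime_in A Q" "I \<subseteq> Q" "a \<notin> Q"
proof -
  have sA: "subring A" using A by (rule noeth_subring)
  let ?P = "\<lambda>J. ideal_in A J \<and> I \<subseteq> J \<and> (\<forall>k. a ^ k \<notin> J)"
  obtain Q where Q: "?P Q" "\<And>K. ?P K ==> Q \<subseteq> K ==> K = Q"
    by (rule noeth_max[of A ?P I]) (use a A I in auto)
  have *: "\<exists>k. a ^ k \<in> adj A Q x" if "x \<in> A" "x \<notin> Q" for x
    using Q(2)[of "adj A Q x"] adj_sub[OF sA, of Q x] adj_mem[OF sA, of Q x] adj_ideal[OF sA, of Q x]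
      Q(1) that by blast
  have "prime_in A Q"
  proof (rule prime_inI)
    show "ideal_in A Q" using Q by blast
    show "1 \<notin> Q" using Q by (metis power_0)
    show "1 \<in> A" using sA by (rule subring_one)
    fix x y assume xy: "x \<in> A" "y \<in> A" "x * y \<in> Q" "x \<notin> Q"
    show "y \<in> Q"
    proof (rule ccontr)
      assume "y \<notin> Q"
      then obtain k l where "a ^ k \<in> adj A Q x" "a ^ l \<in> adj A Q y" using * xy by blast
      then obtain p u q v where pq: "p \<in> Q" "u \<in> A" "a ^ k = p + u * x" "q \<in> Q" "v \<in> A" "a ^ l = q + v * y"
        by (metis adj_memE)
      have "a ^ (k + l) = (q + v * y) * p + (u * x) * q + (u * v) * (x * y)"
        unfolding power_add pq by (simp add: algebra_simps)
      also have "\<dots> \<in> Q"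
      proof -
        have iQ: "ideal_in A Q" using Q(1) by simp
        have "q \<in> A" using ideal_sub[OF iQ] pq by blast
        then show ?thesis using pq xy sA
          by (auto intro!: ideal_add[OF iQ] intro: ideal_mult[OF iQ _ pq(1)] ideal_mult[OF iQ _ pq(4)]
              ideal_mult[OF iQ _ xy(3)] simp: subring_closed)
      qed
      finally show False using Q by blast
    qed
  qed
  then show ?thesis using that[of Q] Q(1) by (metis power_one_right)
qed

lemma prime_above:
  assumes "noetherian A" "ideal_in A I" "1 \<notin> I"
  obtains Q where "prime_in A Q" "I \<subseteq> Q"
  using prime_avoiding_powers[of A I 1] assms by (auto simp: noeth_subring subring_one)

section \<open>Local rings\<close>

lemma local_subring: "local_ring A m ==> subring A"
  and local_ideal: "local_ring A m ==> ideal_in A m"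
  by (auto simp: local_ring_def)

lemma local_not_one: "local_ring A m ==> 1 \<notin> m"
  using ideal_eq_ring[of A m] by (auto simp: local_ring_def)

lemma local_unit:
  assumes "local_ring A m" "a \<in> A" "a \<notin> m" shows "inverse a \<in> A" "a \<noteq> 0"
proof -
  have sA: "subring A" using assms by (auto simp: local_ring_def)
  have i: "ideal_in A (adj A {0} a)" by (rule adj_ideal[OF sA ideal_zero_ideal[OF sA] assms(2)])
  have "a \<in> adj A {0} a" by (rule adj_mem[OF sA ideal_zero_ideal[OF sA]])
  then have "adj A {0} a = A" using i assms by (auto simp: local_ring_def)
  then have "1 \<in> adj A {0} a" using sA by (simp add: subring_one)
  then obtain b where b: "b \<in> A" "1 = b * a" by (auto elim: adj_memE)
  then show "a \<noteq> 0" by auto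
  then show "inverse a \<in> A" using b inverse_unique[of a b] by (simp add: mult.commute)
qed

lemma local_nonunit:
  assumes "local_ring A m" "a \<in> m" "inverse a \<in> A" shows "a = 0"
proof (rule ccontr)
  assume "a \<noteq> 0"
  then have "1 \<in> m" using ideal_mult[OF local_ideal[OF assms(1)] assms(3,2)] by simp
  then show False using local_not_one[OF assms(1)] by simp
qed

lemma local_prime: assumes "local_ring A m" shows "prime_in A m"
proof (rule prime_inI)
  show "1 \<in> A" "ideal_in A m" using assms by (auto simp: local_ring_def subring_one)
  show "1 \<notin> m" using assms by (rule local_not_one)
  fix a b assume ab: "a \<in> A" "b \<in> A" "a * b \<in> m" "a \<notin> m"
  then have "inverse a \<in> A" "a \<noteq> 0" using local_unit[OF assms] by auto
  then have "inverse a * (a * b) \<in> m" using ab assms local_ideal ideal_mult by blast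
  then show "b \<in> m" using \<open>a \<noteq> 0\<close> by (simp add: mult.assoc[symmetric])
qed

lemma local_max: "local_ring A m ==> prime_in A P ==> P \<subseteq> m"
  by (auto simp: local_ring_def prime_in_def)

lemma local_one_minus:
  assumes "local_ring A m" "a \<in> m" shows "inverse (1 - a) \<in> A" "1 - a \<noteq> 0"
proof -
  have "1 - a \<in> A" using ideal_sub[OF local_ideal[OF assms(1)] assms(2)] local_subring[OF assms(1)]
    by (simp add: subring_closed)
  moreover have "1 - a \<notin> m"
    using local_not_one[OF assms(1)] ideal_add[OF local_ideal[OF assms(1)] _ assms(2), of "1 - a"] by auto
  ultimately show "inverse (1 - a) \<in> A" "1 - a \<noteq> 0" using local_unit[OF assms(1)] by blast+
qed

section \<open>Localization\<close>

lemma loc_memI: "a \<in> I ==> u \<in> U ==> z = a / u ==> z \<in> loc_mult I U"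
  by (auto simp: loc_mult_def)

lemma loc_memE:
  assumes "z \<in> loc_mult I U" obtains a u where "a \<in> I" "u \<in> U" "z = a / u"
  using assms by (auto simp: loc_mult_def)

context
  fixes A U :: "'a::field set"
  assumes sA: "subring A" and U: "mult_closed_in A U"
begin

lemma loc_U: "u \<in> U ==> u \<in> A" "u \<in> U ==> u \<noteq> 0" "1 \<in> U" "u \<in> U ==> v \<in> U ==> u * v \<in> U"
  using U by (auto simp: mult_closed_in_def)

lemma loc_incl: "I \<subseteq> loc_mult I U"
  using loc_U(3) by (auto intro!: loc_memI[of _ _ 1])

lemma loc_inverse: "u \<in> U ==> inverse u \<in> loc_mult A U"
  by (rule loc_memI[of 1 _ u]) (auto simp: inverse_eq_divide sA subring_one)

lemma loc_add_gen:
  assumes "ideal_in A I" "z \<in> loc_mult I U" "w \<in> loc_mult I U" shows "z + w \<in> loc_mult I U"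
proof -
  obtain a u b v where *: "a \<in> I" "u \<in> U" "z = a / u" "b \<in> I" "v \<in> U" "w = b / v"
    using assms by (metis loc_memE)
  have "a * v + b * u \<in> I" "u * v \<in> U"
    using * assms loc_U by (auto intro!: ideal_add ideal_mult_right)
  then show ?thesis
    by (rule loc_memI) (use * loc_U in \<open>auto simp: field_simps\<close>)
qed

lemma loc_mult_gen:
  assumes "ideal_in A I" "z \<in> loc_mult A U" "w \<in> loc_mult I U" shows "z * w \<in> loc_mult I U"
proof -
  obtain a u b v where *: "a \<in> A" "u \<in> U" "z = a / u" "b \<in> I" "v \<in> U" "w = b / v"
    using assms by (metis loc_memE)
  have "a * b \<in> I" "u * v \<in> U"
    using * assms loc_U by (auto intro!: ideal_mult)
  then show ?thesis
    by (rule loc_memI) (use * loc_U in \<open>auto simp: field_simps\<close>)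
qed

lemma loc_subring: "subring (loc_mult A U)"
proof -
  have i: "ideal_in A A" by (rule ideal_ring[OF sA])
  have "- z \<in> loc_mult A U" if "z \<in> loc_mult A U" for z
    using that
  proof (rule loc_memE)
    fix a u assume "a \<in> A" "u \<in> U" "z = a / u"
    then show ?thesis using sA by (intro loc_memI[of "- a" _ u]) (auto simp: subring_closed)
  qed
  then show ?thesis
    using loc_add_gen[OF i] loc_mult_gen[OF i] loc_incl[of A] sA
    by (auto simp: subring_def)
qed

lemma loc_ideal: assumes "ideal_in A I" shows "ideal_in (loc_mult A U) (loc_mult I U)"
  unfolding ideal_in_def
proof (intro conjI ballI)
  show "loc_mult I U \<subseteq> loc_mult A U" using ideal_subset[OF assms] by (auto simp: loc_mult_def)
  show "0 \<in> loc_mult I U" using loc_incl[of I] ideal_zero[OF assms] by blast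
qed (auto intro: loc_add_gen[OF assms] loc_mult_gen[OF assms])

lemma contr_ideal: "ideal_in (loc_mult A U) J ==> ideal_in A (J \<inter> A)"
  using loc_incl[of A] sA unfolding ideal_in_def by (auto simp: subring_closed)

text \<open>Multiplying by its denominator brings a fraction of \<open>J\<close> back into
  \<open>A\<close>. So every ideal of the localization is extended, and finite generation carries
  over.\<close>

lemma loc_contr: assumes "ideal_in (loc_mult A U) J" shows "loc_mult (J \<inter> A) U = J"
proof
  show "loc_mult (J \<inter> A) U \<subseteq> J"
  proof
    fix z assume "z \<in> loc_mult (J \<inter> A) U"
    then obtain a u where "a \<in> J" "u \<in> U" "z = a / u" by (auto elim: loc_memE)
    then show "z \<in> J" using ideal_mult[OF assms loc_inverse, of u a] by (simp add: field_simps)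
  qed
  show "J \<subseteq> loc_mult (J \<inter> A) U"
  proof
    fix z assume z: "z \<in> J"
    then obtain a u where au: "a \<in> A" "u \<in> U" "z = a / u" using ideal_sub[OF assms] by (metis loc_memE)
    have "u * z \<in> J" using ideal_mult[OF assms _ z] loc_U au loc_incl[of A] by blast
    then show "z \<in> loc_mult (J \<inter> A) U" using au loc_U by (intro loc_memI[of a _ u]) auto
  qed
qed

lemma loc_gen:
  assumes I: "I = igen A y n" "\<And>i. i < n ==> y i \<in> A"
  shows "loc_mult I U = igen (loc_mult A U) y n"
proof
  have iI: "ideal_in A I" unfolding I using sA I by (intro igen_ideal) auto
  have yL: "y i \<in> loc_mult A U" if "i < n" for i using I that loc_incl[of A] by auto
  have iL: "ideal_in (loc_mult A U) (igen (loc_mult A U) y n)"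
    using yL by (intro igen_ideal loc_subring) auto
  have "I \<subseteq> igen (loc_mult A U) y n \<inter> A" unfolding I
    using I sA contr_ideal[OF iL] gen_mem[OF loc_subring ideal_zero_ideal[OF loc_subring], of n y] yL iL
    by (intro gen_least) (auto intro: ideal_zero subring_zero)
  then have "loc_mult I U \<subseteq> loc_mult (igen (loc_mult A U) y n \<inter> A) U"
    unfolding loc_mult_def by blast
  then show "loc_mult I U \<subseteq> igen (loc_mult A U) y n" using loc_contr[OF iL] by simp
  show "igen (loc_mult A U) y n \<subseteq> loc_mult I U"
    using loc_incl[of I] gen_mem[OF sA ideal_zero_ideal[OF sA], of n y] I ideal_zero[OF iI]
    by (intro gen_least[OF loc_ideal[OF iI]]) auto
qed

lemma loc_noeth: assumes "noetherian A" shows "noetherian (loc_mult A U)"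
proof (rule noetherianI[OF loc_subring])
  fix J assume J: "ideal_in (loc_mult A U) J"
  obtain n y where ny: "\<And>i. i < n ==> y i \<in> J \<inter> A" "J \<inter> A = igen A y n"
    using noeth_fg[OF assms contr_ideal[OF J]] by metis
  then have "loc_mult (J \<inter> A) U = igen (loc_mult A U) y n" by (intro loc_gen) auto
  then show "\<exists>n y. (\<forall>i<n. y i \<in> J) \<and> J \<subseteq> igen (loc_mult A U) y n"
    using ny loc_contr[OF J] by (intro exI[of _ n] exI[of _ y]) auto
qed

lemma contr_loc_prime: assumes "prime_in A P" "P \<inter> U = {}" shows "loc_mult P U \<inter> A = P"
proof
  show "loc_mult P U \<inter> A \<subseteq> P"
  proof
    fix z assume "z \<in> loc_mult P U \<inter> A"
    then obtain a u where *: "a \<in> P" "u \<in> U" "z = a / u" "z \<in> A" by (auto elim: loc_memE)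
    then have "u * z \<in> P" "u \<in> A" "u \<notin> P" using loc_U assms by auto
    then show "z \<in> P" using prime_mult[OF assms(1)] * by blast
  qed
  show "P \<subseteq> loc_mult P U \<inter> A" using loc_incl[of P] prime_ideal[OF assms(1)] by (auto dest: ideal_sub)
qed

lemma loc_prime: assumes "prime_in A P" "P \<inter> U = {}" shows "prime_in (loc_mult A U) (loc_mult P U)"
proof (rule prime_inI)
  have P: "ideal_in A P" using assms by (simp add: prime_in_def)
  show "ideal_in (loc_mult A U) (loc_mult P U)" by (rule loc_ideal[OF P])
  show "1 \<in> loc_mult A U" using loc_subring by (rule subring_one)
  show "1 \<notin> loc_mult P U" using contr_loc_prime[OF assms] prime_not_one[OF assms(1)] sA subring_one by blast
  fix a b assume ab: "a \<in> loc_mult A U" "b \<in> loc_mult A U" "a * b \<in> loc_mult P U" "a \<notin> loc_mult P U"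
  obtain c u d v where *: "c \<in> A" "u \<in> U" "a = c / u" "d \<in> A" "v \<in> U" "b = d / v"
    using ab by (metis loc_memE)
  have "(u * v) * (a * b) \<in> loc_mult P U"
    using ab(3) * loc_U loc_incl[of A] by (intro loc_mult_gen[OF P _ ab(3)]) auto
  moreover have "(u * v) * (a * b) = c * d" using * loc_U by (auto simp: field_simps)
  ultimately have "c * d \<in> P" using contr_loc_prime[OF assms] subring_mult[OF sA *(1,4)] by auto
  moreover have "c \<notin> P" using ab * by (auto simp: loc_mult_def)
  ultimately have "d \<in> P" using * prime_mult[OF assms(1)] by blast
  then show "b \<in> loc_mult P U" using * by (blast intro: loc_memI)
qed

lemma contr_prime: assumes "prime_in (loc_mult A U) Q" shows "prime_in A (Q \<inter> A)" "(Q \<inter> A) \<inter> U = {}"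
proof -
  show "prime_in A (Q \<inter> A)"
    using contr_ideal[OF prime_ideal[OF assms]] prime_not_one[OF assms] prime_mult[OF assms] loc_incl[of A] sA
    by (intro prime_inI) (auto simp: subring_closed)
  show "(Q \<inter> A) \<inter> U = {}"
    using ideal_mult[OF prime_ideal[OF assms] loc_inverse] prime_not_one[OF assms] loc_U(2)
    by (metis disjoint_iff IntD1 left_inverse)
qed

end

section \<open>Localization at a prime\<close>

lemma prime_compl_mult: "subring A ==> prime_in A P ==> mult_closed_in A (A - P)"
  unfolding mult_closed_in_def
  using ideal_zero[OF prime_ideal[of A P]]
  by (auto simp: subring_closed prime_not_one dest: prime_mult)

lemma loc_at_eq: "loc_at A P = loc_mult A (A - P)"
  by (auto simp: loc_at_def loc_mult_def)

text \<open>The maximal ideal of \<open>loc_at A P\<close>, in the form in which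
  \<open>regular_ring\<close> writes it.\<close>

definition mloc :: "'a::field set => 'a set => 'a set" where
  "mloc A P = {a / b | a b. a \<in> P \<and> b \<in> A \<and> b \<notin> P}"

lemma mloc_eq: "mloc A P = loc_mult P (A - P)"
  by (auto simp: mloc_def loc_mult_def)

lemma loc_at_local:
  assumes A: "subring A" and P: "prime_in A P"
  shows "local_ring (loc_at A P) (mloc A P)"
proof -
  note U = prime_compl_mult[OF A P]
  let ?L = "loc_mult A (A - P)"
  have pr: "prime_in ?L (loc_mult P (A - P))" by (rule loc_prime[OF A U P]) auto
  have "I \<subseteq> loc_mult P (A - P)" if I: "ideal_in ?L I" "I \<noteq> ?L" for I
  proof
    fix z assume z: "z \<in> I"
    then obtain a u where au: "a \<in> A" "u \<in> A - P" "z = a / u" using ideal_sub[OF I(1)] by (metis loc_memE)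
    show "z \<in> loc_mult P (A - P)"
    proof (cases "a \<in> P")
      case False
      then have aU: "a \<in> A - P" using au by auto
      have "u / a \<in> ?L" using au aU by (intro loc_memI[of u _ a]) auto
      then have "(u / a) * z \<in> I" using z I by (intro ideal_mult) auto
      moreover have "(u / a) * z = 1" using au aU loc_U(2)[OF A U] by auto
      ultimately show ?thesis using ideal_eq_ring[OF I(1)] I(2) by auto
    qed (use au in \<open>auto intro: loc_memI\<close>)
  qed
  then show ?thesis unfolding local_ring_def loc_at_eq mloc_eq
    using loc_subring[OF A U] pr by (auto simp: prime_in_def)
qed

lemma loc_at_noeth: "noetherian A ==> prime_in A P ==> noetherian (loc_at A P)"
  unfolding loc_at_eq by (intro loc_noeth prime_compl_mult) (auto dest: noeth_subring)

lemma loc_at_subring: "subring A ==> prime_in A P ==> subring (loc_at A P)"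
  unfolding loc_at_eq by (intro loc_subring prime_compl_mult)

text \<open>Since \<open>U\<close> avoids \<open>Q\<close>, clearing a denominator from
  \<open>U\<close> keeps an element outside \<open>Q\<close>. Inside the common field, localizing in
  two steps is therefore literally the same set as localizing once.\<close>

lemma loc_at_loc:
  assumes A: "subring A" and U: "mult_closed_in A U" and Q: "prime_in (loc_mult A U) Q"
  shows "loc_at (loc_mult A U) Q = loc_at A (Q \<inter> A)" "mloc (loc_mult A U) Q = mloc A (Q \<inter> A)"
proof -
  let ?L = "loc_mult A U"
  note P = contr_prime[OF A U Q] and LU = loc_U[OF A U] and inc = loc_incl[OF A U, of A]
  have *: "loc_mult I (?L - Q) = loc_mult (I \<inter> A) (A - Q \<inter> A)" if I: "ideal_in ?L I" for I
  proof (rule Set.set_eqI, rule iffI)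
    fix z assume "z \<in> loc_mult I (?L - Q)"
    then obtain a b where ab: "a \<in> I" "b \<in> ?L" "b \<notin> Q" "z = a / b" by (auto elim: loc_memE)
    obtain c u where c: "c \<in> A" "u \<in> U" "a = c / u" using ab ideal_sub[OF I] by (metis loc_memE)
    obtain d v where d: "d \<in> A" "v \<in> U" "b = d / v" using ab by (metis loc_memE)
    have uv: "u \<noteq> 0" "v \<noteq> 0" "u \<in> A" "v \<in> A" "u \<in> ?L" "v \<in> ?L" using LU inc c d by auto
    have "(u * v) * a \<in> I" using ab uv loc_subring[OF A U] by (intro ideal_mult[OF I]) (auto simp: subring_closed)
    then have n: "c * v \<in> I" using c uv by (simp add: mult_ac)
    have "u * v \<notin> Q" using P(2) c d LU by blast
    then have "(u * v) * b \<notin> Q"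
      using ab(2,3) prime_mult[OF Q _ ab(2), of "u * v"] subring_mult[OF loc_subring[OF A U] uv(5,6)] by blast
    then have dd: "u * d \<notin> Q" using d uv by simp
    show "z \<in> loc_mult (I \<inter> A) (A - Q \<inter> A)"
      by (rule loc_memI[of "c * v" _ "u * d"]) (use n dd ab c d uv A in \<open>auto simp: subring_closed field_simps\<close>)
  next
    fix z assume "z \<in> loc_mult (I \<inter> A) (A - Q \<inter> A)"
    then obtain a b where "a \<in> I" "b \<in> A" "b \<notin> Q" "z = a / b" unfolding loc_mult_def by blast
    then show "z \<in> loc_mult I (?L - Q)" using inc by (intro loc_memI[of a _ b]) auto
  qed
  have "?L \<inter> A = A" using inc by auto
  then show "loc_at ?L Q = loc_at A (Q \<inter> A)" "mloc ?L Q = mloc A (Q \<inter> A)"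
    unfolding loc_at_eq mloc_eq using *[OF ideal_ring[OF loc_subring[OF A U]]] *[OF prime_ideal[OF Q]] by auto
qed

section \<open>Submodules of free modules\<close>

text \<open>Vectors are total functions vanishing from index \<open>r\<close> on, so that equality
  of vectors is equality of functions. For an ideal \<open>J\<close> this is \<open>J\<close> times
  the free module of rank \<open>r\<close>.\<close>

definition fvec :: "'a::field set => nat => (nat => 'a) set" where
  "fvec A r = {u. (\<forall>k<r. u k \<in> A) \<and> (\<forall>k\<ge>r. u k = 0)}"

text \<open>The image of the coefficient vector \<open>c\<close> under the matrix with rows
  \<open>g l\<close>; the differentials of resolutions are written in this way.\<close>

definition lc :: "nat => (nat => 'a::field) => (nat => nat => 'a) => nat => 'a" where
  "lc s c g = (\<lambda>k. \<Sum>l<s. c l * g l k)"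

definition smod :: "'a::field set => (nat => 'a) set => bool" where
  "smod A M \<longleftrightarrow> (\<lambda>_. 0) \<in> M \<and> (\<forall>u\<in>M. \<forall>v\<in>M. (\<lambda>k. u k + v k) \<in> M) \<and>
     (\<forall>c\<in>A. \<forall>u\<in>M. (\<lambda>k. c * u k) \<in> M)"

lemma smod_zero: "smod A M ==> (\<lambda>_. 0) \<in> M"
  and smod_add: "smod A M ==> u \<in> M ==> v \<in> M ==> (\<lambda>k. u k + v k) \<in> M"
  and smod_scale: "smod A M ==> c \<in> A ==> u \<in> M ==> (\<lambda>k. c * u k) \<in> M"
  by (auto simp: smod_def)

lemma smod_diff: "subring A ==> smod A M ==> u \<in> M ==> v \<in> M ==> (\<lambda>k. u k - v k) \<in> M"
  using smod_add[of A M u "\<lambda>k. (-1) * v k"] smod_scale[of A M "-1" v] by (simp add: subring_closed)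

lemma lc_Suc: "lc (Suc s) c g = (\<lambda>k. lc s c g k + c s * g s k)"
  by (auto simp: lc_def)

lemma smod_lc: "smod A M ==> (\<And>l. l < s ==> c l \<in> A) ==> (\<And>l. l < s ==> g l \<in> M) ==> lc s c g \<in> M"
proof (induction s)
  case 0 then show ?case using smod_zero[of A M] by (simp add: lc_def)
next
  case (Suc s) then show ?case
    unfolding lc_Suc by (intro smod_add[of A M] smod_scale[of A M]) auto
qed

lemma fvec_smod: "subring A ==> ideal_in A J ==> smod A (fvec J r)"
  by (auto simp: smod_def fvec_def ideal_zero intro: ideal_add ideal_mult)

lemma fvec_ring_smod: "subring A ==> smod A (fvec A r)"
  by (rule fvec_smod[OF _ ideal_ring])

lemma sum_split_add: "(\<Sum>l<a + b. f l) = (\<Sum>l<a. f l) + (\<Sum>l<b. f (a + l :: nat))"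
  for f :: "nat => 'b::comm_monoid_add"
  by (induction b) (auto simp: add.assoc)

lemma lc_append:
  "lc (a + b) (\<lambda>l. if l < a then c l else e (l - a)) (\<lambda>l. if l < a then g l else h (l - a))
     = (\<lambda>k. lc a c g k + lc b e h k)"
  unfolding lc_def sum_split_add by (auto intro!: sum.cong arg_cong2[of _ _ _ _ plus])

text \<open>Induction on the rank: the last coordinates form an ideal, finitely many vectors
  \<open>h\<close> lift its generators, and subtracting a combination of them leaves a vector with
  last coordinate zero.\<close>

lemma smod_fg:
  assumes A: "noetherian A"
  shows "smod A M ==> M \<subseteq> fvec A r ==>
    \<exists>s g. (\<forall>l<s. g l \<in> M) \<and> (\<forall>u\<in>M. \<exists>c. (\<forall>l<s. c l \<in> A) \<and> u = lc s c g)"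
proof (induction r arbitrary: M)
  case 0
  then have "M \<subseteq> {\<lambda>_. 0}" by (auto simp: fvec_def)
  then show ?case by (intro exI[of _ 0]) (auto simp: lc_def)
next
  case (Suc r)
  have sA: "subring A" using A by (rule noeth_subring)
  let ?L = "(\<lambda>u. u r) ` M"
  have L: "ideal_in A ?L"
    unfolding ideal_in_def
  proof (intro conjI ballI)
    show "?L \<subseteq> A" using Suc.prems by (auto simp: fvec_def)
    show "0 \<in> ?L" using smod_zero[OF Suc.prems(1)] by (rule rev_image_eqI) simp
    show "a + b \<in> ?L" if "a \<in> ?L" "b \<in> ?L" for a b
      using that smod_add[OF Suc.prems(1)] by (auto simp: image_iff)
    show "a * b \<in> ?L" if "a \<in> A" "b \<in> ?L" for a b
      using that smod_scale[OF Suc.prems(1)] by (auto simp: image_iff)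
  qed
  obtain n y where y: "\<And>i. i < n ==> y i \<in> ?L" "?L = igen A y n" using noeth_fg[OF A L] by blast
  have "\<forall>i. \<exists>u. i < n --> u \<in> M \<and> y i = u r" using y(1) by blast
  then obtain h where h: "\<And>i. i < n ==> h i \<in> M" "\<And>i. i < n ==> y i = h i r" by metis
  let ?M = "{u \<in> M. u r = 0}"
  have "smod A ?M" using Suc.prems(1) by (auto simp: smod_def)
  moreover have "?M \<subseteq> fvec A r"
  proof
    fix u assume u: "u \<in> ?M"
    then have "u \<in> fvec A (Suc r)" using Suc.prems(2) by blast
    then show "u \<in> fvec A r" using u by (auto simp: fvec_def) (metis Suc_leI le_neq_implies_less)
  qed
  ultimately obtain s g where g: "\<And>l. l < s ==> g l \<in> ?M"
    "\<And>u. u \<in> ?M ==> \<exists>c. (\<forall>l<s. c l \<in> A) \<and> u = lc s c g" using Suc.IH[of ?M] by blast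
  let ?g = "\<lambda>l. if l < s then g l else h (l - s)"
  show ?case
  proof (intro exI[of _ "s + n"] exI[of _ ?g] conjI ballI allI impI)
    show "?g l \<in> M" if "l < s + n" for l using that g h by auto
    fix u assume u: "u \<in> M"
    then have "u r \<in> igen A y n" using y(2) by blast
    then obtain e where e: "\<forall>l<n. e l \<in> A" "u r = (\<Sum>l<n. e l * y l)"
      by (rule igen_sumE[OF sA])
    have "lc n e h \<in> M" using e h by (intro smod_lc[OF Suc.prems(1)]) auto
    then have "(\<lambda>k. u k - lc n e h k) \<in> M" by (rule smod_diff[OF sA Suc.prems(1) u])
    moreover have "u r = lc n e h r" using e h by (simp add: lc_def)
    ultimately have "(\<lambda>k. u k - lc n e h k) \<in> ?M" by simp
    from g(2)[OF this] obtain c where c: "\<forall>l<s. c l \<in> A" "(\<lambda>k. u k - lc n e h k) = lc s c g"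
      by blast
    have "\<forall>l<s + n. (if l < s then c l else e (l - s)) \<in> A" using c e by auto
    moreover have "u = lc (s + n) (\<lambda>l. if l < s then c l else e (l - s)) ?g"
      unfolding lc_append c(2)[symmetric] by auto
    ultimately show "\<exists>c. (\<forall>l<s + n. c l \<in> A) \<and> u = lc (s + n) c ?g"
      by (intro exI[of _ "\<lambda>l. if l < s then c l else e (l - s)"] conjI)
  qed
qed

text \<open>For a generating family of least length, a relation with a coefficient outside
  \<open>m\<close> could be solved for one generator, which would shorten the family.\<close>

lemma smod_min_gens:
  assumes A: "noetherian A" "local_ring A m" and M: "smod A M" "M \<subseteq> fvec A r"
  shows "\<exists>s g. (\<forall>l<s. g l \<in> M) \<and> (\<forall>u\<in>M. \<exists>c. (\<forall>l<s. c l \<in> A) \<and> u = lc s c g) \<and>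
    (\<forall>c. (\<forall>l<s. c l \<in> A) --> lc s c g = (\<lambda>_. 0) --> (\<forall>l<s. c l \<in> m))"
proof -
  have sA: "subring A" using A by (auto dest: noeth_subring)
  let ?G = "\<lambda>s g. (\<forall>l<s. g l \<in> M) \<and> (\<forall>u\<in>M. \<exists>c. (\<forall>l<s. c l \<in> A) \<and> u = lc s c g)"
  have "\<exists>s. \<exists>g. ?G s g" using smod_fg[OF A(1) M] by blast
  then obtain s where s: "\<exists>g. ?G s g" "\<And>t. t < s ==> \<not> (\<exists>g. ?G t g)"
    using exists_least_iff[of "\<lambda>s. \<exists>g. ?G s g"] by blast
  then obtain g where g: "\<And>l. l < s ==> g l \<in> M" "\<And>u. u \<in> M ==> \<exists>c. (\<forall>l<s. c l \<in> A) \<and> u = lc s c g"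
    by blast
  have "c l \<in> m" if c: "\<forall>l<s. c l \<in> A" "lc s c g = (\<lambda>_. 0)" and l: "l < s" for c l
  proof (rule ccontr)
    assume "c l \<notin> m"
    then have inv: "inverse (c l) \<in> A" "c l \<noteq> 0" using local_unit[OF A(2)] c l by auto
    obtain t where t: "s = Suc t" using l by (cases s) auto
    let ?g = "g(l := g t)"
    have "?G t ?g"
    proof (intro conjI allI impI ballI)
      show "?g j \<in> M" if "j < t" for j using that g t by auto
      fix u assume "u \<in> M"
      then obtain e where e: "\<forall>l<s. e l \<in> A" "u = lc s e g" using g by blast
      \<comment> \<open>\<open>e\<close> corrected by the multiple of the relation \<open>c\<close>
        that kills the coefficient at \<open>l\<close>. The free place \<open>l\<close> is then
        filled with the last generator \<open>g t\<close>.\<close>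
      define f where "f j = e j - e l * inverse (c l) * c j" for j
      have fA: "f j \<in> A" if "j < s" for j
        unfolding f_def using that e c inv l sA by (auto simp: subring_closed)
      have fl: "f l = 0" using inv by (simp add: f_def)
      have "lc s f g k = u k" for k
      proof -
        have "lc s f g k = lc s e g k - e l * inverse (c l) * lc s c g k"
          by (simp add: lc_def f_def sum_subtractf sum_distrib_left left_diff_distrib mult.assoc)
        then show ?thesis using e c by simp
      qed
      moreover have "lc s f g k = lc t (f(l := f t)) ?g k" for k
      proof (cases "l = t")
        case True then show ?thesis using fl t by (simp add: lc_def)
      next
        case False
        then have lt: "l < t" using l t by simp
        have "lc t (f(l := f t)) ?g k = f t * g t k + (\<Sum>j\<in>{..<t} - {l}. f j * g j k)"
          unfolding lc_def using lt by (subst sum.remove[of _ l]) (auto intro!: sum.cong)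
        also have "(\<Sum>j\<in>{..<t} - {l}. f j * g j k) = (\<Sum>j<t. f j * g j k)"
          using fl by (intro sum.mono_neutral_left) auto
        finally show ?thesis by (simp add: lc_def t)
      qed
      ultimately have "u = lc t (f(l := f t)) ?g" by auto
      moreover have "\<forall>j<t. (f(l := f t)) j \<in> A" using fA t by auto
      ultimately show "\<exists>c. (\<forall>j<t. c j \<in> A) \<and> u = lc t c ?g" by blast
    qed
    then show False using s(2)[of t] t by blast
  qed
  then show ?thesis using g by blast
qed

section \<open>Nakayama's lemma\<close>

text \<open>Elimination: in the equation of the last generator \<open>1 - c n\<close> is a unit, so
  that generator can be expressed by the others and substituted; the new coefficients stay in
  \<open>m\<close>.\<close>

lemma nakayama_vec:
  assumes A: "local_ring A m" and W: "smod A W"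
  shows "(\<And>l. l < n ==> \<exists>w\<in>W. \<exists>c. (\<forall>i<n. c i \<in> m) \<and> g l = (\<lambda>k. w k + lc n c g k)) ==>
    l < n ==> g l \<in> W"
proof (induction n arbitrary: l)
  case (Suc n)
  have sA: "subring A" and im: "ideal_in A m" using A by (auto simp: local_ring_def)
  have mA: "a \<in> A" if "a \<in> m" for a using ideal_sub[OF im that] .
  obtain w c where w: "w \<in> W" "\<forall>i<Suc n. c i \<in> m" "g n = (\<lambda>k. w k + lc (Suc n) c g k)"
    using Suc.prems(1)[of n] by blast
  define e where "e = inverse (1 - c n)"
  have e: "e \<in> A" "1 - c n \<noteq> 0" unfolding e_def using local_one_minus[OF A] w by auto
  have gn: "g n k = e * (w k + lc n c g k)" for k
  proof -
    have "(1 - c n) * g n k = w k + lc n c g k"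
      using fun_cong[OF w(3), of k] unfolding lc_Suc by (simp add: left_diff_distrib algebra_simps)
    then show ?thesis unfolding e_def using e(2) by (simp add: field_simps)
  qed
  have 1: "g l \<in> W" if "l < n" for l
  proof (rule Suc.IH)
    show "l < n" by fact
    fix l assume l: "l < n"
    obtain v b where v: "v \<in> W" "\<forall>i<Suc n. b i \<in> m" "g l = (\<lambda>k. v k + lc (Suc n) b g k)"
      using Suc.prems(1)[of l] l by fastforce
    show "\<exists>w\<in>W. \<exists>c. (\<forall>i<n. c i \<in> m) \<and> g l = (\<lambda>k. w k + lc n c g k)"
    proof (intro bexI exI conjI allI impI)
      show "b i + (b n * e) * c i \<in> m" if "i < n" for i
        using that v w e im sA mA by (intro ideal_add[OF im] ideal_mult[OF im]) (auto simp: subring_closed)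
      show "(\<lambda>k. v k + (b n * e) * w k) \<in> W"
        using v w e mA sA by (intro smod_add[OF W] smod_scale[OF W]) (auto simp: subring_closed)
      show "g l = (\<lambda>k. (v k + (b n * e) * w k) + lc n (\<lambda>i. b i + (b n * e) * c i) g k)"
      proof
        fix k
        have "lc n (\<lambda>i. b i + (b n * e) * c i) g k = lc n b g k + (b n * e) * lc n c g k"
          by (simp add: lc_def distrib_right sum.distrib sum_distrib_left mult.assoc)
        then show "g l k = (v k + (b n * e) * w k) + lc n (\<lambda>i. b i + (b n * e) * c i) g k"
          using fun_cong[OF v(3), of k] unfolding lc_Suc gn by (simp add: algebra_simps)
      qed
    qed
  qed
  have "(\<lambda>k. e * (w k + lc n c g k)) \<in> W"
    using 1 w mA e by (intro smod_scale[OF W] smod_add[OF W] smod_lc[OF W]) auto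
  then have "g n \<in> W" using gn by presburger
  then show ?case using 1 Suc.prems(2) less_Suc_eq by blast
qed simp

lemma nakayama_gens:
  fixes y :: "nat => 'a::field"
  assumes A: "local_ring A m" and J: "ideal_in A J"
    and "\<And>l. l < n ==> \<exists>j\<in>J. \<exists>c. (\<forall>i<n. c i \<in> m) \<and> y l = j + (\<Sum>i<n. c i * y i)" and "l < n"
  shows "y l \<in> J"
proof -
  let ?W = "{u::nat => 'a. u 0 \<in> J}"
  have W: "smod A ?W" using J by (auto simp: smod_def intro: ideal_zero ideal_add ideal_mult)
  \<comment> \<open>Scalars are treated as constant functions, so the vector version
    applies.\<close>
  have "(\<lambda>k::nat. y l) \<in> ?W"
  proof (rule nakayama_vec[OF A W, where g = "\<lambda>l k. y l" and n = n])
    show "l < n" by fact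
    fix l assume "l < n"
    then obtain j c where "j \<in> J" "\<forall>i<n. c i \<in> m" "y l = j + (\<Sum>i<n. c i * y i)" using assms by blast
    then show "\<exists>w\<in>?W. \<exists>c. (\<forall>i<n. c i \<in> m) \<and> (\<lambda>k. y l) = (\<lambda>k. w k + lc n c (\<lambda>l k. y l) k)"
      by (intro bexI[of _ "\<lambda>_. j"] exI[of _ c]) (auto simp: lc_def)
  qed
  then show ?thesis by simp
qed

lemma nakayama_elem:
  assumes A: "noetherian A" "local_ring A m" and I: "ideal_in A I" and J: "ideal_in A J"
    and x: "x \<in> m" and *: "\<And>b. b \<in> I ==> \<exists>j\<in>J. \<exists>e\<in>I. b = j + x * e"
  shows "I \<subseteq> J"
proof -
  have sA: "subring A" using A by (auto dest: noeth_subring)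
  have im: "ideal_in A m" using A by (auto simp: local_ring_def)
  obtain n y where y: "\<And>i. i < n ==> y i \<in> I" "I = igen A y n" using noeth_fg[OF A(1) I] by blast
  have "y l \<in> J" if "l < n" for l
  proof (rule nakayama_gens[OF A(2) J, where n = n])
    show "l < n" by fact
    fix l assume "l < n"
    then obtain j e where je: "j \<in> J" "e \<in> I" "y l = j + x * e" using * y by blast
    from je(2) have "e \<in> igen A y n" using y(2) by simp
    then obtain c where c: "\<forall>l<n. c l \<in> A" "e = (\<Sum>l<n. c l * y l)" by (rule igen_sumE[OF sA])
    have "y l = j + (\<Sum>i<n. (x * c i) * y i)" using je c by (simp add: sum_distrib_left mult.assoc)
    moreover have "\<forall>i<n. x * c i \<in> m" using c x im by (auto intro: ideal_mult_right)
    ultimately show "\<exists>j\<in>J. \<exists>c. (\<forall>i<n. c i \<in> m) \<and> y l = j + (\<Sum>i<n. c i * y i)"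
      using je(1) by (intro bexI exI conjI) auto
  qed
  then show ?thesis unfolding y(2) using ideal_zero[OF J] by (intro gen_least[OF J]) auto
qed

section \<open>Krull's principal ideal theorem and chains of primes\<close>

text \<open>The quotient by \<open>J0\<close> is Artinian, its only prime being the maximal ideal.\<close>

lemma descending_chain_stabilizes:
  assumes A: "noetherian A" "local_ring A m" and J0: "\<And>Q. prime_in A Q ==> J0 \<subseteq> Q ==> Q = m"
    and J: "ideal_in A J"
  shows "J0 \<subseteq> J ==> (\<And>k. ideal_in A (I k)) ==> (\<And>k. J \<subseteq> I k) ==>
    (\<And>k. I (Suc k) \<subseteq> I k) ==> \<exists>N. \<forall>k\<ge>N. I k = I N"
  using J
proof (induction J arbitrary: I rule: noeth_induct[OF A(1), consumes 1])
  case (1 J)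
  have sA: "subring A" using A by (auto dest: noeth_subring)
  have dec: "I l \<subseteq> I k" if "k \<le> l" for k l using lift_Suc_antimono_le[of I] 1(6) that by blast
  show ?case
  proof (cases "1 \<in> J")
    case True
    then have "I k = A" for k using ideal_eq_ring[OF 1(4)] 1(5) by blast
    then show ?thesis by auto
  next
    case False
    \<comment> \<open>The annihilator of \<open>a\<close> modulo \<open>J\<close> turns out to be
      \<open>m\<close>, so nothing lies strictly between \<open>J\<close> and
      \<open>adj A J a\<close>. A descending chain either keeps \<open>a\<close> forever, or it
      loses \<open>a\<close> and from then on meets \<open>A a\<close> only inside
      \<open>J\<close>.\<close>
    obtain a where a: "a \<in> A" "a \<notin> J" "prime_in A (colon A J a)"
      using assoc_prime_exists[OF A(1) 1(1) subring_one[OF sA] False] by metis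
    have "J0 \<subseteq> colon A J a" using 1(3) colon_sub[OF 1(1) a(1)] by blast
    then have col: "colon A J a = m" using J0 a by blast
    let ?J' = "adj A J a"
    have J': "ideal_in A ?J'" "J \<subset> ?J'"
      using adj_ideal[OF sA 1(1) a(1)] adj_sub[OF sA, of J a] adj_mem[OF sA 1(1), of a] a by auto
    have J0': "J0 \<subseteq> ?J'" using J' 1(3) by auto
    show ?thesis
    proof (cases "\<forall>k. a \<in> I k")
      case True
      then have "?J' \<subseteq> I k" for k using adj_least[OF 1(4) 1(5)] True by blast
      then show ?thesis using 1(2)[OF J' J0', of I] 1(4,6) by blast
    next
      case False
      then obtain M where M: "a \<notin> I M" by blast
      have *: "c * a \<in> J" if "k \<ge> M" "c \<in> A" "c * a \<in> I k" for k c
      proof -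
        have "a \<notin> I k" using M dec that by blast
        have "c \<in> m"
        proof (rule ccontr)
          assume "c \<notin> m"
          then have "inverse c \<in> A" "c \<noteq> 0" using local_unit[OF A(2)] that by auto
          then have "a \<in> I k" using ideal_mult[OF 1(4) _ that(3), of "inverse c"] by (simp add: mult.assoc[symmetric])
          then show False using \<open>a \<notin> I k\<close> by simp
        qed
        then show ?thesis using col by (auto simp: colon_def)
      qed
      have "\<exists>N. \<forall>k\<ge>N. adj A (I k) a = adj A (I N) a"
        by (rule 1(2)[OF J' J0'], rule adj_ideal[OF sA 1(4) a(1)], rule adj_mono[OF 1(5)],
            rule adj_mono[OF 1(6)])
      then obtain N where N: "\<And>k. k \<ge> N ==> adj A (I k) a = adj A (I N) a" by blast
      let ?N = "max N M"
      \<comment> \<open>The ideals enlarged by \<open>a\<close> are already constant; the extra term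
        \<open>c * a\<close> lies in \<open>J\<close> and hence in every member of the
        chain.\<close>
      have "I ?N \<subseteq> I k" if k: "k \<ge> ?N" for k
      proof
        fix z assume z: "z \<in> I ?N"
        then have "z \<in> adj A (I ?N) a" using adj_sub[OF sA] by blast
        then have "z \<in> adj A (I k) a" using N[of k] N[of ?N] k by simp
        then obtain i c where ic: "i \<in> I k" "c \<in> A" "z = i + c * a" by (rule adj_memE)
        then have "c * a = z - i" by simp
        moreover have "i \<in> I ?N" using ic dec k by blast
        ultimately have "c * a \<in> I ?N" using ideal_diff[OF sA 1(4)] z by simp
        then have "c * a \<in> I k" using *[of ?N c] ic 1(5) by auto
        then show "z \<in> I k" using ic ideal_add[OF 1(4)] by blast
      qed
      then show ?thesis using dec by blast
    qed
  qed
qed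

text \<open>If \<open>m\<close> were the only prime containing \<open>p0\<close> and
  \<open>x\<close>, the quotient by \<open>p0 + (x)\<close> would be Artinian and the ideals
  \<open>Q k\<close> below would become stationary. For \<open>y\<close> in \<open>p1\<close> this
  gives a relation \<open>s * y ^ N = c * y ^ Suc N\<close> modulo \<open>p0\<close> with
  \<open>s\<close> outside \<open>p1\<close>, and cancelling \<open>y ^ N\<close> puts
  \<open>s\<close> into \<open>p1\<close>.\<close>

lemma principal_ideal_theorem_local:
  assumes A: "noetherian A" "local_ring A m" and p: "prime_in A p0" "prime_in A p1" "p0 \<subset> p1" "p1 \<subset> m"
    and x: "x \<in> m"
  shows "\<exists>Q. prime_in A Q \<and> p0 \<subseteq> Q \<and> x \<in> Q \<and> Q \<subset> m"
proof (rule ccontr)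
  assume no: "\<not> ?thesis"
  have sA: "subring A" using A by (auto dest: noeth_subring)
  have xA: "x \<in> A" using x A ideal_sub by (auto simp: local_ring_def)
  have ip0: "ideal_in A p0" and ip1: "ideal_in A p1" using p prime_ideal by auto
  have xp1: "x \<notin> p1" using no p by blast
  obtain y where y: "y \<in> p1" "y \<notin> p0" using p by blast
  have yA: "y \<in> A" using y ideal_sub[OF ip1] by blast
  \<comment> \<open>The contraction to \<open>A\<close> of the ideal generated by \<open>p0\<close>
    and \<open>y ^ k\<close> in the localization at \<open>p1\<close>, with denominators
    cleared.\<close>
  define Q where "Q k = {b \<in> A. \<exists>s\<in>A - p1. \<exists>c\<in>A. \<exists>j\<in>p0. s * b = j + c * y ^ k}" for k
  have QI: "b \<in> Q k" if "b \<in> A" "s \<in> A" "s \<notin> p1" "c \<in> A" "j \<in> p0" "s * b = j + c * y ^ k" for b s c j k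
    unfolding Q_def using that by auto
  have iQ: "ideal_in A (Q k)" for k
    unfolding ideal_in_def
  proof (intro conjI ballI)
    show "Q k \<subseteq> A" by (auto simp: Q_def)
    show "0 \<in> Q k" by (rule QI[of _ 1 0 0])
        (use sA ip0 prime_not_one[OF p(2)] in \<open>auto simp: subring_closed ideal_zero\<close>)
    fix a assume "a \<in> Q k"
    then obtain s c j where a: "a \<in> A" "s \<in> A" "s \<notin> p1" "c \<in> A" "j \<in> p0" "s * a = j + c * y ^ k"
      unfolding Q_def by blast
    { fix b assume "b \<in> Q k"
      then obtain t d i where b: "b \<in> A" "t \<in> A" "t \<notin> p1" "d \<in> A" "i \<in> p0" "t * b = i + d * y ^ k"
        unfolding Q_def by blast
      show "a + b \<in> Q k"
      proof (rule QI[of _ "s * t" "t * c + s * d" "t * j + s * i"])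
        show "s * t \<notin> p1" using a b prime_mult[OF p(2)] by blast
        have "s * t * (a + b) = t * (s * a) + s * (t * b)" by (simp add: algebra_simps)
        then show "s * t * (a + b) = t * j + s * i + (t * c + s * d) * y ^ k"
          unfolding a(6) b(6) by (simp add: algebra_simps)
        show "t * j + s * i \<in> p0" using a b by (intro ideal_add[OF ip0] ideal_mult[OF ip0])
      qed (use a b sA in \<open>auto simp: subring_closed\<close>) }
    fix r assume r: "r \<in> A"
    show "r * a \<in> Q k"
    proof (rule QI[of _ s "r * c" "r * j"])
      have "s * (r * a) = r * (s * a)" by simp
      then show "s * (r * a) = r * j + r * c * y ^ k" unfolding a(6) by (simp add: algebra_simps)
    qed (use a r sA ideal_mult[OF ip0] in \<open>auto simp: subring_closed\<close>)
  qed
  have Qdec: "Q (Suc k) \<subseteq> Q k" for k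
  proof
    fix b assume "b \<in> Q (Suc k)"
    then obtain s c j where b: "b \<in> A" "s \<in> A" "s \<notin> p1" "c \<in> A" "j \<in> p0" "s * b = j + c * y ^ Suc k"
      unfolding Q_def by blast
    show "b \<in> Q k" by (rule QI[of _ s "c * y" j]) (use b yA sA in \<open>auto simp: subring_closed mult.assoc\<close>)
  qed
  have p0Q: "p0 \<subseteq> Q k" for k
  proof
    fix b assume "b \<in> p0"
    then show "b \<in> Q k" using sA prime_not_one[OF p(2)] ideal_sub[OF ip0]
      by (intro QI[of _ 1 0 b]) (auto simp: subring_closed)
  qed
  let ?J0 = "adj A p0 x"
  have iJ0: "ideal_in A ?J0" by (rule adj_ideal[OF sA ip0 xA])
  have "Q' = m" if "prime_in A Q'" "?J0 \<subseteq> Q'" for Q'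
  proof -
    have "p0 \<subseteq> Q'" "x \<in> Q'" using that adj_sub[OF sA, of p0 x] adj_mem[OF sA ip0, of x] by blast+
    then show ?thesis using no that local_max[OF A(2) that(1)] by blast
  qed
  then have "\<exists>N. \<forall>k\<ge>N. adj A (Q k) x = adj A (Q N) x"
  proof (rule descending_chain_stabilizes[OF A _ iJ0 subset_refl])
    show "ideal_in A (adj A (Q k) x)" "?J0 \<subseteq> adj A (Q k) x" "adj A (Q (Suc k)) x \<subseteq> adj A (Q k) x" for k
      by (rule adj_ideal[OF sA iQ xA], rule adj_mono[OF p0Q], rule adj_mono[OF Qdec])
  qed
  then obtain N where N: "\<And>k. k \<ge> N ==> adj A (Q k) x = adj A (Q N) x" by blast
  \<comment> \<open>An element of \<open>Q N\<close> is \<open>c + e * x\<close> with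
    \<open>c\<close> in \<open>Q (Suc N)\<close>. As \<open>x\<close> is outside \<open>p1\<close>,
    it can be moved into the multiplier \<open>s\<close>, so \<open>e\<close> is again in
    \<open>Q N\<close> and Nakayama's lemma applies.\<close>
  have "Q N \<subseteq> Q (Suc N)"
  proof (rule nakayama_elem[OF A iQ iQ x])
    fix b assume b: "b \<in> Q N"
    then have "b \<in> adj A (Q (Suc N)) x" using N[of "Suc N"] adj_sub[OF sA] by auto
    then obtain c e where ce: "c \<in> Q (Suc N)" "e \<in> A" "b = c + e * x" by (rule adj_memE)
    then have "e * x = b - c" by simp
    then have "e * x \<in> Q N" using ideal_diff[OF sA iQ b, of c] ce Qdec by auto
    then obtain s d j where s: "s \<in> A" "s \<notin> p1" "d \<in> A" "j \<in> p0" "s * (e * x) = j + d * y ^ N"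
      unfolding Q_def by blast
    have "s * x \<notin> p1" using s xp1 xA prime_mult[OF p(2)] by blast
    then have "e \<in> Q N" using s ce xA sA
      by (intro QI[of e "s * x" d j]) (auto simp: subring_closed mult_ac)
    then show "\<exists>j\<in>Q (Suc N). \<exists>e\<in>Q N. b = j + x * e" using ce by (auto simp: mult.commute)
  qed
  moreover have "y ^ N \<in> Q N"
    by (rule QI[of _ 1 1 0]) (use sA yA ip0 prime_not_one[OF p(2)] in \<open>auto simp: subring_closed ideal_zero\<close>)
  ultimately have "y ^ N \<in> Q (Suc N)" by blast
  then obtain s c j where s: "s \<in> A" "s \<notin> p1" "c \<in> A" "j \<in> p0" "s * y ^ N = j + c * y ^ Suc N"
    unfolding Q_def by blast
  then have "y ^ N * (s - c * y) \<in> p0" by (simp add: algebra_simps)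
  moreover have "y ^ N \<notin> p0" using prime_power[OF sA p(1) yA] y by blast
  ultimately have "s - c * y \<in> p0" 
    using prime_mult[OF p(1) subring_power[OF sA yA] subring_diff[OF sA s(1) subring_mult[OF sA s(3) yA]]] by blast
  then have "s - c * y \<in> p1" using p by blast
  then have "(s - c * y) + c * y \<in> p1" using y s by (intro ideal_add[OF ip1] ideal_mult[OF ip1])
  then show False using s by simp
qed

text \<open>The exchange form used below: the middle prime of a chain of three can be replaced by
  one through any given element of the top prime. Localization at \<open>P2\<close> reduces it to
  the local case.\<close>

lemma principal_ideal_theorem:
  assumes A: "noetherian A" and P: "prime_in A P0" "prime_in A P1" "prime_in A P2" "P0 \<subset> P1" "P1 \<subset> P2"
    and x: "x \<in> P2"
  shows "\<exists>Q. prime_in A Q \<and> P0 \<subset> Q \<and> x \<in> Q \<and> Q \<subset> P2"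
proof (cases "x \<in> P0")
  case False
  have sA: "subring A" using A by (rule noeth_subring)
  let ?U = "A - P2"
  note U = prime_compl_mult[OF sA P(3)]
  note contr = contr_loc_prime[OF sA U]
  have d: "P0 \<inter> ?U = {}" "P1 \<inter> ?U = {}" using P by auto
  let ?p = "\<lambda>P. loc_mult P ?U"
  have c: "?p P0 \<inter> A = P0" "?p P1 \<inter> A = P1" "?p P2 \<inter> A = P2" using contr P d by auto
  have mono: "?p P0 \<subseteq> ?p P1" "?p P1 \<subseteq> ?p P2" using P unfolding loc_mult_def by blast+
  have "\<exists>Q. prime_in (loc_mult A ?U) Q \<and> ?p P0 \<subseteq> Q \<and> x \<in> Q \<and> Q \<subset> ?p P2"
  proof (rule principal_ideal_theorem_local[where ?p1.0 = "?p P1"])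
    show "noetherian (loc_mult A ?U)" using loc_at_noeth[OF A P(3)] by (simp add: loc_at_eq)
    show "local_ring (loc_mult A ?U) (?p P2)" using loc_at_local[OF sA P(3)] by (simp add: loc_at_eq mloc_eq)
    show "prime_in (loc_mult A ?U) (?p P0)" "prime_in (loc_mult A ?U) (?p P1)"
      using loc_prime[OF sA U] P d by auto
    show "?p P0 \<subset> ?p P1" using mono(1) c(1,2) P(4) by (metis psubset_eq)
    show "?p P1 \<subset> ?p P2" using mono(2) c(2,3) P(5) by (metis psubset_eq)
    show "x \<in> ?p P2" using x loc_incl[OF sA U] by blast
  qed
  then obtain Q where Q: "prime_in (loc_mult A ?U) Q" "?p P0 \<subseteq> Q" "x \<in> Q" "Q \<subset> ?p P2" by blast
  have "Q \<inter> A \<noteq> P2" using loc_contr[OF sA U prime_ideal[OF Q(1)]] Q(4) by auto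
  moreover have "Q \<inter> A \<subseteq> P2" using Q(4) c by blast
  moreover have "x \<in> Q \<inter> A" using Q(3) x prime_ideal[OF P(3)] ideal_sub by blast
  moreover have "P0 \<subseteq> Q \<inter> A" using c Q by blast
  ultimately show ?thesis using contr_prime(1)[OF sA U Q(1)] False by blast
qed (use P in blast)

section \<open>Chains of primes and the height theorem\<close>

text \<open>The existence of such a chain says that \<open>A / J\<close> has dimension at least
  \<open>n\<close>, without forming the quotient.\<close>

definition pchain :: "'a::field set => 'a set => nat => (nat => 'a set) => bool" where
  "pchain A J n P \<longleftrightarrow> (\<forall>i\<le>n. prime_in A (P i)) \<and> (\<forall>i<n. P i \<subset> P (Suc i)) \<and> J \<subseteq> P 0"

lemma pchainD:
  assumes "pchain A J n P"
  shows "i \<le> n ==> prime_in A (P i)" "i < n ==> P i \<subset> P (Suc i)" "J \<subseteq> P 0"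
  using assms by (auto simp: pchain_def)

lemma pchain_upd:
  assumes "pchain A J (Suc n) P" "prime_in A Q" "P n \<subset> Q" shows "pchain A J (Suc n) (P(Suc n := Q))"
  using assms by (auto simp: pchain_def less_Suc_eq le_Suc_eq)

text \<open>Exchanging primes from the top downwards makes all members except the lowest contain
  \<open>x\<close>; dropping the lowest shows that \<open>x\<close> costs at most one step of
  dimension.\<close>

lemma pchain_modify:
  assumes A: "noetherian A"
  shows "pchain A J (Suc n) P ==> x \<in> P (Suc n) ==> \<exists>P'. pchain A (adj A J x) n P' \<and> P' n = P (Suc n)"
proof (induction n arbitrary: P)
  case 0
  note ch = pchainD[OF 0(1)]
  have "adj A J x \<subseteq> P 1"
    using ch(1)[of 1] ch(2)[of 0] ch(3) 0(2) by (intro adj_least) (auto dest: prime_ideal)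
  then show ?case using ch(1)[of 1] by (intro exI[of _ "\<lambda>_. P 1"]) (auto simp: pchain_def)
next
  case (Suc n)
  note ch = pchainD[OF Suc.prems(1)]
  obtain Q where Q: "prime_in A Q" "P n \<subset> Q" "x \<in> Q" "Q \<subset> P (Suc (Suc n))"
    using principal_ideal_theorem[OF A ch(1)[of n] ch(1)[of "Suc n"] ch(1)[of "Suc (Suc n)"]
        ch(2)[of n] ch(2)[of "Suc n"] Suc.prems(2)] by auto
  have "pchain A J (Suc n) P" using Suc.prems(1) by (auto simp: pchain_def)
  from Suc.IH[OF pchain_upd[OF this Q(1,2)]] obtain P' where P': "pchain A (adj A J x) n P'" "P' n = Q" using Q(3) by auto
  have "pchain A (adj A J x) (Suc n) (P'(Suc n := P (Suc (Suc n))))"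
    using P' Q ch(1)[of "Suc (Suc n)"] by (auto simp: pchain_def less_Suc_eq le_Suc_eq)
  then show ?case by (rule exI[where x = "P'(Suc n := P (Suc (Suc n)))", OF conjI]) simp
qed

lemma pchain_modify_local:
  assumes A: "noetherian A" "local_ring A m" and "\<exists>P. pchain A J (Suc n) P" "x \<in> m"
  shows "\<exists>P. pchain A (adj A J x) n P"
proof -
  obtain P where P: "pchain A J (Suc n) P" using assms by blast
  note ch = pchainD[OF P]
  have "P n \<subset> m" using ch(2)[of n] local_max[OF A(2) ch(1)[of "Suc n"]] by auto
  then have "pchain A J (Suc n) (P(Suc n := m))" by (rule pchain_upd[OF P local_prime[OF A(2)]])
  then show ?thesis using pchain_modify[OF A(1), of J n "P(Suc n := m)" x] assms by auto
qed

text \<open>Each adjoined generator shortens a chain by at most one, and after \<open>d\<close> of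
  them no room is left below \<open>m\<close>.\<close>

lemma krull_height:
  assumes A: "noetherian A" "local_ring A m"
  shows "m \<subseteq> gen A J x d ==> (\<And>i. i < d ==> x i \<in> m) ==> \<not> pchain A J (Suc d) P"
proof (induction d arbitrary: J x P)
  case 0
  show ?case
  proof
    assume *: "pchain A J (Suc 0) P"
    then have "J \<subseteq> P 0" "P 0 \<subset> P (Suc 0)" "P (Suc 0) \<subseteq> m"
      using local_max[OF A(2)] by (auto simp: pchain_def)
    then show False using 0 by auto
  qed
next
  case (Suc d)
  show ?case
    using Suc.IH[of "adj A J (x 0)" "\<lambda>i. x (Suc i)"] Suc.prems pchain_modify_local[OF A, of J "Suc d" "x 0"]
    unfolding gen_Suc_shift by blast
qed

text \<open>If the dimension of \<open>A / J\<close> equals the number of generators of its maximal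
  ideal, it is a domain. For the bottom prime \<open>P 0\<close> of a longest chain,
  \<open>J + (x 0)\<close> is prime by induction and agrees with \<open>P 0 + (x 0)\<close> for
  reasons of dimension. Hence \<open>P 0\<close> lies in \<open>J + x 0 P 0\<close>, and Nakayama's
  lemma gives \<open>P 0 = J\<close>.\<close>

lemma regular_prime:
  assumes A: "noetherian A" "local_ring A m"
  shows "ideal_in A J ==> m = gen A J x d ==> (\<And>i. i < d ==> x i \<in> m) ==> pchain A J d P ==> prime_in A J"
proof (induction d arbitrary: J x P)
  case 0 then show ?case using local_prime[OF A(2)] by simp
next
  case (Suc d)
  have sA: "subring A" using A by (auto dest: noeth_subring)
  have im: "ideal_in A m" using A by (simp add: local_ring_def)
  have x0: "x 0 \<in> m" "x 0 \<in> A" using Suc.prems(3)[of 0] ideal_sub[OF im] by auto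
  let ?x = "\<lambda>i. x (Suc i)"
  let ?J1 = "adj A J (x 0)" and ?J2 = "adj A (P 0) (x 0)"
  have xm: "?x i \<in> m" if "i < d" for i using Suc.prems that by auto
  note ch = pchainD[OF Suc.prems(4)]
  have m1: "m = gen A ?J1 ?x d" using Suc.prems(2) by (simp only: gen_Suc_shift)
  have ip0: "ideal_in A (P 0)" using ch(1)[of 0] prime_ideal by auto
  have J1: "prime_in A ?J1"
    using Suc.IH[of ?J1 ?x] m1 xm pchain_modify_local[OF A, of J d "x 0"] Suc.prems x0
      adj_ideal[OF sA Suc.prems(1) x0(2)] by blast
  have chP: "pchain A (P 0) (Suc d) P" using Suc.prems(4) by (auto simp: pchain_def)
  \<comment> \<open>Otherwise the remaining \<open>d\<close> parameters would generate
    \<open>m\<close> over \<open>P 0\<close>, against the chain of length \<open>Suc d\<close>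
    starting there.\<close>
  have x0P: "x 0 \<notin> P 0"
  proof
    assume "x 0 \<in> P 0"
    then have "?J1 \<subseteq> P 0" using ch(3) ip0 by (intro adj_least)
    then have "m \<subseteq> gen A (P 0) ?x d" using m1 gen_mono by blast
    then show False using krull_height[OF A, of "P 0" ?x d P] xm chP by blast
  qed
  have sub: "?J1 \<subseteq> ?J2" by (rule adj_mono[OF ch(3)])
  have iJ2: "ideal_in A ?J2" by (rule adj_ideal[OF sA ip0 x0(2)])
  have "P 0 \<subseteq> m" using local_max[OF A(2) ch(1)[of 0]] by simp
  then have "?J2 \<subseteq> m" using x0 im by (intro adj_least) auto
  then have m2: "m = gen A ?J2 ?x d"
    using m1 gen_mono[OF sub, of A ?x d] gen_least[OF im, of ?J2 d ?x] xm by auto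
  obtain P2 where P2: "pchain A ?J2 d P2" using pchain_modify_local[OF A, of "P 0" d "x 0"] chP x0 by blast
  \<comment> \<open>A strict inclusion would put the prime \<open>?J1\<close> below the chain over
    \<open>?J2\<close>, making it longer than \<open>d\<close> generators allow.\<close>
  have "?J1 = ?J2"
  proof (rule ccontr)
    assume "?J1 \<noteq> ?J2"
    then have "pchain A ?J1 (Suc d) (\<lambda>i. case i of 0 => ?J1 | Suc j => P2 j)"
      using P2 J1 sub by (auto simp: pchain_def split: nat.splits)
    then show False using krull_height[OF A, of ?J1 ?x d] m1 xm by blast
  qed
  have "P 0 \<subseteq> J"
  proof (rule nakayama_elem[OF A ip0 Suc.prems(1) x0(1)])
    fix b assume b: "b \<in> P 0"
    then have "b \<in> ?J1" using adj_sub[OF sA] \<open>?J1 = ?J2\<close> by auto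
    then obtain j a where ja: "j \<in> J" "a \<in> A" "b = j + a * x 0" by (rule adj_memE)
    have "a * x 0 = b - j" using ja by simp
    then have "a * x 0 \<in> P 0" using ideal_diff[OF sA ip0 b, of j] ja ch(3) by auto
    then have "a \<in> P 0" using prime_mult[OF ch(1)[of 0]] ja x0 x0P by auto
    then show "\<exists>j\<in>J. \<exists>e\<in>P 0. b = j + x 0 * e" using ja by (auto simp: mult.commute)
  qed
  then show ?case using ch(1)[of 0] ch(3) by auto
qed

section \<open>Regular systems of parameters\<close>

text \<open>A chain of length \<open>d\<close> stands for the dimension; the matching upper bound is
  \<open>krull_height\<close>. The indexing lets \<open>igen A y i\<close> denote the ideal of the
  first \<open>i\<close> parameters.\<close>

definition regsys :: "'a::field set => 'a set => (nat => 'a) => nat => bool" where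
  "regsys A m y d \<longleftrightarrow> noetherian A \<and> local_ring A m \<and> (\<forall>i<d. y i \<in> m) \<and> m = igen A y d \<and>
     (\<exists>P. pchain A {0} d P)"

lemma regsysD:
  assumes "regsys A m y d"
  shows "noetherian A" "local_ring A m" "i < d ==> y i \<in> m" "i < d ==> y i \<in> A" "m = igen A y d"
    "\<exists>P. pchain A {0} d P" "subring A" "ideal_in A m"
proof -
  show "noetherian A" "local_ring A m" "i < d ==> y i \<in> m" "m = igen A y d" "\<exists>P. pchain A {0} d P"
    using assms by (auto simp: regsys_def)
  then show "subring A" "ideal_in A m" by (auto simp: local_ring_def)
  then show "i < d ==> y i \<in> A" using assms by (auto simp: regsys_def dest: ideal_sub)
qed

lemma prime_chain_to_iff_pchain: "(\<exists>Q. prime_chain_to A Q n) \<longleftrightarrow> (\<exists>P. pchain A {0} n P)"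
  by (auto simp: prime_chain_to_def pchain_def prime_in_def ideal_in_def)

lemma gen_add: "gen A J y (i + k) = gen A (gen A J y i) (\<lambda>l. y (i + l)) k"
  by (induction k) auto

lemma regular_local_regsys:
  assumes "regular_local_dim A m d" obtains y where "regsys A m y d"
proof -
  obtain xs where xs: "length xs = d" "set xs \<subseteq> m" "m = ideal_span A (set xs)"
    using assms by (auto simp: regular_local_dim_def)
  have A: "noetherian A" "local_ring A m" "krull_dim_is A d" using assms by (auto simp: regular_local_dim_def)
  then have "set xs \<subseteq> A" using xs(2) by (auto simp: local_ring_def dest: ideal_sub)
  then have "m = igen A (\<lambda>i. xs ! i) d" using ideal_span_list[of A xs] xs A by (simp add: noeth_subring)
  moreover have "\<exists>P. pchain A {0} d P" using A(3) prime_chain_to_iff_pchain by (auto simp: krull_dim_is_def)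
  moreover have "\<forall>i<d. xs ! i \<in> m" using xs nth_mem by blast
  ultimately show ?thesis using that[of "\<lambda>i. xs ! i"] A by (auto simp: regsys_def)
qed

lemma regsys_regular_local:
  assumes "regsys A m y d" shows "regular_local_dim A m d"
proof -
  note R = regsysD[OF assms]
  have "\<not> pchain A {0} (Suc d) P" for P
    using krull_height[OF R(1,2), of "{0}" y d] R(3,5) by blast
  then have dim: "krull_dim_is A d" using R(6) prime_chain_to_iff_pchain[of A] by (auto simp: krull_dim_is_def)
  let ?xs = "map y [0..<d]"
  have "set ?xs \<subseteq> m" using R(3) by auto
  moreover have "m = ideal_span A (set ?xs)"
  proof -
    have "ideal_span A (set ?xs) = igen A (\<lambda>i. ?xs ! i) d"
      using ideal_span_list[OF R(7), of ?xs] R(4) by (simp add: image_subset_iff)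
    also have "\<dots> = igen A y d" by (rule gen_cong) auto
    finally show ?thesis using R(5) by simp
  qed
  ultimately show ?thesis using R(1,2) dim unfolding regular_local_dim_def by (intro conjI exI[of _ ?xs]) auto
qed

lemma regsys_pchain:
  assumes "regsys A m y d" "i \<le> d" shows "\<exists>P. pchain A (igen A y i) (d - i) P"
  using assms(2)
proof (induction i)
  case 0 then show ?case using regsysD[OF assms(1)] by simp
next
  case (Suc i)
  note R = regsysD[OF assms(1)]
  have "d - i = Suc (d - Suc i)" using Suc by simp
  then show ?case using Suc pchain_modify_local[OF R(1,2), of "igen A y i" "d - Suc i" "y i"] R(3)[of i] by auto
qed

lemma regsys_prime:
  assumes "regsys A m y d" "i \<le> d" shows "prime_in A (igen A y i)"
proof -
  note R = regsysD[OF assms(1)]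
  obtain P where P: "pchain A (igen A y i) (d - i) P" using regsys_pchain[OF assms] by blast
  show ?thesis
  proof (rule regular_prime[OF R(1,2) _ _ _ P])
    show "ideal_in A (igen A y i)" using R(4) assms(2) by (intro igen_ideal[OF R(7)]) auto
    show "m = gen A (igen A y i) (\<lambda>l. y (i + l)) (d - i)" using R(5) assms(2) gen_add[of A "{0}" y i "d - i"] by simp
    show "\<And>l. l < d - i ==> y (i + l) \<in> m" using R(3) by auto
  qed
qed

text \<open>If \<open>y i\<close> were redundant, the other \<open>d - i - 1\<close> parameters
  would generate \<open>m\<close> over the first \<open>i\<close>, too few for a chain of length
  \<open>d - i\<close>.\<close>

lemma regsys_notin:
  assumes "regsys A m y d" "i < d" shows "y i \<notin> igen A y i"
proof
  assume y: "y i \<in> igen A y i"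
  note R = regsysD[OF assms(1)]
  have ii: "ideal_in A (igen A y i)" using R(4) assms(2) by (intro igen_ideal[OF R(7)]) auto
  have "igen A y (Suc i) \<subseteq> igen A y i" unfolding gen.simps(2) by (rule adj_least[OF ii subset_refl y])
  then have "gen A (igen A y (Suc i)) (\<lambda>l. y (Suc i + l)) (d - Suc i) \<subseteq> gen A (igen A y i) (\<lambda>l. y (Suc i + l)) (d - Suc i)"
    by (rule gen_mono)
  moreover have "m = gen A (igen A y (Suc i)) (\<lambda>l. y (Suc i + l)) (d - Suc i)"
    using R(5) assms(2) gen_add[of A "{0}" y "Suc i" "d - Suc i"] by simp
  ultimately have "m \<subseteq> gen A (igen A y i) (\<lambda>l. y (Suc i + l)) (d - Suc i)" by blast
  moreover obtain P where P: "pchain A (igen A y i) (d - i) P"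
    using regsys_pchain[OF assms(1) less_imp_le[OF assms(2)]] by blast
  moreover have "d - i = Suc (d - Suc i)" using assms(2) by simp
  ultimately show False using krull_height[OF R(1,2), of "igen A y i" "\<lambda>l. y (Suc i + l)" "d - Suc i" P] R(3) by auto
qed

lemma regsys_dim_unique:
  assumes "regsys A m y d" "regsys A m z e" shows "d = e"
proof -
  have "e \<le> d" if yd: "regsys A m y d" and ze: "regsys A m z e" for y z d e
  proof (rule ccontr)
    assume "\<not> e \<le> d"
    obtain P where "pchain A {0} e P" using regsysD(6)[OF ze] by blast
    then have "pchain A {0} (Suc d) P" using \<open>\<not> e \<le> d\<close> by (auto simp: pchain_def)
    then show False using krull_height[OF regsysD(1,2)[OF yd], of "{0}" y d] regsysD(3,5)[OF yd] by blast
  qed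
  then show ?thesis using assms by (meson le_antisym)
qed

section \<open>Independence modulo the square of the maximal ideal\<close>

lemma ideal_pow2_mult:
  assumes "subring A" "ideal_in A m" "a \<in> m" "b \<in> m" shows "a * b \<in> ideal_pow A m 2"
proof -
  have "a \<in> ideal_pow A m 1"
    using assms ideal_span_mem[OF assms(1), of "1 * a" "{a * b |a b. a \<in> A \<and> b \<in> m}"]
    by (simp add: One_nat_def) (use subring_one[OF assms(1)] in force)
  then have "a * b \<in> {a * b |a b. a \<in> ideal_pow A m 1 \<and> b \<in> m}" using assms(4) by blast
  from ideal_span_mem[OF assms(1) this] show ?thesis by (simp add: numeral_2_eq_2)
qed

lemma ideal_pow_ideal: assumes "subring A" "ideal_in A I" shows "ideal_in A (ideal_pow A I k)"
proof (induction k)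
  case (Suc k)
  have "{a * b |a b. a \<in> ideal_pow A I k \<and> b \<in> I} \<subseteq> A"
    using ideal_sub[OF Suc] ideal_sub[OF assms(2)] subring_mult[OF assms(1)] by blast
  then show ?case using ideal_span_ideal[OF assms(1)] by simp
qed (use assms ideal_ring in simp)

text \<open>Linear independence of the classes of the \<open>p i\<close> in the cotangent space,
  with coefficients lifted from the residue field to \<open>A\<close>.\<close>

definition indep :: "'a::field set => 'a set => (nat => 'a) => nat => bool" where
  "indep A m p r \<longleftrightarrow> (\<forall>i<r. p i \<in> m) \<and> (\<forall>c. (\<forall>i<r. c i \<in> A) -->
     (\<Sum>i<r. c i * p i) \<in> ideal_pow A m 2 --> (\<forall>i<r. c i \<in> m))"

text \<open>Steinitz exchange in the cotangent space: the elements \<open>p k\<close> replace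
  parameters one after another.\<close>

lemma indep_extend:
  assumes x: "regsys A m x d" and p: "indep A m p r"
  shows "r \<le> d \<and> (\<exists>y. regsys A m y d \<and> (\<forall>i<r. y i = p i))"
proof -
  note R = regsysD[OF x]
  have sq: "ideal_in A (ideal_pow A m 2)" using R by (intro ideal_pow_ideal)
  have "k \<le> d \<and> (\<exists>y. regsys A m y d \<and> (\<forall>i<k. y i = p i))" if "k \<le> r" for k
    using that
  proof (induction k)
    case 0 then show ?case using x by auto
  next
    case (Suc k)
    then obtain z where z: "regsys A m z d" "\<forall>i<k. z i = p i" and kd: "k \<le> d" by auto
    note Z = regsysD[OF z(1)]
    have pm: "p k \<in> m" using p Suc by (auto simp: indep_def)
    then have "p k \<in> igen A z d" using Z(5) by simp
    then obtain c where c: "\<forall>l<d. c l \<in> A" "p k = (\<Sum>l<d. c l * z l)" by (rule igen_sumE[OF Z(7)])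
    have "\<exists>i. k \<le> i \<and> i < d \<and> c i \<notin> m"
    proof (rule ccontr)
      assume no: "\<not> ?thesis"
      \<comment> \<open>The relation \<open>p k\<close> minus the terms with \<open>i < k\<close>,
        extended by zero up to \<open>r\<close>. If all later \<open>c i\<close> were in
        \<open>m\<close>, its value would lie in the square of \<open>m\<close> although its
        coefficient at \<open>k\<close> is one.\<close>
      let ?b = "\<lambda>i. if i < k then - c i else if i = k then 1 else 0"
      have r: "r = k + (r - k)" "0 < r - k" using Suc by auto
      have dk: "d = k + (d - k)" using kd by simp
      have "(\<Sum>i<r. ?b i * p i) = (\<Sum>i<k. ?b i * p i) + (\<Sum>i<r - k. ?b (k + i) * p (k + i))"
        by (subst r(1), subst sum_split_add) simp
      also have "(\<Sum>i<r - k. ?b (k + i) * p (k + i)) = (\<Sum>i<r - k. if i = 0 then p k else 0)"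
        by (intro sum.cong) auto
      also have "\<dots> = p k" using r by simp
      also have "(\<Sum>i<k. ?b i * p i) = - (\<Sum>i<k. c i * z i)" using z(2) by (simp add: sum_negf)
      also have "- (\<Sum>i<k. c i * z i) + p k = (\<Sum>i<d - k. c (k + i) * z (k + i))"
        unfolding c(2) by (subst dk, subst sum_split_add) simp
      finally have e: "(\<Sum>i<r. ?b i * p i) = (\<Sum>i<d - k. c (k + i) * z (k + i))" .
      have "(\<Sum>i<d - k. c (k + i) * z (k + i)) \<in> ideal_pow A m 2"
        using no Z(3) by (intro ideal_sum[OF sq] ideal_pow2_mult R) auto
      moreover have "\<forall>i<r. ?b i \<in> A" using c kd R(7) by (auto simp: subring_closed)
      ultimately have "\<forall>i<r. ?b i \<in> m"
        using p[unfolded indep_def, THEN conjunct2, rule_format, of ?b] unfolding e[symmetric] by simp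
      then have "?b k \<in> m" using Suc.prems by (metis Suc_le_lessD)
      then show False using local_not_one[OF R(2)] by simp
    qed
    then obtain i where i: "k \<le> i" "i < d" "c i \<notin> m" by blast
    have inv: "inverse (c i) \<in> A" "c i \<noteq> 0" using local_unit[OF R(2)] c i by auto
    \<comment> \<open>\<open>z k\<close> moves to the vacated place \<open>i\<close> and
      \<open>p k\<close> takes place \<open>k\<close>, so the first \<open>k\<close> entries stay as
      they are.\<close>
    let ?z = "(z(i := z k))(k := p k)"
    have zm: "?z l \<in> m" if "l < d" for l using that Z(3) i pm by auto
    then have zA: "?z l \<in> A" if "l < d" for l using that ideal_sub[OF R(8)] by blast
    have ig: "ideal_in A (igen A ?z d)" using zA by (intro igen_ideal[OF R(7)]) auto
    have mem: "?z l \<in> igen A ?z d" if "l < d" for l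
      using that zA by (intro gen_mem[OF R(7) ideal_zero_ideal[OF R(7)]]) auto
    have zj: "z l \<in> igen A ?z d" if "l < d" "l \<noteq> i" for l
      using mem[of l] mem[of i] that i by (cases "l = k") (auto split: if_splits)
    have "c i * z i = p k - (\<Sum>l\<in>{..<d} - {i}. c l * z l)"
      unfolding c(2) using i by (subst sum.remove[of _ i]) auto
    also have "\<dots> \<in> igen A ?z d"
      using mem[of k] i zj c by (intro ideal_diff[OF R(7) ig] ideal_sum[OF ig] ideal_mult[OF ig]) auto
    finally have "inverse (c i) * (c i * z i) \<in> igen A ?z d" using inv(1) by (rule ideal_mult[OF ig, rotated])
    then have "z i \<in> igen A ?z d" using inv by (simp add: mult.assoc[symmetric])
    then have "m \<subseteq> igen A ?z d" unfolding Z(5) using zj ideal_zero[OF ig]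
      by (intro gen_least[OF ig]) (simp, metis)
    moreover have "igen A ?z d \<subseteq> m" using zm ideal_zero[OF R(8)] by (intro gen_least[OF R(8)]) auto
    ultimately have "regsys A m ?z d" using zm Z unfolding regsys_def by blast
    moreover have "\<forall>l<Suc k. ?z l = p l" using z(2) i by (auto simp: less_Suc_eq)
    ultimately have "\<exists>y. regsys A m y d \<and> (\<forall>l<Suc k. y l = p l)" by blast
    then show ?case using i by auto
  qed
  then show ?thesis by auto
qed

section \<open>Powers of ideals and quasi-regularity\<close>

definition iprod :: "'a::field set => 'a set => 'a set => 'a set" where
  "iprod A I J = ideal_span A {a * b | a b. a \<in> I \<and> b \<in> J}"

text \<open>The product of \<open>J\<close> with the k-th power of \<open>I\<close>;
  \<open>J = A\<close> gives the power itself. Comparing \<open>jpow A A I k\<close> with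
  \<open>jpow A J I k\<close> replaces computations in the graded ring of \<open>I\<close> modulo
  \<open>J\<close>.\<close>

primrec jpow :: "'a::field set => 'a set => 'a set => nat => 'a set" where
  "jpow A J I 0 = J"
| "jpow A J I (Suc k) = iprod A (jpow A J I k) I"

lemma ideal_pow_eq_jpow: "ideal_pow A I k = jpow A A I k"
  by (induction k) (auto simp: iprod_def)

lemma iprod_least:
  "ideal_in A K ==> (\<And>a b. a \<in> I ==> b \<in> J ==> a * b \<in> K) ==> iprod A I J \<subseteq> K"
  unfolding iprod_def by (intro ideal_span_least) auto

context
  fixes A :: "'a::field set"
  assumes sA: "subring A"
begin

lemma iprod_ideal: "ideal_in A I ==> ideal_in A J ==> ideal_in A (iprod A I J)"
  unfolding iprod_def using ideal_sub[of A I] ideal_sub[of A J] subring_mult[OF sA]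
  by (intro ideal_span_ideal[OF sA]) blast

lemma iprod_mem: "a \<in> I ==> b \<in> J ==> a * b \<in> iprod A I J"
  unfolding iprod_def by (intro ideal_span_mem[OF sA]) auto

lemma iprod_mono: "ideal_in A I' ==> ideal_in A J' ==> I \<subseteq> I' ==> J \<subseteq> J' ==> iprod A I J \<subseteq> iprod A I' J'"
  by (intro iprod_least iprod_ideal) (auto intro: iprod_mem)

lemma jpow_ideal: "ideal_in A J ==> ideal_in A I ==> ideal_in A (jpow A J I k)"
  by (induction k) (auto intro: iprod_ideal)

lemma jpow_mono:
  "ideal_in A J' ==> ideal_in A I' ==> J \<subseteq> J' ==> I \<subseteq> I' ==> jpow A J I k \<subseteq> jpow A J' I' k"
proof (induction k)
  case (Suc k)
  then show ?case using iprod_mono[OF jpow_ideal[of J' I' k], of I' "jpow A J I k" I] by simp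
qed simp

lemma jpow_Suc_subset:
  assumes "ideal_in A J" "ideal_in A I" shows "jpow A J I (Suc k) \<subseteq> jpow A J I k"
  unfolding jpow.simps using ideal_mult_right[OF jpow_ideal[OF assms]] ideal_sub[OF assms(2)]
  by (intro iprod_least jpow_ideal assms) auto

lemma jpow_antimono:
  "ideal_in A J ==> ideal_in A I ==> k \<le> l ==> jpow A J I l \<subseteq> jpow A J I k"
  using lift_Suc_antimono_le[of "jpow A J I"] jpow_Suc_subset by blast

lemma jpow_mult:
  assumes J: "ideal_in A J" and I: "ideal_in A I" and a: "a \<in> jpow A J I k"
  shows "b \<in> jpow A A I l ==> a * b \<in> jpow A J I (k + l)"
proof (induction l arbitrary: b)
  case 0
  then show ?case using ideal_mult_right[OF jpow_ideal[OF J I] _ a] by simp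
next
  case (Suc l)
  have aA: "a \<in> A" using ideal_sub[OF jpow_ideal[OF J I] a] .
  have "iprod A (jpow A A I l) I \<subseteq> colon A (jpow A J I (k + Suc l)) a"
  proof (rule iprod_least[OF colon_ideal[OF sA jpow_ideal[OF J I] aA]])
    fix b c assume bc: "b \<in> jpow A A I l" "c \<in> I"
    then have "(a * b) * c \<in> jpow A J I (Suc (k + l))" using Suc by (auto intro: iprod_mem)
    moreover have "b * c \<in> A"
      using bc ideal_sub[OF jpow_ideal[OF ideal_ring[OF sA] I]] ideal_sub[OF I] subring_mult[OF sA] by blast
    ultimately show "b * c \<in> colon A (jpow A J I (k + Suc l)) a" by (simp add: colon_def mult_ac)
  qed
  then show ?case using Suc.prems by (auto simp: colon_def mult.commute)
qed

lemma jpow_self: assumes "ideal_in A I" shows "jpow A I I k = jpow A A I (Suc k)"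
proof (induction k)
  case 0
  have "iprod A A I \<subseteq> I" using assms by (intro iprod_least) (auto intro: ideal_mult)
  moreover have "I \<subseteq> iprod A A I" using iprod_mem[of 1 A _ I] subring_one[OF sA] by auto
  ultimately show ?case by simp
qed simp

lemma pow_mem_jpow: "ideal_in A I ==> u \<in> I ==> u ^ l \<in> jpow A A I l"
  by (induction l) (auto simp: subring_one[OF sA] mult.commute[of u] intro: iprod_mem)

text \<open>A product of \<open>k\<close> factors from \<open>I + (u)\<close> expands into a form of
  degree \<open>k\<close> in \<open>u\<close>. Statements about powers thereby become statements
  about polynomials in the last generator.\<close>

lemma jpow_adj_iff:
  assumes J: "ideal_in A J" and I: "ideal_in A I" and u: "u \<in> A"
  shows "z \<in> jpow A J (adj A I u) k \<longleftrightarrow>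
    (\<exists>h. (\<forall>l\<le>k. h l \<in> jpow A J I (k - l)) \<and> z = (\<Sum>l\<le>k. h l * u ^ l))" (is "_ \<longleftrightarrow> ?R k z")
proof
  note iadj = adj_ideal[OF sA I u]
  note ip = jpow_ideal[OF J I]
  assume "z \<in> jpow A J (adj A I u) k"
  then show "?R k z"
  proof (induction k arbitrary: z)
    case 0 then show ?case by (intro exI[of _ "\<lambda>_. z"]) auto
  next
    case (Suc k)
    have R: "ideal_in A {z. ?R (Suc k) z}"
      unfolding ideal_in_def
    proof (intro conjI ballI subsetI)
      show "0 \<in> {z. ?R (Suc k) z}" by (auto intro!: exI[of _ "\<lambda>_. 0"] ideal_zero[OF ip])
      fix z assume "z \<in> {z. ?R (Suc k) z}"
      then obtain h where h: "\<forall>l\<le>Suc k. h l \<in> jpow A J I (Suc k - l)" "z = (\<Sum>l\<le>Suc k. h l * u ^ l)" by blast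
      show "z \<in> A" unfolding h(2)
        using h(1) ideal_sub[OF ip] by (intro subring_sum subring_mult subring_power sA u) auto
      { fix w assume "w \<in> {z. ?R (Suc k) z}"
        then obtain g where g: "\<forall>l\<le>Suc k. g l \<in> jpow A J I (Suc k - l)" "w = (\<Sum>l\<le>Suc k. g l * u ^ l)" by blast
        have "z + w = (\<Sum>l\<le>Suc k. (h l + g l) * u ^ l)"
          unfolding h(2) g(2) by (simp add: sum.distrib distrib_right)
        then show "z + w \<in> {z. ?R (Suc k) z}"
          using h(1) g(1) by (intro CollectI exI[of _ "\<lambda>l. h l + g l"]) (auto intro: ideal_add[OF ip]) }
      fix r assume r: "r \<in> A"
      have "r * z = (\<Sum>l\<le>Suc k. (r * h l) * u ^ l)"
        unfolding h(2) by (simp add: sum_distrib_left mult.assoc distrib_left)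
      then show "r * z \<in> {z. ?R (Suc k) z}"
        using h(1) r by (intro CollectI exI[of _ "\<lambda>l. r * h l"]) (auto intro: ideal_mult[OF ip])
    qed
    have "iprod A (jpow A J (adj A I u) k) (adj A I u) \<subseteq> {z. ?R (Suc k) z}"
    proof (rule iprod_least[OF R])
      fix a b assume a: "a \<in> jpow A J (adj A I u) k" and b: "b \<in> adj A I u"
      obtain h where h: "\<forall>l\<le>k. h l \<in> jpow A J I (k - l)" "a = (\<Sum>l\<le>k. h l * u ^ l)" using Suc.IH[OF a] by blast
      obtain i c where ic: "i \<in> I" "c \<in> A" "b = i + c * u" using b by (rule adj_memE)
      let ?g = "\<lambda>l. (if l \<le> k then h l * i else 0) + (case l of 0 => 0 | Suc j => c * h j)"
      have "a * b = (\<Sum>l\<le>k. h l * i * u ^ l) + (\<Sum>l\<le>k. c * h l * u ^ Suc l)"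
        unfolding h(2) ic(3) by (simp add: sum_distrib_right sum_distrib_left distrib_left sum.distrib mult_ac)
      also have "(\<Sum>l\<le>k. h l * i * u ^ l) = (\<Sum>l\<le>Suc k. (if l \<le> k then h l * i else 0) * u ^ l)" by simp
      also have "(\<Sum>l\<le>k. c * h l * u ^ Suc l) = (\<Sum>l\<le>Suc k. (case l of 0 => 0 | Suc j => c * h j) * u ^ l)"
        by (subst sum.atMost_Suc_shift) simp
      also have "(\<Sum>l\<le>Suc k. (if l \<le> k then h l * i else 0) * u ^ l) + \<dots> = (\<Sum>l\<le>Suc k. ?g l * u ^ l)"
        by (simp add: sum.distrib[symmetric] distrib_right)
      finally have "a * b = (\<Sum>l\<le>Suc k. ?g l * u ^ l)" .
      moreover have "?g l \<in> jpow A J I (Suc k - l)" if "l \<le> Suc k" for l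
      proof (rule ideal_add[OF ip])
        show "(if l \<le> k then h l * i else 0) \<in> jpow A J I (Suc k - l)"
          using h(1) ic(1) ideal_zero[OF ip, of "Suc k - l"] by (auto simp: Suc_diff_le intro: iprod_mem)
        show "(case l of 0 => 0 | Suc j => c * h j) \<in> jpow A J I (Suc k - l)"
          using h(1) ic(2) that ideal_zero[OF ip] by (cases l) (auto intro: ideal_mult[OF ip] simp del: jpow.simps)
      qed
      ultimately show "a * b \<in> {z. ?R (Suc k) z}" by (intro CollectI exI[of _ ?g] conjI allI impI)
    qed
    then show ?case using Suc.prems by auto
  qed
next
  note iadj = adj_ideal[OF sA I u]
  assume "?R k z"
  then obtain h where h: "\<forall>l\<le>k. h l \<in> jpow A J I (k - l)" "z = (\<Sum>l\<le>k. h l * u ^ l)" by blast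
  have "h l * u ^ l \<in> jpow A J (adj A I u) k" if "l \<le> k" for l
  proof -
    have "h l \<in> jpow A J (adj A I u) (k - l)"
      using h that jpow_mono[OF J iadj subset_refl adj_sub[OF sA], of "k - l"] by blast
    moreover have "u ^ l \<in> jpow A A (adj A I u) l" by (rule pow_mem_jpow[OF iadj adj_mem[OF sA I]])
    ultimately show ?thesis using jpow_mult[OF J iadj, of "h l" "k - l" "u ^ l" l] that by simp
  qed
  then show "z \<in> jpow A J (adj A I u) k" unfolding h(2) by (intro ideal_sum[OF jpow_ideal[OF J iadj]]) auto
qed

text \<open>Quasi-regularity: as \<open>u\<close> is a nonzerodivisor modulo every power of
  \<open>I\<close>, the constant term of a relation is \<open>- (u * W)\<close> with
  \<open>W\<close> in the same power. It gains the factor \<open>J\<close> from \<open>u\<close>,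
  and \<open>W\<close> is absorbed into the next coefficient, which lowers the degree.\<close>

lemma graded_relation:
  assumes I: "ideal_in A I" and J: "ideal_in A J" "I \<subseteq> J" and u: "u \<in> J"
    and nzd: "\<And>n w. w \<in> A ==> u * w \<in> jpow A A I n ==> w \<in> jpow A A I n"
  shows "(\<And>l. l \<le> k ==> G l \<in> jpow A A I (k - l)) ==> (\<Sum>l\<le>k. G l * u ^ l) = 0 ==>
    l \<le> k ==> G l \<in> jpow A J I (k - l)"
proof (induction k arbitrary: G l)
  case 0 then show ?case using ideal_zero[OF J(1)] by simp
next
  case (Suc k)
  have uA: "u \<in> A" using ideal_sub[OF J(1) u] .
  note ip = jpow_ideal[OF ideal_ring[OF sA] I]
  define W where "W = (\<Sum>l\<le>k. G (Suc l) * u ^ l)"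
  have "(\<Sum>l\<le>Suc k. G l * u ^ l) = G 0 + u * W"
    by (simp only: sum.atMost_Suc_shift) (simp add: W_def sum_distrib_left mult_ac)
  then have G0: "G 0 = - (u * W)" using Suc.prems(2) by (simp add: add_eq_0_iff2)
  have WA: "W \<in> A" unfolding W_def
    using Suc.prems(1) ideal_sub[OF ip] by (intro subring_sum subring_mult subring_power sA uA) auto
  have "u * W = - G 0" using G0 by simp
  then have "u * W \<in> jpow A A I (Suc k)" using Suc.prems(1)[of 0] ideal_uminus[OF sA ip, of "G 0" "Suc k"] by (simp del: jpow.simps)
  then have W: "W \<in> jpow A A I (Suc k)" by (rule nzd[OF WA])
  let ?G = "\<lambda>l. G (Suc l) - (if l = 0 then W else 0)"
  have "(\<Sum>l\<le>k. ?G l * u ^ l) = W - (\<Sum>l\<le>k. (if l = 0 then W else 0) * u ^ l)"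
    by (simp add: W_def left_diff_distrib sum_subtractf)
  also have "(\<Sum>l\<le>k. (if l = 0 then W else 0) * u ^ l) = (\<Sum>l\<le>k. if l = 0 then W else 0)"
    by (intro sum.cong) auto
  finally have z: "(\<Sum>l\<le>k. ?G l * u ^ l) = 0" by simp
  have W': "W \<in> jpow A A I k" using W jpow_Suc_subset[OF ideal_ring[OF sA] I, of k] by blast
  have "?G l \<in> jpow A A I (k - l)" if "l \<le> k" for l
    using Suc.prems(1)[of "Suc l"] that W' ideal_diff[OF sA ip, of "G (Suc l)" k W] by auto
  note IH = Suc.IH[OF this z]
  show ?case
  proof (cases l)
    case 0
    have "u * W \<in> jpow A J I (0 + Suc k)" using u W by (intro jpow_mult[OF J(1) I]) auto
    then show ?thesis using 0 G0 ideal_uminus[OF sA jpow_ideal[OF J(1) I], of "u * W" "Suc k"]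
      by (simp del: jpow.simps)
  next
    case (Suc j)
    then have "?G j \<in> jpow A J I (k - j)" using IH Suc.prems by auto
    moreover have "W \<in> jpow A J I k" using W jpow_mono[OF J(1) I J(2) subset_refl, of k] jpow_self[OF I, of k] by blast
    ultimately show ?thesis
      using Suc ideal_add[OF jpow_ideal[OF J(1) I], of "?G j" "k - j" W] by (cases "j = 0") auto
  qed
qed

end

lemma jpow_zero: "subring A ==> jpow A J {0} (Suc k) \<subseteq> {0}"
  unfolding jpow.simps by (intro iprod_least ideal_zero_ideal) auto

text \<open>The case \<open>i = d\<close>, \<open>J = m\<close> says that the associated graded ring of a regular local ring
  is a domain; general \<open>J\<close> is what the induction on \<open>i\<close> needs.\<close>

lemma regsys_graded_domain:
  assumes y: "regsys A m y d"
  shows "i \<le> d ==> prime_in A J ==> igen A y i \<subseteq> J ==> a \<in> jpow A A (igen A y i) k ==>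
    b \<in> jpow A A (igen A y i) l ==> a * b \<in> jpow A J (igen A y i) (k + l) ==>
    a \<in> jpow A J (igen A y i) k \<or> b \<in> jpow A J (igen A y i) l"
proof (induction i arbitrary: J a b k l)
  case 0
  note R = regsysD[OF y]
  have iJ: "ideal_in A (jpow A J {0} n)" for n
    using 0 by (intro jpow_ideal[OF R(7)] prime_ideal ideal_zero_ideal R)
  show ?case
  proof (cases "k = 0 \<and> l = 0")
    case True then show ?thesis using 0 prime_mult[of A J a b] by auto
  next
    case False
    then have "a = 0 \<or> b = 0" using 0 jpow_zero[OF R(7), of A] by (cases k; cases l) auto
    then show ?thesis using ideal_zero[OF iJ] by auto
  qed
next
  case (Suc i)
  note R = regsysD[OF y] and sA = regsysD(7)[OF y]
  let ?I = "igen A y i" and ?u = "y i"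
  have I: "prime_in A ?I" "ideal_in A ?I" using regsys_prime[OF y, of i] Suc.prems(1) prime_ideal by auto
  have u: "?u \<in> A" "?u \<notin> ?I" using R(4)[of i] regsys_notin[OF y, of i] Suc.prems(1) by auto
  have uJ: "?u \<in> J" using Suc.prems(3) adj_mem[OF sA I(2)] by auto
  have IJ: "?I \<subseteq> J" using Suc.prems(3) adj_sub[OF sA] by auto
  have iJ: "ideal_in A J" using Suc.prems(2) by (rule prime_ideal)
  note ip = jpow_ideal[OF sA ideal_ring[OF sA] I(2)] and ipJ = jpow_ideal[OF sA iJ I(2)]
  note outer_IH = Suc.IH
  \<comment> \<open>Multiplication by \<open>y i\<close> is injective modulo every power of
    \<open>?I\<close>: this is the induction hypothesis with the prime \<open>?I\<close> in place of
    \<open>J\<close>.\<close>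
  have nzd: "w \<in> jpow A A ?I n" if "w \<in> A" "?u * w \<in> jpow A A ?I n" for n w
    using that(2)
  proof (induction n)
    case (Suc n)
    then have "w \<in> jpow A A ?I n" using jpow_Suc_subset[OF sA ideal_ring[OF sA] I(2), of n] by blast
    moreover have "?u * w \<in> jpow A ?I ?I (0 + n)" using Suc.prems jpow_self[OF sA I(2), of n] by simp
    ultimately have "?u \<in> jpow A ?I ?I 0 \<or> w \<in> jpow A ?I ?I n"
      using Suc.prems u \<open>Suc i \<le> d\<close> I by (intro outer_IH) auto
    then show ?case using u jpow_self[OF sA I(2), of n] by auto
  qed (use that in simp)
  show ?case
  proof (rule ccontr)
    assume no: "\<not> ?thesis"
    note iff = jpow_adj_iff[OF sA _ I(2) u(1)]
    obtain a0 where a0: "\<forall>s\<le>k. a0 s \<in> jpow A A ?I (k - s)" "a = (\<Sum>s\<le>k. a0 s * ?u ^ s)"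
      using Suc.prems(4) iff[OF ideal_ring[OF sA]] by auto
    obtain b0 where b0: "\<forall>s\<le>l. b0 s \<in> jpow A A ?I (l - s)" "b = (\<Sum>s\<le>l. b0 s * ?u ^ s)"
      using Suc.prems(5) iff[OF ideal_ring[OF sA]] by auto
    obtain h where h: "\<forall>r\<le>k + l. h r \<in> jpow A J ?I (k + l - r)" "a * b = (\<Sum>r\<le>k + l. h r * ?u ^ r)"
      using Suc.prems(6) iff[OF iJ] by auto
    define a' where "a' s = (if s \<le> k then a0 s else 0)" for s
    define b' where "b' s = (if s \<le> l then b0 s else 0)" for s
    have a': "a' s \<in> jpow A A ?I (k - s)" and b': "b' s \<in> jpow A A ?I (l - s)" for s
      using a0 b0 ideal_zero[OF ip] by (auto simp: a'_def b'_def simp del: jpow.simps)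
    have ea: "a = (\<Sum>s\<le>k. a' s * ?u ^ s)" and eb: "b = (\<Sum>s\<le>l. b' s * ?u ^ s)"
      using a0 b0 by (auto simp: a'_def b'_def)
    define c where "c r = (\<Sum>s\<le>r. a' s * b' (r - s))" for r
    have ab: "a * b = (\<Sum>r\<le>k + l. c r * ?u ^ r)"
      unfolding ea eb c_def by (rule polynomial_product) (auto simp: a'_def b'_def)
    have exps: "k + l - r \<le> (k - s) + (l - (r - s))" if "s \<le> r" for r s using that by auto
    have prodJ: "a' s * b' (r - s) \<in> jpow A J ?I (k + l - r)"
      if "s \<le> r" "a' s \<in> jpow A J ?I (k - s) \<or> b' (r - s) \<in> jpow A J ?I (l - (r - s))" for r s
    proof -
      have "a' s * b' (r - s) \<in> jpow A J ?I ((k - s) + (l - (r - s)))"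
        using that(2) jpow_mult[OF sA iJ I(2) _ b'[of "r - s"], of "a' s" "k - s"]
          jpow_mult[OF sA iJ I(2) _ a'[of s], of "b' (r - s)" "l - (r - s)"]
        by (auto simp: mult.commute add.commute)
      then show ?thesis using jpow_antimono[OF sA iJ I(2) exps[OF that(1)]] by blast
    qed
    have cI: "c r \<in> jpow A A ?I (k + l - r)" for r
      unfolding c_def
    proof (rule ideal_sum[OF ip])
      fix s assume "s \<in> {..r}"
      then show "a' s * b' (r - s) \<in> jpow A A ?I (k + l - r)"
        using jpow_mult[OF sA ideal_ring[OF sA] I(2) a'[of s] b'[of "r - s"]]
          jpow_antimono[OF sA ideal_ring[OF sA] I(2) exps[of s r]] by auto
    qed
    have hI: "h r \<in> jpow A A ?I (k + l - r)" if "r \<le> k + l" for r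
      using h(1) that jpow_mono[OF sA ideal_ring[OF sA] I(2) ideal_subset[OF iJ] subset_refl, of "k + l - r"] by blast
    \<comment> \<open>\<open>c\<close> and \<open>h\<close> are two forms for \<open>a * b\<close>
      and need not agree, but their difference is a relation, which \<open>graded_relation\<close>
      controls coefficient by coefficient.\<close>
    have cJ: "c r \<in> jpow A J ?I (k + l - r)" if r: "r \<le> k + l" for r
    proof -
      have "c r - h r \<in> jpow A J ?I (k + l - r)"
      proof (rule graded_relation[OF sA I(2) iJ IJ uJ nzd, where k = "k + l" and G = "\<lambda>r. c r - h r"])
        show "c r - h r \<in> jpow A A ?I (k + l - r)" if "r \<le> k + l" for r
          using ideal_diff[OF sA ip cI hI[OF that]] .
        show "(\<Sum>l\<le>k + l. (c l - h l) * ?u ^ l) = 0"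
          using ab h(2) by (simp add: left_diff_distrib sum_subtractf)
      qed (use r in auto)
      then show ?thesis using ideal_add[OF ipJ _ h(1)[rule_format, OF r]] by fastforce
    qed
    \<comment> \<open>As for contents of polynomials: take the lowest bad coefficients
      \<open>a' s\<close> and \<open>b' t\<close>. In degree \<open>s + t\<close> every other
      product is good, hence so is theirs, and the induction hypothesis makes one of them
      good.\<close>
    have "\<exists>s\<le>k. a' s \<notin> jpow A J ?I (k - s)"
      using no iff[OF iJ, of a k] ea by auto
    then obtain s where s: "s \<le> k" "a' s \<notin> jpow A J ?I (k - s)" "\<And>s'. s' < s ==> a' s' \<in> jpow A J ?I (k - s')"
    proof -
      assume *: "\<And>s. s \<le> k ==> a' s \<notin> jpow A J ?I (k - s) ==>
        (\<And>s'. s' < s ==> a' s' \<in> jpow A J ?I (k - s')) ==> thesis"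
      let ?Q = "\<lambda>s. s \<le> k \<and> a' s \<notin> jpow A J ?I (k - s)"
      assume "\<exists>s\<le>k. a' s \<notin> jpow A J ?I (k - s)"
      then obtain s where "?Q s" "\<forall>s'<s. \<not> ?Q s'" using exists_least_iff[of ?Q] by blast
      then show thesis using *[of s] by auto
    qed
    have "\<exists>s\<le>l. b' s \<notin> jpow A J ?I (l - s)"
      using no iff[OF iJ, of b l] eb by auto
    then obtain t where t: "t \<le> l" "b' t \<notin> jpow A J ?I (l - t)" "\<And>t'. t' < t ==> b' t' \<in> jpow A J ?I (l - t')"
    proof -
      assume *: "\<And>t. t \<le> l ==> b' t \<notin> jpow A J ?I (l - t) ==>
        (\<And>t'. t' < t ==> b' t' \<in> jpow A J ?I (l - t')) ==> thesis"
      let ?Q = "\<lambda>t. t \<le> l \<and> b' t \<notin> jpow A J ?I (l - t)"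
      assume "\<exists>t\<le>l. b' t \<notin> jpow A J ?I (l - t)"
      then obtain t where "?Q t" "\<forall>t'<t. \<not> ?Q t'" using exists_least_iff[of ?Q] by blast
      then show thesis using *[of t] by auto
    qed
    have "c (s + t) = a' s * b' t + (\<Sum>s'\<in>{..s + t} - {s}. a' s' * b' (s + t - s'))"
      unfolding c_def by (subst sum.remove[of _ s]) auto
    then have "a' s * b' t = c (s + t) - (\<Sum>s'\<in>{..s + t} - {s}. a' s' * b' (s + t - s'))" by simp
    also have "\<dots> \<in> jpow A J ?I (k + l - (s + t))"
    proof (rule ideal_diff[OF sA ipJ cJ ideal_sum[OF ipJ prodJ]])
      fix s' assume s': "s' \<in> {..s + t} - {s}"
      then have "s' < s \<or> s + t - s' < t" by auto
      then show "a' s' \<in> jpow A J ?I (k - s') \<or> b' (s + t - s') \<in> jpow A J ?I (l - (s + t - s'))"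
        using s(3) t(3) by blast
    qed (use s t in auto)
    also have "k + l - (s + t) = (k - s) + (l - t)" using s t by simp
    finally have "a' s \<in> jpow A J ?I (k - s) \<or> b' t \<in> jpow A J ?I (l - t)"
      using Suc.prems a' b' IJ by (intro Suc.IH) auto
    then show False using s t by blast
  qed
qed

lemma regsys_nzd:
  assumes y: "regsys A m y d" and i: "i < d" and w: "w \<in> A"
  shows "y i * w \<in> jpow A A (igen A y i) n ==> w \<in> jpow A A (igen A y i) n"
proof (induction n)
  case (Suc n)
  note sA = regsysD(7)[OF y]
  let ?I = "igen A y i"
  have I: "prime_in A ?I" "ideal_in A ?I" using regsys_prime[OF y, of i] i prime_ideal by auto
  have "w \<in> jpow A A ?I n" using Suc jpow_Suc_subset[OF sA ideal_ring[OF sA] I(2), of n] by blast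
  moreover have "y i * w \<in> jpow A ?I ?I (0 + n)" using Suc.prems jpow_self[OF sA I(2), of n] by simp
  ultimately have "y i \<in> jpow A ?I ?I 0 \<or> w \<in> jpow A ?I ?I n"
    using i I regsysD(4)[OF y i] by (intro regsys_graded_domain[OF y, of i]) auto
  then show ?case using regsys_notin[OF y i] jpow_self[OF sA I(2), of n] by auto
qed (use w in simp)

text \<open>In the associated graded ring the last parameter is a variable over the others. This is
  the source of independence in \<open>regsys_indep\<close> and of transcendence in
  \<open>blow_transcendental\<close>.\<close>

lemma regsys_graded_polynomial:
  assumes y: "regsys A m y (Suc d)" and G: "\<And>l. l \<le> k ==> G l \<in> jpow A A (igen A y d) (k - l)"
    and s: "(\<Sum>l\<le>k. G l * y d ^ l) \<in> jpow A A m (Suc k)" and l: "l \<le> k"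
  shows "G l \<in> jpow A A m (Suc (k - l))"
proof -
  note R = regsysD[OF y] and sA = regsysD(7)[OF y]
  let ?I = "igen A y d" and ?u = "y d"
  have I: "ideal_in A ?I" using regsys_prime[OF y, of d] prime_ideal by auto
  have m: "m = adj A ?I ?u" using R(5) by simp
  have u: "?u \<in> A" "?u \<in> m" using R(3,4)[of d] by auto
  have Im: "?I \<subseteq> m" unfolding m by (rule adj_sub[OF sA])
  note ip = jpow_ideal[OF sA ideal_ring[OF sA] I] and ipm = jpow_ideal[OF sA R(8) I]
  have "(\<Sum>l\<le>k. G l * ?u ^ l) \<in> jpow A m (adj A ?I ?u) k" using s jpow_self[OF sA R(8), of k] m by simp
  then obtain h where h: "\<forall>l\<le>k. h l \<in> jpow A m ?I (k - l)" "(\<Sum>l\<le>k. G l * ?u ^ l) = (\<Sum>l\<le>k. h l * ?u ^ l)"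
    using jpow_adj_iff[OF sA R(8) I u(1)] by blast
  have "G l - h l \<in> jpow A m ?I (k - l)"
  proof (rule graded_relation[OF sA I R(8) Im u(2) regsys_nzd[OF y], where k = k and G = "\<lambda>r. G r - h r"])
    show "G l - h l \<in> jpow A A ?I (k - l)" if "l \<le> k" for l
      using ideal_diff[OF sA ip G[OF that]] h(1) that
        jpow_mono[OF sA ideal_ring[OF sA] I ideal_subset[OF R(8)] subset_refl, of "k - l"] by blast
    show "(\<Sum>l\<le>k. (G l - h l) * ?u ^ l) = 0"
      using h(2) by (simp add: left_diff_distrib sum_subtractf)
  qed (use l in auto)
  then have "G l \<in> jpow A m ?I (k - l)" using ideal_add[OF ipm _ h(1)[rule_format, OF l]] by fastforce
  then show ?thesis using jpow_mono[OF sA R(8) R(8) subset_refl Im, of "k - l"] jpow_self[OF sA R(8), of "k - l"] by blast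
qed

section \<open>Krull's intersection theorem and the order function\<close>

lemma iprod_igen:
  assumes sA: "subring A" and I: "ideal_in A I" and y: "\<And>i. i < n ==> y i \<in> A"
    and z: "z \<in> iprod A I (igen A y n)"
  shows "\<exists>c. (\<forall>i<n. c i \<in> I) \<and> z = (\<Sum>i<n. c i * y i)"
proof -
  let ?K = "{z. \<exists>c. (\<forall>i<n. c i \<in> I) \<and> z = (\<Sum>i<n. c i * y i)}"
  have K: "ideal_in A ?K"
    unfolding ideal_in_def
  proof (intro conjI ballI subsetI)
    show "0 \<in> ?K" by (auto intro!: exI[of _ "\<lambda>_. 0"] ideal_zero[OF I])
    fix a assume "a \<in> ?K"
    then obtain c where c: "\<forall>i<n. c i \<in> I" "a = (\<Sum>i<n. c i * y i)" by blast
    show "a \<in> A" unfolding c(2) using c(1) y ideal_sub[OF I] by (intro subring_sum subring_mult sA) auto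
    { fix b assume "b \<in> ?K"
      then obtain e where e: "\<forall>i<n. e i \<in> I" "b = (\<Sum>i<n. e i * y i)" by blast
      show "a + b \<in> ?K" using c e
        by (intro CollectI exI[of _ "\<lambda>i. c i + e i"]) (auto simp: sum.distrib distrib_right intro: ideal_add[OF I]) }
    fix r assume "r \<in> A"
    then show "r * a \<in> ?K" using c
      by (intro CollectI exI[of _ "\<lambda>i. r * c i"]) (auto simp: sum_distrib_left mult.assoc intro: ideal_mult[OF I])
  qed
  have "iprod A I (igen A y n) \<subseteq> ?K"
  proof (rule iprod_least[OF K])
    fix a b assume a: "a \<in> I" and b: "b \<in> igen A y n"
    obtain c where c: "\<forall>l<n. c l \<in> A" "b = (\<Sum>l<n. c l * y l)" using b by (rule igen_sumE[OF sA])
    then show "a * b \<in> ?K" using a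
      by (intro CollectI exI[of _ "\<lambda>i. a * c i"]) (auto simp: sum_distrib_left mult.assoc intro: ideal_mult_right[OF I])
  qed
  then show ?thesis using z by blast
qed

lemma jpow_subset_if_nilpotent:
  assumes sA: "subring A" and Q: "ideal_in A Q" and nil: "\<And>i. i < n ==> \<exists>r. y i ^ r \<in> Q"
  shows "(\<And>i. i < n ==> y i \<in> A) ==> \<exists>r. jpow A A (igen A y n) r \<subseteq> Q"
  using nil
proof (induction n)
  case 0
  then show ?case using jpow_zero[OF sA, of A 0] ideal_zero[OF Q] by (intro exI[of _ 1]) auto
next
  case (Suc n)
  let ?I = "igen A y n"
  have I: "ideal_in A ?I" using Suc.prems by (intro igen_ideal[OF sA]) auto
  obtain R where R: "jpow A A ?I R \<subseteq> Q" using Suc.IH Suc.prems by auto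
  obtain r where r: "y n ^ r \<in> Q" using Suc.prems by blast
  have yn: "y n \<in> A" using Suc.prems by auto
  \<comment> \<open>In a form of degree \<open>R + r\<close> each term has either exponent at least
    \<open>r\<close> or a coefficient in the \<open>R\<close>-th power.\<close>
  have "jpow A A (adj A ?I (y n)) (R + r) \<subseteq> Q"
  proof
    fix z assume "z \<in> jpow A A (adj A ?I (y n)) (R + r)"
    then obtain h where h: "\<forall>l\<le>R + r. h l \<in> jpow A A ?I (R + r - l)" "z = (\<Sum>l\<le>R + r. h l * y n ^ l)"
      using jpow_adj_iff[OF sA ideal_ring[OF sA] I yn] by blast
    have hA: "h l \<in> A" if "l \<le> R + r" for l using h(1) that ideal_sub[OF jpow_ideal[OF sA ideal_ring[OF sA] I]] by blast
    have "h l * y n ^ l \<in> Q" if l: "l \<le> R + r" for l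
    proof (cases "r \<le> l")
      case True
      then have "y n ^ l = y n ^ (l - r) * y n ^ r" by (simp add: power_add[symmetric])
      then show ?thesis using r hA[OF l] yn sA by (auto intro!: ideal_mult[OF Q] subring_power)
    next
      case False
      then have "h l \<in> jpow A A ?I R"
        using h(1)[rule_format, OF l] subsetD[OF jpow_antimono[OF sA ideal_ring[OF sA] I, of R "R + r - l"]]
        by simp
      then show ?thesis using R yn by (intro ideal_mult_right[OF Q] subring_power[OF sA]) auto
    qed
    then show "z \<in> Q" unfolding h(2) by (intro ideal_sum[OF Q]) auto
  qed
  then show ?case by auto
qed

text \<open>Let \<open>N\<close> be the intersection of the powers and \<open>Q\<close> maximal
  among the ideals above \<open>mN\<close> whose trace on \<open>N\<close> lies in
  \<open>mN\<close>. Then \<open>Q\<close> contains a power of each element of \<open>m\<close>,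
  hence a power of \<open>m\<close>, hence \<open>N\<close>; so \<open>N = mN\<close>, and
  Nakayama's lemma applies.\<close>

lemma krull_intersection:
  assumes A: "noetherian A" "local_ring A m" and a: "\<And>k. a \<in> jpow A A m k"
  shows "a = 0"
proof -
  have sA: "subring A" and im: "ideal_in A m" using A by (auto simp: local_ring_def)
  note ip = jpow_ideal[OF sA ideal_ring[OF sA] im]
  define N where "N = (\<Inter>k. jpow A A m k)"
  have N: "ideal_in A N"
    unfolding ideal_in_def N_def using ideal_sub[OF ip] ideal_zero[OF ip] ideal_add[OF ip] ideal_mult[OF ip]
    by auto
  let ?mN = "iprod A m N"
  have mN: "ideal_in A ?mN" by (rule iprod_ideal[OF sA im N])
  have mNN: "?mN \<subseteq> N" using ideal_mult[OF N] ideal_sub[OF im] by (intro iprod_least[OF N]) auto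
  let ?P = "\<lambda>Q. ideal_in A Q \<and> ?mN \<subseteq> Q \<and> Q \<inter> N \<subseteq> ?mN"
  obtain Q where Q: "?P Q" "\<And>K. ?P K ==> Q \<subseteq> K ==> K = Q"
    by (rule noeth_max[of A ?P ?mN]) (use A mN mNN in auto)
  have iQ: "ideal_in A Q" using Q by blast
  obtain n y where y: "\<And>i. i < n ==> y i \<in> m" "m = igen A y n" using noeth_fg[OF A(1) im] by blast
  have "\<exists>r. x ^ r \<in> Q" if x: "x \<in> m" for x
  proof -
    have xA: "x \<in> A" using ideal_sub[OF im x] .
    have "colon A Q (x ^ k) \<subseteq> colon A Q (x ^ Suc k)" for k
      using ideal_mult[OF iQ xA] by (auto simp: colon_def mult.left_commute[of _ x])
    then have "\<exists>r. \<forall>i\<ge>r. colon A Q (x ^ i) = colon A Q (x ^ r)"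
      by (intro noeth_acc[OF A(1)] colon_ideal[OF sA iQ] subring_power[OF sA xA])
    then obtain r where r: "\<And>i. i \<ge> r ==> colon A Q (x ^ i) = colon A Q (x ^ r)" by blast
    \<comment> \<open>Beyond the index where the ideals \<open>colon A Q (x ^ i)\<close> are
      constant, adjoining \<open>x ^ r\<close> does not enlarge the trace on \<open>N\<close> past
      \<open>?mN\<close>; maximality then puts \<open>x ^ r\<close> into \<open>Q\<close>.\<close>
    have "adj A Q (x ^ r) \<inter> N \<subseteq> ?mN"
    proof
      fix z assume z: "z \<in> adj A Q (x ^ r) \<inter> N"
      then obtain q b where qb: "q \<in> Q" "b \<in> A" "z = q + b * x ^ r" by (auto elim: adj_memE)
      have "x * z \<in> ?mN" using x z by (intro iprod_mem[OF sA]) auto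
      then have "x * z - x * q \<in> Q" using Q(1) ideal_mult[OF iQ xA qb(1)] by (intro ideal_diff[OF sA iQ]) auto
      moreover have "x * z - x * q = b * x ^ Suc r" unfolding qb by (simp add: algebra_simps)
      ultimately have "b \<in> colon A Q (x ^ Suc r)" using qb by (simp add: colon_def)
      then have "b \<in> colon A Q (x ^ r)" using r[of "Suc r"] by simp
      then have "b * x ^ r \<in> Q" by (simp add: colon_def)
      then have "z \<in> Q" unfolding qb using qb(1) by (intro ideal_add[OF iQ])
      then show "z \<in> ?mN" using z Q by blast
    qed
    then have "adj A Q (x ^ r) = Q"
      using Q adj_ideal[OF sA iQ subring_power[OF sA xA]] adj_sub[OF sA, of Q "x ^ r"] by (intro Q(2)) auto
    then show ?thesis using adj_mem[OF sA iQ] by blast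
  qed
  then have "\<exists>r. jpow A A (igen A y n) r \<subseteq> Q"
    using y ideal_sub[OF im] by (intro jpow_subset_if_nilpotent[OF sA iQ]) auto
  then obtain r where "jpow A A m r \<subseteq> Q" using y(2) by auto
  then have NmN: "N \<subseteq> ?mN" using Q(1) unfolding N_def by blast
  obtain k g where g: "\<And>i. i < k ==> g i \<in> N" "N = igen A g k" using noeth_fg[OF A(1) N] by blast
  have gA: "g i \<in> A" if "i < k" for i using g(1) that ideal_sub[OF N] by blast
  have "g l \<in> {0}" if "l < k" for l
  proof (rule nakayama_gens[OF A(2) ideal_zero_ideal[OF sA], where n = k])
    fix l assume "l < k"
    then have "g l \<in> iprod A m (igen A g k)" using g NmN by auto
    then show "\<exists>j\<in>{0}. \<exists>c. (\<forall>i<k. c i \<in> m) \<and> g l = j + (\<Sum>i<k. c i * g i)"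
      using iprod_igen[OF sA im gA] by simp
  qed (rule that)
  then have "N \<subseteq> {0}" unfolding g(2) by (intro gen_least[OF ideal_zero_ideal[OF sA]]) auto
  then show ?thesis using a unfolding N_def by blast
qed

section \<open>The order function of a regular local ring\<close>

context
  fixes A m :: "'a::field set" and y d
  assumes y: "regsys A m y d"
begin

lemma ord_fun_eq:
  assumes "a \<in> ideal_pow A m n" "a \<notin> ideal_pow A m (Suc n)" shows "ord_fun A m a = n"
  unfolding ord_fun_def
proof (rule Greatest_equality)
  show "a \<in> ideal_pow A m n" by fact
  note R = regsysD[OF y]
  fix k assume "a \<in> ideal_pow A m k"
  then show "k \<le> n"
    using assms(2) jpow_antimono[OF R(7) ideal_ring[OF R(7)] R(8), of "Suc n" k]
    unfolding ideal_pow_eq_jpow by (metis not_less_eq_eq subsetD)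
qed

text \<open>Krull's intersection theorem bounds the exponents, so that \<open>GREATEST\<close> is
  attained.\<close>

lemma ord_fun_mem:
  assumes a: "a \<in> A" "a \<noteq> 0" shows "a \<in> ideal_pow A m k \<longleftrightarrow> k \<le> ord_fun A m a"
proof -
  note R = regsysD[OF y]
  have "\<exists>k. a \<notin> ideal_pow A m k" using krull_intersection[OF R(1,2), of a] a unfolding ideal_pow_eq_jpow by blast
  then obtain k0 where k0: "a \<notin> ideal_pow A m k0" "\<And>j. j < k0 ==> a \<in> ideal_pow A m j"
    using exists_least_iff[of "\<lambda>k. a \<notin> ideal_pow A m k"] by blast
  then obtain n where n: "k0 = Suc n" using a by (cases k0) auto
  have "ord_fun A m a = n" using k0 n by (intro ord_fun_eq) auto
  moreover have "a \<notin> ideal_pow A m k" if "k0 \<le> k"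
    using k0(1) jpow_antimono[OF R(7) ideal_ring[OF R(7)] R(8) that] unfolding ideal_pow_eq_jpow by blast
  ultimately show ?thesis using k0 n by (metis not_less_eq_eq not_le)
qed

text \<open>Initial forms multiply because the graded ring is a domain: the case
  \<open>J = m\<close> of \<open>regsys_graded_domain\<close>.\<close>

lemma ord_fun_mult:
  assumes a: "a \<in> A" "a \<noteq> 0" and b: "b \<in> A" "b \<noteq> 0"
  shows "ord_fun A m (a * b) = ord_fun A m a + ord_fun A m b"
proof (rule ord_fun_eq)
  note R = regsysD[OF y]
  let ?k = "ord_fun A m a" and ?l = "ord_fun A m b"
  have ab: "a \<in> jpow A A m ?k" "b \<in> jpow A A m ?l"
    using ord_fun_mem[OF a, of ?k] ord_fun_mem[OF b, of ?l] by (auto simp: ideal_pow_eq_jpow)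
  show "a * b \<in> ideal_pow A m (?k + ?l)"
    using jpow_mult[OF R(7) ideal_ring[OF R(7)] R(8) ab] by (simp add: ideal_pow_eq_jpow)
  show "a * b \<notin> ideal_pow A m (Suc (?k + ?l))"
  proof
    assume "a * b \<in> ideal_pow A m (Suc (?k + ?l))"
    then have "a * b \<in> jpow A m m (?k + ?l)" using jpow_self[OF R(7,8)] by (simp add: ideal_pow_eq_jpow del: jpow.simps)
    then have "a \<in> jpow A m m ?k \<or> b \<in> jpow A m m ?l"
      using regsys_graded_domain[OF y order_refl local_prime[OF R(2)], of a ?k b ?l] R(5) ab by auto
    then have "a \<in> ideal_pow A m (Suc ?k) \<or> b \<in> ideal_pow A m (Suc ?l)"
      using jpow_self[OF R(7,8)] by (simp add: ideal_pow_eq_jpow del: jpow.simps)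
    then show False using ord_fun_mem[OF a, of "Suc ?k"] ord_fun_mem[OF b, of "Suc ?l"] by auto
  qed
qed

end

section \<open>Free resolutions\<close>

abbreviation (input) "bd rs D i u \<equiv> lc (rs i) u (D i)"

text \<open>A free resolution of \<open>A / P\<close>, unbounded to the left; a finite one has
  \<open>rs i = 0\<close> from some point on. The rows of \<open>D i\<close> are the images of the
  basis vectors, and exactness at rank \<open>rs 0 = 1\<close> is the description of
  \<open>P\<close> as the image of \<open>D 1\<close>.\<close>

definition is_res :: "'a::field set => (nat => nat) => (nat => nat => nat => 'a) => 'a set => bool" where
  "is_res A rs D P \<longleftrightarrow> rs 0 = 1 \<and>
     (\<forall>i. \<forall>l<rs (Suc i). D (Suc i) l \<in> fvec A (rs i)) \<and>
     (\<forall>i. \<forall>l<rs (Suc (Suc i)). bd rs D (Suc i) (D (Suc (Suc i)) l) = (\<lambda>_. 0)) \<and>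
     (\<forall>i. \<forall>u\<in>fvec A (rs (Suc i)). bd rs D (Suc i) u = (\<lambda>_. 0) -->
        (\<exists>w\<in>fvec A (rs (Suc (Suc i))). u = bd rs D (Suc (Suc i)) w)) \<and>
     P = {bd rs D 1 u 0 | u. u \<in> fvec A (rs 1)}"

lemma is_resD:
  assumes "is_res A rs D P"
  shows "rs 0 = 1" "l < rs (Suc i) ==> D (Suc i) l \<in> fvec A (rs i)"
    "l < rs (Suc (Suc i)) ==> bd rs D (Suc i) (D (Suc (Suc i)) l) = (\<lambda>_. 0)"
    "u \<in> fvec A (rs (Suc i)) ==> bd rs D (Suc i) u = (\<lambda>_. 0) ==>
      \<exists>w\<in>fvec A (rs (Suc (Suc i))). u = bd rs D (Suc (Suc i)) w"
    "P = {bd rs D 1 u 0 | u. u \<in> fvec A (rs 1)}"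
  using assms unfolding is_res_def by blast+

lemma lc_cong: "(\<And>l. l < s ==> c l = c' l) ==> lc s c g = lc s c' g"
  by (auto simp: lc_def)

lemma lc_add: "lc s (\<lambda>k. u k + v k) g = (\<lambda>k. lc s u g k + lc s v g k)"
  by (auto simp: lc_def sum.distrib distrib_right)

lemma lc_diff: "lc s (\<lambda>k. u k - v k) g = (\<lambda>k. lc s u g k - lc s v g k)"
  by (auto simp: lc_def sum_subtractf left_diff_distrib)

lemma lc_scale: "lc s (\<lambda>k. c * u k) g = (\<lambda>k. c * lc s u g k)"
  by (auto simp: lc_def sum_distrib_left mult.assoc)

lemma lc_lc: "lc s (lc t w h) g = lc t w (\<lambda>l. lc s (h l) g)"
proof
  fix k
  have "lc s (lc t w h) g k = (\<Sum>l<s. \<Sum>j<t. w j * h j l * g l k)"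
    by (simp add: lc_def sum_distrib_right)
  also have "\<dots> = (\<Sum>j<t. \<Sum>l<s. w j * h j l * g l k)" by (rule sum.swap)
  finally show "lc s (lc t w h) g k = lc t w (\<lambda>l. lc s (h l) g) k"
    by (simp add: lc_def sum_distrib_left mult.assoc)
qed

lemma lc_fvec:
  assumes "subring A" "ideal_in A J" "u \<in> fvec J s" "\<And>l. l < s ==> g l \<in> fvec A r"
  shows "lc s u g \<in> fvec J r"
  using assms unfolding fvec_def lc_def
  by (auto intro!: ideal_sum ideal_mult_right sum.neutral)

lemma fvec_unit: "subring A ==> l < r ==> (\<lambda>k. if k = l then 1 else 0) \<in> fvec A r"
  by (auto simp: fvec_def subring_closed)

lemma lc_unit: "l < s ==> lc s (\<lambda>k. if k = l then 1 else 0) g = g l"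
  by (auto simp: lc_def if_distrib[of "\<lambda>x. x * _"] cong: if_cong)

lemma fvec_mono: "I \<subseteq> J ==> fvec I r \<subseteq> fvec J r"
  by (auto simp: fvec_def)

lemma fvec_adj:
  assumes "subring A" "ideal_in A J" "v \<in> fvec (adj A J x) r"
  shows "\<exists>a\<in>fvec J r. \<exists>b\<in>fvec A r. v = (\<lambda>k. a k + x * b k)"
proof -
  have "\<forall>k. \<exists>a b. k < r --> a \<in> J \<and> b \<in> A \<and> v k = a + b * x"
    using assms(3) unfolding fvec_def adj_def by blast
  then obtain a b where ab: "\<And>k. k < r ==> a k \<in> J \<and> b k \<in> A \<and> v k = a k + b k * x" by metis
  let ?a = "\<lambda>k. if k < r then a k else 0" and ?b = "\<lambda>k. if k < r then b k else 0"
  have "v = (\<lambda>k. ?a k + x * ?b k)" using ab assms(3) by (auto simp: fvec_def mult.commute)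
  moreover have "?a \<in> fvec J r" "?b \<in> fvec A r" using ab by (auto simp: fvec_def)
  ultimately show ?thesis by (intro bexI[of _ ?a] bexI[of _ ?b])
qed

context
  fixes A :: "'a::field set" and rs D P
  assumes sA: "subring A" and res: "is_res A rs D P"
begin

lemma res_D_comp: "w \<in> fvec A (rs (Suc (Suc i))) ==>
    bd rs D (Suc i) (lc (rs (Suc (Suc i))) w (D (Suc (Suc i)))) = (\<lambda>_. 0)"
  unfolding lc_lc using is_resD(3)[OF res] by (auto simp: lc_def[of "rs (Suc (Suc i))"])

lemma res_D_fvec: "ideal_in A J ==> w \<in> fvec J (rs (Suc i)) ==> bd rs D (Suc i) w \<in> fvec J (rs i)"
  using is_resD(2)[OF res] by (intro lc_fvec[OF sA]) auto

end

text \<open>Vanishing of the homology of the resolution tensored with \<open>A / J\<close> in degree \<open>i + 1\<close>.\<close>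

definition tor_zero :: "'a::field set => (nat => nat) => (nat => nat => nat => 'a) => nat => 'a set => bool" where
  "tor_zero A rs D i J \<longleftrightarrow> (\<forall>u\<in>fvec A (rs (Suc i)). bd rs D (Suc i) u \<in> fvec J (rs i) -->
     (\<exists>w\<in>fvec A (rs (Suc (Suc i))). (\<lambda>k. u k - bd rs D (Suc (Suc i)) w k) \<in> fvec J (rs (Suc i))))"

section \<open>Regular sequences and vanishing of homology\<close>

definition regseq :: "'a::field set => (nat => 'a) => nat => bool" where
  "regseq A y t \<longleftrightarrow> (\<forall>j<t. y j \<in> A \<and> (\<forall>a\<in>A. y j * a \<in> igen A y j --> a \<in> igen A y j))"

text \<open>The long exact sequence of multiplication by \<open>y j\<close>, unrolled to cycles:
  vanishing for the first \<open>j\<close> elements at the indices \<open>i - 1\<close> and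
  \<open>i\<close> gives it at \<open>i\<close> after adjoining \<open>y j\<close>. Each element
  costs one degree, whence \<open>j \<le> i\<close>.\<close>

lemma tor_zero_regseq:
  assumes sA: "subring A" and res: "is_res A rs D P"
  shows "regseq A y j ==> j \<le> i ==> tor_zero A rs D i (igen A y j)"
proof (induction j arbitrary: i)
  case 0
  have fv: "fvec {0} r = {\<lambda>_. 0}" for r by (auto simp: fvec_def) (metis not_less)
  show ?case unfolding tor_zero_def gen.simps fv
  proof (intro ballI impI)
    fix u assume "u \<in> fvec A (rs (Suc i))" "bd rs D (Suc i) u \<in> {\<lambda>_. 0}"
    then obtain w where "w \<in> fvec A (rs (Suc (Suc i)))" "u = bd rs D (Suc (Suc i)) w"
      using is_resD(4)[OF res] by blast
    then show "\<exists>w\<in>fvec A (rs (Suc (Suc i))). (\<lambda>k. u k - bd rs D (Suc (Suc i)) w k) \<in> {\<lambda>_. 0}"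
      by (intro bexI[of _ w]) auto
  qed
next
  case (Suc j)
  let ?J = "igen A y j" and ?r1 = "rs (Suc i)" and ?r2 = "rs (Suc (Suc i))"
  let ?b0 = "bd rs D i" and ?b1 = "bd rs D (Suc i)" and ?b2 = "bd rs D (Suc (Suc i))"
  have rj: "regseq A y j" using Suc.prems by (auto simp: regseq_def)
  have iJ: "ideal_in A ?J" using rj by (intro igen_ideal[OF sA]) (auto simp: regseq_def)
  have yj: "y j \<in> A" "\<And>a. a \<in> A ==> y j * a \<in> ?J ==> a \<in> ?J" using Suc.prems by (auto simp: regseq_def)
  obtain i' where i': "i = Suc i'" "j \<le> i'" using Suc.prems by (cases i) auto
  note sm = fvec_smod[OF sA iJ] and smA = fvec_ring_smod[OF sA] and iA = ideal_ring[OF sA]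
  note bdJ = res_D_fvec[OF sA res iJ] and bdA = res_D_fvec[OF sA res iA] and comp = res_D_comp[OF sA res]
  show ?case unfolding tor_zero_def
  proof (intro ballI impI)
    fix u assume u: "u \<in> fvec A ?r1" and bu: "?b1 u \<in> fvec (igen A y (Suc j)) (rs i)"
    obtain a b where ab: "a \<in> fvec ?J (rs i)" "b \<in> fvec A (rs i)" "?b1 u = (\<lambda>k. a k + y j * b k)"
      using fvec_adj[OF sA iJ, of _ "y j" "rs i"] bu unfolding gen.simps by meson
    have "?b0 (\<lambda>k. a k + y j * b k) = (\<lambda>_. 0)" using comp[of u i'] u ab(3) i' by simp
    then have eq: "(\<lambda>k. ?b0 a k + y j * ?b0 b k) = (\<lambda>_. 0)"
      unfolding lc_add lc_scale .
    have ba: "?b0 a \<in> fvec ?J (rs i')" and bb: "?b0 b \<in> fvec A (rs i')"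
      using ab bdJ[of a i'] bdA[of b i'] i' by auto
    \<comment> \<open>As \<open>y j\<close> is a nonzerodivisor modulo \<open>?J\<close>,
      \<open>b\<close> is a cycle modulo \<open>?J\<close>; one degree lower the induction
      hypothesis makes it a boundary, which is used to correct \<open>u\<close>.\<close>
    have "?b0 b \<in> fvec ?J (rs i')"
      unfolding fvec_def
    proof (intro CollectI conjI allI impI)
      fix k assume "k < rs i'"
      then have "?b0 a k \<in> ?J" "?b0 b k \<in> A" using ba bb by (auto simp: fvec_def)
      moreover have "y j * ?b0 b k = - ?b0 a k"
        using fun_cong[OF eq, of k] by (simp add: add_eq_0_iff)
      ultimately show "?b0 b k \<in> ?J" using yj(2) ideal_uminus[OF sA iJ] by metis
    next
      fix k assume "rs i' \<le> k" then show "?b0 b k = 0" using bb by (auto simp: fvec_def)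
    qed
    then obtain w where w: "w \<in> fvec A ?r1" "(\<lambda>k. b k - ?b1 w k) \<in> fvec ?J (rs i)"
      using Suc.IH[OF rj i'(2)] ab(2) i'(1) unfolding tor_zero_def by auto
    let ?u = "\<lambda>k. u k - y j * w k"
    have u': "?u \<in> fvec A ?r1"
      using smod_diff[OF sA smA u smod_scale[OF smA yj(1) w(1)]] .
    have "?b1 ?u = (\<lambda>k. a k + y j * (b k - ?b1 w k))"
      unfolding lc_diff lc_scale ab(3) by (simp add: algebra_simps)
    also have "\<dots> \<in> fvec ?J (rs i)" by (intro smod_add[OF sm ab(1)] smod_scale[OF sm yj(1)] w)
    finally obtain v where v: "v \<in> fvec A ?r2"
      "(\<lambda>k. ?u k - ?b2 v k) \<in> fvec ?J ?r1"
      using Suc.IH[OF rj, of i] u' Suc.prems unfolding tor_zero_def by auto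
    have "(\<lambda>k. u k - ?b2 v k) \<in> fvec (igen A y (Suc j)) ?r1"
      unfolding fvec_def
    proof (intro CollectI conjI allI impI)
      fix k assume k: "k < ?r1"
      then have "?u k - ?b2 v k \<in> ?J" "w k \<in> A" using v w by (auto simp: fvec_def)
      then show "u k - ?b2 v k \<in> igen A y (Suc j)"
        unfolding gen.simps by (rule adj_memI) (simp add: algebra_simps)
    next
      fix k assume "?r1 \<le> k"
      then show "u k - ?b2 v k = 0"
        using u bdA[OF v(1)] by (auto simp: fvec_def)
    qed
    then show "\<exists>w\<in>fvec A ?r2.
        (\<lambda>k. u k - ?b2 w k) \<in> fvec (igen A y (Suc j)) ?r1"
      using v(1) by blast
  qed
qed

text \<open>Minimal generators are chosen for \<open>P\<close> and then for each syzygy module in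
  turn. A row of \<open>D (Suc (Suc i))\<close> is a relation among minimal generators, so its
  entries lie in \<open>m\<close>; for \<open>D 1\<close> nothing of the kind can hold, since its
  entries generate \<open>P\<close>.\<close>

lemma minimal_resolution_exists:
  assumes A: "noetherian A" "local_ring A m" and P: "ideal_in A P"
  obtains rs D where "is_res A rs D P"
    "\<And>i l k. l < rs (Suc (Suc i)) ==> k < rs (Suc i) ==> D (Suc (Suc i)) l k \<in> m"
proof -
  have sA: "subring A" using A by (auto dest: noeth_subring)
  define MG where "MG M s g \<longleftrightarrow> (\<forall>l<s. g l \<in> M) \<and> (\<forall>u\<in>M. \<exists>c. (\<forall>l<s. c l \<in> A) \<and> u = lc s c g) \<and>
    (\<forall>c. (\<forall>l<s. c l \<in> A) --> lc s c g = (\<lambda>_. 0) --> (\<forall>l<s. c l \<in> m))"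
    for M :: "(nat => 'a) set" and s :: nat and g
  have ex: "\<exists>s g. MG M s g" if "smod A M" "M \<subseteq> fvec A r" for M r
    using smod_min_gens[OF A that] unfolding MG_def .
  define Syz where "Syz s g = {u \<in> fvec A s. lc s u g = (\<lambda>_. 0)}" for s and g :: "nat => nat => 'a"
  have Syz: "smod A (Syz s g)" "Syz s g \<subseteq> fvec A s" for s g
    using fvec_ring_smod[OF sA, of s] unfolding smod_def Syz_def
    by (auto simp: lc_add lc_scale) (auto simp: lc_def)
  have M0: "smod A (fvec P 1)" "fvec P 1 \<subseteq> fvec A 1"
    using fvec_smod[OF sA P] fvec_mono[OF ideal_subset[OF P]] by auto
  obtain s0 g0 where 0: "MG (fvec P 1) s0 g0" using ex[OF M0] by blast
  \<comment> \<open>The recursion carries the rank together with the matrix, as the next syzygy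
    module depends on both.\<close>
  define f where "f = rec_nat (s0, g0) (\<lambda>_ x. SOME y. MG (Syz (fst x) (snd x)) (fst y) (snd y))"
  have f: "f 0 = (s0, g0)" by (simp add: f_def)
  have fS: "MG (Syz (fst (f n)) (snd (f n))) (fst (f (Suc n))) (snd (f (Suc n)))" for n
  proof -
    obtain s g where "MG (Syz (fst (f n)) (snd (f n))) s g" using ex[OF Syz] by blast
    then have "\<exists>y. MG (Syz (fst (f n)) (snd (f n))) (fst y) (snd y)" by (intro exI[of _ "(s, g)"]) simp
    from someI_ex[OF this] show ?thesis by (simp add: f_def)
  qed
  define rs where "rs i = (case i of 0 => 1 | Suc n => fst (f n))" for i
  define D where "D i = (case i of 0 => (\<lambda>_ _. 0) | Suc n => snd (f n))" for i
  have r0: "rs 0 = 1" by (simp add: rs_def)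
  have g0: "MG (fvec P 1) (rs 1) (D 1)" using 0 f by (simp add: rs_def D_def)
  have gS: "MG (Syz (rs (Suc i)) (D (Suc i))) (rs (Suc (Suc i))) (D (Suc (Suc i)))" for i
    using fS[of i] by (simp add: rs_def D_def)
  have memS: "D (Suc (Suc i)) l \<in> Syz (rs (Suc i)) (D (Suc i))" if "l < rs (Suc (Suc i))" for i l
    using gS[of i] that unfolding MG_def by blast
  have norm: "\<exists>w\<in>fvec A s. u = lc s w g" if "\<forall>l<s. c l \<in> A" "u = lc s c g" for s c u g
    using that by (intro bexI[of _ "\<lambda>l. if l < s then c l else 0"]) (auto simp: fvec_def intro: lc_cong)
  have "is_res A rs D P"
    unfolding is_res_def
  proof (intro conjI allI impI ballI)
    show "rs 0 = 1" by fact
    show "D (Suc i) l \<in> fvec A (rs i)" if "l < rs (Suc i)" for i l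
    proof (cases i)
      case 0
      then have "D 1 l \<in> fvec P 1" using g0 that unfolding MG_def by auto
      then show ?thesis using 0 M0 r0 by auto
    next
      case (Suc j) then show ?thesis using memS[of l j] that Syz(2) by blast
    qed
    show "bd rs D (Suc i) (D (Suc (Suc i)) l) = (\<lambda>_. 0)" if "l < rs (Suc (Suc i))" for i l
      using memS[OF that] by (simp add: Syz_def)
    show "\<exists>w\<in>fvec A (rs (Suc (Suc i))). u = bd rs D (Suc (Suc i)) w"
      if "u \<in> fvec A (rs (Suc i))" "bd rs D (Suc i) u = (\<lambda>_. 0)" for i u
    proof -
      have "u \<in> Syz (rs (Suc i)) (D (Suc i))" using that by (simp add: Syz_def)
      then obtain c where "\<forall>l<rs (Suc (Suc i)). c l \<in> A" "u = bd rs D (Suc (Suc i)) c"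
        using gS[of i] unfolding MG_def by blast
      from norm[OF this] show ?thesis .
    qed
    show "P = {bd rs D 1 u 0 |u. u \<in> fvec A (rs 1)}"
    proof (intro equalityI subsetI)
      fix p assume "p \<in> P"
      then have "(\<lambda>k. if k = 0 then p else 0) \<in> fvec P 1" by (auto simp: fvec_def)
      then obtain c where "\<forall>l<rs 1. c l \<in> A" "(\<lambda>k. if k = 0 then p else 0) = bd rs D 1 c"
        using g0 unfolding MG_def by blast
      from norm[OF this] obtain w where w: "w \<in> fvec A (rs 1)" "(\<lambda>k. if k = 0 then p else 0) = bd rs D 1 w"
        by blast
      have "p = bd rs D 1 w 0" using fun_cong[OF w(2), of 0] by simp
      then show "p \<in> {bd rs D 1 u 0 |u. u \<in> fvec A (rs 1)}" using w(1) by blast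
    next
      fix p assume "p \<in> {bd rs D 1 u 0 |u. u \<in> fvec A (rs 1)}"
      then obtain u where u: "u \<in> fvec A (rs 1)" "p = bd rs D 1 u 0" by blast
      have "bd rs D 1 u \<in> fvec P 1"
        using u(1) g0 by (intro smod_lc[OF M0(1)]) (auto simp: fvec_def MG_def)
      then show "p \<in> P" using u by (auto simp: fvec_def)
    qed
  qed
  moreover have "D (Suc (Suc i)) l k \<in> m" if "l < rs (Suc (Suc i))" "k < rs (Suc i)" for i l k
  proof -
    have "D (Suc (Suc i)) l \<in> fvec A (rs (Suc i))" "bd rs D (Suc i) (D (Suc (Suc i)) l) = (\<lambda>_. 0)"
      using memS[OF that(1)] by (auto simp: Syz_def)
    moreover have "\<forall>c. (\<forall>l<rs (Suc i). c l \<in> A) --> bd rs D (Suc i) c = (\<lambda>_. 0) --> (\<forall>l<rs (Suc i). c l \<in> m)"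
      using g0 gS by (cases i) (auto simp: MG_def)
    ultimately show ?thesis using that(2) by (auto simp: fvec_def)
  qed
  ultimately show ?thesis using that by blast
qed

lemma regsys_regseq: assumes "regsys A m y d" shows "regseq A y d"
  unfolding regseq_def
proof (intro allI impI conjI ballI)
  fix j a assume j: "j < d"
  show "y j \<in> A" using regsysD(4)[OF assms j] .
  assume "a \<in> A" "y j * a \<in> igen A y j"
  then show "a \<in> igen A y j"
    using prime_mult[OF regsys_prime[OF assms, of j] regsysD(4)[OF assms j]] regsys_notin[OF assms j] j by auto
qed

text \<open>A minimal resolution over a regular local ring stops: modulo a regular system of parameters
  its differentials vanish, while it stays exact in degrees above the dimension.\<close>

lemma finite_free_resolution:
  assumes y: "regsys A m y d" and P: "ideal_in A P"
  obtains rs D where "is_res A rs D P" "\<And>i. d < i ==> rs (Suc i) = 0"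
proof -
  note R = regsysD[OF y]
  obtain rs D where F: "is_res A rs D P"
    "\<And>i l k. l < rs (Suc (Suc i)) ==> k < rs (Suc i) ==> D (Suc (Suc i)) l k \<in> m"
    using minimal_resolution_exists[OF R(1,2) P] by blast
  have inm: "bd rs D (Suc (Suc i)) u k \<in> m"
    if "u \<in> fvec A (rs (Suc (Suc i)))" "k < rs (Suc i)" for i u k
    unfolding lc_def using that F(2) by (intro ideal_sum[OF R(8)] ideal_mult[OF R(8)]) (auto simp: fvec_def)
  have "rs (Suc i) = 0" if i: "d < i" for i
  proof (rule ccontr)
    assume "rs (Suc i) \<noteq> 0"
    then have pos: "0 < rs (Suc i)" by simp
    let ?e = "\<lambda>k. if k = 0 then 1 else 0 :: 'a"
    obtain i' where i': "i = Suc i'" using i by (cases i) auto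
    have e: "?e \<in> fvec A (rs (Suc i))" using fvec_unit[OF R(7) pos] .
    have t: "tor_zero A rs D i m"
      using tor_zero_regseq[OF R(7) F(1) regsys_regseq[OF y], of i] i R(5) by simp
    have "bd rs D (Suc i) ?e \<in> fvec A (rs i)"
      by (rule res_D_fvec[OF R(7) F(1) ideal_ring[OF R(7)] e])
    then have "bd rs D (Suc i) ?e \<in> fvec m (rs i)"
      using inm[of ?e i'] e i' by (auto simp: fvec_def)
    then obtain w where w: "w \<in> fvec A (rs (Suc (Suc i)))"
      "(\<lambda>k. ?e k - bd rs D (Suc (Suc i)) w k) \<in> fvec m (rs (Suc i))"
      using t e unfolding tor_zero_def by blast
    have "1 - bd rs D (Suc (Suc i)) w 0 \<in> m" using w(2) pos by (auto simp: fvec_def)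
    from ideal_add[OF R(8) this inm[OF w(1) pos]] have "1 \<in> m" by simp
    then show False using local_not_one[OF R(2)] by simp
  qed
  then show ?thesis using that F(1) by blast
qed

section \<open>Localizing a resolution\<close>

lemma common_denominator:
  assumes sA: "subring A" and U: "mult_closed_in A U"
  shows "u \<in> fvec (loc_mult A U) r ==> \<exists>s\<in>U. (\<lambda>k. s * u k) \<in> fvec A r"
proof (induction r arbitrary: u)
  case 0 then show ?case using loc_U[OF sA U] by (intro bexI[of _ 1]) (auto simp: fvec_def)
next
  case (Suc r)
  let ?v = "\<lambda>k. if k < r then u k else 0"
  have "?v \<in> fvec (loc_mult A U) r" using Suc.prems by (auto simp: fvec_def)
  then obtain s where s: "s \<in> U" "(\<lambda>k. s * ?v k) \<in> fvec A r" using Suc.IH by blast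
  obtain a t where t: "a \<in> A" "t \<in> U" "u r = a / t"
    using Suc.prems unfolding fvec_def loc_mult_def by auto
  note LU = loc_U[OF sA U]
  have "(\<lambda>k. (s * t) * u k) \<in> fvec A (Suc r)"
    unfolding fvec_def
  proof (intro CollectI conjI allI impI)
    fix k assume "k < Suc r"
    then consider "k < r" | "k = r" by linarith
    then show "(s * t) * u k \<in> A"
    proof cases
      case 1
      then have "s * u k \<in> A" using s by (auto simp: fvec_def)
      then have "t * (s * u k) \<in> A" using t LU(1) by (blast intro: subring_mult[OF sA])
      then show ?thesis by (simp add: mult_ac)
    next
      case 2
      then show ?thesis using t s LU sA by (auto intro: subring_mult)
    qed
  qed (use Suc.prems in \<open>auto simp: fvec_def\<close>)
  then show ?case using s t LU by blast
qed

text \<open>Ranks and matrices stay the same. A cycle with fractional entries is scaled by a common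
  denominator, lifted over \<open>A\<close> and scaled back.\<close>

lemma loc_resolution:
  assumes sA: "subring A" and U: "mult_closed_in A U" and F: "is_res A rs D P"
  shows "is_res (loc_mult A U) rs D (loc_mult P U)"
proof -
  let ?L = "loc_mult A U"
  note LU = loc_U[OF sA U] and inc = loc_incl[OF sA U] and sL = loc_subring[OF sA U]
  have fv: "fvec A r \<subseteq> fvec ?L r" for r by (rule fvec_mono[OF inc])
  have div: "(\<lambda>k. inverse s * u k) \<in> fvec ?L r" if "s \<in> U" "u \<in> fvec A r" for s u r
    using smod_scale[OF fvec_ring_smod[OF sL] loc_inverse[OF sA U that(1)]] fv that(2) by blast
  show ?thesis unfolding is_res_def
  proof (intro conjI allI impI ballI)
    show "rs 0 = 1" using is_resD(1)[OF F] .
    show "D (Suc i) l \<in> fvec ?L (rs i)" if "l < rs (Suc i)" for i l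
      using is_resD(2)[OF F that] fv by blast
    show "bd rs D (Suc i) (D (Suc (Suc i)) l) = (\<lambda>_. 0)" if "l < rs (Suc (Suc i))" for i l
      using is_resD(3)[OF F that] .
    show "\<exists>w\<in>fvec ?L (rs (Suc (Suc i))). u = bd rs D (Suc (Suc i)) w"
      if u: "u \<in> fvec ?L (rs (Suc i))" "bd rs D (Suc i) u = (\<lambda>_. 0)" for i u
    proof -
      obtain s where s: "s \<in> U" "(\<lambda>k. s * u k) \<in> fvec A (rs (Suc i))" using common_denominator[OF sA U u(1)] by blast
      have "bd rs D (Suc i) (\<lambda>k. s * u k) = (\<lambda>_. 0)" unfolding lc_scale u(2) by simp
      then obtain w where w: "w \<in> fvec A (rs (Suc (Suc i)))" "(\<lambda>k. s * u k) = bd rs D (Suc (Suc i)) w"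
        using is_resD(4)[OF F s(2)] by blast
      have "u = (\<lambda>k. inverse s * (s * u k))" using LU(2)[OF s(1)] by (auto simp: mult.assoc[symmetric])
      also have "\<dots> = bd rs D (Suc (Suc i)) (\<lambda>k. inverse s * w k)"
        unfolding lc_scale using fun_cong[OF w(2)] by simp
      finally show ?thesis using div[OF s(1) w(1)] by blast
    qed
    show "loc_mult P U = {bd rs D 1 u 0 |u. u \<in> fvec ?L (rs 1)}"
    proof (intro equalityI subsetI)
      fix p assume "p \<in> loc_mult P U"
      then obtain a s where as: "a \<in> P" "s \<in> U" "p = a / s" by (rule loc_memE)
      then obtain u where "u \<in> fvec A (rs 1)" "a = bd rs D 1 u 0" using is_resD(5)[OF F] by blast
      then show "p \<in> {bd rs D 1 u 0 |u. u \<in> fvec ?L (rs 1)}"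
        using as div[of s u "rs 1"] lc_scale[of "rs 1" "inverse s" u "D 1"]
        by (intro CollectI exI[of _ "\<lambda>k. inverse s * u k"]) (simp add: divide_inverse mult.commute)
    next
      fix p assume "p \<in> {bd rs D 1 u 0 |u. u \<in> fvec ?L (rs 1)}"
      then obtain u where u: "u \<in> fvec ?L (rs 1)" "p = bd rs D 1 u 0" by blast
      obtain s where s: "s \<in> U" "(\<lambda>k. s * u k) \<in> fvec A (rs 1)" using common_denominator[OF sA U u(1)] by blast
      have "s * p \<in> P" using is_resD(5)[OF F] s(2) unfolding u(2)
        by (auto intro!: exI[of _ "\<lambda>k. s * u k"] simp: lc_scale)
      then show "p \<in> loc_mult P U" using s(1) LU(2)[OF s(1)] by (intro loc_memI[of "s * p" _ s]) auto
    qed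
  qed
qed

section \<open>Localizations of regular local rings are regular\<close>

text \<open>If \<open>x\<close> avoids the first \<open>k\<close> primes but lies in the next one, a
  product is added that lies in \<open>I\<close> and in all earlier primes but not in
  \<open>Q k\<close>; incomparability provides its factors.\<close>

lemma prime_avoidance_incomparable:
  fixes Q :: "nat => 'a::field set"
  assumes sA: "subring A" and I: "ideal_in A I"
  shows "(\<And>i. i < k ==> prime_in A (Q i)) ==> (\<And>i j. i < k ==> j < k ==> Q i \<subseteq> Q j ==> Q i = Q j) ==>
    (\<And>i. i < k ==> \<not> I \<subseteq> Q i) ==> \<exists>x\<in>I. \<forall>i<k. x \<notin> Q i"
proof (induction k)
  case 0 then show ?case using ideal_zero[OF I] by auto
next
  case (Suc k)
  then obtain x where x: "x \<in> I" "\<forall>i<k. x \<notin> Q i" by (metis less_SucI)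
  show ?case
  proof (cases "x \<in> Q k")
    case True
    then have "Q i \<noteq> Q k" if "i < k" for i using x that by auto
    then have "\<exists>q. q \<in> Q i \<and> q \<notin> Q k" if "i < k" for i
      using Suc.prems(2)[of i k] that by (metis less_SucI lessI subsetI)
    then obtain q where q: "\<And>i. i < k ==> q i \<in> Q i" "\<And>i. i < k ==> q i \<notin> Q k" by metis
    obtain w where w: "w \<in> I" "w \<notin> Q k" using Suc.prems(3)[of k] by auto
    note pk = Suc.prems(1)[OF lessI]
    have qA: "q i \<in> A" if "i < k" for i
      using q(1)[OF that] ideal_sub[OF prime_ideal[OF Suc.prems(1)[of i]]] that by simp
    let ?y = "w * prod q {..<k}"
    have PA: "prod q {..<k} \<in> A" using qA by (auto intro!: subring_prod[OF sA])
    have wA: "w \<in> A" using ideal_sub[OF I w(1)] .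
    have yI: "?y \<in> I" using ideal_mult_right[OF I PA w(1)] .
    have "prod q {..<k} \<notin> Q k" by (rule prime_prod[OF sA pk qA q(2)])
    then have yk: "?y \<notin> Q k" using prime_mult[OF pk wA PA] w(2) by blast
    have yi: "?y \<in> Q i" if i: "i < k" for i
    proof -
      have iQ: "ideal_in A (Q i)" using Suc.prems(1)[of i] i prime_ideal by auto
      have "prod q {..<k} = q i * prod q ({..<k} - {i})" using i by (subst prod.remove[of _ i]) auto
      then have "?y = (w * prod q ({..<k} - {i})) * q i" by (simp add: mult_ac)
      moreover have "w * prod q ({..<k} - {i}) \<in> A" using qA wA by (auto intro!: subring_mult[OF sA] subring_prod[OF sA])
      ultimately show ?thesis using ideal_mult[OF iQ _ q(1)[OF i]] by metis
    qed
    show ?thesis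
    proof (intro bexI[of _ "x + ?y"] allI impI)
      show "x + ?y \<in> I" using ideal_add[OF I x(1) yI] .
      fix i assume i: "i < Suc k"
      have iQ: "ideal_in A (Q i)" using Suc.prems(1)[OF i] prime_ideal by auto
      show "x + ?y \<notin> Q i"
      proof
        assume *: "x + ?y \<in> Q i"
        show False
        proof (cases "i < k")
          case True
          then have "x \<in> Q i" using ideal_diff[OF sA iQ * yi[OF True]] by simp
          then show False using x True by auto
        next
          case False
          then have "i = k" using i by simp
          then have "?y \<in> Q k" using ideal_diff[OF sA iQ *, of x] \<open>x \<in> Q k\<close> by simp
          then show False using yk by simp
        qed
      qed
    qed
  next
    case False then show ?thesis using x by (auto simp: less_Suc_eq)
  qed
qed

text \<open>In depth zero the quotient by \<open>J\<close> has a socle element. The zero divisors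
  modulo \<open>J\<close> lie in annihilators that are prime, and prime avoidance puts all of
  \<open>n\<close> into a single one of them.\<close>

lemma maximal_annihilator:
  assumes A: "noetherian A" "local_ring A n" and J: "ideal_in A J"
    and zd: "\<And>z. z \<in> n ==> \<exists>a\<in>A. a \<notin> J \<and> z * a \<in> J"
  shows "\<exists>s\<in>A. s \<notin> J \<and> (\<forall>z\<in>n. z * s \<in> J)"
proof -
  have sA: "subring A" and im: "ideal_in A n" using A by (auto simp: local_ring_def)
  \<comment> \<open>The elements outside \<open>J\<close> whose annihilator modulo \<open>J\<close>
    is as large as possible.\<close>
  define M where "M = {c \<in> A. c \<notin> J \<and> (\<forall>a\<in>A. a \<notin> J --> colon A J c \<subseteq> colon A J a --> colon A J a = colon A J c)}"
  have Mex: "\<exists>c\<in>M. colon A J a \<subseteq> colon A J c" if a: "a \<in> A" "a \<notin> J" for a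
  proof -
    let ?P = "\<lambda>I. \<exists>c\<in>A. c \<notin> J \<and> I = colon A J c \<and> colon A J a \<subseteq> I"
    obtain I where I: "?P I" "\<And>K. ?P K ==> I \<subseteq> K ==> K = I"
      by (rule noeth_max[of A ?P "colon A J a"]) (use a A J sA in \<open>auto intro: colon_ideal\<close>)
    then obtain c where c: "c \<in> A" "c \<notin> J" "I = colon A J c" "colon A J a \<subseteq> I" by blast
    have "colon A J b = colon A J c" if "b \<in> A" "b \<notin> J" "colon A J c \<subseteq> colon A J b" for b
      using I(2)[of "colon A J b"] that c by blast
    then show ?thesis using c unfolding M_def by blast
  qed
  have Mpr: "prime_in A (colon A J c)" if c: "c \<in> M" for c
  proof -
    obtain e where e: "e \<in> A" "e \<notin> J" "prime_in A (colon A J e)" "colon A J c \<subseteq> colon A J e"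
      using assoc_prime_exists[OF A(1) J, of c] c unfolding M_def by blast
    then have "colon A J e = colon A J c" using c unfolding M_def by blast
    then show ?thesis using e by simp
  qed
  \<comment> \<open>Finitely many \<open>c i\<close> from \<open>M\<close> generate, over
    \<open>J\<close>, an ideal containing all of \<open>M\<close>. This stands in for the finiteness
    of the set of associated primes.\<close>
  let ?P = "\<lambda>K. \<exists>k c. (\<forall>i<k. c i \<in> M) \<and> K = gen A J c k"
  obtain K where K: "?P K" "\<And>K'. ?P K' ==> K \<subseteq> K' ==> K' = K"
  proof (rule noeth_max[of A ?P J])
    show "noetherian A" by fact
    show "?P J" by (intro exI[of _ 0] exI[of _ "\<lambda>_. 0"]) auto
    show "ideal_in A I" if "?P I" for I using that gen_ideal[OF sA J] unfolding M_def by blast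
  qed (rule that)
  then obtain k c where kc: "\<And>i. i < k ==> c i \<in> M" "K = gen A J c k" by blast
  have cA: "c i \<in> A" if "i < k" for i using kc(1)[OF that] unfolding M_def by blast
  have iK: "ideal_in A K" unfolding kc(2) by (rule gen_ideal[OF sA J cA])
  have MK: "M \<subseteq> K"
  proof
    fix e assume e: "e \<in> M"
    let ?c = "c(k := e)"
    have g: "gen A J ?c (Suc k) = adj A K e" using gen_cong[of k ?c c A J] kc(2) by simp
    have "?P (adj A K e)" unfolding g[symmetric]
      by (rule exI[of _ "Suc k"], rule exI[of _ ?c]) (use kc(1) e in \<open>auto simp: less_Suc_eq\<close>)
    then have "adj A K e = K" using K(2) adj_sub[OF sA] by blast
    then show "e \<in> K" using adj_mem[OF sA iK, of e] by simp
  qed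
  let ?Q = "\<lambda>i. colon A J (c i)"
  have "\<exists>i<k. n \<subseteq> ?Q i"
  proof (rule ccontr)
    assume "\<not> ?thesis"
    then have "\<exists>x\<in>n. \<forall>i<k. x \<notin> ?Q i"
      using Mpr kc(1) by (intro prime_avoidance_incomparable[OF sA im]) (auto simp: M_def)
    then obtain x where x: "x \<in> n" "\<forall>i<k. x \<notin> ?Q i" by blast
    obtain a where a: "a \<in> A" "a \<notin> J" "x * a \<in> J" using zd x by blast
    obtain e where e: "e \<in> M" "colon A J a \<subseteq> colon A J e" using Mex[OF a(1,2)] by blast
    have eA: "e \<in> A" "e \<notin> J" using e(1) unfolding M_def by auto
    have xe: "x \<in> colon A J e" using e(2) a x ideal_sub[OF im] by (auto simp: colon_def)
    have "\<exists>q. i < k --> q \<in> ?Q i \<and> q \<notin> colon A J e" for i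
    proof (cases "i < k")
      case True
      have "\<not> ?Q i \<subseteq> colon A J e"
      proof
        assume "?Q i \<subseteq> colon A J e"
        then have "colon A J e = ?Q i" using kc(1)[OF True] eA unfolding M_def by blast
        then show False using xe x True by auto
      qed
      then show ?thesis by blast
    qed auto
    then obtain q where q: "\<And>i. i < k ==> q i \<in> ?Q i" "\<And>i. i < k ==> q i \<notin> colon A J e" by metis
    have qA: "q i \<in> A" if "i < k" for i using q(1)[OF that] by (auto simp: colon_def)
    \<comment> \<open>The product of the \<open>q i\<close> annihilates every \<open>c i\<close>
      modulo \<open>J\<close>, hence all of \<open>M\<close> and in particular \<open>e\<close>,
      although no factor lies in the prime \<open>colon A J e\<close>.\<close>
    have "prod q {..<k} \<notin> colon A J e" by (rule prime_prod[OF sA Mpr[OF e(1)] qA q(2)])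
    moreover have "prod q {..<k} \<in> colon A J e"
    proof -
      have PA: "prod q {..<k} \<in> A" using qA by (auto intro!: subring_prod[OF sA])
      have "K \<subseteq> colon A J (prod q {..<k})" unfolding kc(2)
      proof (rule gen_least[OF colon_ideal[OF sA J PA] colon_sub[OF J PA]])
        fix i assume i: "i < k"
        have "prod q {..<k} = q i * prod q ({..<k} - {i})" using i by (subst prod.remove[of _ i]) auto
        then have "c i * prod q {..<k} = prod q ({..<k} - {i}) * (q i * c i)" by (simp add: mult_ac)
        also have "\<dots> \<in> J" using q(1)[OF i] qA
          by (intro ideal_mult[OF J, of _ "q i * c i"] subring_prod[OF sA]) (auto simp: colon_def)
        finally show "c i \<in> colon A J (prod q {..<k})" using cA[OF i] by (simp add: colon_def)
      qed
      then show ?thesis using MK e(1) PA by (auto simp: colon_def mult.commute)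
    qed
    ultimately show False by blast
  qed
  then obtain i where "i < k" "n \<subseteq> ?Q i" by blast
  then show ?thesis using kc(1) unfolding M_def by (intro bexI[of _ "c i"]) (auto simp: colon_def)
qed

text \<open>Bounds the length of regular sequences by the dimension. The top of the chain is kept as
  an associated prime of the ideal generated so far: a regular element \<open>y t\<close> lies
  outside it, and a larger associated prime exists after adjoining \<open>y t\<close>.\<close>

lemma regseq_prime_chain:
  assumes A: "noetherian A" "local_ring A n"
  shows "regseq A y t ==> (\<And>i. i < t ==> y i \<in> n) ==>
    \<exists>P c. pchain A {0} t P \<and> c \<in> A \<and> c \<notin> igen A y t \<and> P t = colon A (igen A y t) c"
proof (induction t)
  case 0
  have sA: "subring A" using A by (auto dest: noeth_subring)
  have "colon A {0} 1 = {0}" using sA by (auto simp: colon_def subring_closed)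
  then show ?case using prime_zero_ideal[OF sA] subring_one[OF sA]
    by (intro exI[of _ "\<lambda>_. {0}"] exI[of _ 1]) (auto simp: pchain_def)
next
  case (Suc t)
  have sA: "subring A" using A by (auto dest: noeth_subring)
  have "regseq A y t" using Suc.prems by (auto simp: regseq_def)
  then obtain P c where P: "pchain A {0} t P" "c \<in> A" "c \<notin> igen A y t" "P t = colon A (igen A y t) c"
    using Suc by auto
  let ?J = "igen A y t" and ?J' = "igen A y (Suc t)"
  have yA: "y i \<in> A" if "i < Suc t" for i using Suc.prems(1) that by (auto simp: regseq_def)
  have J: "ideal_in A ?J" and J': "ideal_in A ?J'" using yA by (intro igen_ideal[OF sA]; simp)+
  have yt: "y t \<in> A" "\<And>a. a \<in> A ==> y t * a \<in> ?J ==> a \<in> ?J" using Suc.prems(1) by (auto simp: regseq_def)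
  have prP: "prime_in A (P t)" using P(1) by (simp add: pchain_def)
  have PA: "p \<in> A" if "p \<in> P t" for p using that prime_ideal[OF prP] ideal_sub by blast
  let ?N = "{b \<in> A. \<forall>p\<in>P t. p * b \<in> ?J}"
  have N: "ideal_in A ?N"
    unfolding ideal_in_def using ideal_zero[OF J] ideal_add[OF J] ideal_mult[OF J] sA
    by (auto simp: subring_closed distrib_left mult.left_commute)
  have cN: "c \<in> ?N" using P by (auto simp: colon_def)
  \<comment> \<open>If all of \<open>?N\<close> were in \<open>?J'\<close>, dividing by the regular
    element \<open>y t\<close> would stay inside \<open>?N\<close>, so \<open>?N\<close> would lie
    in \<open>?J + y t ?N\<close> and by Nakayama's lemma in \<open>?J\<close>; but \<open>c\<close>
    does not.\<close>
  have "\<not> ?N \<subseteq> ?J'"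
  proof
    assume sub: "?N \<subseteq> ?J'"
    have "?N \<subseteq> ?J"
    proof (rule nakayama_elem[OF A N J])
      show "y t \<in> n" using Suc.prems by simp
      fix b assume b: "b \<in> ?N"
      then obtain j a where ja: "j \<in> ?J" "a \<in> A" "b = j + a * y t" using sub unfolding gen.simps adj_def by blast
      have "p * a \<in> ?J" if p: "p \<in> P t" for p
      proof (rule yt(2))
        show "p * a \<in> A" using PA[OF p] ja sA by (auto simp: subring_closed)
        have "y t * (p * a) = p * b - p * j" unfolding ja(3) by (simp add: algebra_simps)
        moreover have "p * b \<in> ?J" "p * j \<in> ?J" using b p ideal_mult[OF J PA[OF p] ja(1)] by auto
        ultimately show "y t * (p * a) \<in> ?J" using ideal_diff[OF sA J] by simp
      qed
      then show "\<exists>j\<in>?J. \<exists>e\<in>?N. b = j + y t * e" using ja by (intro bexI[of _ j] bexI[of _ a]) (auto simp: mult.commute)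
    qed
    then show False using cN P by blast
  qed
  then obtain b where b: "b \<in> ?N" "b \<notin> ?J'" by blast
  then obtain c' where c': "c' \<in> A" "c' \<notin> ?J'" "prime_in A (colon A ?J' c')" "colon A ?J' b \<subseteq> colon A ?J' c'"
    using assoc_prime_exists[OF A(1) J', of b] by blast
  have JJ': "?J \<subseteq> ?J'" using adj_sub[OF sA] by auto
  have "P t \<subseteq> colon A ?J' b" using b PA JJ' by (auto simp: colon_def)
  moreover have "y t \<in> colon A ?J' b"
  proof -
    have "y t \<in> ?J'" using adj_mem[OF sA J] by simp
    then show ?thesis using b yt(1) ideal_mult_right[OF J'] by (auto simp: colon_def)
  qed
  moreover have "y t \<notin> P t" using P yt by (auto simp: colon_def)
  ultimately have "P t \<subset> colon A ?J' c'" using c'(4) by blast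
  then have "pchain A {0} (Suc t) (P(Suc t := colon A ?J' c'))"
    using P(1) c'(3) by (auto simp: pchain_def less_Suc_eq le_Suc_eq)
  then have "pchain A {0} (Suc t) (P(Suc t := colon A ?J' c')) \<and> c' \<in> A \<and> c' \<notin> ?J' \<and>
      (P(Suc t := colon A ?J' c')) (Suc t) = colon A ?J' c'" using c' by simp
  then show ?case by blast
qed

text \<open>One step of a descent in the homological degree. The socle element \<open>s\<close>
  embeds the residue field into \<open>A / J0\<close>, so vanishing for \<open>J0\<close>, together
  with vanishing one degree higher, gives vanishing for the residue field; from there it spreads to
  all \<open>J\<close>.\<close>

lemma tor_zero_step:
  assumes A: "noetherian A" "local_ring A n" and res: "is_res A rs D P"
    and J0: "ideal_in A J0" "tor_zero A rs D i J0" and s: "s \<in> A" "s \<notin> J0" "\<And>z. z \<in> n ==> z * s \<in> J0"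
    and up: "\<And>J. ideal_in A J ==> tor_zero A rs D (Suc i) J" and J: "ideal_in A J"
  shows "tor_zero A rs D i J"
proof -
  have sA: "subring A" and im: "ideal_in A n" using A by (auto simp: local_ring_def)
  note smA = fvec_ring_smod[OF sA] and iA = ideal_ring[OF sA]
  note bd = res_D_fvec[OF sA res] and comp = res_D_comp[OF sA res]
  let ?bd = "\<lambda>i u. bd rs D i u"
  let ?b1 = "?bd (Suc i)" and ?b2 = "?bd (Suc (Suc i))" and ?r1 = "rs (Suc i)" and ?r2 = "rs (Suc (Suc i))"
  \<comment> \<open>For a cycle \<open>u\<close> modulo \<open>n\<close>, \<open>s * u\<close> is a
    cycle modulo \<open>J0\<close>, hence a boundary of some \<open>w\<close> there. Now
    \<open>w\<close> is a cycle modulo \<open>J0 + (s)\<close>, and vanishing one degree higher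
    allows the factor \<open>s\<close> to be split off.\<close>
  have resid: "tor_zero A rs D i n"
    unfolding tor_zero_def
  proof (intro ballI impI)
    fix u assume u: "u \<in> fvec A ?r1" "?b1 u \<in> fvec n (rs i)"
    have "?b1 (\<lambda>k. s * u k) \<in> fvec J0 (rs i)"
      unfolding lc_scale using u(2) s(3) by (auto simp: fvec_def mult.commute[of s])
    then obtain w where w: "w \<in> fvec A ?r2"
      "(\<lambda>k. s * u k - ?b2 w k) \<in> fvec J0 ?r1"
      using J0(2) smod_scale[OF smA s(1) u(1)] unfolding tor_zero_def by blast
    let ?J1 = "adj A J0 s"
    have J1: "ideal_in A ?J1" by (rule adj_ideal[OF sA J0(1) s(1)])
    have "?b2 w \<in> fvec ?J1 ?r1"
      unfolding fvec_def
    proof (intro CollectI conjI allI impI)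
      fix k assume "k < ?r1"
      then have "s * u k - ?b2 w k \<in> ?J1" "u k \<in> A" using w(2) u(1) adj_sub[OF sA] by (auto simp: fvec_def)
      moreover have "s * u k \<in> ?J1" using ideal_mult_right[OF J1 \<open>u k \<in> A\<close> adj_mem[OF sA J0(1)]] .
      ultimately have "s * u k - (s * u k - ?b2 w k) \<in> ?J1" using ideal_diff[OF sA J1] by blast
      then show "?b2 w k \<in> ?J1" by simp
    qed (use bd[OF iA w(1)] in \<open>auto simp: fvec_def\<close>)
    then obtain w2 where w2: "w2 \<in> fvec A (rs (Suc (Suc (Suc i))))"
      "(\<lambda>k. w k - ?bd (Suc (Suc (Suc i))) w2 k) \<in> fvec ?J1 ?r2"
      using up[OF J1] w(1) unfolding tor_zero_def by blast
    obtain a b where ab: "a \<in> fvec J0 ?r2" "b \<in> fvec A ?r2"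
      "(\<lambda>k. w k - ?bd (Suc (Suc (Suc i))) w2 k) = (\<lambda>k. a k + s * b k)"
      using fvec_adj[OF sA J0(1) w2(2)] by blast
    have "?b2 (\<lambda>k. w k - ?bd (Suc (Suc (Suc i))) w2 k) = ?b2 w"
      unfolding lc_diff comp[OF w2(1)] by simp
    then have bw: "?b2 w = (\<lambda>k. ?b2 a k + s * ?b2 b k)"
      unfolding ab(3) lc_add lc_scale by simp
    have "u k - ?b2 b k \<in> n" if k: "k < ?r1" for k
    proof (rule ccontr)
      let ?c = "u k - ?b2 b k"
      assume "?c \<notin> n"
      moreover have cA: "?c \<in> A" using u(1) bd[OF iA ab(2)] k sA by (auto simp: fvec_def subring_closed)
      ultimately have inv: "inverse ?c \<in> A" "?c \<noteq> 0" using local_unit[OF A(2)] by blast+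
      have "s * ?c = (s * u k - ?b2 w k) + ?b2 a k"
        unfolding bw by (simp add: algebra_simps)
      also have "\<dots> \<in> J0" using w(2) bd[OF J0(1) ab(1)] k by (intro ideal_add[OF J0(1)]) (auto simp: fvec_def)
      finally have "(s * ?c) * inverse ?c \<in> J0" by (rule ideal_mult_right[OF J0(1) inv(1)])
      then show False using inv(2) s(2) by (simp add: mult.assoc)
    qed
    then have "(\<lambda>k. u k - ?b2 b k) \<in> fvec n ?r1"
      using u(1) bd[OF iA ab(2)] by (auto simp: fvec_def)
    then show "\<exists>w\<in>fvec A ?r2. (\<lambda>k. u k - ?b2 w k) \<in> fvec n ?r1"
      using ab(2) by blast
  qed
  show ?thesis
  proof (rule noeth_induct[OF A(1) J])
    fix J assume J: "ideal_in A J" and IH: "\<And>J'. ideal_in A J' ==> J \<subset> J' ==> tor_zero A rs D i J'"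
    note smJ = fvec_smod[OF sA J]
    show "tor_zero A rs D i J"
    proof (cases "J = A \<or> J = n")
      case True
      then show ?thesis
      proof
        assume "J = A"
        then show ?thesis unfolding tor_zero_def
          using smod_zero[OF smA] by (auto intro!: bexI[of _ "\<lambda>_. 0"] simp: lc_def)
      qed (use resid in simp)
    next
      case False
      then have "J \<subset> n" using A(2) J unfolding local_ring_def by blast
      then obtain a where a: "a \<in> n" "a \<notin> J" by blast
      have aA: "a \<in> A" using ideal_sub[OF im a(1)] .
      let ?J1 = "adj A J a" and ?J2 = "colon A J a"
      have J1: "ideal_in A ?J1" "J \<subset> ?J1" using adj_ideal[OF sA J aA] adj_sub[OF sA, of J a] adj_mem[OF sA J, of a] a by auto
      have J2: "ideal_in A ?J2" "J \<subseteq> ?J2" using colon_ideal[OF sA J aA] colon_sub[OF J aA] by auto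
      have dec: "\<exists>w j v. w \<in> fvec A ?r2 \<and> j \<in> fvec J ?r1 \<and> v \<in> fvec A ?r1 \<and>
          (\<lambda>k. u k - ?b2 w k) = (\<lambda>k. j k + a * v k) \<and> ?b1 v \<in> fvec ?J2 (rs i)"
        if u: "u \<in> fvec A ?r1" "?b1 u \<in> fvec J (rs i)" for u
      proof -
        have "?b1 u \<in> fvec ?J1 (rs i)" using u(2) fvec_mono[of J ?J1] J1 by blast
        then obtain w where w: "w \<in> fvec A ?r2" "(\<lambda>k. u k - ?b2 w k) \<in> fvec ?J1 ?r1"
          using IH[OF J1] u(1) unfolding tor_zero_def by blast
        obtain j v where jv: "j \<in> fvec J ?r1" "v \<in> fvec A ?r1"
          "(\<lambda>k. u k - ?b2 w k) = (\<lambda>k. j k + a * v k)"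
          using fvec_adj[OF sA J w(2)] by blast
        have "?b1 (\<lambda>k. u k - ?b2 w k) = ?b1 u"
          unfolding lc_diff comp[OF w(1)] by simp
        then have e: "?b1 u = (\<lambda>k. ?b1 j k + a * ?b1 v k)"
          unfolding jv(3) lc_add lc_scale by simp
        have bv: "?b1 v \<in> fvec A (rs i)" by (rule bd[OF iA jv(2)])
        have bj: "?b1 j \<in> fvec J (rs i)" by (rule bd[OF J jv(1)])
        have "?b1 v k * a \<in> J" if k: "k < rs i" for k
        proof -
          have "?b1 v k * a = ?b1 u k - ?b1 j k" using fun_cong[OF e, of k] by (simp add: mult.commute)
          then show ?thesis using ideal_diff[OF sA J] u(2) bj k by (auto simp: fvec_def)
        qed
        then have "?b1 v \<in> fvec ?J2 (rs i)" using bv by (auto simp: fvec_def colon_def)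
        then show ?thesis using w(1) jv by blast
      qed
      show ?thesis
      proof (cases "?J2 = J")
        case False
        show ?thesis unfolding tor_zero_def
        proof (intro ballI impI)
          fix u assume u: "u \<in> fvec A ?r1" "?b1 u \<in> fvec J (rs i)"
          from dec[OF this] obtain w j v where wjv: "w \<in> fvec A ?r2" "j \<in> fvec J ?r1"
            "v \<in> fvec A ?r1" "(\<lambda>k. u k - ?b2 w k) = (\<lambda>k. j k + a * v k)"
            "?b1 v \<in> fvec ?J2 (rs i)" by blast
          have "J \<subset> ?J2" using False J2 by blast
          then obtain x where x: "x \<in> fvec A ?r2" "(\<lambda>k. v k - ?b2 x k) \<in> fvec ?J2 ?r1"
            using IH[OF J2(1)] wjv unfolding tor_zero_def by blast
          let ?w = "\<lambda>k. w k + a * x k"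
          have "(\<lambda>k. u k - ?b2 ?w k) = (\<lambda>k. j k + a * (v k - ?b2 x k))"
          proof
            fix k show "u k - ?b2 ?w k = j k + a * (v k - ?b2 x k)"
              using fun_cong[OF wjv(4), of k] unfolding lc_add lc_scale by (simp add: algebra_simps)
          qed
          also have "\<dots> \<in> fvec J ?r1"
            using wjv(2) x(2) by (intro smod_add[OF smJ]) (auto simp: fvec_def colon_def mult.commute)
          finally show "\<exists>w\<in>fvec A ?r2. (\<lambda>k. u k - ?b2 w k) \<in> fvec J ?r1"
            using smod_add[OF smA wjv(1) smod_scale[OF smA aA x(1)]] by blast
        qed
      next
        case True
        let ?Z = "{u \<in> fvec A ?r1. ?b1 u \<in> fvec J (rs i)}"
        let ?W = "{u. \<exists>w\<in>fvec A ?r2. (\<lambda>k. u k - ?b2 w k) \<in> fvec J ?r1}"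
        have Z: "smod A ?Z" using smA[of "?r1"] smJ[of "rs i"]
          unfolding smod_def by (auto simp: lc_add lc_scale) (auto simp: lc_def)
        have W: "smod A ?W"
          unfolding smod_def
        proof (intro conjI ballI)
          show "(\<lambda>_. 0) \<in> ?W" using smod_zero[OF smA] smod_zero[OF smJ]
            by (auto intro!: bexI[of _ "\<lambda>_. 0"] simp: lc_def)
          fix u assume "u \<in> ?W"
          then obtain w where w: "w \<in> fvec A ?r2" "(\<lambda>k. u k - ?b2 w k) \<in> fvec J ?r1" by blast
          { fix v assume "v \<in> ?W"
            then obtain x where x: "x \<in> fvec A ?r2" "(\<lambda>k. v k - ?b2 x k) \<in> fvec J ?r1" by blast
            have "(\<lambda>k. (u k + v k) - ?b2 (\<lambda>k. w k + x k) k) =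
              (\<lambda>k. (u k - ?b2 w k) + (v k - ?b2 x k))"
              unfolding lc_add by (simp add: algebra_simps)
            then show "(\<lambda>k. u k + v k) \<in> ?W"
              using smod_add[OF smJ w(2) x(2)] smod_add[OF smA w(1) x(1)]
              by (intro CollectI bexI[of _ "\<lambda>k. w k + x k"]) auto }
          fix c assume c: "c \<in> A"
          have "(\<lambda>k. c * u k - ?b2 (\<lambda>k. c * w k) k) = (\<lambda>k. c * (u k - ?b2 w k))"
            unfolding lc_scale by (simp add: algebra_simps)
          then show "(\<lambda>k. c * u k) \<in> ?W"
            using smod_scale[OF smJ c w(2)] smod_scale[OF smA c w(1)]
            by (intro CollectI bexI[of _ "\<lambda>k. c * w k"]) auto
        qed
        obtain r g where g: "\<forall>l<r. g l \<in> ?Z" "\<forall>u\<in>?Z. \<exists>c. (\<forall>l<r. c l \<in> A) \<and> u = lc r c g"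
          using smod_fg[OF A(1) Z, of "?r1"] by auto
        have "g l \<in> ?W" if l: "l < r" for l
        proof (rule nakayama_vec[OF A(2) W, where g = g and n = r])
          show "l < r" by fact
          fix l assume l: "l < r"
          then have gl: "g l \<in> fvec A ?r1" "?b1 (g l) \<in> fvec J (rs i)" using g(1) by auto
          from dec[OF this] obtain w j v where wjv: "w \<in> fvec A ?r2" "j \<in> fvec J ?r1"
            "v \<in> fvec A ?r1" "(\<lambda>k. g l k - ?b2 w k) = (\<lambda>k. j k + a * v k)"
            "?b1 v \<in> fvec ?J2 (rs i)" by blast
          then have "v \<in> ?Z" using True by auto
          then obtain c where c: "\<forall>l<r. c l \<in> A" "v = lc r c g" using g(2) by blast
          let ?w = "\<lambda>k. j k + ?b2 w k"
          have "?w \<in> ?W" using wjv by (auto intro!: bexI[of _ w])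
          moreover have "g l = (\<lambda>k. ?w k + lc r (\<lambda>i. a * c i) g k)"
          proof
            fix k show "g l k = ?w k + lc r (\<lambda>i. a * c i) g k"
              using fun_cong[OF wjv(4), of k] unfolding lc_scale c(2)[symmetric] by (simp add: algebra_simps)
          qed
          moreover have "\<forall>i<r. a * c i \<in> n" using c a by (auto intro: ideal_mult_right[OF im])
          ultimately show "\<exists>w\<in>?W. \<exists>c. (\<forall>i<r. c i \<in> n) \<and> g l = (\<lambda>k. w k + lc r c g k)"
            by (intro bexI[of _ ?w] exI[of _ "\<lambda>i. a * c i"] conjI)
        qed
        note gW = this
        have "?Z \<subseteq> ?W"
        proof
          fix u assume "u \<in> ?Z"
          then obtain c where "\<forall>l<r. c l \<in> A" "u = lc r c g" using g(2) by blast
          then show "u \<in> ?W" using smod_lc[OF W, of r c g] gW by simp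
        qed
        then show ?thesis unfolding tor_zero_def by blast
      qed
    qed
  qed
qed

lemma pchain_le: "pchain A J n P ==> k \<le> n ==> pchain A J k P"
  by (auto simp: pchain_def)

section \<open>The Koszul complex\<close>

lemma antisymmetric_double_sum:
  fixes a :: "nat => nat => 'b::ab_group_add"
  assumes "finite I" "\<And>j l. j \<in> I ==> l \<in> I ==> j \<noteq> l ==> a j l + a l j = 0"
  shows "(\<Sum>j\<in>I. \<Sum>l\<in>I - {j}. a j l) = 0"
  using assms
proof (induction I)
  case (insert x I)
  have "(\<Sum>j\<in>I. \<Sum>l\<in>insert x I - {j}. a j l) = (\<Sum>j\<in>I. a j x + (\<Sum>l\<in>I - {j}. a j l))"
  proof (rule sum.cong)
    fix j assume "j \<in> I"
    then have "insert x I - {j} = insert x (I - {j})" using insert by auto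
    then show "(\<Sum>l\<in>insert x I - {j}. a j l) = a j x + (\<Sum>l\<in>I - {j}. a j l)" using insert by simp
  qed simp
  also have "\<dots> = (\<Sum>j\<in>I. a j x)" using insert by (simp add: sum.distrib)
  finally have "(\<Sum>j\<in>insert x I. \<Sum>l\<in>insert x I - {j}. a j l) = (\<Sum>l\<in>I. a x l) + (\<Sum>j\<in>I. a j x)"
    using insert by simp
  also have "\<dots> = (\<Sum>l\<in>I. a x l + a l x)" by (simp add: sum.distrib)
  also have "\<dots> = 0" using insert by (intro sum.neutral) auto
  finally show ?case .
qed simp

text \<open>Counting the elements above \<open>j\<close> gives the largest element of a set sign
  one, which suits the induction over the sets \<open>{..<i}\<close> in
  \<open>koszul_lower_bound\<close>.\<close>

definition koszul_sign :: "nat set => nat => 'a::field" where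
  "koszul_sign I j = (- 1) ^ card {l \<in> I. j < l}"

lemma koszul_sign_max:
  assumes "\<forall>l\<in>I. l \<le> i" shows "koszul_sign I i = (1::'a::field)"
proof -
  have "{l \<in> I. i < l} = {}" using assms by auto
  then show ?thesis by (simp only: koszul_sign_def card.empty power_0)
qed

lemma koszul_sign_antisym:
  assumes "finite I" "j \<in> I" "l \<in> I" "j \<noteq> l"
  shows "koszul_sign I j * koszul_sign (I - {j}) l + koszul_sign I l * koszul_sign (I - {l}) j = (0::'a::field)"
proof -
  have *: "koszul_sign I j * koszul_sign (I - {j}) l + koszul_sign I l * koszul_sign (I - {l}) j = (0::'a::field)"
    if "j \<in> I" "l \<in> I" "j < l" for j l
  proof -
    have "{i \<in> I - {j}. l < i} = {i \<in> I. l < i}" using that by auto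
    moreover have "{i \<in> I. j < i} = insert l {i \<in> I - {l}. j < i}" using that by auto
    ultimately show ?thesis using assms(1) by (simp add: koszul_sign_def)
  qed
  show ?thesis using *[of j l] *[of l j] assms by (cases "j < l") (auto simp: add.commute)
qed

text \<open>The Koszul complex on \<open>x\<close>, with basis indexed by the subsets of \<open>{..<\<mu>}\<close>, maps to any resolution
  of the ideal generated by \<open>x\<close>.\<close>

lemma koszul_map_exists:
  assumes sA: "subring A" and res: "is_res A rs D P" and x: "\<And>j. j < \<mu> ==> x j \<in> P" and PA: "P \<subseteq> A"
  shows "\<exists>f. f {} = (\<lambda>k. if k = 0 then 1 else 0) \<and> (\<forall>I\<subseteq>{..<\<mu>}. card I \<le> i --> f I \<in> fvec A (rs (card I)) \<and>
    (0 < card I --> bd rs D (card I) (f I) =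
       (\<lambda>k. \<Sum>j\<in>I. koszul_sign I j * x j * f (I - {j}) k)))"
proof (induction i)
  case 0
  have "I = {}" if "I \<subseteq> {..<\<mu>}" "card I \<le> 0" for I
    using that finite_subset[of I "{..<\<mu>}"] by auto
  then show ?case
    using is_resD(1)[OF res] fvec_unit[OF sA, of 0 1]
    by (intro exI[of _ "\<lambda>_ k. if k = 0 then 1 else 0"]) fastforce
next
  case (Suc i)
  then obtain f where f0: "f {} = (\<lambda>k. if k = 0 then 1 else 0)"
    and f: "\<And>I. I \<subseteq> {..<\<mu>} ==> card I \<le> i ==> f I \<in> fvec A (rs (card I))"
    "\<And>I. I \<subseteq> {..<\<mu>} ==> card I \<le> i ==> 0 < card I ==> bd rs D (card I) (f I) =
       (\<lambda>k. \<Sum>j\<in>I. koszul_sign I j * x j * f (I - {j}) k)" by blast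
  have ex: "\<exists>u\<in>fvec A (rs (Suc i)). bd rs D (Suc i) u =
       (\<lambda>k. \<Sum>j\<in>I. koszul_sign I j * x j * f (I - {j}) k)"
    if I: "I \<subseteq> {..<\<mu>}" "card I = Suc i" for I
  proof -
    have fin: "finite I" using I finite_subset by blast
    have cI: "card (I - {j}) = i" "I - {j} \<subseteq> {..<\<mu>}" if "j \<in> I" for j using that I fin by auto
    have xA: "x j \<in> A" if "j \<in> I" for j using x PA I that by blast
    let ?z = "\<lambda>k. \<Sum>j\<in>I. koszul_sign I j * x j * f (I - {j}) k"
    have sg: "koszul_sign I j \<in> A" for I j
      unfolding koszul_sign_def using sA by (intro subring_power) (auto simp: subring_closed)
    have fj: "f (I - {j}) \<in> fvec A (rs i)" if "j \<in> I" for j using f(1)[of "I - {j}"] cI[OF that] by auto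
    have z: "?z \<in> fvec A (rs i)"
      unfolding fvec_def using fj sg xA
      by (auto simp: fvec_def intro!: subring_sum[OF sA] subring_mult[OF sA] sum.neutral)
    show ?thesis
    proof (cases i)
      case 0
      then obtain j where j: "I = {j}" using I card_1_singletonE by auto
      have "x j \<in> P" using x j I by auto
      then obtain u where u: "u \<in> fvec A (rs 1)" "x j = bd rs D 1 u 0" using is_resD(5)[OF res] by blast
      have "bd rs D 1 u \<in> fvec A (rs 0)" using res_D_fvec[OF sA res ideal_ring[OF sA], of u 0] u by simp
      moreover have "koszul_sign {j} j = (1::'a)" by (rule koszul_sign_max) simp
      ultimately have "bd rs D 1 u k = ?z k" for k
        using u(2) is_resD(1)[OF res] unfolding j f0 fvec_def
        by (cases k) (auto simp: f0)
      then show ?thesis using u 0 by (intro bexI[of _ u]) auto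
    next
      case (Suc i')
      have "bd rs D i ?z k = 0" for k
      proof -
        have "bd rs D i ?z k = (\<Sum>l<rs i. \<Sum>j\<in>I. koszul_sign I j * x j * f (I - {j}) l * D i l k)"
          by (simp add: lc_def sum_distrib_right)
        also have "\<dots> = (\<Sum>j\<in>I. \<Sum>l<rs i. koszul_sign I j * x j * f (I - {j}) l * D i l k)"
          by (rule sum.swap)
        also have "\<dots> = (\<Sum>j\<in>I. koszul_sign I j * x j * bd rs D i (f (I - {j})) k)"
          by (simp add: lc_def sum_distrib_left mult.assoc)
        also have "\<dots> = (\<Sum>j\<in>I. koszul_sign I j * x j *
            (\<Sum>l\<in>I - {j}. koszul_sign (I - {j}) l * x l * f (I - {j} - {l}) k))"
        proof (rule sum.cong)
          fix j assume j: "j \<in> I"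
          have "bd rs D i (f (I - {j})) = (\<lambda>k. \<Sum>l\<in>I - {j}. koszul_sign (I - {j}) l * x l * f (I - {j} - {l}) k)"
            using f(2)[of "I - {j}"] cI[OF j] Suc by auto
          then show "koszul_sign I j * x j * bd rs D i (f (I - {j})) k = koszul_sign I j * x j *
            (\<Sum>l\<in>I - {j}. koszul_sign (I - {j}) l * x l * f (I - {j} - {l}) k)" by simp
        qed simp
        also have "\<dots> = (\<Sum>j\<in>I. \<Sum>l\<in>I - {j}. (koszul_sign I j * koszul_sign (I - {j}) l) * (x j * x l * f (I - {j} - {l}) k))"
          by (simp add: sum_distrib_left mult_ac)
        also have "\<dots> = 0"
        proof (rule antisymmetric_double_sum[OF fin])
          fix j l assume jl: "j \<in> I" "l \<in> I" "j \<noteq> l"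
          have "I - {l} - {j} = I - {j} - {l}" by auto
          then have "koszul_sign I j * koszul_sign (I - {j}) l * (x j * x l * f (I - {j} - {l}) k) +
            koszul_sign I l * koszul_sign (I - {l}) j * (x l * x j * f (I - {l} - {j}) k) =
            (koszul_sign I j * koszul_sign (I - {j}) l + koszul_sign I l * koszul_sign (I - {l}) j) *
              (x j * x l * f (I - {j} - {l}) k)" by (simp add: algebra_simps)
          then show "koszul_sign I j * koszul_sign (I - {j}) l * (x j * x l * f (I - {j} - {l}) k) +
            koszul_sign I l * koszul_sign (I - {l}) j * (x l * x j * f (I - {l} - {j}) k) = 0"
            using koszul_sign_antisym[OF fin jl, where ?'a = 'a] by simp
        qed
        finally show ?thesis .
      qed
      then have "bd rs D (Suc i') ?z = (\<lambda>_. 0)" unfolding Suc by blast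
      then obtain w where "w \<in> fvec A (rs (Suc (Suc i')))" "?z = bd rs D (Suc (Suc i')) w"
        using is_resD(4)[OF res, of ?z i'] z Suc by auto
      then show ?thesis using Suc by (intro bexI[of _ w]) auto
    qed
  qed
  let ?ok = "\<lambda>I u. u \<in> fvec A (rs (Suc i)) \<and>
     bd rs D (Suc i) u = (\<lambda>k. \<Sum>j\<in>I. koszul_sign I j * x j * f (I - {j}) k)"
  define g where "g I = (SOME u. ?ok I u)" for I
  have g: "?ok I (g I)" if "I \<subseteq> {..<\<mu>}" "card I = Suc i" for I
    unfolding g_def using ex[OF that] by (intro someI_ex[of "?ok I"]) blast
  let ?f = "\<lambda>I. if card I = Suc i then g I else f I"
  show ?case
  proof (intro exI[of _ ?f] conjI allI impI)
    show "?f {} = (\<lambda>k. if k = 0 then 1 else 0)" using f0 by simp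
    fix I assume I: "I \<subseteq> {..<\<mu>}" "card I \<le> Suc i"
    have fin: "finite I" using I finite_subset by blast
    have "card (I - {j}) \<noteq> Suc i" if "j \<in> I" for j using that fin I card_Diff_singleton[OF that] by simp
    then have e: "(\<Sum>j\<in>I. koszul_sign I j * x j * ?f (I - {j}) k) = (\<Sum>j\<in>I. koszul_sign I j * x j * f (I - {j}) k)" for k
      by (intro sum.cong) auto
    show "?f I \<in> fvec A (rs (card I))" using f(1)[of I] g[of I] I by auto
    show "bd rs D (card I) (?f I) = (\<lambda>k. \<Sum>j\<in>I. koszul_sign I j * x j * ?f (I - {j}) k)" if "0 < card I"
      unfolding e using f(2)[of I] g[of I] I that by auto
  qed
qed

text \<open>The comparison map from the Koszul complex into a resolution of the residue field stays
  nonzero modulo \<open>n\<close> in every degree up to \<open>\<mu>\<close>, so homology with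
  residue field coefficients cannot vanish there.\<close>

lemma koszul_lower_bound:
  assumes A: "local_ring A n" and res: "is_res A rs D n" and x: "indep A n x \<mu>" and gen: "n = igen A x \<mu>"
    and t: "t < \<mu>" "tor_zero A rs D t n"
  shows False
proof -
  have sA: "subring A" and im: "ideal_in A n" using A by (auto simp: local_ring_def)
  have xn: "x j \<in> n" if "j < \<mu>" for j using x that by (simp add: indep_def)
  have xi: "c j \<in> n" if "\<And>i. i < \<mu> ==> c i \<in> A" "(\<Sum>i<\<mu>. c i * x i) \<in> ideal_pow A n 2" "j < \<mu>" for c j
    using x that by (auto simp: indep_def)
  have sq: "ideal_in A (ideal_pow A n 2)" using sA im by (intro ideal_pow_ideal)
  note bd = res_D_fvec[OF sA res ideal_ring[OF sA]] and comp = res_D_comp[OF sA res]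
  obtain f where f0: "f {} = (\<lambda>k. if k = 0 then 1 else 0)"
    and f: "\<And>I. I \<subseteq> {..<\<mu>} ==> card I \<le> \<mu> ==> f I \<in> fvec A (rs (card I))"
    "\<And>I. I \<subseteq> {..<\<mu>} ==> card I \<le> \<mu> ==> 0 < card I ==> bd rs D (card I) (f I) =
       (\<lambda>k. \<Sum>j\<in>I. koszul_sign I j * x j * f (I - {j}) k)"
    using koszul_map_exists[OF sA res, of \<mu> x \<mu>] xn ideal_subset[OF im] by blast
  have sg: "koszul_sign I j \<in> A" for I j
    unfolding koszul_sign_def using sA by (intro subring_power) (auto simp: subring_closed)
  define ap where "ap i p u = (\<Sum>l<rs i. p l * u l)" for i and p u :: "nat => 'a"
  have apA: "ap i p u \<in> J" if "ideal_in A J" "\<And>l. l < rs i ==> p l \<in> A" "u \<in> fvec J (rs i)" for i p u J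
    unfolding ap_def using that by (intro ideal_sum[OF that(1)] ideal_mult[OF that(1)]) (auto simp: fvec_def)
  have aplc: "ap i p (lc s c g) = (\<Sum>j<s. c j * ap i p (g j))" for i p s c g
  proof -
    have "ap i p (lc s c g) = (\<Sum>l<rs i. \<Sum>j<s. p l * (c j * g j l))" by (simp add: ap_def lc_def sum_distrib_left)
    also have "\<dots> = (\<Sum>j<s. \<Sum>l<rs i. p l * (c j * g j l))" by (rule sum.swap)
    finally show ?thesis by (simp add: ap_def sum_distrib_left mult_ac)
  qed
  \<comment> \<open>\<open>p\<close> is a functional on the i-th free module which modulo
    \<open>n\<close> kills boundaries and, on the images of the basis elements, takes the value one
    at \<open>{..<i}\<close> and zero at the others. Composed with the next differential it has
    values in \<open>n\<close>; writing these as combinations of the \<open>x j\<close> and keeping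
    the coefficient of \<open>x i\<close> gives the next functional.\<close>
  have main: "\<exists>p. (\<forall>l<rs i. p l \<in> A) \<and>
      (\<forall>I\<subseteq>{..<\<mu>}. card I = i --> ap i p (f I) - (if I = {..<i} then 1 else 0) \<in> n) \<and>
      (\<forall>w\<in>fvec A (rs (Suc i)). ap i p (bd rs D (Suc i) w) \<in> n)" if "i \<le> \<mu>" for i
    using that
  proof (induction i)
    case 0
    have "I = {}" if "I \<subseteq> {..<\<mu>}" "card I = 0" for I
      using that finite_subset[of I "{..<\<mu>}"] by auto
    then have "\<forall>I\<subseteq>{..<\<mu>}. card I = 0 --> ap 0 (\<lambda>_. 1) (f I) - (if I = {..<0} then 1 else 0) \<in> n"
    proof (intro allI impI)
      fix I assume "\<And>I. I \<subseteq> {..<\<mu>} ==> card I = 0 ==> I = {}" "I \<subseteq> {..<\<mu>}" "card I = 0"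
      then have "I = {}" by blast
      then show "ap 0 (\<lambda>_. 1) (f I) - (if I = {..<0} then 1 else 0) \<in> n"
        using f0 ideal_zero[OF im] is_resD(1)[OF res] by (simp add: ap_def)
    qed
    moreover have "ap 0 (\<lambda>_. 1) (bd rs D (Suc 0) w) \<in> n" if "w \<in> fvec A (rs (Suc 0))" for w
      using is_resD(1,5)[OF res] that by (auto simp: ap_def)
    ultimately show ?case using subring_one[OF sA] by (intro exI[of _ "\<lambda>_. 1"]) auto
  next
    case (Suc i)
    then obtain p where p: "\<And>l. l < rs i ==> p l \<in> A"
      "\<And>I. I \<subseteq> {..<\<mu>} ==> card I = i ==> ap i p (f I) - (if I = {..<i} then 1 else 0) \<in> n"
      "\<And>w. w \<in> fvec A (rs (Suc i)) ==> ap i p (bd rs D (Suc i) w) \<in> n" by auto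
    let ?r1 = "rs (Suc i)" and ?b1 = "bd rs D (Suc i)"
    have i\<mu>: "i < \<mu>" using Suc by simp
    have "\<exists>c. l < ?r1 --> (\<forall>j<\<mu>. c j \<in> A) \<and> ap i p (D (Suc i) l) = (\<Sum>j<\<mu>. c j * x j)" for l
    proof (cases "l < ?r1")
      case True
      have "ap i p (D (Suc i) l) \<in> igen A x \<mu>"
        using p(3)[OF fvec_unit[OF sA True]] unfolding lc_unit[OF True] gen[symmetric] .
      then show ?thesis by (elim igen_sumE[OF sA]) blast
    qed auto
    then obtain q where q: "\<And>l j. l < ?r1 ==> j < \<mu> ==> q l j \<in> A"
      "\<And>l. l < ?r1 ==> ap i p (D (Suc i) l) = (\<Sum>j<\<mu>. q l j * x j)" by metis
    define \<psi> where "\<psi> j u = ap (Suc i) (\<lambda>l. q l j) u" for j u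
    have \<psi>A: "\<psi> j u \<in> A" if "j < \<mu>" "u \<in> fvec A (?r1)" for j u
      unfolding \<psi>_def using that q by (intro apA ideal_ring[OF sA]) auto
    have \<psi>: "ap i p (?b1 u) = (\<Sum>j<\<mu>. \<psi> j u * x j)" for u
    proof -
      have "ap i p (?b1 u) = (\<Sum>l<?r1. \<Sum>j<\<mu>. u l * (q l j * x j))"
        unfolding aplc using q(2) by (intro sum.cong) (auto simp: sum_distrib_left)
      also have "\<dots> = (\<Sum>j<\<mu>. \<Sum>l<?r1. u l * (q l j * x j))" by (rule sum.swap)
      finally show ?thesis by (simp add: \<psi>_def ap_def sum_distrib_right sum_distrib_left mult_ac)
    qed
    show ?case
    proof (intro exI[of _ "\<lambda>l. q l i"] conjI allI impI ballI)
      show "q l i \<in> A" if "l < ?r1" for l using q(1)[OF that i\<mu>] .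
      show "ap (Suc i) (\<lambda>l. q l i) (bd rs D (Suc (Suc i)) w) \<in> n"
        if w: "w \<in> fvec A (rs (Suc (Suc i)))" for w
      proof -
        let ?b = "bd rs D (Suc (Suc i)) w"
        have "(\<Sum>j<\<mu>. \<psi> j ?b * x j) = 0" unfolding \<psi>[symmetric] comp[OF w] by (simp add: ap_def)
        then have "\<psi> i ?b \<in> n" using \<psi>A bd[OF w] ideal_zero[OF sq] i\<mu> by (intro xi[of "\<lambda>j. \<psi> j ?b"]) auto
        then show ?thesis unfolding \<psi>_def .
      qed
      fix I assume I: "I \<subseteq> {..<\<mu>}" "card I = Suc i"
      have fin: "finite I" using I finite_subset by blast
      have fI: "f I \<in> fvec A (?r1)" using f(1)[OF I(1)] I(2) Suc.prems by auto
      have sub: "card (I - {j}) = i" "I - {j} \<subseteq> {..<\<mu>}" if "j \<in> I" for j using that I fin by auto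
      let ?c = "\<lambda>j. if j \<in> I then koszul_sign I j * ap i p (f (I - {j})) else 0"
      have apf: "ap i p (f (I - {j})) \<in> A" if "j \<in> I" for j
        using f(1)[of "I - {j}"] sub[OF that] Suc.prems p(1) by (intro apA ideal_ring[OF sA]) auto
      have "ap i p (?b1 (f I)) = (\<Sum>l<rs i. \<Sum>j\<in>I. p l * (koszul_sign I j * x j * f (I - {j}) l))"
        using f(2)[OF I(1)] I(2) Suc.prems by (simp add: ap_def sum_distrib_left)
      also have "\<dots> = (\<Sum>j\<in>I. \<Sum>l<rs i. p l * (koszul_sign I j * x j * f (I - {j}) l))" by (rule sum.swap)
      also have "\<dots> = (\<Sum>j\<in>I. ?c j * x j)" by (simp add: ap_def sum_distrib_left sum_distrib_right mult_ac)
      also have "\<dots> = (\<Sum>j<\<mu>. ?c j * x j)" using I(1) by (intro sum.mono_neutral_left) auto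
      finally have "(\<Sum>j<\<mu>. \<psi> j (f I) * x j) = (\<Sum>j<\<mu>. ?c j * x j)" unfolding \<psi> .
      then have "(\<Sum>j<\<mu>. (\<psi> j (f I) - ?c j) * x j) = 0" by (simp add: left_diff_distrib sum_subtractf)
      then have *: "\<psi> i (f I) - ?c i \<in> n"
        using \<psi>A fI apf sg ideal_zero[OF sq] i\<mu> sA
        by (intro xi[of "\<lambda>j. \<psi> j (f I) - ?c j"]) (auto intro!: subring_diff subring_mult subring_zero)
      show "ap (Suc i) (\<lambda>l. q l i) (f I) - (if I = {..<Suc i} then 1 else 0) \<in> n"
      proof (cases "I = {..<Suc i}")
        case True
        have "koszul_sign I i = (1::'a)" using True by (intro koszul_sign_max) auto
        moreover have "I - {i} = {..<i}" "i \<in> I" using True by auto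
        ultimately have "?c i = ap i p (f {..<i})" by simp
        moreover have "ap i p (f {..<i}) - 1 \<in> n" using p(2)[of "{..<i}"] i\<mu> by auto
        ultimately have "?c i - 1 \<in> n" by simp
        from ideal_add[OF im * this] have "\<psi> i (f I) - 1 \<in> n" by (simp only: diff_add_cancel add_diff_eq)
        then show ?thesis using True by (simp add: \<psi>_def)
      next
        case False
        have "?c i \<in> n"
        proof (cases "i \<in> I")
          case True
          then have "I - {i} \<noteq> {..<i}" using False by (metis insert_Diff lessThan_Suc)
          then have "ap i p (f (I - {i})) \<in> n" using p(2)[of "I - {i}"] sub[OF True] by simp
          then show ?thesis using True ideal_mult[OF im sg] by simp
        qed (use ideal_zero[OF im] in simp)
        then have "(\<psi> i (f I) - ?c i) + ?c i \<in> n" using ideal_add[OF im *] by blast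
        then show ?thesis using False by (simp add: \<psi>_def)
      qed
    qed
  qed
  \<comment> \<open>The image of the basis element \<open>?I\<close> is a cycle modulo
    \<open>n\<close>. If it were a boundary modulo \<open>n\<close>, the functional would vanish on
    it modulo \<open>n\<close>, while its value there is one.\<close>
  let ?I = "{..<Suc t}" and ?r1 = "rs (Suc t)" and ?r2 = "rs (Suc (Suc t))"
  let ?b1 = "bd rs D (Suc t)" and ?b2 = "bd rs D (Suc (Suc t))"
  have I: "?I \<subseteq> {..<\<mu>}" "card ?I = Suc t" using t by auto
  obtain p where p': "\<forall>l<?r1. p l \<in> A"
    "\<forall>I\<subseteq>{..<\<mu>}. card I = Suc t --> ap (Suc t) p (f I) - (if I = {..<Suc t} then 1 else 0) \<in> n"
    "\<forall>w\<in>fvec A ?r2. ap (Suc t) p (?b2 w) \<in> n"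
    using main[of "Suc t"] t by auto
  let ?p = "ap (Suc t) p"
  have p: "\<And>l. l < ?r1 ==> p l \<in> A" "?p (f ?I) - 1 \<in> n"
    "\<And>w. w \<in> fvec A ?r2 ==> ?p (?b2 w) \<in> n"
    using p'(1,3) p'(2)[rule_format, OF I] by auto
  have fI: "f ?I \<in> fvec A ?r1" using f(1)[OF I(1)] I(2) t by auto
  have "?b1 (f ?I) \<in> fvec n (rs t)"
    unfolding fvec_def
  proof (intro CollectI conjI allI impI)
    fix k assume k: "k < rs t"
    have "koszul_sign ?I j * x j * f (?I - {j}) k \<in> n" if j: "j \<in> ?I" for j
    proof -
      have "card (?I - {j}) = t" "?I - {j} \<subseteq> {..<\<mu>}" using j t by auto
      then have "f (?I - {j}) k \<in> A" using f(1)[of "?I - {j}"] k t by (auto simp: fvec_def)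
      then show ?thesis using sg j t xn by (intro ideal_mult_right[OF im] ideal_mult[OF im]) auto
    qed
    then show "?b1 (f ?I) k \<in> n"
      using f(2)[OF I(1)] I(2) t ideal_sum[OF im, of ?I "\<lambda>j. koszul_sign ?I j * x j * f (?I - {j}) k"]
      by (simp del: lessThan_Suc sum.lessThan_Suc)
  qed (use bd[OF fI] in \<open>auto simp: fvec_def\<close>)
  then obtain w where w: "w \<in> fvec A ?r2"
    "(\<lambda>k. f ?I k - ?b2 w k) \<in> fvec n ?r1"
    using t(2) fI unfolding tor_zero_def by blast
  have "?p (f ?I) = ?p (\<lambda>k. f ?I k - ?b2 w k)
      + ?p (?b2 w)"
    by (simp add: ap_def sum.distrib[symmetric] algebra_simps)
  also have "\<dots> \<in> n" using apA[OF im p(1) w(2)] p(3)[OF w(1)] by (rule ideal_add[OF im])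
  finally have "?p (f ?I) - (?p (f ?I) - 1) \<in> n" using ideal_diff[OF sA im _ p(2)] by blast
  then show False using local_not_one[OF A] by simp
qed

section \<open>Serre's theorem\<close>

text \<open>A combination lying in the square of \<open>n\<close> can be rewritten with coefficients
  in \<open>n\<close>; the difference of the two expressions is a relation, to which minimality
  applies.\<close>

lemma minimal_generators_indep:
  assumes A: "noetherian A" "local_ring A n"
  obtains x \<mu> where "indep A n x \<mu>" "n = igen A x \<mu>"
proof -
  have sA: "subring A" and im: "ideal_in A n" using A by (auto simp: local_ring_def)
  have mA: "a \<in> A" if "a \<in> n" for a using ideal_sub[OF im that] .
  obtain s g where g: "\<forall>l<s. g l \<in> fvec n 1" "\<forall>u\<in>fvec n 1. \<exists>c. (\<forall>l<s. c l \<in> A) \<and> u = lc s c g"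
    "\<forall>c. (\<forall>l<s. c l \<in> A) --> lc s c g = (\<lambda>_. 0) --> (\<forall>l<s. c l \<in> n)"
    using smod_min_gens[OF A fvec_smod[OF sA im] fvec_mono[OF ideal_subset[OF im]], of 1] by blast
  let ?x = "\<lambda>l. g l 0"
  have xn: "?x l \<in> n" if "l < s" for l using g(1) that by (auto simp: fvec_def)
  have xA: "?x l \<in> A" if "l < s" for l using mA[OF xn[OF that]] .
  have n: "n = igen A ?x s"
  proof
    show "igen A ?x s \<subseteq> n" using xn ideal_zero[OF im] by (intro gen_least[OF im]) auto
    show "n \<subseteq> igen A ?x s"
    proof
      fix z assume z: "z \<in> n"
      then have "(\<lambda>k. if k = 0 then z else 0) \<in> fvec n 1" by (auto simp: fvec_def)
      then obtain c where c: "\<forall>l<s. c l \<in> A" "(\<lambda>k. if k = 0 then z else 0) = lc s c g" using g(2) by blast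
      have "z = (\<Sum>l<s. c l * ?x l)" using fun_cong[OF c(2), of 0] by (simp add: lc_def)
      then show "z \<in> igen A ?x s" using igen_sumI[OF sA c(1)] by simp
    qed
  qed
  have "indep A n ?x s"
    unfolding indep_def
  proof (intro conjI allI impI)
    show "?x i \<in> n" if "i < s" for i using xn that .
    fix c i assume c: "\<forall>i<s. c i \<in> A" "(\<Sum>i<s. c i * ?x i) \<in> ideal_pow A n 2" and i: "i < s"
    have "(\<Sum>i<s. c i * ?x i) \<in> jpow A n n 1"
      using c(2) jpow_self[OF sA im, of 1] by (simp add: ideal_pow_eq_jpow numeral_2_eq_2)
    then have "(\<Sum>i<s. c i * ?x i) \<in> iprod A n (igen A ?x s)" using n by simp
    then obtain e where e: "\<forall>i<s. e i \<in> n" "(\<Sum>i<s. c i * ?x i) = (\<Sum>i<s. e i * ?x i)"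
      using iprod_igen[OF sA im, where y = ?x and n = s] xA by blast
    have "lc s (\<lambda>i. c i - e i) g = (\<lambda>_. 0)"
    proof
      fix k
      show "lc s (\<lambda>i. c i - e i) g k = 0"
      proof (cases k)
        case 0
        then show ?thesis using e(2) by (simp add: lc_def left_diff_distrib sum_subtractf)
      next
        case (Suc j)
        then show ?thesis using g(1) by (auto simp: lc_def fvec_def)
      qed
    qed
    moreover have "\<forall>i<s. c i - e i \<in> A" using c(1) e(1) mA subring_diff[OF sA] by blast
    ultimately have "c i - e i \<in> n" using g(3)[rule_format, of "\<lambda>i. c i - e i" i] i by simp
    then have "(c i - e i) + e i \<in> n" using e i by (intro ideal_add[OF im]) auto
    then show "c i \<in> n" by simp
  qed
  then show ?thesis using that n by blast
qed

text \<open>Modulo a longest regular sequence \<open>z\<close>, of length \<open>t\<close>, every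
  element of the maximal ideal is a zero divisor, so a socle element exists. The finite resolution
  inherited from \<open>A\<close> then lets vanishing descend to index \<open>t\<close>, and the
  Koszul bound gives \<open>\<mu> \<le> t\<close>. A regular sequence of length \<open>t\<close>
  yields a chain of primes of that length, hence one of length \<open>\<mu>\<close>.\<close>

theorem regular_localization:
  assumes y: "regsys A m y d" and P: "prime_in A P"
  obtains e z where "regsys (loc_at A P) (mloc A P) z e"
proof -
  note R = regsysD[OF y]
  let ?B = "loc_at A P" and ?n = "mloc A P"
  note U = prime_compl_mult[OF R(7) P]
  have B: "noetherian ?B" "local_ring ?B ?n" using loc_at_noeth[OF R(1) P] loc_at_local[OF R(7) P] by auto
  have sB: "subring ?B" and im: "ideal_in ?B ?n" using B by (auto simp: local_ring_def)
  obtain rs D where F: "is_res A rs D P" "\<And>i. d < i ==> rs (Suc i) = 0"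
    using finite_free_resolution[OF y prime_ideal[OF P]] by blast
  have res: "is_res ?B rs D ?n" using loc_resolution[OF R(7) U F(1)] by (simp add: loc_at_eq mloc_eq)
  obtain x \<mu> where x: "indep ?B ?n x \<mu>" "?n = igen ?B x \<mu>" using minimal_generators_indep[OF B] by blast
  have xn: "x i \<in> ?n" if "i < \<mu>" for i using x(1) that by (simp add: indep_def)
  have bound: "t \<le> \<mu>" if ch: "\<exists>Q. pchain ?B {0} t Q" for t
  proof (rule ccontr)
    assume "\<not> t \<le> \<mu>"
    then have "\<exists>Q. pchain ?B {0} (Suc \<mu>) Q" using ch pchain_le[of ?B "{0}" t _ "Suc \<mu>"] by auto
    then show False using krull_height[OF B, of "{0}" x \<mu>] x(2) xn by blast
  qed
  let ?S = "\<lambda>t. \<exists>z. regseq ?B z t \<and> (\<forall>i<t. z i \<in> ?n)"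
  have chS: "\<exists>Q. pchain ?B {0} t Q" if "?S t" for t using regseq_prime_chain[OF B] that by blast
  have "?S 0" by (auto simp: regseq_def)
  moreover have "\<forall>t. ?S t --> t \<le> \<mu>" using chS bound by blast
  ultimately obtain t where t: "?S t" "\<And>t'. ?S t' ==> t' \<le> t"
    using GreatestI_nat[of ?S 0 \<mu>] Greatest_le_nat[of ?S _ \<mu>] by blast
  then obtain z where z: "regseq ?B z t" "\<And>i. i < t ==> z i \<in> ?n" by blast
  let ?J = "igen ?B z t"
  have zB: "z i \<in> ?B" if "i < t" for i using z(1) that by (simp add: regseq_def)
  have J: "ideal_in ?B ?J" using zB by (intro igen_ideal[OF sB]) auto
  have zd: "\<exists>a\<in>?B. a \<notin> ?J \<and> w * a \<in> ?J" if w: "w \<in> ?n" for w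
  proof (rule ccontr)
    assume no: "\<not> ?thesis"
    let ?z = "z(t := w)"
    have g: "igen ?B ?z j = igen ?B z j" if "j \<le> t" for j using that by (intro gen_cong) auto
    have "regseq ?B ?z (Suc t)"
      unfolding regseq_def
    proof (intro allI impI conjI ballI)
      fix j assume j: "j < Suc t"
      show "?z j \<in> ?B" using j zB ideal_sub[OF im w] by auto
      fix a assume "a \<in> ?B" "?z j * a \<in> igen ?B ?z j"
      then show "a \<in> igen ?B ?z j" using j g[of j] no z(1) by (cases "j = t") (auto simp: regseq_def)
    qed
    then have "?S (Suc t)" using z(2) w by (intro exI[of _ ?z]) auto
    then show False using t(2) by fastforce
  qed
  obtain s where s: "s \<in> ?B" "s \<notin> ?J" "\<And>w. w \<in> ?n ==> w * s \<in> ?J"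
    using maximal_annihilator[OF B J zd] by blast
  have triv: "tor_zero ?B rs D i J" if "d < i" "ideal_in ?B J" for i J
    unfolding tor_zero_def
  proof (intro ballI impI)
    fix u assume u: "u \<in> fvec ?B (rs (Suc i))"
    then have "u = (\<lambda>_. 0)" using F(2)[OF that(1)] by (auto simp: fvec_def)
    then show "\<exists>w\<in>fvec ?B (rs (Suc (Suc i))). (\<lambda>k. u k - bd rs D (Suc (Suc i)) w k) \<in> fvec J (rs (Suc i))"
      using smod_zero[OF fvec_ring_smod[OF sB]] ideal_zero[OF that(2)]
      by (intro bexI[of _ "\<lambda>_. 0"]) (auto simp: lc_def fvec_def)
  qed
  \<comment> \<open>Descending induction from a degree where the resolution is zero. The summand
    \<open>k\<close> only raises the starting point, so that \<open>i = t\<close> is reached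
    whatever \<open>t\<close> is.\<close>
  have "t \<le> i --> (\<forall>J. ideal_in ?B J --> tor_zero ?B rs D i J)" if "i \<le> Suc d + k" for i k
    using that
  proof (induction "Suc d + k - i" arbitrary: i)
    case 0
    then show ?case using triv by auto
  next
    case (Suc l)
    then have up: "t \<le> Suc i --> (\<forall>J. ideal_in ?B J --> tor_zero ?B rs D (Suc i) J)" by simp
    show ?case
    proof (intro impI allI)
      fix J assume ti: "t \<le> i" and J': "ideal_in ?B J"
      show "tor_zero ?B rs D i J"
        by (rule tor_zero_step[OF B res J tor_zero_regseq[OF sB res z(1) ti] s(1,2)])
          (use s(3) up ti J' in auto)
    qed
  qed
  from this[of t t] have "tor_zero ?B rs D t ?n" using im by simp
  then have "\<not> t < \<mu>" using koszul_lower_bound[OF B(2) res x] by blast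
  then have "\<exists>Q. pchain ?B {0} \<mu> Q" using chS[OF t(1)] pchain_le[of ?B "{0}" t _ \<mu>] by auto
  then have "regsys ?B ?n x \<mu>" using B x(2) xn by (simp add: regsys_def)
  then show ?thesis by (rule that)
qed

section \<open>Factoriality through principal colon ideals\<close>

text \<open>The principal ideal of \<open>x\<close>; the name does not refer to principal ideal
  domains.\<close>

definition pid :: "'a::field set => 'a => 'a set" where
  "pid A x = {a * x | a. a \<in> A}"

definition pel :: "'a::field set => 'a => bool" where
  "pel A p \<longleftrightarrow> p \<in> A \<and> p \<noteq> 0 \<and> prime_in A (pid A p)"

text \<open>For a Noetherian domain this is equivalent to irreducible elements being prime, and in
  this form the property passes to localizations.\<close>

definition colons_principal :: "'a::field set => bool" where
  "colons_principal A \<longleftrightarrow> (\<forall>f\<in>A. f \<noteq> 0 --> (\<forall>c\<in>A. \<exists>g. colon A (pid A f) c = pid A g))"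

lemma pid_adj: "pid A x = adj A {0} x"
  by (auto simp: pid_def adj_def)

lemma pid_ideal: "subring A ==> x \<in> A ==> ideal_in A (pid A x)"
  unfolding pid_adj by (intro adj_ideal ideal_zero_ideal)

lemma pid_mem: "subring A ==> x \<in> pid A x"
  unfolding pid_adj by (intro adj_mem ideal_zero_ideal)

lemma pid_least: "ideal_in A I ==> x \<in> I ==> pid A x \<subseteq> I"
  by (auto simp: pid_def intro: ideal_mult)

lemma pid_memI: "a \<in> A ==> a * x \<in> pid A x" "a \<in> A ==> x * a \<in> pid A x"
  by (auto simp: pid_def)

lemma pid_memE:
  assumes "z \<in> pid A x" obtains a where "a \<in> A" "z = a * x"
  using assms by (auto simp: pid_def)

lemma pid_one: "pid A 1 = A"
  by (auto simp: pid_def)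

lemma unit_inD: "unit_in A u ==> u \<in> A" "unit_in A u ==> u \<noteq> 0" "unit_in A u ==> inverse u \<in> A"
  by (auto simp: unit_in_def)

lemma unit_in_one: "subring A ==> unit_in A 1"
  by (auto simp: unit_in_def subring_one)

lemma unit_in_mult: "subring A ==> unit_in A u ==> unit_in A v ==> unit_in A (u * v)"
  by (auto simp: unit_in_def subring_mult)

lemma unit_in_inverse: "unit_in A u ==> unit_in A (inverse u)"
  by (auto simp: unit_in_def)

lemma pid_unit: assumes "subring A" "unit_in A u" shows "pid A (u * x) = pid A x"
proof
  show "pid A (u * x) \<subseteq> pid A x"
    using assms unit_inD(1)[OF assms(2)] by (auto simp: pid_def mult.assoc[symmetric] intro: subring_mult)
  show "pid A x \<subseteq> pid A (u * x)"
  proof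
    fix z assume "z \<in> pid A x"
    then obtain a where a: "a \<in> A" "z = a * x" by (rule pid_memE)
    then have "z = (a * inverse u) * (u * x)" using unit_inD[OF assms(2)] by simp
    then show "z \<in> pid A (u * x)" using pid_memI(1)[of "a * inverse u" A "u * x"]
        subring_mult[OF assms(1) a(1) unit_inD(3)[OF assms(2)]] by simp
  qed
qed

lemma one_in_pid_iff: "x \<in> A ==> x \<noteq> 0 ==> 1 \<in> pid A x \<longleftrightarrow> unit_in A x"
proof -
  assume x: "x \<in> A" "x \<noteq> 0"
  have "inverse x = a" if "1 = a * x" for a using that inverse_unique[of x a] by (simp add: mult.commute)
  then show "1 \<in> pid A x \<longleftrightarrow> unit_in A x"
    using x by (auto simp: pid_def unit_in_def intro!: exI[of _ "inverse x"])
qed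

lemma pelD: "pel A p ==> p \<in> A" "pel A p ==> p \<noteq> 0" "pel A p ==> prime_in A (pid A p)"
  by (auto simp: pel_def)

lemma pel_nonunit: "pel A p ==> \<not> unit_in A p"
  using prime_not_one[of A "pid A p"] one_in_pid_iff[of p A] by (auto simp: pel_def)

lemma irreducibleD:
  assumes "irreducible_in A p"
  shows "p \<in> A" "p \<noteq> 0" "\<not> unit_in A p" "a \<in> A ==> b \<in> A ==> p = a * b ==> unit_in A a \<or> unit_in A b"
  using assms by (auto simp: irreducible_in_def)

lemma pel_irreducible: assumes sA: "subring A" and p: "pel A p" shows "irreducible_in A p"
  unfolding irreducible_in_def
proof (intro conjI ballI impI)
  show "p \<in> A" "p \<noteq> 0" "\<not> unit_in A p" using pelD[OF p] pel_nonunit[OF p] by auto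
  fix a b assume ab: "a \<in> A" "b \<in> A" "p = a * b"
  have *: "unit_in A b" if "a \<in> pid A p" "p = a * b" "b \<in> A" for a b
  proof -
    from \<open>a \<in> pid A p\<close> obtain c where c: "c \<in> A" "a = c * p" by (rule pid_memE)
    then have "p * (c * b) = p * 1" using \<open>p = a * b\<close> by (metis mult.assoc mult.commute mult.right_neutral)
    then have "c * b = 1" using pelD(2)[OF p] mult_left_cancel by blast
    then have "b \<noteq> 0" "inverse b = c" using inverse_unique[of b c] by (auto simp: mult.commute)
    then show ?thesis using \<open>b \<in> A\<close> c by (simp add: unit_in_def)
  qed
  have "a * b \<in> pid A p" using pid_mem[OF sA] ab by metis
  then have "a \<in> pid A p \<or> b \<in> pid A p" using prime_mult[OF pelD(3)[OF p]] ab by blast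
  then show "unit_in A a \<or> unit_in A b" using *[of a b] *[of b a] ab by (auto simp: mult.commute)
qed

lemma atomic_factorization:
  assumes A: "noetherian A" and f: "f \<in> A" "f \<noteq> 0"
  shows "\<exists>u xs. unit_in A u \<and> (\<forall>p\<in>set xs. irreducible_in A p) \<and> f = u * prod_list xs"
proof (rule ccontr)
  have sA: "subring A" using A by (rule noeth_subring)
  let ?F = "\<lambda>f. \<exists>u xs. unit_in A u \<and> (\<forall>p\<in>set xs. irreducible_in A p) \<and> f = u * prod_list xs"
  assume no: "\<not> ?F f"
  let ?P = "\<lambda>I. \<exists>f\<in>A. f \<noteq> 0 \<and> \<not> ?F f \<and> I = pid A f"
  obtain I where I: "?P I" "\<And>K. ?P K ==> I \<subseteq> K ==> K = I"
    by (rule noeth_max[of A ?P "pid A f"]) (use f A no sA in \<open>auto intro: pid_ideal\<close>)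
  then obtain g where g: "g \<in> A" "g \<noteq> 0" "\<not> ?F g" "I = pid A g" by blast
  have "\<not> unit_in A g"
  proof
    assume "unit_in A g"
    then have "?F g" by (intro exI[of _ g] exI[of _ "[]"]) simp
    then show False using g by blast
  qed
  moreover have "\<not> irreducible_in A g"
  proof
    assume "irreducible_in A g"
    then have "?F g" using unit_in_one[OF sA] by (intro exI[of _ 1] exI[of _ "[g]"]) simp
    then show False using g by blast
  qed
  ultimately obtain a b where ab: "a \<in> A" "b \<in> A" "g = a * b" "\<not> unit_in A a" "\<not> unit_in A b"
    using g by (auto simp: irreducible_in_def)
  have n: "a \<noteq> 0" "b \<noteq> 0" using ab g by auto
  have *: "?F a" if "a \<in> A" "b \<in> A" "g = a * b" "\<not> unit_in A b" for a b
  proof (rule ccontr)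
    assume na: "\<not> ?F a"
    have a0: "a \<noteq> 0" "b \<noteq> 0" using that g by auto
    have "I \<subseteq> pid A a" unfolding g using that by (intro pid_least pid_ideal sA) (auto intro: pid_memI)
    then have "pid A a = I" using I(2)[of "pid A a"] that na a0 by blast
    then have "a \<in> pid A g" using pid_mem[OF sA, of a] g by simp
    then obtain c where "c \<in> A" "a = c * g" by (rule pid_memE)
    then have "c * b = 1" using that a0 by auto
    then have "inverse b = c" using inverse_unique[of b c] by (auto simp: mult.commute)
    then show False using that a0 \<open>c \<in> A\<close> by (simp add: unit_in_def)
  qed
  obtain u xs where u: "unit_in A u" "\<forall>p\<in>set xs. irreducible_in A p" "a = u * prod_list xs" using *[of a b] ab by blast
  obtain v ys where v: "unit_in A v" "\<forall>p\<in>set ys. irreducible_in A p" "b = v * prod_list ys"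
    using *[of b a] ab by (metis mult.commute)
  have "?F g" using u v unit_in_mult[OF sA u(1) v(1)] unfolding ab(3)
    by (intro exI[of _ "u * v"] exI[of _ "xs @ ys"]) (auto simp: mult_ac)
  then show False using g by blast
qed

lemma colon_pid_scale:
  assumes "subring A" "p \<noteq> 0" shows "colon A (pid A (p * f)) (p * c) = colon A (pid A f) c"
proof -
  have "z * (p * c) = a * (p * f) \<longleftrightarrow> z * c = a * f" for z a using assms(2) by (simp add: mult.left_commute)
  then show ?thesis by (simp add: colon_def pid_def)
qed

lemma not_dvd_cancel:
  assumes sA: "subring A"
  shows "\<forall>p\<in>set xs. pel A p \<and> c \<notin> pid A p ==> u \<in> A ==> a \<in> A ==> c \<in> A ==> e \<in> A ==>
    a * c = e * prod_list xs ==> a \<in> pid A (prod_list xs)"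
proof (induction xs arbitrary: a)
  case Nil then show ?case by (simp add: pid_one)
next
  case (Cons p xs)
  note xsA = subring_prod_list[OF sA]
  have p: "pel A p" "c \<notin> pid A p" using Cons by auto
  have "set xs \<subseteq> A" using Cons.prems(1) by (auto dest: pelD(1))
  then have "a * c \<in> pid A p" unfolding Cons.prems(6) using xsA Cons.prems(5) sA
    by (auto intro!: exI[of _ "e * prod_list xs"] subring_mult simp: pid_def mult_ac)
  then have "a \<in> pid A p" using prime_mult[OF pelD(3)[OF p(1)]] Cons.prems p by blast
  then obtain a' where a': "a' \<in> A" "a = a' * p" by (rule pid_memE)
  have "a' * c = e * prod_list xs" using Cons.prems(6) a' pelD(2)[OF p(1)] by simp
  then have "a' \<in> pid A (prod_list xs)" using Cons a' by auto
  then show ?case using a' by (auto simp: pid_def mult_ac)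
qed

text \<open>A prime factor shared by \<open>f\<close> and \<open>c\<close> cancels from the colon
  ideal; once none is shared, the colon ideal is \<open>pid A f\<close>.\<close>

lemma colons_principal_if_irreducible_prime:
  assumes A: "noetherian A" and pr: "\<And>p. irreducible_in A p ==> pel A p"
  shows "colons_principal A"
  unfolding colons_principal_def
proof (intro ballI impI)
  have sA: "subring A" using A by (rule noeth_subring)
  have *: "\<forall>p\<in>set xs. pel A p ==> c \<in> A ==> \<exists>g. colon A (pid A (prod_list xs)) c = pid A g" for xs c
  proof (induction "length xs" arbitrary: xs c)
    case 0
    then have "colon A (pid A (prod_list xs)) c = pid A 1" using sA by (auto simp: pid_one colon_def subring_closed)
    then show ?case by blast
  next
    case (Suc n)
    show ?case
    proof (cases "\<exists>p\<in>set xs. c \<in> pid A p")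
      case True
      then obtain p where p: "p \<in> set xs" "c \<in> pid A p" by blast
      then obtain ys zs where xs: "xs = ys @ p # zs" by (meson split_list)
      obtain e where e: "e \<in> A" "c = e * p" using p(2) by (rule pid_memE)
      have "prod_list xs = p * prod_list (ys @ zs)" unfolding xs by simp
      moreover have "c = p * e" using e by simp
      moreover have "p \<noteq> 0" using Suc.prems p pelD by blast
      ultimately have "colon A (pid A (prod_list xs)) c = colon A (pid A (prod_list (ys @ zs))) e"
        using colon_pid_scale[OF sA] by metis
      then show ?thesis using Suc.hyps(1)[of "ys @ zs" e] Suc.hyps(2) Suc.prems e xs by auto
    next
      case False
      have "set xs \<subseteq> A" using Suc.prems by (auto dest: pelD(1))
      then have PA: "prod_list xs \<in> A" by (intro subring_prod_list[OF sA]) auto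
      have "colon A (pid A (prod_list xs)) c \<subseteq> pid A (prod_list xs)"
        using False Suc.prems not_dvd_cancel[OF sA, of xs c 1] sA
        by (auto simp: colon_def subring_closed elim!: pid_memE)
      moreover have "pid A (prod_list xs) \<subseteq> colon A (pid A (prod_list xs)) c"
        by (rule colon_sub[OF pid_ideal[OF sA PA] Suc.prems(2)])
      ultimately show ?thesis by blast
    qed
  qed
  fix f c assume f: "f \<in> A" "f \<noteq> 0" and c: "c \<in> A"
  obtain u xs where u: "unit_in A u" "\<forall>p\<in>set xs. irreducible_in A p" "f = u * prod_list xs"
    using atomic_factorization[OF A f] by blast
  show "\<exists>g. colon A (pid A f) c = pid A g"
    unfolding u(3) pid_unit[OF sA u(1)] using *[of xs c] u(2) pr c by blast
qed

text \<open>For irreducible \<open>f\<close> it is thus enough to find one principal prime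
  containing it: its generator divides \<open>f\<close> and is no unit.\<close>

lemma principal_colon_prime_irreducible:
  assumes sA: "subring A" and f: "irreducible_in A f" and Q: "prime_in A (pid A g)" "f \<in> pid A g" "g \<in> A"
  shows "pel A f"
proof -
  obtain h where h: "h \<in> A" "f = h * g" using Q(2) by (rule pid_memE)
  have "g \<noteq> 0" using h irreducibleD(2)[OF f] by auto
  then have "\<not> unit_in A g" using one_in_pid_iff[OF Q(3)] prime_not_one[OF Q(1)] by blast
  then have "unit_in A h" using irreducibleD(4)[OF f h(1) Q(3) h(2)] by blast
  then have "pid A f = pid A g" unfolding h(2) by (rule pid_unit[OF sA])
  then show ?thesis using Q irreducibleD[OF f] by (simp add: pel_def)
qed

text \<open>An associated prime of \<open>pid A f\<close> is a colon ideal and therefore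
  principal.\<close>

lemma irreducible_prime_if_colons_principal:
  assumes A: "noetherian A" and pc: "colons_principal A" and f: "irreducible_in A f"
  shows "pel A f"
proof -
  have sA: "subring A" using A by (rule noeth_subring)
  note F = irreducibleD[OF f]
  have I: "ideal_in A (pid A f)" by (rule pid_ideal[OF sA F(1)])
  have "1 \<notin> pid A f" using one_in_pid_iff[OF F(1,2)] F(3) by simp
  then obtain c where c: "c \<in> A" "prime_in A (colon A (pid A f) c)" "colon A (pid A f) 1 \<subseteq> colon A (pid A f) c"
    using assoc_prime_exists[OF A I subring_one[OF sA]] by metis
  obtain g where g: "colon A (pid A f) c = pid A g" using pc F c(1) unfolding colons_principal_def by blast
  have gA: "g \<in> A" using pid_mem[OF sA, of g] g by (auto simp: colon_def)
  have "f \<in> pid A g" using g colon_sub[OF I c(1)] pid_mem[OF sA, of f] by auto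
  then show ?thesis using principal_colon_prime_irreducible[OF sA f] c(2) g gA by simp
qed

lemma loc_colon:
  assumes sA: "subring A" and U: "mult_closed_in A U" and f: "f \<in> A" and c: "c \<in> A"
  shows "colon (loc_mult A U) (pid (loc_mult A U) f) c = loc_mult (colon A (pid A f) c) U"
proof (intro equalityI subsetI)
  let ?L = "loc_mult A U"
  note LU = loc_U[OF sA U] and inc = loc_incl[OF sA U, of A] and sL = loc_subring[OF sA U]
  fix z assume "z \<in> colon ?L (pid ?L f) c"
  then obtain e where z: "z \<in> ?L" "e \<in> ?L" "z * c = e * f" unfolding colon_def pid_def by blast
  obtain w s where w: "w \<in> A" "s \<in> U" "z = w / s" using z(1) by (rule loc_memE)
  obtain v t where v: "v \<in> A" "t \<in> U" "e = v / t" using z(2) by (rule loc_memE)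
  have n: "s \<noteq> 0" "t \<noteq> 0" "s \<in> A" "t \<in> A" using LU w v by auto
  have "(t * w) * c = (s * v) * f" using z(3) n unfolding w(3) v(3) by (simp add: field_simps)
  then have "t * w \<in> colon A (pid A f) c" using n v w sA by (auto simp: colon_def subring_mult pid_memI)
  then show "z \<in> loc_mult (colon A (pid A f) c) U" using n w v LU by (intro loc_memI[of "t * w" _ "t * s"]) auto
next
  let ?L = "loc_mult A U"
  note LU = loc_U[OF sA U] and inc = loc_incl[OF sA U, of A] and sL = loc_subring[OF sA U]
  fix z assume "z \<in> loc_mult (colon A (pid A f) c) U"
  then obtain w s where w: "w \<in> colon A (pid A f) c" "s \<in> U" "z = w / s" by (rule loc_memE)
  then obtain e where e: "w \<in> A" "e \<in> A" "w * c = e * f" unfolding colon_def pid_def by blast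
  have "z * c = (e / s) * f" using e w LU(2)[OF w(2)] by (simp add: field_simps)
  moreover have "e / s \<in> ?L" "z \<in> ?L" using e w by (auto intro: loc_memI)
  ultimately show "z \<in> colon ?L (pid ?L f) c" unfolding colon_def pid_def by blast
qed

lemma loc_pid:
  assumes sA: "subring A" and U: "mult_closed_in A U" shows "loc_mult (pid A g) U = pid (loc_mult A U) g"
  by (auto simp: loc_mult_def pid_def) (metis times_divide_eq_left)+

lemma pid_frac:
  assumes sA: "subring A" and U: "mult_closed_in A U" and u: "u \<in> U"
  shows "pid (loc_mult A U) (a / u) = pid (loc_mult A U) a"
proof -
  have "unit_in (loc_mult A U) (inverse u)"
    using loc_inverse[OF sA U u] loc_incl[OF sA U, of A] loc_U[OF sA U] u by (auto simp: unit_in_def)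
  from pid_unit[OF loc_subring[OF sA U] this, of a] show ?thesis by (simp add: field_simps)
qed

lemma colons_principal_loc:
  assumes sA: "subring A" and U: "mult_closed_in A U" and pc: "colons_principal A"
  shows "colons_principal (loc_mult A U)"
  unfolding colons_principal_def
proof (intro ballI impI)
  let ?L = "loc_mult A U"
  note LU = loc_U[OF sA U]
  fix f c assume f: "f \<in> ?L" "f \<noteq> 0" and c: "c \<in> ?L"
  obtain a u where a: "a \<in> A" "u \<in> U" "f = a / u" using f(1) by (rule loc_memE)
  obtain b v where b: "b \<in> A" "v \<in> U" "c = b / v" using c by (rule loc_memE)
  obtain g where g: "colon A (pid A a) b = pid A g" 
  proof -
    have "a \<noteq> 0" using a f by auto
    then show thesis using pc a(1) b(1) that unfolding colons_principal_def by blast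
  qed
  have "colon ?L (pid ?L f) c = colon ?L (pid ?L a) b"
  proof -
    have iL: "ideal_in ?L (pid ?L a)"
      using a loc_incl[OF sA U, of A] by (intro pid_ideal loc_subring sA U) auto
    have "z * (b / v) \<in> pid ?L a \<longleftrightarrow> z * b \<in> pid ?L a" for z
    proof
      assume "z * b \<in> pid ?L a"
      then have "inverse v * (z * b) \<in> pid ?L a" by (rule ideal_mult[OF iL loc_inverse[OF sA U b(2)]])
      then show "z * (b / v) \<in> pid ?L a" by (simp add: field_simps)
    next
      assume "z * (b / v) \<in> pid ?L a"
      then have "v * (z * (b / v)) \<in> pid ?L a"
        using ideal_mult[OF iL, of v] LU b loc_incl[OF sA U, of A] by blast
      then show "z * b \<in> pid ?L a" using LU(2)[OF b(2)] by (simp add: field_simps)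
    qed
    then show ?thesis unfolding a(3) b(3) pid_frac[OF sA U a(2)] by (simp add: colon_def)
  qed
  also have "\<dots> = pid ?L g" unfolding loc_colon[OF sA U a(1) b(1)] g loc_pid[OF sA U] ..
  finally show "\<exists>g. colon ?L (pid ?L f) c = pid ?L g" by blast
qed

section \<open>Uniqueness of factorization\<close>

text \<open>The unit \<open>u\<close> collects the units that arise when the primes of
  \<open>xs\<close> are matched one by one.\<close>

lemma prime_factors_match:
  assumes sA: "subring A"
  shows "\<forall>p\<in>set xs. pel A p ==> \<forall>p\<in>set ys. irreducible_in A p ==> unit_in A u ==>
    prod_list xs = u * prod_list ys ==>
    \<exists>zs. mset zs = mset ys \<and> length zs = length xs \<and> (\<forall>i<length xs. associated_in A (xs ! i) (zs ! i))"
proof (induction xs arbitrary: ys u)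
  case Nil
  have "ys = []"
  proof (rule ccontr)
    assume "ys \<noteq> []"
    then obtain q ys' where ys: "ys = q # ys'" by (cases ys) auto
    have q: "irreducible_in A q" and "set ys' \<subseteq> A" using Nil ys by (auto dest: irreducibleD(1))
    then have PA: "prod_list ys' \<in> A" by (auto intro: subring_prod_list[OF sA])
    have 1: "(u * prod_list ys') * q = 1" using Nil ys by (simp add: mult_ac)
    have "u * prod_list ys' \<in> A" using PA Nil(3) sA unit_inD by (auto intro: subring_mult)
    from pid_memI(1)[OF this, of q] have "1 \<in> pid A q" unfolding 1 .
    then show False using one_in_pid_iff[of q A] irreducibleD[OF q] by blast
  qed
  then show ?case by auto
next
  case (Cons p xs)
  have p: "pel A p" using Cons by simp
  have ysA: "set ys \<subseteq> A" using Cons.prems(2) by (auto dest: irreducibleD(1))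
  have xsA: "set xs \<subseteq> A" using Cons.prems(1) by (auto dest: pelD(1))
  have PX: "prod_list xs \<in> A" by (rule subring_prod_list[OF sA xsA])
  have dv: "\<exists>q\<in>set ys. q \<in> pid A p" if "set ys \<subseteq> A" "u * prod_list ys \<in> pid A p" "unit_in A u" for ys u
    using that
  proof (induction ys arbitrary: u)
    case Nil
    then have "inverse u * u \<in> pid A p" using ideal_mult[OF pid_ideal[OF sA pelD(1)[OF p]] unit_inD(3)] by simp
    then have "1 \<in> pid A p" using unit_inD(2)[OF Nil(3)] by simp
    then show ?case using prime_not_one[OF pelD(3)[OF p]] by blast
  next
    case (Cons q ys)
    have PA: "prod_list ys \<in> A" using Cons.prems(1) by (intro subring_prod_list[OF sA]) auto
    have "q * (u * prod_list ys) \<in> pid A p" using Cons.prems(2) by (simp add: mult_ac)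
    moreover have "u * prod_list ys \<in> A" using PA unit_inD(1)[OF Cons.prems(3)] subring_mult[OF sA] by blast
    ultimately have "q \<in> pid A p \<or> u * prod_list ys \<in> pid A p" using prime_mult[OF pelD(3)[OF p]] Cons.prems(1) by auto
    then show ?case using Cons by auto
  qed
  have "u * prod_list ys \<in> pid A p" using Cons.prems(4) PX pid_memI(2)[OF PX, of p] by simp
  then obtain q where q: "q \<in> set ys" "q \<in> pid A p" using dv[OF ysA _ Cons.prems(3)] by blast
  obtain w where w: "w \<in> A" "q = w * p" using q(2) by (rule pid_memE)
  have qi: "irreducible_in A q" using Cons q by blast
  have wu: "unit_in A w" using irreducibleD(4)[OF qi w(1) pelD(1)[OF p] w(2)] pel_nonunit[OF p] by blast
  obtain as bs where ys: "ys = as @ q # bs" using q(1) by (meson split_list)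
  have "p * prod_list xs = p * ((u * w) * prod_list (as @ bs))" using Cons.prems(4) unfolding ys w(2) by (simp add: mult_ac)
  then have "prod_list xs = (u * w) * prod_list (as @ bs)" using pelD(2)[OF p] by simp
  then obtain zs where zs: "mset zs = mset (as @ bs)" "length zs = length xs" "\<forall>i<length xs. associated_in A (xs ! i) (zs ! i)"
    using Cons.IH[of "as @ bs" "u * w"] Cons.prems ys unit_in_mult[OF sA Cons.prems(3) wu] by auto
  have "p = inverse w * q" using w unit_inD(2)[OF wu] by simp
  then have "associated_in A p q" using unit_in_inverse[OF wu] unfolding associated_in_def by blast
  then have "\<forall>i<length (p # xs). associated_in A ((p # xs) ! i) ((q # zs) ! i)" using zs(3) by (auto simp: nth_Cons split: nat.splits)
  moreover have "mset (q # zs) = mset ys" using zs(1) ys by simp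
  ultimately show ?case using zs(2) by (intro exI[of _ "q # zs"]) auto
qed

lemma ufd_if_irreducible_prime:
  assumes A: "noetherian A" and pr: "\<And>p. irreducible_in A p ==> pel A p"
  shows "ufd A"
proof -
  have sA: "subring A" using A by (rule noeth_subring)
  have ex: "\<exists>xs. xs \<noteq> [] \<and> (\<forall>p\<in>set xs. irreducible_in A p) \<and> a = prod_list xs"
    if a: "a \<in> A" "a \<noteq> 0" "\<not> unit_in A a" for a
  proof -
    obtain u xs where u: "unit_in A u" "\<forall>p\<in>set xs. irreducible_in A p" "a = u * prod_list xs"
      using atomic_factorization[OF A a(1,2)] by blast
    have "xs \<noteq> []" using u a(3) by auto
    then obtain p ys where xs: "xs = p # ys" by (cases xs) auto
    have p: "irreducible_in A p" using u xs by simp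
    have "irreducible_in A (u * p)"
    proof -
      have "pid A (u * p) = pid A p" by (rule pid_unit[OF sA u(1)])
      then have "pel A (u * p)" using pr[OF p] unit_inD[OF u(1)] subring_mult[OF sA] by (auto simp: pel_def)
      then show ?thesis by (rule pel_irreducible[OF sA])
    qed
    then show ?thesis using u xs by (intro exI[of _ "(u * p) # ys"]) (auto simp: mult_ac)
  qed
  have uniq: "length xs = length ys \<and> (\<exists>f. bij_betw f {..<length xs} {..<length ys} \<and>
      (\<forall>i<length xs. associated_in A (xs ! i) (ys ! f i)))"
    if "\<forall>p\<in>set xs. irreducible_in A p" "\<forall>p\<in>set ys. irreducible_in A p" "prod_list xs = prod_list ys" for xs ys
  proof -
    have "\<exists>zs. mset zs = mset ys \<and> length zs = length xs \<and> (\<forall>i<length xs. associated_in A (xs ! i) (zs ! i))"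
      using prime_factors_match[OF sA, of xs ys 1] that pr unit_in_one[OF sA] by simp
    then obtain zs where zs: "mset zs = mset ys" "length zs = length xs" "\<forall>i<length xs. associated_in A (xs ! i) (zs ! i)"
      by blast
    obtain f where f: "f permutes {..<length ys}" "permute_list f ys = zs"
      using zs(1) by (rule mset_eq_permutation)
    have len: "length xs = length ys" using zs(1,2) by (metis size_mset)
    have "zs ! i = ys ! f i" if "i < length ys" for i using f that by (simp add: permute_list_nth[symmetric])
    then show ?thesis using len zs(3) permutes_imp_bij[OF f(1)] by (intro conjI exI[of _ f]) auto
  qed
  show ?thesis unfolding ufd_def using sA ex uniq by blast
qed

section \<open>Discrete valuation rings of prime elements\<close>

text \<open>Otherwise the quotients \<open>a / p ^ k\<close> would generate an ascending chain of
  principal ideals, which can stop only if \<open>p\<close> is a unit.\<close>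

lemma noeth_power_bound:
  assumes A: "noetherian A" and p: "p \<in> A" "p \<noteq> 0" "\<not> unit_in A p" and a: "a \<in> A" "a \<noteq> 0"
  shows "\<exists>k. a \<in> pid A (p ^ k) \<and> a \<notin> pid A (p ^ Suc k)"
proof (rule ccontr)
  assume no: "\<not> ?thesis"
  have sA: "subring A" using A by (rule noeth_subring)
  have all: "a \<in> pid A (p ^ k)" for k
  proof (induction k)
    case 0 then show ?case using a by (simp add: pid_one)
  next
    case (Suc k) then show ?case using no by blast
  qed
  define c where "c k = a / p ^ k" for k
  have cA: "c k \<in> A" for k using all[of k] p by (auto simp: c_def elim!: pid_memE)
  have cS: "c k = p * c (Suc k)" for k using p by (simp add: c_def)
  have "pid A (c k) \<subseteq> pid A (c (Suc k))" for k
    using cA cS[of k] p by (intro pid_least pid_ideal sA) (auto intro: pid_memI)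
  then have "\<exists>N. \<forall>i\<ge>N. pid A (c i) = pid A (c N)" using cA by (intro noeth_acc[OF A] pid_ideal sA)
  then obtain N where "pid A (c (Suc N)) = pid A (c N)" by (metis le_SucI order_refl)
  then have "c (Suc N) \<in> pid A (c N)" using pid_mem[OF sA] by metis
  then obtain e where e: "e \<in> A" "c (Suc N) = e * c N" by (rule pid_memE)
  have "c (Suc N) \<noteq> 0" using a p by (simp add: c_def)
  moreover have "c (Suc N) * (e * p) = c (Suc N) * 1" using arg_cong[OF e(2), of id] cS[of N] by (simp add: mult_ac)
  ultimately have "e * p = 1" using mult_left_cancel by blast
  then have "inverse p = e" using inverse_unique[of p e] by (simp add: mult.commute)
  then show False using e p by (simp add: unit_in_def)
qed

lemma pel_power_cancel:
  assumes sA: "subring A" and p: "pel A p" and u: "u \<in> A" "u \<notin> pid A p"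
  shows "a \<in> A ==> a * u \<in> pid A (p ^ k) ==> a \<in> pid A (p ^ k)"
proof (induction k arbitrary: a)
  case 0 then show ?case by (simp add: pid_one)
next
  case (Suc k)
  obtain e where e: "e \<in> A" "a * u = e * p ^ Suc k" using Suc.prems(2) by (rule pid_memE)
  note P = pelD[OF p]
  have "a * u \<in> pid A p" unfolding e(2) using pid_memI(1)[of "e * p ^ k" A p] e sA P by (simp add: subring_closed mult_ac)
  then have "a \<in> pid A p" using prime_mult[OF P(3)] u Suc.prems by blast
  then obtain b where b: "b \<in> A" "a = b * p" by (rule pid_memE)
  have "b * u = e * p ^ k" using e(2) b P(2) by simp
  then have "b \<in> pid A (p ^ k)" using Suc.IH[of b] b e by (auto intro: pid_memI)
  then obtain c where "c \<in> A" "b = c * p ^ k" by (rule pid_memE)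
  then show ?case using b by (auto simp: pid_def mult_ac)
qed

lemma pel_loc_dvr:
  assumes A: "noetherian A" and p: "pel A p" and qf: "quotient_field_is_ambient A"
  shows "dvr (loc_at A (pid A p))"
proof -
  have sA: "subring A" using A by (rule noeth_subring)
  note P = pelD[OF p]
  let ?L = "loc_at A (pid A p)"
  note U = prime_compl_mult[OF sA P(3)] and lL = loc_at_local[OF sA P(3)] and nL = loc_at_noeth[OF A P(3)]
  note sL = loc_at_subring[OF sA P(3)]
  have inc: "A \<subseteq> ?L" unfolding loc_at_eq by (rule loc_incl[OF sA U])
  have pL: "p \<in> ?L" using inc P(1) by blast
  have mL: "mloc A (pid A p) = pid ?L p" unfolding mloc_eq loc_at_eq by (rule loc_pid[OF sA U])
  have pn: "\<not> unit_in ?L p"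
    using local_nonunit[OF lL] pid_mem[OF sL, of p] P(2) unfolding mL unit_in_def by blast
  have dec: "\<exists>n w. unit_in ?L w \<and> z = p powi n * w" if z: "z \<noteq> 0" for z
  proof -
    have *: "\<exists>k c. unit_in ?L c \<and> a = c * p ^ k" if a: "a \<in> A" "a \<noteq> 0" for a
    proof -
      obtain k where k: "a \<in> pid ?L (p ^ k)" "a \<notin> pid ?L (p ^ Suc k)"
        using noeth_power_bound[OF nL pL P(2) pn _ a(2)] a(1) inc by blast
      obtain c where c: "c \<in> ?L" "a = c * p ^ k" using k(1) by (rule pid_memE)
      have "c \<notin> pid ?L p" using k(2) c by (auto simp: pid_def mult_ac)
      then show ?thesis using local_unit[OF lL c(1)] c unfolding mL unit_in_def by blast
    qed
    obtain a b where ab: "a \<in> A" "b \<in> A" "b \<noteq> 0" "z = a / b" using qf unfolding quotient_field_is_ambient_def by blast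
    obtain k c where c: "unit_in ?L c" "a = c * p ^ k" using *[of a] ab z by auto
    obtain l d where d: "unit_in ?L d" "b = d * p ^ l" using *[of b] ab by auto
    have "z = p powi (int k - int l) * (c * inverse d)"
      unfolding ab(4) c(2) d(2) using P(2) unit_inD(2)[OF d(1)] by (simp add: power_int_diff field_simps)
    then show ?thesis using unit_in_mult[OF sL c(1) unit_in_inverse[OF d(1)]] by blast
  qed
  have pos: "p powi n * w \<in> ?L \<longleftrightarrow> 0 \<le> n" if w: "unit_in ?L w" for n w
  proof
    assume "0 \<le> n"
    then have "p powi n = p ^ nat n" by (simp add: power_int_def)
    then show "p powi n * w \<in> ?L" using subring_mult[OF sL subring_power[OF sL pL] unit_inD(1)[OF w]] by simp
  next
    assume n: "p powi n * w \<in> ?L"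
    show "0 \<le> n"
    proof (rule ccontr)
      assume "\<not> 0 \<le> n"
      then have "p powi n * p ^ nat (- n - 1) = inverse p"
        using power_int_add[of p n "- n - 1"] P(2) by (simp add: power_int_def)
      then have "inverse p = p powi n * p ^ nat (- n - 1) * (w * inverse w)" using unit_inD(2)[OF w] by simp
      also have "\<dots> = (p powi n * w) * inverse w * p ^ nat (- n - 1)" by (simp only: mult_ac)
      also have "\<dots> \<in> ?L" by (intro subring_mult[OF sL] subring_power[OF sL] n unit_inD(3)[OF w] pL)
      finally show False using pn pL P(2) by (simp add: unit_in_def)
    qed
  qed
  \<comment> \<open>The exponent is unique because, by \<open>pos\<close>, \<open>p powi n\<close>
    times a unit lies in \<open>?L\<close> only for \<open>n \<ge> 0\<close>.\<close>
  define v where "v z = (THE n. \<exists>w. unit_in ?L w \<and> z = p powi n * w)" for z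
  have vI: "v (p powi n * w) = n" if w: "unit_in ?L w" for n w
    unfolding v_def
  proof (rule the_equality)
    show "\<exists>w'. unit_in ?L w' \<and> p powi n * w = p powi n * w'" using w by blast
    fix k assume "\<exists>w'. unit_in ?L w' \<and> p powi n * w = p powi k * w'"
    then obtain w' where w': "unit_in ?L w'" "p powi n * w = p powi k * w'" by blast
    have nz: "w \<noteq> 0" "w' \<noteq> 0" using w w'(1) unit_inD(2) by blast+
    have "p powi (n - k) * w = w'" "p powi (k - n) * w' = w"
      using w'(2) P(2) by (simp_all add: power_int_diff field_simps)
    then have "0 \<le> n - k" "0 \<le> k - n" using pos[OF w, of "n - k"] pos[OF w'(1), of "k - n"] unit_inD(1) w w'(1) by auto
    then show "k = n" by simp
  qed
  have vmem: "z \<in> ?L \<longleftrightarrow> z = 0 \<or> 0 \<le> v z" for z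
    using dec[of z] pos vI subring_zero[OF sL] by (cases "z = 0") auto
  have vmult: "v (x * y) = v x + v y" if xy: "x \<noteq> 0" "y \<noteq> 0" for x y
  proof -
    obtain n w where x: "unit_in ?L w" "x = p powi n * w" using dec[OF xy(1)] by blast
    obtain k u where y: "unit_in ?L u" "y = p powi k * u" using dec[OF xy(2)] by blast
    have "x * y = p powi (n + k) * (w * u)" unfolding x(2) y(2) using P(2) by (simp add: power_int_add)
    then show ?thesis using vI[OF unit_in_mult[OF sL x(1) y(1)], of "n + k"] vI[OF x(1), of n] vI[OF y(1), of k] x y by metis
  qed
  have vadd: "min (v x) (v y) \<le> v (x + y)" if "x \<noteq> 0" "y \<noteq> 0" "x + y \<noteq> 0" for x y
  proof -
    have *: "v x \<le> v (x + y)" if "x \<noteq> 0" "y \<noteq> 0" "x + y \<noteq> 0" "v x \<le> v y" for x y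
    proof -
      have "v (y / x) + v x = v y" using vmult[of "y / x" x] that by simp
      then have "y / x \<in> ?L" using vmem that by simp
      then have "1 + y / x \<in> ?L" using sL by (simp add: subring_closed)
      moreover have e: "1 + y / x = (x + y) / x" using that by (simp add: field_simps)
      ultimately have "0 \<le> v ((x + y) / x)" using vmem that by auto
      moreover have "v ((x + y) / x) + v x = v (x + y)" using vmult[of "(x + y) / x" x] that by simp
      ultimately show ?thesis by simp
    qed
    show ?thesis using *[of x y] *[of y x] that by (auto simp: min_def add.commute)
  qed
  have "v p = 1" using vI[OF unit_in_one[OF sL], of 1] by simp
  then show ?thesis unfolding dvr_def using vmult vadd vmem P(2) by (intro exI[of _ v]) auto
qed

section \<open>Stably free ideals of rank one\<close>

definition lin :: "((nat => 'a::field) => nat => 'a) => bool" where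
  "lin f \<longleftrightarrow> (\<forall>u v. f (\<lambda>k. u k + v k) = (\<lambda>k. f u k + f v k)) \<and> (\<forall>c u. f (\<lambda>k. c * u k) = (\<lambda>k. c * f u k))"

lemma lin_add: "lin f ==> f (\<lambda>k. u k + v k) = (\<lambda>k. f u k + f v k)"
  and lin_scale: "lin f ==> f (\<lambda>k. c * u k) = (\<lambda>k. c * f u k)"
  by (auto simp: lin_def)

lemma lin_zero: "lin f ==> f (\<lambda>_. 0) = (\<lambda>_. 0)"
  using lin_scale[of f 0] by simp

lemma lin_lc: "lin f ==> f (lc s c g) = lc s c (\<lambda>l. f (g l))"
proof (induction s)
  case 0 then show ?case using lin_zero[of f] by (simp add: lc_def)
next
  case (Suc s)
  then show ?case unfolding lc_Suc by (simp add: lin_add[OF Suc.prems] lin_scale[OF Suc.prems])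
qed

definition un :: "nat => nat => 'a::field" where
  "un l = (\<lambda>k. if k = l then 1 else 0)"

lemma un_fvec: "subring A ==> l < r ==> un l \<in> fvec A r"
  unfolding un_def by (rule fvec_unit)

lemma lc_un: "u \<in> fvec A r ==> lc r u un = u"
proof
  fix k assume u: "u \<in> fvec A r"
  have "lc r u un k = (\<Sum>l<r. if l = k then u l else 0)"
    unfolding lc_def un_def by (intro sum.cong) auto
  then show "lc r u un k = u k" using u by (auto simp: fvec_def)
qed

text \<open>Linear on pairs, that is on the direct sum; not bilinear.\<close>

definition joint_lin :: "((nat => 'a::field) => (nat => 'a) => nat => 'a) => bool" where
  "joint_lin \<gamma> \<longleftrightarrow>
    (\<forall>u u' v v'. \<gamma> (\<lambda>k. u k + u' k) (\<lambda>k. v k + v' k) = (\<lambda>k. \<gamma> u v k + \<gamma> u' v' k)) \<and>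
    (\<forall>c u v. \<gamma> (\<lambda>k. c * u k) (\<lambda>k. c * v k) = (\<lambda>k. c * \<gamma> u v k))"

text \<open>\<open>K \<times> D\<^sup>a\<close> is isomorphic to \<open>D\<^sup>b\<close>, the isomorphism and its inverse being restrictions of
  maps that are linear over the whole field.\<close>

definition stably_free :: "'a::field set => (nat => 'a) set => bool" where
  "stably_free D K \<longleftrightarrow> (\<exists>a b \<alpha>1 \<alpha>2 \<gamma>. lin \<alpha>1 \<and> lin \<alpha>2 \<and> joint_lin \<gamma> \<and>
     (\<forall>c\<in>fvec D b. \<alpha>1 c \<in> K \<and> \<alpha>2 c \<in> fvec D a \<and> \<gamma> (\<alpha>1 c) (\<alpha>2 c) = c) \<and>
     (\<forall>v\<in>K. \<forall>w\<in>fvec D a. \<gamma> v w \<in> fvec D b \<and> \<alpha>1 (\<gamma> v w) = v \<and> \<alpha>2 (\<gamma> v w) = w))"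

text \<open>\<open>tk\<close>, \<open>dr\<close> and \<open>cat\<close> take, drop and join
  coordinates; they identify vectors of length \<open>s + a\<close> with pairs.\<close>

definition tk :: "nat => (nat => 'a::field) => nat => 'a" where
  "tk s t = (\<lambda>k. if k < s then t k else 0)"

definition dr :: "nat => (nat => 'a::field) => nat => 'a" where
  "dr s t = (\<lambda>k. t (s + k))"

definition cat :: "nat => (nat => 'a::field) => (nat => 'a) => nat => 'a" where
  "cat s v w = (\<lambda>k. if k < s then v k else w (k - s))"

lemma cat_tk_dr: "cat s (tk s t) (dr s t) = t"
  by (auto simp: cat_def tk_def dr_def)

lemma tk_cat: "v \<in> fvec D s ==> tk s (cat s v w) = v"
  by (auto simp: cat_def tk_def fvec_def)

lemma dr_cat: "dr s (cat s v w) = w"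
  by (auto simp: cat_def dr_def)

lemma tk_fvec: "t \<in> fvec D (s + a) ==> tk s t \<in> fvec D s"
  and dr_fvec: "t \<in> fvec D (s + a) ==> dr s t \<in> fvec D a"
  and cat_fvec: "v \<in> fvec D s ==> w \<in> fvec D a ==> cat s v w \<in> fvec D (s + a)"
  by (auto simp: cat_def tk_def dr_def fvec_def)

lemma stably_free_zero: assumes "subring D" shows "stably_free D {\<lambda>_. 0}"
proof -
  have "fvec D 0 = {\<lambda>_. 0}" by (auto simp: fvec_def)
  then show ?thesis unfolding stably_free_def
    by (intro exI[of _ 0] exI[of _ "\<lambda>_ _. 0"] exI[of _ "\<lambda>_ _ _. 0"]) (auto simp: lin_def joint_lin_def)
qed

text \<open>The section \<open>\<sigma>\<close> splits the free module of rank \<open>s\<close> into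
  \<open>M\<close> and the kernel. If the kernel plus rank \<open>a\<close> is free of rank
  \<open>b\<close>, then \<open>M\<close> plus rank \<open>b\<close> is free of rank
  \<open>s + a\<close>.\<close>

lemma stably_free_step:
  assumes sD: "subring D" and M: "M = {lc s c g | c. c \<in> fvec D s}"
    and \<sigma>: "lin \<sigma>" "\<And>v. v \<in> M ==> \<sigma> v \<in> fvec D s" "\<And>v. v \<in> M ==> lc s (\<sigma> v) g = v"
    and K: "stably_free D {u \<in> fvec D s. lc s u g = (\<lambda>_. 0)}" (is "stably_free D ?K")
  shows "stably_free D M"
proof -
  obtain a b \<alpha>1 \<alpha>2 \<gamma> where lin: "lin \<alpha>1" "lin \<alpha>2" and jl: "joint_lin \<gamma>"
    and c: "\<And>c. c \<in> fvec D b ==> \<alpha>1 c \<in> ?K" "\<And>c. c \<in> fvec D b ==> \<alpha>2 c \<in> fvec D a"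
      "\<And>c. c \<in> fvec D b ==> \<gamma> (\<alpha>1 c) (\<alpha>2 c) = c"
    and k: "\<And>v w. v \<in> ?K ==> w \<in> fvec D a ==> \<gamma> v w \<in> fvec D b"
      "\<And>v w. v \<in> ?K ==> w \<in> fvec D a ==> \<alpha>1 (\<gamma> v w) = v"
      "\<And>v w. v \<in> ?K ==> w \<in> fvec D a ==> \<alpha>2 (\<gamma> v w) = w"
    using K unfolding stably_free_def by blast
  note sm = fvec_ring_smod[OF sD]
  let ?g = "\<lambda>t. lc s (tk s t) g"
  let ?r = "\<lambda>t k. tk s t k + (-1) * \<sigma> (?g t) k"
  define \<beta>2 where "\<beta>2 t = \<gamma> (?r t) (dr s t)" for t
  define \<delta> where "\<delta> v c = cat s (\<lambda>k. \<sigma> v k + \<alpha>1 c k) (\<alpha>2 c)" for v c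
  have tk_add: "tk s (\<lambda>k. u k + v k) = (\<lambda>k. tk s u k + tk s v k)" for u v :: "nat => 'a" by (auto simp: tk_def)
  have tk_scale: "tk s (\<lambda>k. e * v k) = (\<lambda>k. e * tk s v k)" for e and v :: "nat => 'a" by (auto simp: tk_def)
  have g_add: "?g (\<lambda>k. u k + v k) = (\<lambda>k. ?g u k + ?g v k)" for u v unfolding tk_add lc_add ..
  have g_scale: "?g (\<lambda>k. e * v k) = (\<lambda>k. e * ?g v k)" for e v unfolding tk_scale lc_scale ..
  have r_add: "?r (\<lambda>k. u k + v k) = (\<lambda>k. ?r u k + ?r v k)" for u v
    unfolding g_add lin_add[OF \<sigma>(1)] unfolding tk_add by (simp add: algebra_simps)
  have r_scale: "?r (\<lambda>k. e * v k) = (\<lambda>k. e * ?r v k)" for e v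
    unfolding g_scale lin_scale[OF \<sigma>(1)] unfolding tk_scale by (simp add: algebra_simps)
  have L1: "lin ?g" unfolding lin_def using g_add g_scale by blast
  have L2: "lin \<beta>2" unfolding lin_def \<beta>2_def
  proof (intro conjI allI)
    fix u v :: "nat => 'a" and e
    have "dr s (\<lambda>k. u k + v k) = (\<lambda>k. dr s u k + dr s v k)" by (auto simp: dr_def)
    then show "\<gamma> (?r (\<lambda>k. u k + v k)) (dr s (\<lambda>k. u k + v k)) = (\<lambda>k. \<gamma> (?r u) (dr s u) k + \<gamma> (?r v) (dr s v) k)"
      unfolding r_add using jl by (simp add: joint_lin_def)
    have "dr s (\<lambda>k. e * u k) = (\<lambda>k. e * dr s u k)" by (auto simp: dr_def)
    then show "\<gamma> (?r (\<lambda>k. e * u k)) (dr s (\<lambda>k. e * u k)) = (\<lambda>k. e * \<gamma> (?r u) (dr s u) k)"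
      unfolding r_scale using jl by (simp add: joint_lin_def)
  qed
  have L3: "joint_lin \<delta>" unfolding joint_lin_def \<delta>_def
    by (auto simp: lin_add[OF \<sigma>(1)] lin_add[OF lin(1)] lin_add[OF lin(2)] lin_scale[OF \<sigma>(1)]
        lin_scale[OF lin(1)] lin_scale[OF lin(2)] cat_def fun_eq_iff algebra_simps)
  have gM: "?g t \<in> M" if "t \<in> fvec D (s + a)" for t using tk_fvec[OF that] M by blast
  have rK: "?r t \<in> ?K" if t: "t \<in> fvec D (s + a)" for t
  proof -
    have "?r t = (\<lambda>k. tk s t k - \<sigma> (?g t) k)" by simp
    moreover have "(\<lambda>k. tk s t k - \<sigma> (?g t) k) \<in> fvec D s"
      using smod_diff[OF sD sm tk_fvec[OF t] \<sigma>(2)[OF gM[OF t]]] .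
    moreover have "lc s (\<lambda>k. tk s t k - \<sigma> (?g t) k) g = (\<lambda>_. 0)" unfolding lc_diff \<sigma>(3)[OF gM[OF t]] by simp
    ultimately show ?thesis by simp
  qed
  have A: "?g t \<in> M \<and> \<beta>2 t \<in> fvec D b \<and> \<delta> (?g t) (\<beta>2 t) = t" if t: "t \<in> fvec D (s + a)" for t
  proof (intro conjI)
    show "?g t \<in> M" by (rule gM[OF t])
    show "\<beta>2 t \<in> fvec D b" unfolding \<beta>2_def by (rule k(1)[OF rK[OF t] dr_fvec[OF t]])
    have "\<alpha>1 (\<beta>2 t) = ?r t" "\<alpha>2 (\<beta>2 t) = dr s t" unfolding \<beta>2_def by (rule k(2,3)[OF rK[OF t] dr_fvec[OF t]])+
    then show "\<delta> (?g t) (\<beta>2 t) = t" unfolding \<delta>_def by (simp add: cat_tk_dr)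
  qed
  have B: "\<delta> v e \<in> fvec D (s + a) \<and> ?g (\<delta> v e) = v \<and> \<beta>2 (\<delta> v e) = e" if v: "v \<in> M" and e: "e \<in> fvec D b" for v e
  proof -
    have a1: "\<alpha>1 e \<in> fvec D s" "lc s (\<alpha>1 e) g = (\<lambda>_. 0)" using c(1)[OF e] by auto
    have s1: "(\<lambda>k. \<sigma> v k + \<alpha>1 e k) \<in> fvec D s" by (rule smod_add[OF sm \<sigma>(2)[OF v] a1(1)])
    have tkd: "tk s (\<delta> v e) = (\<lambda>k. \<sigma> v k + \<alpha>1 e k)" unfolding \<delta>_def by (rule tk_cat[OF s1])
    have gd: "?g (\<delta> v e) = v" unfolding tkd lc_add \<sigma>(3)[OF v] a1(2) by simp
    have "?r (\<delta> v e) = \<alpha>1 e" unfolding gd unfolding tkd by simp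
    moreover have "dr s (\<delta> v e) = \<alpha>2 e" unfolding \<delta>_def by (rule dr_cat)
    ultimately have "\<beta>2 (\<delta> v e) = e" unfolding \<beta>2_def using c(3)[OF e] by simp
    moreover have "\<delta> v e \<in> fvec D (s + a)" unfolding \<delta>_def by (rule cat_fvec[OF s1 c(2)[OF e]])
    ultimately show ?thesis using gd by blast
  qed
  show ?thesis unfolding stably_free_def
    by (rule exI[of _ b], rule exI[of _ "s + a"], rule exI[of _ ?g], rule exI[of _ \<beta>2], rule exI[of _ \<delta>])
      (use L1 L2 L3 A B in blast)
qed

text \<open>The \<open>u l\<close> express that \<open>Q\<close> is invertible and so give a section
  of the first differential. Sections propagate up the resolution, and stable freeness comes back
  down from its zero end.\<close>

lemma resolution_stably_free:
  assumes sD: "subring D" and res: "is_res D rs B Q" and fin: "\<And>i. d < i ==> rs (Suc i) = 0" and Q: "ideal_in D Q"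
    and u: "\<And>l q. l < rs 1 ==> q \<in> Q ==> q * u l \<in> D" "(\<Sum>l<rs 1. u l * B 1 l 0) = 1"
  shows "stably_free D (fvec Q 1)"
proof -
  note R = is_resD[OF res] and comp = res_D_comp[OF sD res] and iD = ideal_ring[OF sD] and sm = fvec_ring_smod[OF sD]
  \<comment> \<open>The syzygy modules, beginning with \<open>Q\<close> itself as a module of
    vectors of length one.\<close>
  define Kn where "Kn i = (case i of 0 => fvec Q 1 | Suc j => {u \<in> fvec D (rs (Suc j)). bd rs B (Suc j) u = (\<lambda>_. 0)})" for i
  have K0: "Kn 0 = fvec Q 1" and KS: "Kn (Suc i) = {u \<in> fvec D (rs (Suc i)). bd rs B (Suc i) u = (\<lambda>_. 0)}" for i
    by (simp_all add: Kn_def)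
  have KD: "Kn i \<subseteq> fvec D (rs i)" for i
    using fvec_mono[OF ideal_subset[OF Q]] R(1) by (cases i) (auto simp: K0 KS)
  have Kim: "Kn i = {bd rs B (Suc i) c | c. c \<in> fvec D (rs (Suc i))}" for i
  proof (cases i)
    case 0
    have "fvec Q 1 = {bd rs B 1 c | c. c \<in> fvec D (rs 1)}"
    proof (intro equalityI subsetI)
      fix v assume v: "v \<in> fvec Q 1"
      then have "v 0 \<in> Q" by (auto simp: fvec_def)
      then obtain c where c: "c \<in> fvec D (rs 1)" "v 0 = bd rs B 1 c 0" using R(5) by blast
      have "bd rs B 1 c \<in> fvec D (rs 0)" using res_D_fvec[OF sD res iD, of c 0] c by simp
      then have "v k = bd rs B 1 c k" for k using v c R(1) by (cases k) (auto simp: fvec_def)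
      then show "v \<in> {bd rs B 1 c | c. c \<in> fvec D (rs 1)}" using c by blast
    next
      fix v assume "v \<in> {bd rs B 1 c | c. c \<in> fvec D (rs 1)}"
      then obtain c where c: "c \<in> fvec D (rs 1)" "v = bd rs B 1 c" by blast
      have "bd rs B 1 c \<in> fvec D (rs 0)" using res_D_fvec[OF sD res iD, of c 0] c by simp
      moreover have "v 0 \<in> Q" using c R(5) by blast
      ultimately show "v \<in> fvec Q 1" using c R(1) by (auto simp: fvec_def)
    qed
    then show ?thesis using 0 K0 by simp
  next
    case (Suc j)
    show ?thesis unfolding Suc KS
      using R(4)[of _ j] comp[of _ j] res_D_fvec[OF sD res iD, of _ "Suc j"] by blast
  qed
  have BK: "B (Suc i) l \<in> Kn i" if "l < rs (Suc i)" for i l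
    unfolding Kim using lc_un[of "un l" D] un_fvec[OF sD that] lc_unit[OF that, of "B (Suc i)"]
    by (intro CollectI exI[of _ "un l"]) (auto simp: un_def)
  have sec: "\<exists>\<sigma>. lin \<sigma> \<and> (\<forall>v\<in>Kn i. \<sigma> v \<in> fvec D (rs (Suc i)) \<and> bd rs B (Suc i) (\<sigma> v) = v)" for i
  proof (induction i)
    case 0
    let ?\<sigma> = "\<lambda>v k. v 0 * (if k < rs 1 then u k else 0)"
    have "?\<sigma> v \<in> fvec D (rs 1) \<and> bd rs B 1 (?\<sigma> v) = v" if v: "v \<in> fvec Q 1" for v
    proof
      show "?\<sigma> v \<in> fvec D (rs 1)" using v u(1) by (auto simp: fvec_def)
      show "bd rs B 1 (?\<sigma> v) = v"
      proof
        fix k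
        show "bd rs B 1 (?\<sigma> v) k = v k"
        proof (cases k)
          case 0
          have "bd rs B 1 (?\<sigma> v) 0 = v 0 * (\<Sum>l<rs 1. u l * B 1 l 0)"
            by (simp add: lc_def sum_distrib_left mult.assoc)
          then show ?thesis using 0 u(2) by simp
        next
          case (Suc j)
          have "B 1 l k = 0" if "l < rs 1" for l using R(2)[of l 0] that Suc R(1) by (auto simp: fvec_def)
          then show ?thesis using v Suc by (auto simp: lc_def fvec_def)
        qed
      qed
    qed
    moreover have "lin ?\<sigma>" by (auto simp: lin_def algebra_simps)
    ultimately show ?case unfolding K0 by (intro exI[of _ ?\<sigma>]) auto
  next
    case (Suc i)
    then obtain \<sigma> where \<sigma>: "lin \<sigma>" "\<And>v. v \<in> Kn i ==> \<sigma> v \<in> fvec D (rs (Suc i))"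
      "\<And>v. v \<in> Kn i ==> bd rs B (Suc i) (\<sigma> v) = v" by blast
    \<comment> \<open>The identity minus \<open>\<sigma>\<close> after the differential projects
      onto the next syzygy module; lifting its values on the basis vectors gives the next
      section.\<close>
    let ?\<pi> = "\<lambda>l k. un l k - \<sigma> (B (Suc i) l) k"
    have "\<exists>h. l < rs (Suc i) --> h \<in> fvec D (rs (Suc (Suc i))) \<and> ?\<pi> l = bd rs B (Suc (Suc i)) h" for l
    proof (cases "l < rs (Suc i)")
      case True
      have "?\<pi> l \<in> fvec D (rs (Suc i))" by (rule smod_diff[OF sD sm un_fvec[OF sD True] \<sigma>(2)[OF BK[OF True]]])
      moreover have "bd rs B (Suc i) (?\<pi> l) = (\<lambda>_. 0)"
        unfolding lc_diff \<sigma>(3)[OF BK[OF True]] using lc_unit[OF True, of "B (Suc i)"] by (simp add: un_def)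
      ultimately show ?thesis using R(4)[of "?\<pi> l" i] by blast
    qed auto
    then obtain h where h: "\<And>l. l < rs (Suc i) ==> h l \<in> fvec D (rs (Suc (Suc i)))"
      "\<And>l. l < rs (Suc i) ==> ?\<pi> l = bd rs B (Suc (Suc i)) (h l)" by metis
    let ?\<tau> = "\<lambda>v. lc (rs (Suc i)) v h"
    have "?\<tau> v \<in> fvec D (rs (Suc (Suc i))) \<and> bd rs B (Suc (Suc i)) (?\<tau> v) = v" if v: "v \<in> Kn (Suc i)" for v
    proof
      have vD: "v \<in> fvec D (rs (Suc i))" "bd rs B (Suc i) v = (\<lambda>_. 0)" using v unfolding KS by auto
      show "?\<tau> v \<in> fvec D (rs (Suc (Suc i)))" by (rule lc_fvec[OF sD iD vD(1) h(1)])
      have "bd rs B (Suc (Suc i)) (?\<tau> v) =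
          lc (rs (Suc i)) v (\<lambda>l. bd rs B (Suc (Suc i)) (h l))" by (rule lc_lc)
      also have "\<dots> = lc (rs (Suc i)) v ?\<pi>"
        unfolding lc_def[of "rs (Suc i)"] by (intro ext sum.cong refl) (simp add: h(2)[symmetric])
      also have "\<dots> = (\<lambda>k. lc (rs (Suc i)) v un k - lc (rs (Suc i)) v (\<lambda>l. \<sigma> (B (Suc i) l)) k)"
        by (auto simp: lc_def right_diff_distrib sum_subtractf)
      also have "\<dots> = v" unfolding lc_un[OF vD(1)] lin_lc[OF \<sigma>(1), symmetric] vD(2) lin_zero[OF \<sigma>(1)] by simp
      finally show "bd rs B (Suc (Suc i)) (?\<tau> v) = v" .
    qed
    moreover have "lin ?\<tau>" by (auto simp: lin_def lc_add lc_scale)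
    ultimately show ?case by blast
  qed
  have "stably_free D (Kn i)" if "i \<le> Suc (Suc d)" for i
    using that
  proof (induction "Suc (Suc d) - i" arbitrary: i)
    case 0
    then have i: "i = Suc (Suc d)" by simp
    have "Kn i = {\<lambda>_. 0}" using fin[of "Suc d"] unfolding i KS by (auto simp: fvec_def lc_def)
    then show ?case using stably_free_zero[OF sD] by simp
  next
    case (Suc n)
    then have "stably_free D (Kn (Suc i))" by simp
    moreover obtain \<sigma> where "lin \<sigma>" "\<And>v. v \<in> Kn i ==> \<sigma> v \<in> fvec D (rs (Suc i))"
      "\<And>v. v \<in> Kn i ==> bd rs B (Suc i) (\<sigma> v) = v" using sec[of i] by blast
    ultimately show ?case using stably_free_step[OF sD Kim[of i], of \<sigma>] unfolding KS by blast
  qed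
  from this[of 0] show ?thesis unfolding K0 by simp
qed

section \<open>Determinants and generators of rank one modules\<close>

text \<open>\<open>J\<close> may be a fractional ideal. In the expansion over permutations each term
  has exactly one factor from the first row.\<close>

lemma det_first_row_mem:
  assumes sD: "subring D" and J: "0 \<in> J" "\<And>x y. x \<in> J ==> y \<in> J ==> x + y \<in> J" "\<And>c x. c \<in> D ==> x \<in> J ==> c * x \<in> J"
    and X: "X \<in> carrier_mat (Suc n) (Suc n)" "\<And>j. j < Suc n ==> X $$ (0, j) \<in> J"
      "\<And>i j. 0 < i ==> i < Suc n ==> j < Suc n ==> X $$ (i, j) \<in> D"
  shows "det X \<in> J"
proof -
  have sumJ: "sum f S \<in> J" if "\<And>s. s \<in> S ==> f s \<in> J" for f and S :: "(nat => nat) set"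
    using that J by (induction S rule: infinite_finite_induct) auto
  have "signof p * (\<Prod>i = 0..<Suc n. X $$ (i, p i)) \<in> J" if p: "p permutes {0..<Suc n}" for p
  proof -
    have pi: "p i < Suc n" if "i < Suc n" for i using permutes_in_image[OF p, of i] that by auto
    have "{0..<Suc n} = insert 0 {1..<Suc n}" by auto
    then have "(\<Prod>i = 0..<Suc n. X $$ (i, p i)) = X $$ (0, p 0) * (\<Prod>i = 1..<Suc n. X $$ (i, p i))" by simp
    then have "signof p * (\<Prod>i = 0..<Suc n. X $$ (i, p i)) = (signof p * (\<Prod>i = 1..<Suc n. X $$ (i, p i))) * X $$ (0, p 0)" by simp
    moreover have "signof p * (\<Prod>i = 1..<Suc n. X $$ (i, p i)) \<in> D"
      using X(3) pi sD by (intro subring_mult subring_prod) (auto simp: sign_def subring_closed)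
    ultimately show ?thesis using J(3)[OF _ X(2)[OF pi[of 0]]] by (metis zero_less_Suc)
  qed
  then show ?thesis unfolding det_def'[OF X(1)] by (intro sumJ) auto
qed

text \<open>Padding with zeros makes both matrices square, so the product in the other order is the
  identity as well; yet its entry at \<open>(m, m)\<close> is zero.\<close>

lemma no_left_inverse_rectangular:
  fixes X Y :: "'a::field mat"
  assumes "X \<in> carrier_mat n m" "Y \<in> carrier_mat m n" "m < n" "X * Y = 1\<^sub>m n"
  shows False
proof -
  let ?X = "mat n n (\<lambda>(i, j). if j < m then X $$ (i, j) else 0)"
  let ?Y = "mat n n (\<lambda>(i, j). if i < m then Y $$ (i, j) else 0)"
  have "?X * ?Y = 1\<^sub>m n"
  proof (rule eq_matI)
    fix i j assume ij: "i < dim_row (1\<^sub>m n)" "j < dim_col (1\<^sub>m n)"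
    have "(?X * ?Y) $$ (i, j) = (\<Sum>k = 0..<n. (if k < m then X $$ (i, k) * Y $$ (k, j) else 0))"
      using ij by (auto simp: scalar_prod_def intro!: sum.cong)
    also have "\<dots> = (\<Sum>k = 0..<m. X $$ (i, k) * Y $$ (k, j))"
      using assms(3) by (intro sum.mono_neutral_cong_right) auto
    also have "\<dots> = (X * Y) $$ (i, j)" using ij assms(1,2) by (auto simp: scalar_prod_def)
    finally show "(?X * ?Y) $$ (i, j) = 1\<^sub>m n $$ (i, j)" using assms(4) by simp
  qed auto
  then have "?Y * ?X = 1\<^sub>m n" 
    by (rule mat_mult_left_right_inverse[rotated 2]) simp_all
  then have "(?Y * ?X) $$ (m, m) = 1" using assms(3) by simp
  moreover have "(?Y * ?X) $$ (m, m) = 0" using assms(3) by (auto simp: scalar_prod_def)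
  ultimately show False by simp
qed

text \<open>The isomorphism and its inverse become matrices over the field, which forces
  \<open>b = Suc a\<close>. The determinant of \<open>\<Phi>\<close> lies in \<open>Q\<close>
  because its first row does, that of \<open>\<Psi>\<close> multiplies \<open>Q\<close> into
  \<open>D\<close>, and their product is one; so the first generates \<open>Q\<close>.\<close>

lemma stably_free_ideal_principal:
  assumes sD: "subring D" and Q: "ideal_in D Q" "q \<in> Q" "q \<noteq> 0" and sf: "stably_free D (fvec Q 1)"
  shows "\<exists>\<delta>\<in>Q. Q = pid D \<delta>"
proof -
  obtain a b \<alpha>1 \<alpha>2 \<gamma> where lin: "lin \<alpha>1" "lin \<alpha>2" and jl: "joint_lin \<gamma>"
    and c: "\<And>c. c \<in> fvec D b ==> \<alpha>1 c \<in> fvec Q 1" "\<And>c. c \<in> fvec D b ==> \<alpha>2 c \<in> fvec D a"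
      "\<And>c. c \<in> fvec D b ==> \<gamma> (\<alpha>1 c) (\<alpha>2 c) = c"
    and k: "\<And>v w. v \<in> fvec Q 1 ==> w \<in> fvec D a ==> \<gamma> v w \<in> fvec D b"
      "\<And>v w. v \<in> fvec Q 1 ==> w \<in> fvec D a ==> \<alpha>1 (\<gamma> v w) = v"
      "\<And>v w. v \<in> fvec Q 1 ==> w \<in> fvec D a ==> \<alpha>2 (\<gamma> v w) = w"
    using sf unfolding stably_free_def by blast
  let ?z = "\<lambda>_::nat. 0::'a"
  note smA = fvec_ring_smod[OF sD] and smQ = fvec_smod[OF sD Q(1)]
  have z: "?z \<in> fvec D n" "?z \<in> fvec Q n" for n using smod_zero[OF smA] smod_zero[OF smQ] by auto
  have l1: "lin (\<lambda>v. \<gamma> v ?z)" and l2: "lin (\<lambda>w. \<gamma> ?z w)"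
    unfolding lin_def
    using jl[unfolded joint_lin_def, THEN conjunct1, rule_format, of _ _ ?z ?z]
      jl[unfolded joint_lin_def, THEN conjunct2, rule_format, of _ _ ?z]
      jl[unfolded joint_lin_def, THEN conjunct1, rule_format, of ?z ?z]
      jl[unfolded joint_lin_def, THEN conjunct2, rule_format, of _ ?z] by auto
  \<comment> \<open>The vector \<open>un 0\<close> need not have its entry in \<open>Q\<close>, so
    \<open>c0\<close> may have entries outside \<open>D\<close>. Facts about it are obtained by
    scaling with an element of \<open>Q\<close> and dividing again in the field.\<close>
  define c0 where "c0 = \<gamma> (un 0) ?z"
  define cj where "cj j = \<gamma> ?z (un j)" for j
  have \<gamma>_exp: "\<gamma> v w i = v 0 * c0 i + (\<Sum>k<a. w k * cj k i)" if "v \<in> fvec Q 1" "w \<in> fvec D a" for v w i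
  proof -
    have "\<gamma> v w = (\<lambda>k. \<gamma> v ?z k + \<gamma> ?z w k)"
      using jl[unfolded joint_lin_def, THEN conjunct1, rule_format, of v ?z ?z w] by simp
    moreover have "v = (\<lambda>k. v 0 * un 0 k)" using that(1) by (auto simp: un_def fvec_def fun_eq_iff)
    then have "\<gamma> v ?z = (\<lambda>k. v 0 * c0 k)" unfolding c0_def using lin_scale[OF l1, of "v 0" "un 0"] by simp
    moreover have "\<gamma> ?z w = lc a w cj" unfolding cj_def using lin_lc[OF l2, of a w un] lc_un[OF that(2)] by simp
    ultimately show ?thesis by (simp add: lc_def)
  qed
  have qc0: "(\<lambda>k. r * c0 k) \<in> fvec D b" "\<alpha>1 (\<lambda>k. r * c0 k) = (\<lambda>k. r * un 0 k)" "\<alpha>2 (\<lambda>k. r * c0 k) = ?z" if r: "r \<in> Q" for r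
  proof -
    have e: "\<gamma> (\<lambda>k. r * un 0 k) ?z = (\<lambda>k. r * c0 k)" unfolding c0_def using lin_scale[OF l1, of r "un 0"] .
    have "(\<lambda>k. r * un 0 k) \<in> fvec Q 1" using r ideal_zero[OF Q(1)] by (auto simp: fvec_def un_def)
    from k[OF this z(1)] show "(\<lambda>k. r * c0 k) \<in> fvec D b" "\<alpha>1 (\<lambda>k. r * c0 k) = (\<lambda>k. r * un 0 k)" "\<alpha>2 (\<lambda>k. r * c0 k) = ?z"
      unfolding e by auto
  qed
  have c0f: "c0 \<in> fvec UNIV b" using qc0(1)[OF Q(2)] Q(3) by (auto simp: fvec_def)
  have c0a: "\<alpha>1 c0 = un 0" "\<alpha>2 c0 = ?z"
    using qc0(2,3)[OF Q(2)] Q(3) unfolding lin_scale[OF lin(1)] lin_scale[OF lin(2)] by (auto simp: fun_eq_iff)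
  have cjf: "cj j \<in> fvec D b" "\<alpha>1 (cj j) = ?z" "\<alpha>2 (cj j) = un j" if "j < a" for j
    unfolding cj_def using k[OF z(2) un_fvec[OF sD that]] by auto
  define \<Phi> where "\<Phi> = mat (Suc a) b (\<lambda>(i, j). if i = 0 then \<alpha>1 (un j) 0 else \<alpha>2 (un j) (i - 1))"
  define \<Psi> where "\<Psi> = mat b (Suc a) (\<lambda>(i, j). if j = 0 then c0 i else cj (j - 1) i)"
  have car: "\<Phi> \<in> carrier_mat (Suc a) b" "\<Psi> \<in> carrier_mat b (Suc a)" by (auto simp: \<Phi>_def \<Psi>_def)
  have P1: "\<Psi> * \<Phi> = 1\<^sub>m b"
  proof (rule eq_matI)
    fix i j assume ij: "i < dim_row (1\<^sub>m b)" "j < dim_col (1\<^sub>m b)"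
    then have uj: "un j \<in> fvec D b" using un_fvec[OF sD] by simp
    have "(\<Psi> * \<Phi>) $$ (i, j) = (\<Sum>k = 0..<Suc a. \<Psi> $$ (i, k) * \<Phi> $$ (k, j))"
      using ij car by (simp add: scalar_prod_def)
    also have "\<dots> = c0 i * \<alpha>1 (un j) 0 + (\<Sum>k<a. cj k i * \<alpha>2 (un j) k)"
      using ij unfolding atLeast0LessThan by (subst sum.lessThan_Suc_shift) (auto simp: \<Phi>_def \<Psi>_def)
    also have "\<dots> = \<gamma> (\<alpha>1 (un j)) (\<alpha>2 (un j)) i" using \<gamma>_exp[OF c(1,2)[OF uj]] by (simp add: mult.commute)
    also have "\<dots> = un j i" using c(3)[OF uj] by simp
    finally show "(\<Psi> * \<Phi>) $$ (i, j) = 1\<^sub>m b $$ (i, j)" using ij by (auto simp: un_def)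
  qed (use car in auto)
  have P2: "\<Phi> * \<Psi> = 1\<^sub>m (Suc a)"
  proof (rule eq_matI)
    fix i j assume ij: "i < dim_row (1\<^sub>m (Suc a))" "j < dim_col (1\<^sub>m (Suc a))"
    define v where "v = (if j = 0 then c0 else cj (j - 1))"
    have v: "v \<in> fvec UNIV b" "\<alpha>1 v 0 = (if j = 0 then 1 else 0)" "\<alpha>2 v l = (if j = Suc l then 1 else 0)" for l
      using c0f c0a cjf[of "j - 1"] fvec_mono[OF subset_UNIV, of D b] ij by (auto simp: v_def un_def)
    have "(\<Phi> * \<Psi>) $$ (i, j) = (\<Sum>k<b. \<Phi> $$ (i, k) * v k)"
      using ij car by (auto simp: scalar_prod_def \<Psi>_def v_def atLeast0LessThan intro!: sum.cong)
    also have "\<dots> = (if i = 0 then lc b v (\<lambda>k. \<alpha>1 (un k)) 0 else lc b v (\<lambda>k. \<alpha>2 (un k)) (i - 1))"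
      using ij by (auto simp: lc_def \<Phi>_def mult.commute)
    also have "\<dots> = (if i = 0 then \<alpha>1 v 0 else \<alpha>2 v (i - 1))"
      unfolding lin_lc[OF lin(1), symmetric] lin_lc[OF lin(2), symmetric] lc_un[OF v(1)] ..
    finally show "(\<Phi> * \<Psi>) $$ (i, j) = 1\<^sub>m (Suc a) $$ (i, j)" using ij v(2,3) by auto
  qed (use car in auto)
  have "\<not> Suc a < b" using no_left_inverse_rectangular[OF car(2,1)] P1 by blast
  moreover have "\<not> b < Suc a" using no_left_inverse_rectangular[OF car] P2 by blast
  ultimately have b: "b = Suc a" by simp
  note car' = car[unfolded b]
  have un0: "un j \<in> fvec D b" if "j < Suc a" for j using un_fvec[OF sD] that b by simp
  have d1: "det \<Phi> \<in> Q"
  proof (rule det_first_row_mem[OF sD _ _ _ car'(1)])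
    show "\<Phi> $$ (0, j) \<in> Q" if "j < Suc a" for j
      using c(1)[OF un0[OF that]] that b by (auto simp: \<Phi>_def fvec_def)
    show "\<Phi> $$ (i, j) \<in> D" if "0 < i" "i < Suc a" "j < Suc a" for i j
      using c(2)[OF un0[OF that(3)]] that b by (auto simp: \<Phi>_def fvec_def)
  qed (use ideal_zero[OF Q(1)] ideal_add[OF Q(1)] ideal_mult[OF Q(1)] in auto)
  have d2: "det \<Psi> * r \<in> D" if r: "r \<in> Q" for r
  proof -
    have "det (transpose_mat \<Psi>) \<in> {x. x * r \<in> D}"
    proof (rule det_first_row_mem[OF sD])
      show "transpose_mat \<Psi> \<in> carrier_mat (Suc a) (Suc a)" using car' by simp
      show "transpose_mat \<Psi> $$ (0, j) \<in> {x. x * r \<in> D}" if "j < Suc a" for j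
        using qc0(1)[OF r] that b by (auto simp: \<Psi>_def fvec_def mult.commute)
      show "transpose_mat \<Psi> $$ (i, j) \<in> D" if "0 < i" "i < Suc a" "j < Suc a" for i j
        using cjf(1)[of "i - 1"] that b by (auto simp: \<Psi>_def fvec_def)
    qed (use sD in \<open>auto simp: subring_closed distrib_right mult.assoc\<close>)
    then show ?thesis using det_transpose[OF car'(2)] by simp
  qed
  have "det \<Phi> * det \<Psi> = 1" using det_mult[OF car'] P2 b by simp
  then have e: "r = (det \<Psi> * r) * det \<Phi>" for r by (metis mult.assoc mult.commute mult.right_neutral)
  have "Q \<subseteq> pid D (det \<Phi>)"
  proof
    fix r assume "r \<in> Q"
    from pid_memI(1)[OF d2[OF this], of "det \<Phi>"] show "r \<in> pid D (det \<Phi>)" using e[of r] by simp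
  qed
  moreover have "pid D (det \<Phi>) \<subseteq> Q" by (rule pid_least[OF Q(1) d1])
  ultimately show ?thesis using d1 by blast
qed

section \<open>Regular local rings are factorial\<close>

text \<open>A chain of primes of the localization contracts to a chain inside \<open>p\<close>, and
  \<open>m\<close> fits on top.\<close>

lemma regsys_loc_dim_less:
  assumes y: "regsys A m y d" and p: "prime_in A p" "p \<noteq> m" and z: "regsys (loc_at A p) (mloc A p) z e"
  shows "e < d"
proof (rule ccontr)
  assume "\<not> e < d"
  note R = regsysD[OF y]
  note U = prime_compl_mult[OF R(7) p(1)]
  obtain P where P: "pchain (loc_mult A (A - p)) {0} e P" using regsysD(6)[OF z] by (auto simp: loc_at_eq)
  note ch = pchainD[OF P]
  let ?P = "\<lambda>i. if i \<le> e then P i \<inter> A else m"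
  have "pchain A {0} (Suc e) ?P"
    unfolding pchain_def
  proof (intro conjI allI impI)
    show "prime_in A (?P i)" for i
      using contr_prime(1)[OF R(7) U ch(1)] local_prime[OF R(2)] by auto
    show "{0} \<subseteq> ?P 0" using ch(3) R(7) by (auto simp: subring_zero)
    fix i assume i: "i < Suc e"
    show "?P i \<subset> ?P (Suc i)"
    proof (cases "i < e")
      case True
      have "P i \<inter> A \<noteq> P (Suc i) \<inter> A"
      proof
        assume eq: "P i \<inter> A = P (Suc i) \<inter> A"
        have "loc_mult (P i \<inter> A) (A - p) = P i" "loc_mult (P (Suc i) \<inter> A) (A - p) = P (Suc i)"
          using loc_contr[OF R(7) U prime_ideal[OF ch(1)]] True by simp_all
        then have "P i = P (Suc i)" unfolding eq by simp
        then show False using ch(2)[OF True] by simp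
      qed
      then show ?thesis using ch(2)[OF True] True by auto
    next
      case False
      then have "i = e" using i by simp
      moreover have "P e \<inter> A \<subseteq> p" using contr_prime(2)[OF R(7) U ch(1)[of e]] by auto
      moreover have "p \<subset> m" using local_max[OF R(2) p(1)] p(2) by blast
      ultimately show ?thesis by auto
    qed
  qed
  then have "pchain A {0} (Suc d) ?P" by (rule pchain_le) (use \<open>\<not> e < d\<close> in simp)
  then show False using krull_height[OF R(1,2), of "{0}" y d] R(3,5) by blast
qed

text \<open>Induction on the dimension, following Auslander, Buchsbaum and Kaplansky. Let
  \<open>?Q\<close> be an associated prime of \<open>f\<close>. If it misses the parameter
  \<open>?x\<close>, invert \<open>?x\<close>: the extended ideal is locally principal, because
  localizations at primes missing \<open>?x\<close> have smaller dimension, and it has a finite free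
  resolution. It is therefore stably free, hence principal, and its generator can be brought back to
  \<open>A\<close> as \<open>?x\<close> is prime.\<close>

theorem regular_local_factorial:
  assumes "regsys A m y d" "irreducible_in A f" shows "pel A f"
  using assms
proof (induction d arbitrary: A m y f rule: less_induct)
  case (less d)
  note y = less.prems(1) and f = less.prems(2)
  note R = regsysD[OF y] and F = irreducibleD[OF less.prems(2)]
  note sA = R(7)
  have pos: "0 < d"
  proof (rule ccontr)
    assume "\<not> 0 < d"
    then have "m = {0}" using R(5) by simp
    then have "unit_in A f" using local_unit[OF R(2) F(1)] F(1,2) by (simp add: unit_in_def)
    then show False using F(3) by simp
  qed
  let ?x = "y 0"
  have xm: "?x \<in> m" and xA: "?x \<in> A" using R(3,4) pos by auto
  have x0: "?x \<noteq> 0" using regsys_notin[OF y pos] by simp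
  have x: "pel A ?x" using regsys_prime[OF y, of 1] pos xA x0 by (simp add: pel_def pid_adj)
  have I: "ideal_in A (pid A f)" by (rule pid_ideal[OF sA F(1)])
  have "1 \<notin> pid A f" using one_in_pid_iff[OF F(1,2)] F(3) by simp
  then obtain c where c: "c \<in> A" "c \<notin> pid A f" "prime_in A (colon A (pid A f) c)"
    using assoc_prime_exists[OF R(1) I subring_one[OF sA]] by metis
  let ?Q = "colon A (pid A f) c"
  have iQ: "ideal_in A ?Q" by (rule prime_ideal[OF c(3)])
  have fQ: "f \<in> ?Q" using colon_sub[OF I c(1)] pid_mem[OF sA, of f] by auto
  show ?case
  proof (cases "?x \<in> ?Q")
    case True
    \<comment> \<open>In \<open>?x * c = h * f\<close> the prime \<open>?x\<close> cannot divide
      \<open>h\<close>, or \<open>f\<close> would divide \<open>c\<close>; so it divides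
      \<open>f\<close>.\<close>
    then obtain h where h: "h \<in> A" "?x * c = h * f" by (auto simp: colon_def pid_def)
    have "h * f \<in> pid A ?x" unfolding h(2)[symmetric] using c(1) by (rule pid_memI)
    moreover have "h \<notin> pid A ?x"
    proof
      assume "h \<in> pid A ?x"
      then obtain k where "k \<in> A" "h = k * ?x" by (rule pid_memE)
      then have "c = k * f" using h(2) x0 by simp
      then show False using c(2) \<open>k \<in> A\<close> by (auto simp: pid_def)
    qed
    ultimately have "f \<in> pid A ?x" using prime_mult[OF pelD(3)[OF x] h(1) F(1)] by blast
    then show ?thesis using principal_colon_prime_irreducible[OF sA f pelD(3)[OF x] _ xA] by blast
  next
    case False
    define U where "U = range (\<lambda>k::nat. ?x ^ k)"
    have U: "mult_closed_in A U"
      unfolding mult_closed_in_def U_def using xA x0 sA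
      by (auto simp: subring_closed power_add[symmetric] intro: range_eqI[of _ _ 0])
    note LU = loc_U[OF sA U] and inc = loc_incl[OF sA U, of A]
    have QU: "?Q \<inter> U = {}" using False prime_power[OF sA c(3) xA] by (auto simp: U_def)
    let ?D = "loc_mult A U" and ?Q' = "loc_mult ?Q U"
    have sD: "subring ?D" by (rule loc_subring[OF sA U])
    have nD: "noetherian ?D" by (rule loc_noeth[OF sA U R(1)])
    have iQ': "ideal_in ?D ?Q'" by (rule loc_ideal[OF sA U iQ])
    obtain rs B where F0: "is_res A rs B ?Q" "\<And>i. d < i ==> rs (Suc i) = 0"
      using finite_free_resolution[OF y iQ] by blast
    note res = loc_resolution[OF sA U F0(1)]
    let ?w = "\<lambda>l. B 1 l 0"
    \<comment> \<open>\<open>?H\<close> is the inverse fractional ideal of \<open>?Q'\<close> and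
      \<open>?I\<close> the product of the two, written with the finite generators \<open>?w\<close>
      of \<open>?Q'\<close>.\<close>
    let ?H = "{h. \<forall>z\<in>?Q'. z * h \<in> ?D}"
    let ?I = "{t. \<exists>u. (\<forall>l<rs 1. u l \<in> ?H) \<and> t = (\<Sum>l<rs 1. u l * ?w l)}"
    have wQ: "?w l \<in> ?Q'" if "l < rs 1" for l
      using is_resD(5)[OF res] un_fvec[OF sD that] lc_unit[OF that, of "B 1"] unfolding un_def by auto
    have Hadd: "h + k \<in> ?H" if "h \<in> ?H" "k \<in> ?H" for h k
      using that sD by (auto simp: distrib_left subring_add)
    have Hmul: "e * h \<in> ?H" if "e \<in> ?D" "h \<in> ?H" for e h
      using that(2) subring_mult[OF sD that(1)] by (auto simp: mult.left_commute[of _ e])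
    have H0: "0 \<in> ?H" using sD by (auto simp: subring_zero)
    have iI: "ideal_in ?D ?I"
      unfolding ideal_in_def
    proof (intro conjI ballI subsetI)
      show "0 \<in> ?I" using H0 by (intro CollectI exI[of _ "\<lambda>_. 0"]) auto
      fix t assume "t \<in> ?I"
      then obtain u where u: "\<forall>l<rs 1. u l \<in> ?H" "t = (\<Sum>l<rs 1. u l * ?w l)" by blast
      show "t \<in> ?D" unfolding u(2)
      proof (rule subring_sum[OF sD])
        fix l assume "l \<in> {..<rs 1}"
        then have "?w l * u l \<in> ?D" using u(1) wQ by blast
        then show "u l * ?w l \<in> ?D" by (simp add: mult.commute)
      qed
      { fix t' assume "t' \<in> ?I"
        then obtain u' where u': "\<forall>l<rs 1. u' l \<in> ?H" "t' = (\<Sum>l<rs 1. u' l * ?w l)" by blast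
        show "t + t' \<in> ?I"
          using u u' Hadd by (intro CollectI exI[of _ "\<lambda>l. u l + u' l"]) (simp add: sum.distrib distrib_right) }
      fix r assume r: "r \<in> ?D"
      show "r * t \<in> ?I"
        using u Hmul[OF r] by (intro CollectI exI[of _ "\<lambda>l. r * u l"]) (simp add: sum_distrib_left mult.assoc)
    qed
    have QH: "q * h \<in> ?I" if "q \<in> ?Q'" "h \<in> ?H" for q h
    proof -
      from that(1) obtain e where e: "e \<in> fvec ?D (rs 1)" "q = bd rs B 1 e 0" using is_resD(5)[OF res] by blast
      then have "\<forall>l<rs 1. e l * h \<in> ?H" using Hmul that(2) by (auto simp: fvec_def)
      then show ?thesis unfolding e(2)
        by (intro CollectI exI[of _ "\<lambda>l. e l * h"]) (simp add: lc_def sum_distrib_right sum_distrib_left mult_ac)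
    qed
    \<comment> \<open>If the product lay in a prime \<open>M\<close>, then at the contraction of
      \<open>M\<close> the induction hypothesis makes \<open>?Q\<close> principal, generated by some
      \<open>q0\<close>. Some \<open>s\<close> outside \<open>M\<close> multiplies \<open>?Q\<close>
      into \<open>pid A q0\<close>, so \<open>s / q0\<close> is in \<open>?H\<close> and
      \<open>s\<close> itself in the product.\<close>
    have "1 \<in> ?I"
    proof (rule ccontr)
      assume "1 \<notin> ?I"
      then obtain M where M: "prime_in ?D M" "?I \<subseteq> M" using prime_above[OF nD iI] by blast
      let ?p = "M \<inter> A"
      note p = contr_prime[OF sA U M(1)]
      have "?x \<in> U" unfolding U_def by (rule range_eqI[of _ _ 1]) simp
      then have xp: "?x \<notin> ?p" using p(2) xA by blast
      then have "?p \<noteq> m" using xm by blast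
      obtain e z where z: "regsys (loc_at A ?p) (mloc A ?p) z e" using regular_localization[OF y p(1)] by blast
      have ed: "e < d" by (rule regsys_loc_dim_less[OF y p(1) \<open>?p \<noteq> m\<close> z])
      let ?V = "A - ?p"
      note V = prime_compl_mult[OF sA p(1)]
      have pc: "colons_principal (loc_mult A ?V)"
        using colons_principal_if_irreducible_prime[OF regsysD(1)[OF z]] less.IH[OF ed z] by (simp add: loc_at_eq)
      have "f \<in> loc_mult A ?V" "c \<in> loc_mult A ?V" using F(1) c(1) loc_incl[OF sA V, of A] by auto
      then obtain g where g: "colon (loc_mult A ?V) (pid (loc_mult A ?V) f) c = pid (loc_mult A ?V) g"
        using pc F(2) unfolding colons_principal_def by blast
      have gQ: "loc_mult ?Q ?V = pid (loc_mult A ?V) g" using g loc_colon[OF sA V F(1) c(1)] by simp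
      have "g \<in> loc_mult ?Q ?V" unfolding gQ by (rule pid_mem[OF loc_subring[OF sA V]])
      then obtain q0 s0 where q0: "q0 \<in> ?Q" "s0 \<in> ?V" "g = q0 / s0" by (rule loc_memE)
      have gQ': "loc_mult ?Q ?V = pid (loc_mult A ?V) q0" using gQ pid_frac[OF sA V q0(2)] q0(3) by simp
      have q0n: "q0 \<noteq> 0"
      proof
        assume "q0 = 0"
        then have "f \<in> {0}" using fQ gQ' loc_incl[OF sA V, of ?Q] by (auto simp: pid_def)
        then show False using F(2) by simp
      qed
      obtain r w where w: "\<And>i. i < r ==> w i \<in> ?Q" "?Q = igen A w r" using noeth_fg[OF R(1) iQ] by blast
      have "\<exists>b. i < r --> b \<in> loc_mult A ?V \<and> w i = b * q0" for i
      proof (cases "i < r")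
        case True
        then have "w i \<in> pid (loc_mult A ?V) q0" using w(1) gQ' loc_incl[OF sA V, of ?Q] by blast
        then show ?thesis by (auto simp: pid_def)
      qed auto
      then obtain b where b: "\<And>i. i < r ==> b i \<in> loc_mult A ?V" "\<And>i. i < r ==> w i = b i * q0" by metis
      let ?b = "\<lambda>i. if i < r then b i else 0"
      have "?b \<in> fvec (loc_mult A ?V) r" using b(1) by (simp add: fvec_def)
      then obtain s where s: "s \<in> ?V" "(\<lambda>i. s * ?b i) \<in> fvec A r" using common_denominator[OF sA V] by blast
      have q0A: "q0 \<in> A" using q0(1) by (simp add: colon_def)
      have "?Q \<subseteq> colon A (pid A q0) s" unfolding w(2)
      proof (rule gen_least)
        show ic: "ideal_in A (colon A (pid A q0) s)" using s(1) by (intro colon_ideal[OF sA pid_ideal[OF sA q0A]]) auto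
        show "{0} \<subseteq> colon A (pid A q0) s" using ideal_zero[OF ic] by simp
        fix i assume i: "i < r"
        then have "s * b i \<in> A" using s(2) by (auto simp: fvec_def)
        from pid_memI(1)[OF this, of q0] have "w i * s \<in> pid A q0" unfolding b(2)[OF i] by (simp add: mult_ac)
        then show "w i \<in> colon A (pid A q0) s" using w(1)[OF i] by (simp add: colon_def)
      qed
      have "s / q0 \<in> ?H"
      proof (intro CollectI ballI)
        fix z assume "z \<in> ?Q'"
        then obtain a t where a: "a \<in> ?Q" "t \<in> U" "z = a / t" by (rule loc_memE)
        then have "a \<in> colon A (pid A q0) s" using \<open>?Q \<subseteq> colon A (pid A q0) s\<close> by blast
        then obtain b where "b \<in> A" "a * s = b * q0" by (auto simp: colon_def pid_def)
        then show "z * (s / q0) \<in> ?D" using a q0n by (intro loc_memI[of b _ t]) (auto simp: field_simps)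
      qed
      moreover have "q0 \<in> ?Q'" using q0(1) loc_incl[OF sA U, of ?Q] by blast
      ultimately have "q0 * (s / q0) \<in> ?I" by (intro QH)
      then have "s \<in> M" using M(2) q0n by auto
      then show False using s(1) by auto
    qed
    then obtain u where u: "\<forall>l<rs 1. u l \<in> ?H" "1 = (\<Sum>l<rs 1. u l * ?w l)" by blast
    have sf: "stably_free ?D (fvec ?Q' 1)"
      by (rule resolution_stably_free[OF sD res F0(2) iQ']) (use u in auto)
    have "f \<in> ?Q'" using fQ loc_incl[OF sA U, of ?Q] by blast
    then obtain \<delta> where \<delta>: "\<delta> \<in> ?Q'" "?Q' = pid ?D \<delta>"
      using stably_free_ideal_principal[OF sD iQ' _ F(2) sf] by blast
    obtain a t where a: "a \<in> ?Q" "t \<in> U" "\<delta> = a / t" using \<delta>(1) by (rule loc_memE)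
    have Qa: "?Q' = pid ?D a" using \<delta>(2) pid_frac[OF sA U a(2)] a(3) by simp
    have aA: "a \<in> A" using a(1) by (simp add: colon_def)
    have a0: "a \<noteq> 0"
    proof
      assume "a = 0"
      then have "f = 0" using \<open>f \<in> ?Q'\<close> Qa by (auto simp: pid_def)
      then show False using F(2) by simp
    qed
    \<comment> \<open>Removing the largest power of the prime \<open>?x\<close> from
      \<open>a\<close> leaves a generator \<open>g\<close> not divisible by \<open>?x\<close>;
      powers of \<open>?x\<close> in denominators then cancel by
      \<open>pel_power_cancel\<close>.\<close>
    obtain j where j: "a \<in> pid A (?x ^ j)" "a \<notin> pid A (?x ^ Suc j)"
      using noeth_power_bound[OF R(1) xA x0 pel_nonunit[OF x] aA a0] by blast
    obtain g where g: "g \<in> A" "a = g * ?x ^ j" using j(1) by (rule pid_memE)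
    have gx: "g \<notin> pid A ?x" using j(2) g by (auto simp: pid_def mult_ac)
    have gQ: "g \<in> ?Q" using prime_mult[OF c(3) g(1) subring_power[OF sA xA, of j]] a(1) g(2) False
        prime_power[OF sA c(3) xA] by blast
    have "pid ?D a = pid ?D g"
    proof -
      have "?x ^ j \<in> U" by (simp add: U_def)
      moreover have "?x ^ j \<noteq> 0" using x0 by simp
      ultimately have "unit_in ?D (?x ^ j)" using loc_inverse[OF sA U] inc LU by (auto simp: unit_in_def)
      then show ?thesis using pid_unit[OF sD, of "?x ^ j" g] g(2) by (simp add: mult.commute)
    qed
    then have Qg: "?Q' = pid ?D g" using Qa by simp
    have "?Q \<subseteq> pid A g"
    proof
      fix z assume z: "z \<in> ?Q"
      then have "z \<in> pid ?D g" using Qg loc_incl[OF sA U, of ?Q] by blast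
      then obtain b where b: "b \<in> ?D" "z = b * g" by (rule pid_memE)
      obtain v k where v: "v \<in> A" "b = v / ?x ^ k" using b(1) by (auto simp: U_def elim!: loc_memE)
      have zA: "z \<in> A" using z by (simp add: colon_def)
      have "v * g = z * ?x ^ k" using b v x0 by simp
      then have "v * g \<in> pid A (?x ^ k)" using zA by (auto simp: pid_def)
      then have "v \<in> pid A (?x ^ k)" using pel_power_cancel[OF sA x g(1) gx v(1)] by blast
      then obtain v' where "v' \<in> A" "v = v' * ?x ^ k" by (rule pid_memE)
      then show "z \<in> pid A g" using b v x0 by (auto simp: pid_def)
    qed
    moreover have "pid A g \<subseteq> ?Q" by (rule pid_least[OF iQ gQ])
    ultimately have "?Q = pid A g" by blast
    then show ?thesis using principal_colon_prime_irreducible[OF sA f, of g] c(3) fQ g(1) by simp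
  qed
qed

lemma regsys_colons_principal: "regsys A m y d ==> colons_principal A"
  using colons_principal_if_irreducible_prime regular_local_factorial regsysD(1) by metis

lemma localization_noetherian_ufd_regular:
  assumes y: "regsys A m y d" and U: "mult_closed_in A U"
  shows "noetherian (loc_mult A U)" "\<And>p. irreducible_in (loc_mult A U) p ==> pel (loc_mult A U) p"
    "ufd (loc_mult A U)" "regular_ring (loc_mult A U)"
proof -
  note R = regsysD[OF y]
  show n: "noetherian (loc_mult A U)" by (rule loc_noeth[OF R(7) U R(1)])
  show pr: "pel (loc_mult A U) p" if "irreducible_in (loc_mult A U) p" for p
    using irreducible_prime_if_colons_principal[OF n colons_principal_loc[OF R(7) U regsys_colons_principal[OF y]] that] .
  show "ufd (loc_mult A U)" by (rule ufd_if_irreducible_prime[OF n pr])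
  show "regular_ring (loc_mult A U)"
    unfolding regular_ring_def mloc_def[symmetric]
  proof (intro conjI allI impI)
    show "subring (loc_mult A U)" by (rule loc_subring[OF R(7) U])
    fix P assume P: "prime_in (loc_mult A U) P"
    obtain e z where "regsys (loc_at A (P \<inter> A)) (mloc A (P \<inter> A)) z e"
      using regular_localization[OF y contr_prime(1)[OF R(7) U P]] by blast
    then show "regular_local (loc_at (loc_mult A U) P) (mloc (loc_mult A U) P)"
      unfolding loc_at_loc[OF R(7) U P] regular_local_def using regsys_regular_local by blast
  qed
qed

section \<open>Blowing up the maximal ideal\<close>

text \<open>An explicit form of the ring generated over \<open>A\<close> by \<open>I / x\<close>.
  The ideal is variable, so that the generators of \<open>m\<close> can be taken in one at a
  time.\<close>

definition blow :: "'a::field set => 'a set => 'a => 'a set" where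
  "blow A I x = {a / x ^ k | a k. a \<in> jpow A A I k}"

lemma blow_memI: "a \<in> jpow A A I k ==> z = a / x ^ k ==> z \<in> blow A I x"
  by (auto simp: blow_def)

lemma blow_memE:
  assumes "z \<in> blow A I x" obtains a k where "a \<in> jpow A A I k" "z = a / x ^ k"
  using assms by (auto simp: blow_def)

lemma blow_mono: "subring A ==> ideal_in A J ==> I \<subseteq> J ==> blow A I x \<subseteq> blow A J x"
  unfolding blow_def using jpow_mono[of A A J A I] ideal_ring[of A] by blast

lemma subring_of_ring: "subring A ==> A \<subseteq> blow A I x"
  by (auto intro!: blow_memI[of _ A I 0])

lemma blow_subring:
  assumes sA: "subring A" and I: "ideal_in A I" and x: "x \<in> I" "x \<noteq> 0"
  shows "subring (blow A I x)"
proof -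
  note ip = jpow_ideal[OF sA ideal_ring[OF sA] I] and xp = pow_mem_jpow[OF sA I x(1)]
  note jm = jpow_mult[OF sA ideal_ring[OF sA] I]
  have "z + w \<in> blow A I x \<and> z * w \<in> blow A I x" if "z \<in> blow A I x" "w \<in> blow A I x" for z w
  proof -
    from that obtain a k b l where a: "a \<in> jpow A A I k" "z = a / x ^ k" and b: "b \<in> jpow A A I l" "w = b / x ^ l"
      by (auto simp: blow_def)
    have "a * x ^ l \<in> jpow A A I (k + l)" "b * x ^ k \<in> jpow A A I (k + l)" "a * b \<in> jpow A A I (k + l)"
      using jm[OF a(1) xp[of l]] jm[OF b(1) xp[of k]] jm[OF a(1) b(1)] by (auto simp: add.commute)
    moreover have "z + w = (a * x ^ l + b * x ^ k) / x ^ (k + l)" "z * w = (a * b) / x ^ (k + l)"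
      unfolding a(2) b(2) using x(2) by (simp_all add: power_add field_simps)
    ultimately show ?thesis
      using blow_memI[of "a * x ^ l + b * x ^ k" A I "k + l"] blow_memI[of "a * b" A I "k + l"] ideal_add[OF ip] by blast
  qed
  moreover have "- z \<in> blow A I x" if z: "z \<in> blow A I x" for z
  proof -
    obtain a k where "a \<in> jpow A A I k" "z = a / x ^ k" using z by (rule blow_memE)
    then show ?thesis using blow_memI[of "- a" A I k "- z" x] ideal_uminus[OF sA ip] by simp
  qed
  ultimately show ?thesis using subring_of_ring[OF sA, of I x] sA unfolding subring_def by auto
qed

lemma blowup_ring_eq_blow:
  assumes sA: "subring A" and I: "ideal_in A I" and x: "x \<in> I" "x \<noteq> 0"
  shows "blowup_ring A I x = blow A I x"
  unfolding blowup_ring_def ring_gen_def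
proof
  have "{y / x |y. y \<in> I} \<subseteq> blow A I x"
    using jpow_self[OF sA I, of 0] by (auto intro!: blow_memI[where k = 1])
  then show "\<Inter> {B. subring B \<and> A \<union> {y / x |y. y \<in> I} \<subseteq> B} \<subseteq> blow A I x"
    using blow_subring[OF assms] subring_of_ring[OF sA, of I x] by blast
  show "blow A I x \<subseteq> \<Inter> {B. subring B \<and> A \<union> {y / x |y. y \<in> I} \<subseteq> B}"
  proof
    fix z assume "z \<in> blow A I x"
    then obtain a k where a: "a \<in> jpow A A I k" "z = a / x ^ k" by (rule blow_memE)
    { fix B assume B: "subring B" "A \<union> {y / x |y. y \<in> I} \<subseteq> B"
      have "jpow A A I k \<subseteq> {b \<in> A. b / x ^ k \<in> B}" for k
      proof (induction k)
        case 0 then show ?case using B by auto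
      next
        case (Suc k)
        have "ideal_in A {b \<in> A. b / x ^ Suc k \<in> B}"
          unfolding ideal_in_def
        proof (intro conjI ballI)
          fix a b assume "a \<in> {b \<in> A. b / x ^ Suc k \<in> B}" "b \<in> {b \<in> A. b / x ^ Suc k \<in> B}"
          then show "a + b \<in> {b \<in> A. b / x ^ Suc k \<in> B}"
            using subring_add[OF B(1), of "a / x ^ Suc k" "b / x ^ Suc k"] sA by (auto simp: add_divide_distrib subring_add)
        next
          fix r a assume "r \<in> A" "a \<in> {b \<in> A. b / x ^ Suc k \<in> B}"
          then show "r * a \<in> {b \<in> A. b / x ^ Suc k \<in> B}"
            using subring_mult[OF B(1), of r "a / x ^ Suc k"] sA B(2) by (auto simp: subring_mult)
        qed (use sA B in \<open>auto simp: subring_zero\<close>)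
        then show ?case unfolding jpow.simps
        proof (rule iprod_least)
          fix a b assume ab: "a \<in> jpow A A I k" "b \<in> I"
          then have "a \<in> A" "a / x ^ k \<in> B" "b \<in> A" "b / x \<in> B" using Suc B(2) ideal_sub[OF I] by auto
          then show "a * b \<in> {b \<in> A. b / x ^ Suc k \<in> B}"
            using subring_mult[OF B(1), of "a / x ^ k" "b / x"] sA by (auto simp: subring_mult mult_ac)
        qed
      qed
      then have "z \<in> B" using a by auto }
    then show "z \<in> \<Inter> {B. subring B \<and> A \<union> {y / x |y. y \<in> I} \<subseteq> B}" by blast
  qed
qed

section \<open>Polynomials with coefficients in a subring or an ideal\<close>

definition PE :: "'a::field set => 'a poly set" where
  "PE E = {G. \<forall>i. coeff G i \<in> E}"

lemma PE_add: "subring E ==> ideal_in E p ==> G \<in> PE p ==> H \<in> PE p ==> G + H \<in> PE p"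
  and PE_diff: "subring E ==> ideal_in E p ==> G \<in> PE p ==> H \<in> PE p ==> G - H \<in> PE p"
  and PE_mult: "subring E ==> ideal_in E p ==> G \<in> PE E ==> H \<in> PE p ==> G * H \<in> PE p"
  and PE_const: "0 \<in> p ==> c \<in> p ==> [:c:] \<in> PE p"
  and PE_smult: "ideal_in E p ==> c \<in> E ==> G \<in> PE p ==> smult c G \<in> PE p"
  and PE_monom: "0 \<in> p ==> c \<in> p ==> monom c n \<in> PE p"
  by (auto simp: PE_def coeff_mult coeff_pCons ideal_add ideal_diff ideal_mult split: nat.splits
      intro!: ideal_sum ideal_mult)

lemma poly_PE_mem:
  assumes "subring C" "ideal_in C X" "G \<in> PE X" "z \<in> C" shows "poly G z \<in> X"
  unfolding poly_altdef using assms by (intro ideal_sum ideal_mult_right subring_power) (auto simp: PE_def)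

lemma PE_mono: "p \<subseteq> q ==> PE p \<subseteq> PE q"
  by (auto simp: PE_def)

text \<open>The product of the lowest coefficients outside \<open>p\<close> is, modulo
  \<open>p\<close>, a coefficient of the product.\<close>

lemma PE_prime:
  assumes sE: "subring E" and p: "prime_in E p" and G: "G \<in> PE E" "G \<notin> PE p" and H: "H \<in> PE E" "H \<notin> PE p"
  shows "G * H \<notin> PE p"
proof
  assume GH: "G * H \<in> PE p"
  note ip = prime_ideal[OF p]
  obtain i where i: "coeff G i \<notin> p" "\<And>k. k < i ==> coeff G k \<in> p"
    using G(2) exists_least_iff[of "\<lambda>i. coeff G i \<notin> p"] by (auto simp: PE_def)
  obtain j where j: "coeff H j \<notin> p" "\<And>k. k < j ==> coeff H k \<in> p"
    using H(2) exists_least_iff[of "\<lambda>i. coeff H i \<notin> p"] by (auto simp: PE_def)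
  have GE: "coeff G k \<in> E" and HE: "coeff H k \<in> E" for k using G H by (auto simp: PE_def)
  have "coeff (G * H) (i + j) = coeff G i * coeff H j + (\<Sum>k\<in>{..i + j} - {i}. coeff G k * coeff H (i + j - k))"
    unfolding coeff_mult by (subst sum.remove[of _ i]) auto
  then have "coeff G i * coeff H j = coeff (G * H) (i + j) - (\<Sum>k\<in>{..i + j} - {i}. coeff G k * coeff H (i + j - k))" by simp
  also have "\<dots> \<in> p"
  proof (rule ideal_diff[OF sE ip])
    show "coeff (G * H) (i + j) \<in> p" using GH by (simp add: PE_def)
    show "(\<Sum>k\<in>{..i + j} - {i}. coeff G k * coeff H (i + j - k)) \<in> p"
    proof (rule ideal_sum[OF ip])
      fix k assume "k \<in> {..i + j} - {i}"
      then have "k < i \<or> i + j - k < j" by auto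
      then show "coeff G k * coeff H (i + j - k) \<in> p"
        using i(2) j(2) GE HE ideal_mult[OF ip] ideal_mult_right[OF ip] by blast
    qed
  qed
  finally show False using prime_mult[OF p GE HE] i j by blast
qed

lemma PE_pseudo_division:
  assumes sE: "subring E" and H: "H \<in> PE E" "0 < degree H"
  shows "G \<in> PE E ==> \<exists>N Q R. Q \<in> PE E \<and> R \<in> PE E \<and> smult (lead_coeff H ^ N) G = H * Q + R \<and> degree R < degree H"
proof (induction "degree G" arbitrary: G rule: less_induct)
  case less
  have iE: "ideal_in E E" by (rule ideal_ring[OF sE])
  have lE: "lead_coeff H \<in> E" "lead_coeff G \<in> E" using H less by (auto simp: PE_def)
  show ?case
  proof (cases "degree G < degree H")
    case True
    then show ?thesis using less.prems subring_zero[OF sE]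
      by (intro exI[of _ 0] exI[of _ 0] exI[of _ G]) (auto simp: PE_def)
  next
    case False
    let ?M = "monom (lead_coeff G) (degree G - degree H)"
    let ?G = "smult (lead_coeff H) G - ?M * H"
    have M: "?M \<in> PE E" by (rule PE_monom[OF subring_zero[OF sE] lE(2)])
    have G1: "?G \<in> PE E"
      by (rule PE_diff[OF sE iE PE_smult[OF iE lE(1) less.prems] PE_mult[OF sE iE M H(1)]])
    have gt: "0 < degree G" using False H(2) by simp
    have "degree ?G < degree G"
    proof (rule ccontr)
      assume "\<not> degree ?G < degree G"
      have d1: "degree (?M * H) \<le> degree G"
        using degree_mult_le[of ?M H] degree_monom_le[of "lead_coeff G" "degree G - degree H"] False by linarith
      have "degree ?G \<le> degree G"
        using degree_diff_le[of "smult (lead_coeff H) G" "degree G" "?M * H"] degree_smult_le[of "lead_coeff H" G] d1 by simp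
      then have "degree ?G = degree G" using \<open>\<not> degree ?G < degree G\<close> by simp
      moreover have "coeff ?G (degree G) = 0"
        using False by (simp add: coeff_monom_mult)
      ultimately have "?G = 0" using leading_coeff_0_iff by metis
      then show False using \<open>\<not> degree ?G < degree G\<close> gt by simp
    qed
    then obtain N Q R where NQR: "Q \<in> PE E" "R \<in> PE E" "smult (lead_coeff H ^ N) ?G = H * Q + R" "degree R < degree H"
      using less.hyps[OF _ G1] by blast
    have lN: "lead_coeff H ^ N \<in> E" using subring_power[OF sE lE(1)] .
    have "smult (lead_coeff H ^ Suc N) G = H * (Q + smult (lead_coeff H ^ N) ?M) + R"
    proof -
      have "smult (lead_coeff H ^ N) ?G = smult (lead_coeff H ^ Suc N) G - smult (lead_coeff H ^ N) (?M * H)"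
        by (simp add: smult_diff_right mult.commute)
      then have "smult (lead_coeff H ^ Suc N) G = H * Q + R + smult (lead_coeff H ^ N) (?M * H)" using NQR(3) by simp
      then show ?thesis by (simp add: algebra_simps)
    qed
    moreover have "Q + smult (lead_coeff H ^ N) ?M \<in> PE E"
      by (rule PE_add[OF sE iE NQR(1) PE_smult[OF iE lN M]])
    ultimately show ?thesis using NQR by blast
  qed
qed

text \<open>Taking a further generator \<open>u\<close> into the ideal adjoins \<open>u / x\<close>
  to the ring, by the homogeneous description in \<open>jpow_adj_iff\<close>.\<close>

lemma blow_adj:
  assumes sA: "subring A" and I: "ideal_in A I" and x: "x \<in> I" "x \<noteq> 0" and u: "u \<in> A"
  shows "blow A (adj A I u) x = {poly G (u / x) | G. G \<in> PE (blow A I x)}"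
proof (intro equalityI subsetI)
  note iadj = adj_ideal[OF sA I u]
  have sE: "subring (blow A I x)" by (rule blow_subring[OF sA I x])
  fix z assume "z \<in> blow A (adj A I u) x"
  then obtain a k where a: "a \<in> jpow A A (adj A I u) k" "z = a / x ^ k" by (rule blow_memE)
  obtain h where h: "\<forall>l\<le>k. h l \<in> jpow A A I (k - l)" "a = (\<Sum>l\<le>k. h l * u ^ l)"
    using a(1) jpow_adj_iff[OF sA ideal_ring[OF sA] I u] by blast
  let ?G = "\<Sum>l\<le>k. monom (h l / x ^ (k - l)) l"
  have "coeff ?G i = (if i \<le> k then h i / x ^ (k - i) else 0)" for i by (simp add: coeff_sum)
  then have "?G \<in> PE (blow A I x)" using h(1) subring_zero[OF sE] by (auto simp: PE_def blow_def)
  moreover have "poly ?G (u / x) = z"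
  proof -
    have "poly ?G (u / x) = (\<Sum>l\<le>k. h l / x ^ (k - l) * (u / x) ^ l)" by (simp add: poly_sum poly_monom)
    also have "\<dots> = (\<Sum>l\<le>k. h l * u ^ l / x ^ k)"
    proof (rule sum.cong)
      fix l assume "l \<in> {..k}"
      then have "x ^ k = x ^ (k - l) * x ^ l" by (simp add: power_add[symmetric])
      then show "h l / x ^ (k - l) * (u / x) ^ l = h l * u ^ l / x ^ k" using x(2) by (simp add: power_divide field_simps)
    qed simp
    finally show ?thesis unfolding a(2) h(2) by (simp add: sum_divide_distrib)
  qed
  ultimately show "z \<in> {poly G (u / x) | G. G \<in> PE (blow A I x)}" by (intro CollectI exI[of _ ?G]) simp
next
  note iadj = adj_ideal[OF sA I u]
  have x': "x \<in> adj A I u" using adj_sub[OF sA] x by blast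
  have sC: "subring (blow A (adj A I u) x)" by (rule blow_subring[OF sA iadj x' x(2)])
  fix z assume "z \<in> {poly G (u / x) | G. G \<in> PE (blow A I x)}"
  then obtain G where G: "G \<in> PE (blow A I x)" "z = poly G (u / x)" by blast
  have "G \<in> PE (blow A (adj A I u) x)" using G(1) PE_mono[OF blow_mono[OF sA iadj adj_sub[OF sA]]] by blast
  moreover have "u / x \<in> blow A (adj A I u) x"
    using adj_mem[OF sA I, of u] jpow_self[OF sA iadj, of 0] by (intro blow_memI[of u _ _ 1]) auto
  ultimately show "z \<in> blow A (adj A I u) x"
    unfolding G(2) by (intro poly_PE_mem[OF sC ideal_ring[OF sC]])
qed

text \<open>Moves any parameter to the first or the last place, where other results speak about
  it.\<close>

lemma regsys_swap:
  assumes y: "regsys A m y d" and ij: "i < d" "j < d"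
  shows "regsys A m (y \<circ> Transposition.transpose i j) d"
proof -
  note R = regsysD[OF y]
  let ?z = "y \<circ> Transposition.transpose i j"
  have t: "Transposition.transpose i j l < d" if "l < d" for l using that ij by (auto simp: Transposition.transpose_def)
  have zA: "?z l \<in> A" "?z l \<in> m" if "l < d" for l using R(3,4)[OF t[OF that]] by auto
  have "y l = ?z (Transposition.transpose i j l)" for l by simp
  then have "y l \<in> igen A ?z d" if "l < d" for l
    using gen_mem[OF R(7) ideal_zero_ideal[OF R(7)], of d ?z "Transposition.transpose i j l"] zA(1) t[OF that] by metis
  moreover have "ideal_in A (igen A ?z d)" using zA by (intro igen_ideal[OF R(7)]) auto
  ultimately have "m \<subseteq> igen A ?z d" unfolding R(5) by (intro gen_least) (auto intro: ideal_zero)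
  moreover have "igen A ?z d \<subseteq> m" using zA ideal_zero[OF R(8)] by (intro gen_least[OF R(8)]) auto
  ultimately show ?thesis using R zA unfolding regsys_def by auto
qed

text \<open>With the parameter in question moved to the last place, its coefficient is that of the
  variable in a form of degree one.\<close>

lemma regsys_indep: assumes y: "regsys A m y d" shows "indep A m y d"
  unfolding indep_def
proof (intro conjI allI impI)
  note R = regsysD[OF y]
  show "y i \<in> m" if "i < d" for i using R(3) that .
  fix c i assume c: "\<forall>i<d. c i \<in> A" "(\<Sum>i<d. c i * y i) \<in> ideal_pow A m 2" and i: "i < d"
  obtain d' where d: "d = Suc d'" using i by (cases d) auto
  let ?t = "Transposition.transpose i d'"
  let ?z = "y \<circ> ?t"
  have z: "regsys A m ?z (Suc d')" using regsys_swap[OF y i, of d'] d by simp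
  have "?t permutes {..<Suc d'}" using i d by (auto intro!: permutes_swap_id)
  then have "(\<Sum>l<Suc d'. c l * y l) = (\<Sum>l<Suc d'. c (?t l) * ?z l)"
    using sum.permute[of ?t "{..<Suc d'}" "\<lambda>l. c l * y l"] by (simp add: o_def)
  also have "\<dots> = (\<Sum>l<d'. c (?t l) * ?z l) + c i * ?z d'" by simp
  finally have e: "(\<Sum>l<Suc d'. c l * y l) = (\<Sum>l<d'. c (?t l) * ?z l) + c i * ?z d'" .
  let ?G = "\<lambda>l. if l = 0 then (\<Sum>l<d'. c (?t l) * ?z l) else c i"
  have I: "ideal_in A (igen A ?z d')" using regsys_prime[OF z, of d'] prime_ideal by auto
  have "\<forall>l<d'. c (?t l) \<in> A" using c(1) i d by (auto simp: Transposition.transpose_def)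
  then have "(\<Sum>l<d'. c (?t l) * ?z l) \<in> igen A ?z d'" by (intro igen_sumI[OF R(7)]) auto
  then have G0: "?G 0 \<in> jpow A A (igen A ?z d') 1" using jpow_self[OF R(7) I, of 0] by simp
  have G1: "?G l \<in> jpow A A (igen A ?z d') (1 - l)" if "l \<le> 1" for l using that G0 c(1) i by (cases l) auto
  have "(\<Sum>l\<le>1. ?G l * ?z d' ^ l) = (\<Sum>l<Suc d'. c l * y l)" unfolding e by simp
  then have G2: "(\<Sum>l\<le>1. ?G l * ?z d' ^ l) \<in> jpow A A m (Suc 1)" using c(2) d by (simp add: ideal_pow_eq_jpow numeral_2_eq_2)
  show "c i \<in> m" using regsys_graded_polynomial[OF z G1 G2, of 1] jpow_self[OF R(7,8), of 0] by simp
qed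

lemma regsys_first:
  assumes y: "regsys A m y d" and x: "x \<in> m" "x \<notin> ideal_pow A m 2"
  obtains z where "regsys A m z d" "z 0 = x" "0 < d"
proof -
  note R = regsysD[OF y]
  have "indep A m (\<lambda>_. x) 1"
    unfolding indep_def
  proof (intro conjI allI impI)
    fix c :: "nat => 'a" and i :: nat assume c: "\<forall>i<1. c i \<in> A" "(\<Sum>i<1. c i * x) \<in> ideal_pow A m 2" "i < 1"
    show "c i \<in> m"
    proof (rule ccontr)
      assume "c i \<notin> m"
      then have "inverse (c 0) \<in> A" "c 0 \<noteq> 0" using local_unit[OF R(2), of "c 0"] c by auto
      then have "inverse (c 0) * (c 0 * x) \<in> ideal_pow A m 2"
        using ideal_mult[OF ideal_pow_ideal[OF R(7,8)]] c(2) by auto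
      then show False using x(2) \<open>c 0 \<noteq> 0\<close> by (simp add: mult.assoc[symmetric])
    qed
  qed (use x in simp)
  from indep_extend[OF y this] show ?thesis using that by auto
qed

section \<open>The blow-up of a regular local ring along its first parameter\<close>

context
  fixes A m :: "'a::field set" and y :: "nat => 'a" and d :: nat
  assumes y: "regsys A m y d" and d: "0 < d"
begin

abbreviation (input) "bx \<equiv> y 0"
abbreviation (input) "bC \<equiv> blow A m (y 0)"

lemma blow_facts:
  shows "bx \<in> m" "bx \<in> A" "bx \<noteq> 0" "bx \<notin> jpow A A m 2" "subring bC" "A \<subseteq> bC" "bx \<in> bC"
proof -
  note R = regsysD[OF y]
  show "bx \<in> m" "bx \<in> A" using R(3,4) d by auto
  show n: "bx \<noteq> 0" using regsys_notin[OF y d] by simp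
  show "bx \<notin> jpow A A m 2"
  proof
    assume "bx \<in> jpow A A m 2"
    moreover have "(\<Sum>i<d. (if i = 0 then 1 else 0) * y i) = bx" using d by (simp add: if_distrib[of "\<lambda>t. t * _"] cong: if_cong)
    moreover have "\<forall>c. (\<forall>i<d. c i \<in> A) --> (\<Sum>i<d. c i * y i) \<in> ideal_pow A m 2 --> (\<forall>i<d. c i \<in> m)"
      using regsys_indep[OF y] by (simp add: indep_def)
    from this[rule_format, of "\<lambda>i. if i = 0 then 1 else 0" 0] have
      "(\<Sum>i<d. (if i = 0 then 1 else 0) * y i) \<in> ideal_pow A m 2 ==> 1 \<in> m"
      using R(7) d by (simp add: subring_closed)
    ultimately show False using local_not_one[OF R(2)] by (simp add: ideal_pow_eq_jpow)
  qed
  show "subring bC" by (rule blow_subring[OF R(7,8) \<open>bx \<in> m\<close> n])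
  show "A \<subseteq> bC" by (rule subring_of_ring[OF R(7)])
  then show "bx \<in> bC" using \<open>bx \<in> A\<close> by blast
qed

text \<open>\<open>bx\<close> has order one, and the order is additive.\<close>

lemma jpow_cancel_power:
  assumes "a \<in> A" "a * bx ^ l \<in> jpow A A m (l + k)" shows "a \<in> jpow A A m k"
  using assms(2)
proof (induction l)
  case (Suc l)
  note R = regsysD[OF y]
  show ?case
  proof (cases "a = 0 \<or> l + k = 0")
    case True
    then show ?thesis using assms(1) ideal_zero[OF jpow_ideal[OF R(7) ideal_ring[OF R(7)] R(8)]] by auto
  next
    case False
    have nz: "a * bx ^ l \<in> A" "a * bx ^ l \<noteq> 0" using False assms(1) blow_facts R(7) by (auto simp: subring_closed)
    have o1: "ord_fun A m bx = 1"
      using ord_fun_mem[OF y blow_facts(2,3), of 1] ord_fun_mem[OF y blow_facts(2,3), of 2] blow_facts(1,4)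
        jpow_self[OF R(7,8), of 0] by (simp add: ideal_pow_eq_jpow)
    have "(a * bx ^ l) * bx \<in> ideal_pow A m (Suc (l + k))" using Suc.prems by (simp add: ideal_pow_eq_jpow mult_ac del: jpow.simps)
    then have "Suc (l + k) \<le> ord_fun A m (a * bx ^ l) + 1"
      using ord_fun_mem[OF y, of "(a * bx ^ l) * bx" "Suc (l + k)"] ord_fun_mult[OF y nz blow_facts(2,3)] nz blow_facts R(7) o1
      by (simp add: subring_closed)
    then have "a * bx ^ l \<in> jpow A A m (l + k)" using ord_fun_mem[OF y nz, of "l + k"] by (simp add: ideal_pow_eq_jpow)
    then show ?thesis by (rule Suc.IH)
  qed
qed simp

text \<open>Divisibility by \<open>bx\<close> in the blow-up is read off from the order of the
  numerator. This reduces primality of \<open>bx\<close> and the order valuation to the graded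
  ring.\<close>

lemma blow_x_mem_iff:
  assumes a: "a \<in> jpow A A m k"
  shows "a / bx ^ k \<in> pid bC bx \<longleftrightarrow> a \<in> jpow A A m (Suc k)"
proof
  note R = regsysD[OF y] and B = blow_facts
  have aA: "a \<in> A" using ideal_sub[OF jpow_ideal[OF R(7) ideal_ring[OF R(7)] R(8)] a] .
  assume "a / bx ^ k \<in> pid bC bx"
  then obtain f where "f \<in> bC" "a / bx ^ k = f * bx" by (rule pid_memE)
  then obtain b l where b: "b \<in> jpow A A m l" "a / bx ^ k = b / bx ^ l * bx" by (auto elim!: blow_memE)
  have "a * bx ^ l = b * bx ^ Suc k" using b(2) B(3) by (simp add: field_simps)
  also have "\<dots> \<in> jpow A A m (l + Suc k)"
    by (rule jpow_mult[OF R(7) ideal_ring[OF R(7)] R(8) b(1) pow_mem_jpow[OF R(7,8) B(1)]])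
  finally show "a \<in> jpow A A m (Suc k)" by (rule jpow_cancel_power[OF aA])
next
  note R = regsysD[OF y] and B = blow_facts
  assume "a \<in> jpow A A m (Suc k)"
  then have "a / bx ^ Suc k \<in> bC" by (rule blow_memI) simp
  moreover have "a / bx ^ k = (a / bx ^ Suc k) * bx" using B(3) by simp
  ultimately show "a / bx ^ k \<in> pid bC bx" unfolding pid_def by blast
qed

lemma blow_x_prime: "pel bC bx"
  unfolding pel_def
proof (intro conjI)
  note R = regsysD[OF y] and B = blow_facts
  show "bx \<in> bC" "bx \<noteq> 0" using B by auto
  show "prime_in bC (pid bC bx)"
  proof (rule prime_inI)
    show "ideal_in bC (pid bC bx)" by (rule pid_ideal[OF B(5,7)])
    show "1 \<in> bC" using B(5) by (rule subring_one)
    show "1 \<notin> pid bC bx"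
      using blow_x_mem_iff[of 1 0] R(7) jpow_self[OF R(7,8), of 0] local_not_one[OF R(2)] by (simp add: subring_one)
    fix f g assume fg: "f \<in> bC" "g \<in> bC" "f * g \<in> pid bC bx" "f \<notin> pid bC bx"
    obtain a k where a: "a \<in> jpow A A m k" "f = a / bx ^ k" using fg(1) by (rule blow_memE)
    obtain b l where b: "b \<in> jpow A A m l" "g = b / bx ^ l" using fg(2) by (rule blow_memE)
    have "a * b \<in> jpow A A m (k + l)" by (rule jpow_mult[OF R(7) ideal_ring[OF R(7)] R(8) a(1) b(1)])
    moreover have "f * g = a * b / bx ^ (k + l)" using a b by (simp add: power_add)
    ultimately have "a * b \<in> jpow A A m (Suc (k + l))" using fg(3) blow_x_mem_iff by simp
    then have "a * b \<in> jpow A m m (k + l)" using jpow_self[OF R(7,8)] by simp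
    then have "a \<in> jpow A m m k \<or> b \<in> jpow A m m l"
      using regsys_graded_domain[OF y order_refl local_prime[OF R(2)], of a k b l] R(5) a b by auto
    then show "g \<in> pid bC bx"
      using fg(4) blow_x_mem_iff[OF a(1)] blow_x_mem_iff[OF b(1)] a b jpow_self[OF R(7,8)] by auto
  qed
qed

text \<open>Dividing numerator and denominator by the power of \<open>bx\<close> given by the order
  of the denominator leaves a denominator prime to \<open>bx\<close>.\<close>

lemma order_valuation_ring_eq: assumes qf: "quotient_field_is_ambient A"
  shows "order_valuation_ring A m = loc_at bC (pid bC bx)"
proof (intro equalityI subsetI)
  note R = regsysD[OF y] and B = blow_facts
  fix z assume "z \<in> order_valuation_ring A m"
  then consider "z = 0" | a b where "a \<in> A" "b \<in> A" "a \<noteq> 0" "b \<noteq> 0" "ord_fun A m b \<le> ord_fun A m a" "z = a / b"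
    unfolding order_valuation_ring_def by blast
  then show "z \<in> loc_at bC (pid bC bx)"
  proof cases
    case 1 then show ?thesis using subring_zero[OF loc_at_subring[OF B(5) pelD(3)[OF blow_x_prime]]] by simp
  next
    case 2
    let ?k = "ord_fun A m b"
    have ab: "a \<in> jpow A A m ?k" "b \<in> jpow A A m ?k" "b \<notin> jpow A A m (Suc ?k)"
      using ord_fun_mem[OF y 2(1,3), of ?k] ord_fun_mem[OF y 2(2,4), of ?k] ord_fun_mem[OF y 2(2,4), of "Suc ?k"] 2(5)
      by (auto simp: ideal_pow_eq_jpow simp del: jpow.simps)
    have "z = (a / bx ^ ?k) / (b / bx ^ ?k)" using 2 B(3) by simp
    moreover have "a / bx ^ ?k \<in> bC" "b / bx ^ ?k \<in> bC" using ab by (auto simp: blow_def)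
    moreover have "b / bx ^ ?k \<notin> pid bC bx" using blow_x_mem_iff[OF ab(2)] ab(3) by simp
    ultimately show ?thesis unfolding loc_at_def by blast
  qed
next
  note R = regsysD[OF y] and B = blow_facts
  fix z assume "z \<in> loc_at bC (pid bC bx)"
  then obtain f g where fg: "f \<in> bC" "g \<in> bC" "g \<notin> pid bC bx" "z = f / g" unfolding loc_at_def by blast
  obtain a k where a: "a \<in> jpow A A m k" "f = a / bx ^ k" using fg(1) by (rule blow_memE)
  obtain b l where b: "b \<in> jpow A A m l" "g = b / bx ^ l" using fg(2) by (rule blow_memE)
  have aA: "a \<in> A" and bA: "b \<in> A" using ideal_sub[OF jpow_ideal[OF R(7) ideal_ring[OF R(7)] R(8)]] a b by auto
  have bl: "b \<notin> jpow A A m (Suc l)" using blow_x_mem_iff[OF b(1)] b fg by simp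
  have b0: "b \<noteq> 0" using bl ideal_zero[OF jpow_ideal[OF R(7) ideal_ring[OF R(7)] R(8)]] by metis
  show "z \<in> order_valuation_ring A m"
  proof (cases "a = 0")
    case True then show ?thesis using fg a by (simp add: order_valuation_ring_def)
  next
    case False
    let ?a = "a * bx ^ l" and ?b = "b * bx ^ k"
    have "z = ?a / ?b" unfolding fg a b using B(3) by (simp add: field_simps)
    moreover have nz: "?a \<in> A" "?b \<in> A" "?a \<noteq> 0" "?b \<noteq> 0" using aA bA b0 False B R(7) by (auto simp: subring_closed)
    moreover have "ord_fun A m ?b \<le> ord_fun A m ?a"
    proof -
      have "?a \<in> jpow A A m (k + l)"
        by (rule jpow_mult[OF R(7) ideal_ring[OF R(7)] R(8) a(1) pow_mem_jpow[OF R(7,8) B(1)]])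
      then have "k + l \<le> ord_fun A m ?a" using ord_fun_mem[OF y nz(1,3)] by (simp add: ideal_pow_eq_jpow)
      moreover have "\<not> Suc (k + l) \<le> ord_fun A m ?b"
      proof
        assume "Suc (k + l) \<le> ord_fun A m ?b"
        then have "?b \<in> jpow A A m (k + Suc l)" using ord_fun_mem[OF y nz(2,4), of "Suc (k + l)"] by (simp add: ideal_pow_eq_jpow del: jpow.simps)
        then show False using jpow_cancel_power[OF bA] bl by blast
      qed
      ultimately show ?thesis by simp
    qed
    ultimately show ?thesis unfolding order_valuation_ring_def by blast
  qed
qed

text \<open>Modulo \<open>x\<close> the fraction \<open>y i / x\<close> is transcendental over the subring generated by the others.\<close>

lemma blow_transcendental:
  assumes z: "regsys A m z (Suc n)" and I: "I \<subseteq> igen A z n" "bx \<in> I" "ideal_in A I" and G: "G \<in> PE (blow A I bx)"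
    and p: "poly G (z n / bx) \<in> pid bC bx"
  shows "G \<in> PE (pid bC bx)"
proof -
  note R = regsysD[OF y] and B = blow_facts
  let ?J = "igen A z n" and ?u = "z n"
  note iA = ideal_ring[OF R(7)]
  have J: "ideal_in A ?J" using regsys_prime[OF z, of n] prime_ideal by auto
  have xJ: "bx \<in> ?J" using I by blast
  have GJ: "coeff G i \<in> blow A ?J bx" for i using G blow_mono[OF R(7) J I(1)] by (auto simp: PE_def)
  then have "\<forall>i. \<exists>a k. a \<in> jpow A A ?J k \<and> coeff G i = a / bx ^ k" by (meson blow_memE)
  then obtain a k where ak: "\<And>i. a i \<in> jpow A A ?J (k i)" "\<And>i. coeff G i = a i / bx ^ k i" by metis
  \<comment> \<open>The coefficients are brought to the common denominator
    \<open>bx ^ M\<close>.\<close>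
  define N where "N = degree G"
  define M where "M = (\<Sum>i\<le>N. k i)"
  have kM: "k i \<le> M" if "i \<le> N" for i unfolding M_def using that by (intro member_le_sum) auto
  define g where "g i = (if i \<le> N then a i * bx ^ (M - k i) else 0)" for i
  have gJ: "g i \<in> jpow A A ?J M" for i
    using jpow_mult[OF R(7) iA J ak(1) pow_mem_jpow[OF R(7) J xJ], of i "M - k i"] kM[of i]
      ideal_zero[OF jpow_ideal[OF R(7) iA J]] by (auto simp: g_def)
  have gc: "coeff G i = g i / bx ^ M" for i
  proof (cases "i \<le> N")
    case True
    then have "bx ^ M = bx ^ k i * bx ^ (M - k i)" using kM[OF True] by (simp add: power_add[symmetric])
    then show ?thesis using ak(2)[of i] True B(3) by (simp add: g_def)
  next
    case False then show ?thesis by (simp add: g_def N_def coeff_eq_0)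
  qed
  \<comment> \<open>Multiplying the value of \<open>G\<close> by \<open>bx ^ (M + N)\<close> gives a
    form of degree \<open>M + N\<close> in \<open>?u\<close> with these coefficients; those above
    \<open>N\<close> are zero.\<close>
  let ?h = "\<lambda>i. if i \<le> N then g i * bx ^ (N - i) else 0"
  have hJ: "?h i \<in> jpow A A ?J (M + N - i)" if "i \<le> M + N" for i
  proof (cases "i \<le> N")
    case True
    then show ?thesis using jpow_mult[OF R(7) iA J gJ pow_mem_jpow[OF R(7) J xJ], of i "N - i"] by simp
  next
    case False then show ?thesis using ideal_zero[OF jpow_ideal[OF R(7) iA J]] by auto
  qed
  have Jm: "?J \<subseteq> m" using local_max[OF R(2) regsys_prime[OF z, of n]] by simp
  note um = regsysD(3)[OF z, of n]
  let ?s = "\<Sum>i\<le>M + N. ?h i * ?u ^ i"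
  have s: "?s = (\<Sum>i\<le>N. g i * bx ^ (N - i) * ?u ^ i)" by (intro sum.mono_neutral_cong_right) auto
  have sm: "?s \<in> jpow A A m (M + N)"
  proof (rule ideal_sum[OF jpow_ideal[OF R(7) iA R(8)]])
    fix i assume "i \<in> {..M + N}"
    then have "?h i \<in> jpow A A m (M + N - i)"
      using subsetD[OF jpow_mono[OF R(7) iA R(8) subset_refl Jm], OF hJ[of i]] by simp
    then have "?h i * ?u ^ i \<in> jpow A A m (M + N - i + i)"
      by (rule jpow_mult[OF R(7) iA R(8)]) (use um in \<open>auto intro: pow_mem_jpow[OF R(7,8)]\<close>)
    then show "?h i * ?u ^ i \<in> jpow A A m (M + N)" using \<open>i \<in> {..M + N}\<close> by simp
  qed
  have "poly G (?u / bx) = ?s / bx ^ (M + N)"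
  proof -
    have "poly G (?u / bx) = (\<Sum>i\<le>N. g i / bx ^ M * (?u / bx) ^ i)" unfolding poly_altdef N_def gc ..
    also have "\<dots> = (\<Sum>i\<le>N. g i * bx ^ (N - i) * ?u ^ i / bx ^ (M + N))"
    proof (rule sum.cong)
      fix i assume "i \<in> {..N}"
      then have "bx ^ (M + N) = bx ^ M * (bx ^ (N - i) * bx ^ i)" by (simp add: power_add[symmetric])
      then show "g i / bx ^ M * (?u / bx) ^ i = g i * bx ^ (N - i) * ?u ^ i / bx ^ (M + N)"
        using B(3) by (simp add: power_divide field_simps)
    qed simp
    finally show ?thesis unfolding s by (simp add: sum_divide_distrib)
  qed
  then have "?s \<in> jpow A A m (Suc (M + N))" using p blow_x_mem_iff[OF sm] by simp
  note hm = regsys_graded_polynomial[OF z hJ this]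
  have "coeff G i \<in> pid bC bx" for i
  proof (cases "i \<le> N")
    case True
    have "g i \<in> A" using ideal_sub[OF jpow_ideal[OF R(7) iA J] gJ] .
    have "g i * bx ^ (N - i) \<in> jpow A A m (N - i + Suc M)"
      using hm[of i] True by (simp add: add.commute del: jpow.simps)
    then have "g i \<in> jpow A A m (Suc M)" by (rule jpow_cancel_power[OF \<open>g i \<in> A\<close>])
    moreover have "g i \<in> jpow A A m M" using gJ jpow_mono[OF R(7) iA R(8) subset_refl Jm] by blast
    ultimately show ?thesis unfolding gc using blow_x_mem_iff by blast
  next
    case False
    then show ?thesis using ideal_zero[OF pid_ideal[OF B(5,7)]] by (simp add: N_def coeff_eq_0)
  qed
  then show ?thesis by (simp add: PE_def)
qed

end

section \<open>Local quadratic transforms\<close>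

text \<open>\<open>X\<close> and the \<open>f l\<close> generate \<open>q\<close> after localization, and the chain shows that the number
  \<open>t\<close> of the \<open>f l\<close> is the right one.\<close>

definition generic_sys :: "'a::field set => 'a set => 'a set => nat => (nat => 'a) => bool" where
  "generic_sys E X q t f \<longleftrightarrow> (\<forall>l<t. f l \<in> q) \<and> (\<exists>P. pchain E X t P \<and> P t = q) \<and>
     (\<forall>g\<in>q. \<exists>s\<in>E - q. s * g \<in> gen E X f t)"

text \<open>By \<open>tr\<close>, \<open>E'\<close> modulo \<open>X\<close> is a polynomial ring in
  \<open>Z\<close> over \<open>E\<close> modulo its trace. A prime there is either extended from
  below, and the system stays as it is, or exceeds the extended prime by one further
  generator.\<close>

lemma generic_sys_step:
  fixes f :: "nat => 'a::field"
  assumes sE: "subring E" and sE': "subring E'" and E': "E' = {poly G Z | G. G \<in> PE E}"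
    and X: "ideal_in E' X" and q: "prime_in E' q" "X \<subseteq> q"
    and tr: "\<And>G. G \<in> PE E ==> poly G Z \<in> X ==> G \<in> PE (X \<inter> E)"
    and g: "generic_sys E (X \<inter> E) (q \<inter> E) t f"
  obtains t' f' where "generic_sys E' X q t' f'" "t \<le> t'" "t' \<le> Suc t" "\<forall>l<t. f' l = f l"
    "Z \<in> q ==> t' = Suc t \<and> f' t = Z"
proof -
  let ?X = "X \<inter> E" and ?q = "q \<inter> E"
  note iE = ideal_ring[OF sE] and iq = prime_ideal[OF q(1)]
  have EE': "E \<subseteq> E'"
  proof
    fix c assume "c \<in> E"
    then show "c \<in> E'" unfolding E' using subring_zero[OF sE] by (intro CollectI exI[of _ "[:c:]"]) (auto simp: PE_const)
  qed
  have ZE': "Z \<in> E'" unfolding E' using sE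
    by (intro CollectI exI[of _ "[:0, 1:]"]) (auto simp: PE_def coeff_pCons subring_closed split: nat.splits)
  have pE': "poly G Z \<in> E'" if "G \<in> PE E" for G using that E' by blast
  from g obtain P where f: "\<And>l. l < t ==> f l \<in> ?q" and P: "pchain E ?X t P" "P t = ?q"
    and gs: "\<And>g. g \<in> ?q ==> \<exists>s\<in>E - ?q. s * g \<in> gen E ?X f t"
    unfolding generic_sys_def by blast
  note PD = pchainD[OF P(1)]
  have Psub: "P i \<subseteq> P j" if "i \<le> j" "j \<le> t" for i j
    using that
  proof (induction j rule: dec_induct)
    case (step n) then show ?case using PD(2)[of n] by auto
  qed simp
  have XP: "?X \<subseteq> P i" if "i \<le> t" for i using PD(3) Psub[of 0 i] that by blast
  have pq: "prime_in E ?q" using PD(1)[of t] P(2) by simp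
  note ipq = prime_ideal[OF pq]
  \<comment> \<open>The extension of \<open>p\<close> to \<open>E'\<close>. By \<open>tr\<close>,
    the polynomial representing an element is unique modulo every ideal above the trace of
    \<open>X\<close>, so membership can be tested on coefficients.\<close>
  define ext where "ext p = {poly G Z | G. G \<in> PE p}" for p
  have ext_iff: "poly G Z \<in> ext p \<longleftrightarrow> G \<in> PE p" if G: "G \<in> PE E" and p: "ideal_in E p" "?X \<subseteq> p" for G p
  proof
    assume "poly G Z \<in> ext p"
    then obtain H where H: "H \<in> PE p" "poly G Z = poly H Z" by (auto simp: ext_def)
    have "H \<in> PE E" using H PE_mono[OF ideal_subset[OF p(1)]] by blast
    then have "G - H \<in> PE E" by (rule PE_diff[OF sE iE G])
    moreover have "poly (G - H) Z \<in> X" using H ideal_zero[OF X] by simp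
    ultimately have "G - H \<in> PE p" using tr PE_mono[OF p(2)] by blast
    from PE_add[OF sE p(1) this H(1)] show "G \<in> PE p" by simp
  qed (auto simp: ext_def)
  have ext_const: "c \<in> ext p \<longleftrightarrow> c \<in> p" if "c \<in> E" and p: "ideal_in E p" "?X \<subseteq> p" for c p
    using ext_iff[of "[:c:]" p] PE_const[of E c] that ideal_zero[OF p(1)] subring_zero[OF sE]
    by (auto simp: PE_def coeff_pCons split: nat.splits)
  have ext_ideal: "ideal_in E' (ext p)" if p: "ideal_in E p" for p
    unfolding ideal_in_def
  proof (intro conjI ballI)
    show "ext p \<subseteq> E'" using PE_mono[OF ideal_subset[OF p]] by (auto simp: ext_def E')
    show "0 \<in> ext p" using ideal_zero[OF p] unfolding ext_def by (intro CollectI exI[of _ 0]) (simp add: PE_def)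
    fix a b assume "a \<in> ext p" "b \<in> ext p"
    then obtain G H where "G \<in> PE p" "a = poly G Z" "H \<in> PE p" "b = poly H Z" by (auto simp: ext_def)
    then show "a + b \<in> ext p" unfolding ext_def using PE_add[OF sE p, of G H] by (intro CollectI exI[of _ "G + H"]) simp
  next
    fix r a assume "r \<in> E'" "a \<in> ext p"
    then obtain G H where "G \<in> PE E" "r = poly G Z" "H \<in> PE p" "a = poly H Z" by (auto simp: ext_def E')
    then show "r * a \<in> ext p" unfolding ext_def using PE_mult[OF sE p, of G H] by (intro CollectI exI[of _ "G * H"]) simp
  qed
  have ext_prime: "prime_in E' (ext p)" if p: "prime_in E p" "?X \<subseteq> p" for p
  proof (rule prime_inI[OF ext_ideal[OF prime_ideal[OF p(1)]]])
    note ip = prime_ideal[OF p(1)]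
    show "1 \<notin> ext p" using ext_const[OF subring_one[OF sE] ip p(2)] prime_not_one[OF p(1)] by simp
    show "1 \<in> E'" using sE' by (rule subring_one)
    fix a b assume "a \<in> E'" "b \<in> E'" and ab: "a * b \<in> ext p" "a \<notin> ext p"
    then obtain G H where G: "G \<in> PE E" "a = poly G Z" and H: "H \<in> PE E" "b = poly H Z" by (auto simp: E')
    have "G * H \<in> PE p" using ext_iff[OF PE_mult[OF sE iE G(1) H(1)] ip p(2)] ab(1) G H by simp
    moreover have "G \<notin> PE p" using ab(2) G ext_iff[OF G(1) ip p(2)] by simp
    ultimately have "H \<in> PE p" using PE_prime[OF sE p(1) G(1) _ H(1)] by blast
    then show "b \<in> ext p" using H by (auto simp: ext_def)
  qed
  have extP: "prime_in E' (ext (P i))" if "i \<le> t" for i using ext_prime[OF PD(1)[OF that] XP[OF that]] .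
  have extP_less: "ext (P i) \<subset> ext (P (Suc i))" if i: "i < t" for i
  proof
    show "ext (P i) \<subseteq> ext (P (Suc i))" using PE_mono[of "P i" "P (Suc i)"] PD(2)[OF i] unfolding ext_def by blast
    obtain c where c: "c \<in> P (Suc i)" "c \<notin> P i" using PD(2)[OF i] by blast
    have ids: "ideal_in E (P i)" "ideal_in E (P (Suc i))" using PD(1)[of i] PD(1)[of "Suc i"] i prime_ideal by auto
    have "c \<in> E" using ideal_sub[OF ids(2) c(1)] .
    then have "c \<in> ext (P (Suc i))" "c \<notin> ext (P i)"
      using ext_const[OF _ ids(1) XP[of i]] ext_const[OF _ ids(2) XP[of "Suc i"]] c i by auto
    then show "ext (P i) \<noteq> ext (P (Suc i))" by blast
  qed
  have Xext: "X \<subseteq> ext (P 0)"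
  proof
    fix z assume z: "z \<in> X"
    then obtain G where G: "G \<in> PE E" "z = poly G Z" using ideal_sub[OF X] E' by auto
    then have "G \<in> PE ?X" using tr z by blast
    then show "z \<in> ext (P 0)" using G PE_mono[OF XP[of 0]] by (auto simp: ext_def)
  qed
  have ext_q: "ext ?q \<subseteq> q"
    using poly_PE_mem[OF sE' iq _ ZE'] PE_mono[of ?q q] by (auto simp: ext_def)
  have Xq: "?X \<subseteq> ?q" using q(2) by blast
  have gen_E': "gen E ?X f t \<subseteq> gen E' X f' t'" if "t \<le> t'" "\<forall>l<t. f' l = f l" "\<And>l. l < t' ==> f' l \<in> E'" for t' f'
  proof
    fix z assume "z \<in> gen E ?X f t"
    then obtain j c where j: "j \<in> ?X" "\<forall>l<t. c l \<in> E" "z = j + (\<Sum>l<t. c l * f l)" using igen_iff[OF sE] by blast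
    let ?c = "\<lambda>l. if l < t then c l else 0"
    have "(\<Sum>l<t'. ?c l * f' l) = (\<Sum>l<t. c l * f l)"
      using that by (intro sum.mono_neutral_cong_right) auto
    moreover have "\<forall>l<t'. ?c l \<in> E'" using j EE' subring_zero[OF sE'] by auto
    ultimately show "z \<in> gen E' X f' t'" unfolding igen_iff[OF sE'] using j(1,3)
      by (intro bexI[of _ j] exI[of _ ?c]) auto
  qed
  have ext_gen: "\<exists>s\<in>E. s \<notin> ?q \<and> s * poly G Z \<in> gen E' X f' t'"
    if G: "G \<in> PE ?q" and f': "t \<le> t'" "\<forall>l<t. f' l = f l" "\<And>l. l < t' ==> f' l \<in> E'" for G t' f'
  proof -
    have igE: "ideal_in E' (gen E' X f' t')" by (rule gen_ideal[OF sE' X]) (use f'(3) in auto)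
    have "\<exists>s\<in>E. s \<notin> ?q \<and> (\<forall>i<n. s * coeff G i \<in> gen E' X f' t')" for n
    proof (induction n)
      case 0 then show ?case using subring_one[OF sE] prime_not_one[OF pq] by auto
    next
      case (Suc n)
      then obtain s where s: "s \<in> E" "s \<notin> ?q" "\<forall>i<n. s * coeff G i \<in> gen E' X f' t'" by blast
      obtain r where r: "r \<in> E" "r \<notin> ?q" "r * coeff G n \<in> gen E ?X f t" using gs[of "coeff G n"] G by (auto simp: PE_def)
      have rn: "r * coeff G n \<in> gen E' X f' t'" using gen_E'[OF f'] r by blast
      have "s * r \<notin> ?q" using prime_mult[OF pq s(1) r(1)] s r by blast
      moreover have "s * r \<in> E" using subring_mult[OF sE s(1) r(1)] .
      moreover have "s * r * coeff G i \<in> gen E' X f' t'" if "i < Suc n" for i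
      proof (cases "i = n")
        case True
        then show ?thesis using ideal_mult[OF igE _ rn, of s] s EE' by (auto simp: mult_ac)
      next
        case False
        then have "s * coeff G i \<in> gen E' X f' t'" using s that by simp
        from ideal_mult[OF igE _ this, of r] show ?thesis using r EE' by (auto simp: mult_ac)
      qed
      ultimately show ?case by blast
    qed
    from this[of "Suc (degree G)"] obtain s where s: "s \<in> E" "s \<notin> ?q"
      "\<And>i. i < Suc (degree G) ==> s * coeff G i \<in> gen E' X f' t'" by blast
    have "s * poly G Z = (\<Sum>i\<le>degree G. Z ^ i * (s * coeff G i))"
      unfolding poly_altdef by (simp add: sum_distrib_left mult_ac)
    also have "\<dots> \<in> gen E' X f' t'"
    proof (rule ideal_sum[OF igE])
      show "Z ^ i * (s * coeff G i) \<in> gen E' X f' t'" if "i \<in> {..degree G}" for i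
        using ideal_mult[OF igE subring_power[OF sE' ZE'] s(3)] that by simp
    qed
    finally show ?thesis using s by blast
  qed
  show ?thesis
  proof (cases "ext ?q = q")
    case True
    have fE': "f l \<in> E'" if "l < t" for l using f[OF that] EE' by blast
    have "\<exists>s\<in>E' - q. s * g \<in> gen E' X f t" if "g \<in> q" for g
    proof -
      obtain G where "G \<in> PE ?q" "g = poly G Z" using \<open>g \<in> q\<close> True unfolding ext_def by blast
      then obtain s where "s \<in> E" "s \<notin> ?q" "s * g \<in> gen E' X f t" using ext_gen[of G t f] fE' by blast
      then show ?thesis using EE' by blast
    qed
    moreover have "pchain E' X t (\<lambda>i. ext (P i))" unfolding pchain_def using extP extP_less Xext by simp
    ultimately have "generic_sys E' X q t f"
      unfolding generic_sys_def using True P(2) f by (intro conjI exI[of _ "\<lambda>i. ext (P i)"]) auto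
    moreover have "Z \<notin> q"
    proof
      assume "Z \<in> q"
      have X1: "[:0, 1:] \<in> PE E" using sE by (auto simp: PE_def coeff_pCons subring_closed split: nat.splits)
      have "poly [:0, 1:] Z \<in> ext ?q" using \<open>Z \<in> q\<close> True by simp
      then have "coeff [:0, 1:] 1 \<in> ?q" using ext_iff[OF X1 ipq Xq] unfolding PE_def by blast
      then show False using prime_not_one[OF pq] by simp
    qed
    ultimately show ?thesis by (intro that[of t f]) auto
  next
    case False
    \<comment> \<open>The polynomials witnessing that \<open>q\<close> is not extended.
      Pseudo-division by one of least degree leaves remainders that are not bad, so this one
      polynomial generates the rest of \<open>q\<close> up to multipliers outside
      \<open>q\<close>.\<close>
    define bad where "bad H \<longleftrightarrow> H \<in> PE E \<and> poly H Z \<in> q \<and> H \<notin> PE ?q" for H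
    have bad_deg: "0 < degree H" if "bad H" for H
    proof (rule ccontr)
      assume "\<not> 0 < degree H"
      then obtain c where c: "H = [:c:]" using degree_eq_zeroE[of H] by auto
      then have "c \<in> q" "c \<in> E" using that by (auto simp: bad_def PE_def coeff_pCons dest: spec[of _ 0])
      then show False using that c ideal_zero[OF ipq] by (auto simp: bad_def PE_def coeff_pCons split: nat.splits)
    qed
    have "\<exists>H. bad H"
    proof -
      obtain z where z: "z \<in> q" "z \<notin> ext ?q" using False ext_q by blast
      then obtain G where "G \<in> PE E" "z = poly G Z" using ideal_sub[OF iq] E' by auto
      then show ?thesis using z by (auto simp: bad_def ext_def)
    qed
    then obtain H0 where H0: "bad H0" "\<And>H. bad H ==> degree H0 \<le> degree H"
      using ex_has_least_nat[of bad _ degree] by blast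
    \<comment> \<open>If \<open>Z\<close> itself is in \<open>q\<close>, it is preferred as the
      witness of least degree, so that the prescribed quotients enter the system.\<close>
    define H where "H = (if Z \<in> q then [:0, 1:] else H0)"
    have badH: "bad H" and Hmin: "\<And>G. bad G ==> degree H \<le> degree G"
    proof -
      have "bad [:0, 1:]" if "Z \<in> q"
      proof -
        have "coeff [:0, 1:] 1 \<notin> ?q" using prime_not_one[OF pq] by simp
        then have "[:0, 1:] \<notin> PE ?q" unfolding PE_def by blast
        then show ?thesis using that sE by (auto simp: bad_def PE_def coeff_pCons subring_closed split: nat.splits)
      qed
      then show "bad H" using H0 by (simp add: H_def)
      show "degree H \<le> degree G" if "bad G" for G using bad_deg[OF that] H0(2)[OF that] by (simp add: H_def)
    qed
    have HE: "H \<in> PE E" "poly H Z \<in> q" "H \<notin> PE ?q" using badH by (auto simp: bad_def)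
    have lE: "lead_coeff H \<in> E" using HE by (simp add: PE_def)
    \<comment> \<open>A leading term with coefficient in \<open>?q\<close> could be subtracted,
      leaving a bad polynomial of smaller degree.\<close>
    have lq: "lead_coeff H \<notin> ?q"
    proof
      assume l: "lead_coeff H \<in> ?q"
      let ?M = "monom (lead_coeff H) (degree H)"
      have M: "?M \<in> PE ?q" by (rule PE_monom[OF ideal_zero[OF ipq] l])
      then have ME: "?M \<in> PE E" using PE_mono[of ?q E] by blast
      have "poly ?M Z \<in> q" using M ext_q by (auto simp: ext_def)
      then have "poly (H - ?M) Z \<in> q" using ideal_diff[OF sE' iq HE(2)] by simp
      moreover have "H - ?M \<notin> PE ?q" using PE_add[OF sE ipq _ M, of "H - ?M"] HE(3) by auto
      ultimately have "bad (H - ?M)" using PE_diff[OF sE iE HE(1) ME] by (simp add: bad_def)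
      moreover have "degree (H - ?M) < degree H"
      proof -
        have "degree (H - ?M) \<le> degree H" using degree_diff_le[of H "degree H" ?M] degree_monom_le[of "lead_coeff H" "degree H"] by simp
        moreover have "coeff (H - ?M) (degree H) = 0" by simp
        moreover have "0 \<in> PE ?q" using ideal_zero[OF ipq] by (simp add: PE_def)
        then have "H - ?M \<noteq> 0" using \<open>H - ?M \<notin> PE ?q\<close> by metis
        ultimately show ?thesis using leading_coeff_0_iff[of "H - ?M"] by (metis le_neq_implies_less)
      qed
      ultimately show False using Hmin by fastforce
    qed
    let ?f = "f(t := poly H Z)"
    have fE': "?f l \<in> E'" if "l < Suc t" for l using that f[of l] EE' pE'[OF HE(1)] by (auto simp: less_Suc_eq)
    have "\<exists>s\<in>E' - q. s * g \<in> gen E' X ?f (Suc t)" if gq: "g \<in> q" for g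
    proof -
      obtain G where G: "G \<in> PE E" "g = poly G Z" using ideal_sub[OF iq gq] E' by auto
      obtain M Q D where D: "Q \<in> PE E" "D \<in> PE E" "smult (lead_coeff H ^ M) G = H * Q + D" "degree D < degree H"
        using PE_pseudo_division[OF sE HE(1) bad_deg[OF badH] G(1)] by blast
      let ?l = "lead_coeff H ^ M"
      have lM: "?l \<in> E" "?l \<notin> ?q" using subring_power[OF sE lE] prime_power[OF sE pq lE] lq by blast+
      have ev: "?l * g = poly H Z * poly Q Z + poly D Z" using arg_cong[OF D(3), of "\<lambda>p. poly p Z"] G(2) by simp
      have "poly D Z \<in> q"
      proof -
        have "?l * g - poly Q Z * poly H Z \<in> q"
          using ideal_mult[OF iq _ gq, of ?l] ideal_mult[OF iq pE'[OF D(1)] HE(2)] lM EE' by (auto intro!: ideal_diff[OF sE' iq])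
        then show ?thesis using ev by (simp add: mult.commute)
      qed
      then have "D \<in> PE ?q" using D Hmin[of D] by (auto simp: bad_def)
      then obtain s where s: "s \<in> E" "s \<notin> ?q" "s * poly D Z \<in> gen E' X ?f (Suc t)"
        using ext_gen[of D "Suc t" ?f] fE' by auto
      have ig: "ideal_in E' (gen E' X ?f (Suc t))" by (rule gen_ideal[OF sE' X fE'])
      have "?f t \<in> gen E' X ?f (Suc t)" by (rule gen_mem[OF sE' X]) (use fE' in auto)
      then have "s * poly Q Z * poly H Z \<in> gen E' X ?f (Suc t)"
        using ideal_mult[OF ig, of "s * poly Q Z"] s EE' pE'[OF D(1)] sE' by (auto simp: subring_mult)
      then have "s * poly Q Z * poly H Z + s * poly D Z \<in> gen E' X ?f (Suc t)" using ideal_add[OF ig] s by blast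
      moreover have "s * ?l * g = s * (?l * g)" by simp
      ultimately have "s * ?l * g \<in> gen E' X ?f (Suc t)" unfolding ev by (simp add: algebra_simps)
      moreover have "s * ?l \<in> E' - q"
        using prime_mult[OF pq s(1) lM(1)] subring_mult[OF sE s(1) lM(1)] s lM EE' by blast
      ultimately show ?thesis by blast
    qed
    moreover have "pchain E' X (Suc t) ((\<lambda>i. ext (P i))(Suc t := q))"
      unfolding pchain_def using extP extP_less Xext q False ext_q P(2) by (auto simp: less_Suc_eq le_Suc_eq)
    ultimately have "generic_sys E' X q (Suc t) ?f"
      unfolding generic_sys_def using HE(2) f by (intro conjI exI[of _ "(\<lambda>i. ext (P i))(Suc t := q)"]) (auto simp: less_Suc_eq)
    then show ?thesis by (rule that) (auto simp: H_def)
  qed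
qed

lemma subring_Int_ideal:
  assumes "subring E" "E \<subseteq> C" "ideal_in C q" shows "ideal_in E (q \<inter> E)"
  using assms by (auto simp: ideal_in_def subring_def)

lemma subring_Int_prime:
  assumes "subring E" "E \<subseteq> C" "prime_in C q" shows "prime_in E (q \<inter> E)"
proof (rule prime_inI)
  show "ideal_in E (q \<inter> E)" by (rule subring_Int_ideal[OF assms(1,2) prime_ideal[OF assms(3)]])
  show "1 \<notin> q \<inter> E" using prime_not_one[OF assms(3)] by simp
  show "b \<in> q \<inter> E" if "a \<in> E" "b \<in> E" "a * b \<in> q \<inter> E" "a \<notin> q \<inter> E" for a b
    using prime_mult[OF assms(3), of a b] that assms(2) by blast
qed (rule subring_one[OF assms(1)])

lemma blow_igen_first: assumes sA: "subring A" and x: "y 0 \<in> A" "y 0 \<noteq> 0" shows "blow A (igen A y (Suc 0)) (y 0) = A"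
proof
  have ig: "igen A y (Suc 0) = pid A (y 0)" by (simp add: pid_adj)
  have "jpow A A (pid A (y 0)) k \<subseteq> pid A (y 0 ^ k)" for k
  proof (induction k)
    case 0 then show ?case by (simp add: pid_one)
  next
    case (Suc k)
    show ?case unfolding jpow.simps
    proof (rule iprod_least[OF pid_ideal[OF sA]])
      show "y 0 ^ Suc k \<in> A" using x sA by (intro subring_power)
      fix a b assume "a \<in> jpow A A (pid A (y 0)) k" "b \<in> pid A (y 0)"
      then obtain a' b' where "a' \<in> A" "a = a' * y 0 ^ k" "b' \<in> A" "b = b' * y 0" using Suc by (auto simp: pid_def)
      then show "a * b \<in> pid A (y 0 ^ Suc k)"
        unfolding pid_def using subring_mult[OF sA] by (intro CollectI exI[of _ "a' * b'"]) (auto simp: mult_ac)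
    qed
  qed
  then show "blow A (igen A y (Suc 0)) (y 0) \<subseteq> A" using x unfolding ig blow_def pid_def by fastforce
  show "A \<subseteq> blow A (igen A y (Suc 0)) (y 0)" by (rule subring_of_ring[OF sA])
qed

lemma blow_Int_maximal:
  assumes y: "regsys A m y d" and d: "0 < d" shows "pid (blow A m (y 0)) (y 0) \<inter> A = m"
proof -
  note R = regsysD[OF y]
  have "a \<in> pid (blow A m (y 0)) (y 0) \<longleftrightarrow> a \<in> m" if "a \<in> A" for a
    using blow_x_mem_iff[OF y d, of a 0] that jpow_self[OF R(7,8), of 0] by simp
  then show ?thesis using ideal_subset[OF R(8)] by blast
qed

text \<open>The quotients \<open>y (Suc l) / y 0\<close> are adjoined one at a time. Each of the
  first \<open>r\<close> lies in \<open>q\<close> and contributes itself, and no step contributes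
  more than one element. The clause \<open>i \<le> r --> t = i\<close> pins down the index at which
  the next quotient is stored.\<close>

lemma blow_generic_sys:
  assumes y: "regsys A m y d" and q: "prime_in (blow A m (y 0)) q" "m \<subseteq> q"
    and r: "\<And>l. l < r ==> y (Suc l) / y 0 \<in> q"
  shows "Suc i \<le> d ==> \<exists>t f. generic_sys (blow A (igen A y (Suc i)) (y 0)) (pid (blow A m (y 0)) (y 0) \<inter> blow A (igen A y (Suc i)) (y 0))
     (q \<inter> blow A (igen A y (Suc i)) (y 0)) t f \<and> min r i \<le> t \<and> t \<le> i \<and> (\<forall>l<min r i. f l = y (Suc l) / y 0) \<and> (i \<le> r --> t = i)"
proof (induction i)
  note R = regsysD[OF y]
  let ?C = "blow A m (y 0)" and ?X = "pid (blow A m (y 0)) (y 0)"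
  case 0
  then have d: "0 < d" by simp
  note B = blow_facts[OF y d]
  have E: "blow A (igen A y (Suc 0)) (y 0) = A" using blow_igen_first[of A y] R(7) B(2,3) by blast
  have "q \<inter> A = m" using local_max[OF R(2) subring_Int_prime[OF R(7) B(6) q(1)]] q(2) ideal_subset[OF R(8)] by blast
  moreover have "generic_sys A m m 0 (\<lambda>_. 0)"
    unfolding generic_sys_def pchain_def using local_prime[OF R(2)] local_not_one[OF R(2)] subring_one[OF R(7)]
    by (auto intro!: bexI[of _ 1] exI[of _ "\<lambda>_. m"])
  ultimately show ?case unfolding E blow_Int_maximal[OF y d] by (intro exI[of _ 0] exI[of _ "\<lambda>_. 0"]) simp
next
  case (Suc i)
  note R = regsysD[OF y]
  let ?C = "blow A m (y 0)" and ?X = "pid (blow A m (y 0)) (y 0)"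
  let ?E = "blow A (igen A y (Suc i)) (y 0)" and ?E' = "blow A (igen A y (Suc (Suc i))) (y 0)"
  have d: "0 < d" "Suc i < d" using Suc.prems by auto
  note B = blow_facts[OF y d(1)]
  have I: "ideal_in A (igen A y (Suc i))" "ideal_in A (igen A y (Suc (Suc i)))"
    using d R(4) by (intro igen_ideal[OF R(7)]; simp)+
  have xI: "y 0 \<in> igen A y (Suc i)" by (rule gen_mem[OF R(7) ideal_zero_ideal[OF R(7)]]) (use d R(4) in auto)
  have xI': "y 0 \<in> igen A y (Suc (Suc i))" using xI adj_sub[OF R(7)] by auto
  have Im: "igen A y (Suc (Suc i)) \<subseteq> m" using d R(3) ideal_zero[OF R(8)] by (intro gen_least[OF R(8)]) auto
  have sE: "subring ?E" "subring ?E'" using blow_subring[OF R(7)] I xI xI' B(3) by auto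
  have EC: "?E' \<subseteq> ?C" "?E \<subseteq> ?E'"
    using blow_mono[OF R(7,8) Im] blow_mono[OF R(7) I(2), of "igen A y (Suc i)"] adj_sub[OF R(7)] by auto
  have E': "?E' = {poly G (y (Suc i) / y 0) | G. G \<in> PE ?E}"
    using blow_adj[OF R(7) I(1) xI B(3) R(4)[OF d(2)]] by simp
  have Xm: "?X \<subseteq> q" using q B prime_ideal[OF q(1)] by (intro pid_least) auto
  have tr: "G \<in> PE (?X \<inter> ?E' \<inter> ?E)" if G: "G \<in> PE ?E" "poly G (y (Suc i) / y 0) \<in> ?X \<inter> ?E'" for G
  proof -
    \<comment> \<open>Transcendence is available for the last parameter, so \<open>y (Suc i)\<close>
      is swapped there; the parameters used so far keep their places.\<close>
    let ?z = "y \<circ> Transposition.transpose (Suc i) (d - 1)"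
    have z: "regsys A m ?z (Suc (d - 1))" using regsys_swap[OF y d(2), of "d - 1"] d by simp
    have zy: "?z l = y l" if "l < Suc i" for l using that d by (auto simp: Transposition.transpose_def)
    have "igen A y (Suc i) = igen A ?z (Suc i)" by (rule gen_cong) (use zy in auto)
    also have "\<dots> \<subseteq> igen A ?z (d - 1)" using d by (intro gen_mono_n[OF R(7)]) auto
    finally have "igen A y (Suc i) \<subseteq> igen A ?z (d - 1)" .
    moreover have "?z (d - 1) = y (Suc i)" by simp
    ultimately have "G \<in> PE ?X" using blow_transcendental[OF y d(1) z _ xI I(1) G(1)] G(2) by simp
    then show ?thesis using G(1) EC by (auto simp: PE_def)
  qed
  obtain t f where t: "generic_sys ?E (?X \<inter> ?E) (q \<inter> ?E) t f" "min r i \<le> t" "t \<le> i"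
    "\<forall>l<min r i. f l = y (Suc l) / y 0" "i \<le> r --> t = i" using Suc.IH d by auto
  have Xi: "ideal_in ?E' (?X \<inter> ?E')" by (rule subring_Int_ideal[OF sE(2) EC(1) pid_ideal[OF B(5,7)]])
  have qi: "prime_in ?E' (q \<inter> ?E')" by (rule subring_Int_prime[OF sE(2) EC(1) q(1)])
  have EE: "?X \<inter> ?E' \<inter> ?E = ?X \<inter> ?E" "q \<inter> ?E' \<inter> ?E = q \<inter> ?E" using EC by auto
  have Xq: "?X \<inter> ?E' \<subseteq> q \<inter> ?E'" using Xm by blast
  obtain t' f' where t': "generic_sys ?E' (?X \<inter> ?E') (q \<inter> ?E') t' f'" "t \<le> t'" "t' \<le> Suc t" "\<forall>l<t. f' l = f l"
    "y (Suc i) / y 0 \<in> q \<inter> ?E' ==> t' = Suc t \<and> f' t = y (Suc i) / y 0"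
    using generic_sys_step[OF sE E' Xi qi Xq tr, of t f] t(1) unfolding EE by blast
  have ZE: "y (Suc i) / y 0 \<in> ?E'"
    unfolding E' using sE(1) by (intro CollectI exI[of _ "[:0, 1:]"]) (auto simp: PE_def coeff_pCons subring_closed split: nat.splits)
  have new: "t' = Suc t \<and> f' t = y (Suc i) / y 0" if "i < r" using t'(5) r[OF that] ZE by blast
  show ?case
  proof (intro exI[of _ t'] exI[of _ f'] conjI)
    show "generic_sys ?E' (?X \<inter> ?E') (q \<inter> ?E') t' f'" by (rule t'(1))
    have "t \<le> i" "i \<le> r --> t = i" "min r i \<le> t" using t by auto
    then show "min r (Suc i) \<le> t'" "t' \<le> Suc i" "Suc i \<le> r --> t' = Suc i"
      using new t'(2,3) by (cases "i < r"; simp)+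
    show "\<forall>l<min r (Suc i). f' l = y (Suc l) / y 0"
    proof (intro allI impI)
      fix l assume l: "l < min r (Suc i)"
      show "f' l = y (Suc l) / y 0"
      proof (cases "l = i")
        case True then show ?thesis using new t(5) l by auto
      next
        case False then show ?thesis using t t' l by auto
      qed
    qed
  qed
qed

text \<open>The \<open>y (Suc l) / y 0\<close> in \<open>q\<close> are chosen first, so they are part of the system.\<close>

theorem transform_regsys:
  assumes y: "regsys A m y d" and d: "0 < d" and q: "prime_in (blow A m (y 0)) q" "m \<subseteq> q"
    and B: "noetherian (loc_at (blow A m (y 0)) q)"
    and r: "r < d" "\<And>l. l < r ==> y (Suc l) / y 0 \<in> q"
  obtains w e where "regsys (loc_at (blow A m (y 0)) q) (mloc (blow A m (y 0)) q) w e"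
    "r < e" "e \<le> d" "w 0 = y 0" "\<And>l. l < r ==> w (Suc l) = y (Suc l) / y 0"
proof -
  note R = regsysD[OF y] and F = blow_facts[OF y d]
  let ?C = "blow A m (y 0)" and ?X = "pid (blow A m (y 0)) (y 0)"
  let ?B = "loc_at ?C q" and ?n = "mloc ?C q" and ?U = "?C - q"
  obtain t f where t: "generic_sys (blow A (igen A y (Suc (d - 1))) (y 0)) (?X \<inter> blow A (igen A y (Suc (d - 1))) (y 0))
     (q \<inter> blow A (igen A y (Suc (d - 1))) (y 0)) t f" "min r (d - 1) \<le> t" "t \<le> d - 1"
     "\<forall>l<min r (d - 1). f l = y (Suc l) / y 0"
    using blow_generic_sys[OF y q r(2), of r "d - 1"] d by (auto simp del: gen.simps)
  have "igen A y (Suc (d - 1)) = m" using R(5) d by simp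
  moreover have "?X \<inter> ?C = ?X" "q \<inter> ?C = q"
    using ideal_subset[OF pid_ideal[OF F(5,7)]] ideal_subset[OF prime_ideal[OF q(1)]] by auto
  ultimately have g: "generic_sys ?C ?X q t f" using t(1) by (simp del: gen.simps)
  from g obtain P where f: "\<And>l. l < t ==> f l \<in> q" and P: "pchain ?C ?X t P" "P t = q"
    and gs: "\<And>g. g \<in> q ==> \<exists>s\<in>?C - q. s * g \<in> gen ?C ?X f t"
    unfolding generic_sys_def by blast
  note PD = pchainD[OF P(1)]
  note U = prime_compl_mult[OF F(5) q(1)] and LB = loc_at_local[OF F(5) q(1)] and iq = prime_ideal[OF q(1)]
  note Beq = loc_at_eq[of ?C q] and neq = mloc_eq[of ?C q]
  have sB: "subring ?B" using LB by (rule local_subring)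
  have CB: "?C \<subseteq> ?B" "q \<subseteq> ?n" unfolding Beq neq using loc_incl[OF F(5) U] by blast+
  define w where "w l = (if l = 0 then y 0 else f (l - 1))" for l
  have wn: "w l \<in> ?n" if "l < Suc t" for l using that f[of "l - 1"] CB q F(1) by (auto simp: w_def)
  have nB: "?n \<subseteq> ?B" using LB local_ideal ideal_subset by blast
  have igB: "ideal_in ?B (igen ?B w (Suc t))" using wn nB by (intro igen_ideal[OF sB]) blast
  have wB: "w l \<in> igen ?B w (Suc t)" if "l < Suc t" for l
    by (rule gen_mem[OF sB ideal_zero_ideal[OF sB] _ that]) (use wn nB in blast)
  have "gen ?C ?X f t \<subseteq> igen ?B w (Suc t) \<inter> ?C"
  proof (rule gen_least)
    show iC: "ideal_in ?C (igen ?B w (Suc t) \<inter> ?C)" by (rule subring_Int_ideal[OF F(5) CB(1) igB])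
    show "?X \<subseteq> igen ?B w (Suc t) \<inter> ?C" using wB[of 0] F(7) by (intro pid_least[OF iC]) (simp add: w_def)
    show "f l \<in> igen ?B w (Suc t) \<inter> ?C" if "l < t" for l using wB[of "Suc l"] f[OF that] ideal_sub[OF iq] that by (simp add: w_def)
  qed
  have "?n \<subseteq> igen ?B w (Suc t)"
  proof
    fix z assume "z \<in> ?n"
    then obtain g b where z: "g \<in> q" "b \<in> ?C" "b \<notin> q" "z = g / b" unfolding mloc_def by blast
    obtain s where s: "s \<in> ?C - q" "s * g \<in> gen ?C ?X f t" using gs[OF z(1)] by blast
    have sb: "s * b \<in> ?U" using prime_mult[OF q(1), of s b] s z subring_mult[OF F(5)] by blast
    have "s \<noteq> 0" using s ideal_zero[OF iq] by blast
    then have "z = inverse (s * b) * (s * g)" unfolding z(4) by (simp add: field_simps)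
    moreover have "inverse (s * b) \<in> ?B" unfolding Beq by (rule loc_inverse[OF F(5) U sb])
    moreover have "s * g \<in> igen ?B w (Suc t)" using s(2) \<open>gen ?C ?X f t \<subseteq> _\<close> by blast
    ultimately show "z \<in> igen ?B w (Suc t)" using ideal_mult[OF igB] by simp
  qed
  moreover have "igen ?B w (Suc t) \<subseteq> ?n"
    using wn ideal_zero[OF local_ideal[OF LB]] by (intro gen_least[OF local_ideal[OF LB]]) auto
  ultimately have gen: "?n = igen ?B w (Suc t)" by blast
  have Pq: "P i \<inter> ?U = {}" if "i \<le> t" for i
  proof -
    have "P i \<subseteq> P t" using that
    proof (induction rule: inc_induct)
      case (step n) then show ?case using PD(2)[of n] by auto
    qed simp
    then show ?thesis using P(2) by blast
  qed
  \<comment> \<open>The chain above \<open>?X\<close> has length \<open>t\<close>. The zero ideal,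
    which lacks \<open>y 0\<close>, is put below it and brings the length to the number
    \<open>Suc t\<close> of generators.\<close>
  define Q where "Q i = (if i = 0 then {0} else loc_mult (P (i - 1)) ?U)" for i
  have "pchain ?B {0} (Suc t) Q"
    unfolding pchain_def
  proof (intro conjI allI impI)
    show "prime_in ?B (Q i)" if "i \<le> Suc t" for i
      using that loc_prime[OF F(5) U PD(1)[of "i - 1"] Pq] prime_zero_ideal[OF sB] by (auto simp: Q_def Beq)
    fix i assume i: "i < Suc t"
    show "Q i \<subset> Q (Suc i)"
    proof (cases i)
      case 0
      have "y 0 \<in> P 0" using PD(3) pid_mem[OF F(5)] by blast
      then have "y 0 \<in> Q 1" using loc_incl[OF F(5) U, of "P 0"] by (auto simp: Q_def)
      moreover have "0 \<in> Q 1" using prime_zero[OF PD(1)[of 0]] loc_incl[OF F(5) U, of "P 0"] by (auto simp: Q_def)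
      ultimately show ?thesis using 0 F(3) by (auto simp: Q_def)
    next
      case (Suc k)
      have k: "k < t" "k \<le> t" "Suc k \<le> t" using Suc i by auto
      have "loc_mult (P k) ?U \<subseteq> loc_mult (P (Suc k)) ?U" using PD(2)[OF k(1)] by (auto simp: loc_mult_def)
      moreover have "loc_mult (P k) ?U \<noteq> loc_mult (P (Suc k)) ?U"
      proof
        assume eq: "loc_mult (P k) ?U = loc_mult (P (Suc k)) ?U"
        have "P k = loc_mult (P k) ?U \<inter> ?C" by (rule contr_loc_prime[OF F(5) U PD(1)[OF k(2)] Pq[OF k(2)], symmetric])
        also have "\<dots> = P (Suc k)" unfolding eq by (rule contr_loc_prime[OF F(5) U PD(1)[OF k(3)] Pq[OF k(3)]])
        finally show False using PD(2)[OF k(1)] by simp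
      qed
      ultimately show ?thesis using Suc by (simp add: Q_def psubset_eq)
    qed
  qed (simp add: Q_def)
  then have "regsys ?B ?n w (Suc t)" unfolding regsys_def using B LB wn gen by blast
  then show ?thesis
    by (rule that) (use t r(1) in \<open>auto simp: w_def\<close>)
qed

section \<open>Divisors and valuation rings under one transform\<close>

lemma loc_pid_Int:
  assumes sA: "subring A" and U: "mult_closed_in A U" and p: "prime_in A (pid A p)" "pid A p \<inter> U = {}"
  shows "pid (loc_mult A U) p \<inter> A = pid A p" "prime_in (loc_mult A U) (pid (loc_mult A U) p)"
  unfolding loc_pid[OF sA U, symmetric] using contr_loc_prime[OF sA U p] loc_prime[OF sA U p] by auto

lemma regsys_pel: assumes y: "regsys A m y d" and i: "i < d" shows "pel A (y i)"
proof -
  note R = regsysD[OF y]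
  let ?z = "y \<circ> Transposition.transpose i 0"
  have z: "regsys A m ?z d" using regsys_swap[OF y i, of 0] i by simp
  have "?z 0 = y i" by simp
  moreover have "igen A ?z 1 = pid A (?z 0)" by (simp add: pid_adj)
  moreover have "prime_in A (igen A ?z 1)" by (rule regsys_prime[OF z]) (use i in simp)
  moreover have "?z 0 \<noteq> 0" using regsys_notin[OF z, of 0] i by simp
  ultimately show ?thesis unfolding pel_def using R(4)[OF i] by simp
qed

lemma indepD:
  assumes "indep A m p r" "\<forall>i<r. c i \<in> A" "(\<Sum>i<r. c i * p i) \<in> ideal_pow A m 2" "i < r"
  shows "c i \<in> m"
  using assms by (simp add: indep_def)

lemma indep_subfamily:
  assumes sA: "subring A" and z: "indep A m z e" and s: "inj_on s {..<r}" "s ` {..<r} \<subseteq> {..<e}"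
  shows "indep A m (\<lambda>i. z (s i)) r"
  unfolding indep_def
proof (intro conjI allI impI)
  show "z (s i) \<in> m" if "i < r" for i using z s that by (auto simp: indep_def)
  fix c i assume c: "\<forall>i<r. c i \<in> A" "(\<Sum>i<r. c i * z (s i)) \<in> ideal_pow A m 2" and i: "i < r"
  let ?b = "\<lambda>l. if l \<in> s ` {..<r} then c (inv_into {..<r} s l) else 0"
  have inv: "inv_into {..<r} s (s i) = i" if "i < r" for i using s(1) that by (simp add: inv_into_f_f)
  have "(\<Sum>l<e. ?b l * z l) = (\<Sum>l\<in>s ` {..<r}. c (inv_into {..<r} s l) * z l)"
    using s(2) by (intro sum.mono_neutral_cong_right) auto
  also have "\<dots> = (\<Sum>i<r. c i * z (s i))" using s(1) inv by (subst sum.reindex) auto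
  finally have "(\<Sum>l<e. ?b l * z l) \<in> ideal_pow A m 2" using c(2) by simp
  moreover have "\<forall>l<e. ?b l \<in> A" using c(1) inv sA by (auto simp: subring_zero)
  moreover have "s i < e" using s(2) i by auto
  ultimately have "?b (s i) \<in> m" using indepD[OF z, of ?b "s i"] by blast
  then show "c i \<in> m" using i inv by simp
qed

lemma regsys_not_pow2: assumes y: "regsys A m y d" and i: "i < d" shows "y i \<notin> ideal_pow A m 2"
proof
  note R = regsysD[OF y]
  assume "y i \<in> ideal_pow A m 2"
  moreover have "indep A m (\<lambda>_. y i) 1"
    using indep_subfamily[OF R(7) regsys_indep[OF y], of "\<lambda>_. i" 1] i by (auto simp: inj_on_def)
  then have "1 \<in> m" if "y i \<in> ideal_pow A m 2"
    using indepD[of A m "\<lambda>_. y i" 1 "\<lambda>_. 1" 0] that subring_one[OF R(7)] by simp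
  ultimately show False using local_not_one[OF R(2)] by simp
qed

lemma regsys_not_dvd: assumes y: "regsys A m y d" and i: "i < d" "j < d" "i \<noteq> j" shows "y i \<notin> pid A (y j)"
proof
  note R = regsysD[OF y]
  let ?s = "\<lambda>l. if l = 0 then i else j"
  assume "y i \<in> pid A (y j)"
  then obtain a where a: "a \<in> A" "y i = a * y j" by (rule pid_memE)
  let ?c = "\<lambda>l. if l = 0 then 1 else - a"
  have I: "indep A m (\<lambda>l. y (?s l)) 2"
    using i by (intro indep_subfamily[OF R(7) regsys_indep[OF y]]) (auto simp: inj_on_def split: if_splits)
  have "(\<Sum>l<2::nat. ?c l * y (?s l)) = 0" using a by (simp add: numeral_2_eq_2)
  then have "(\<Sum>l<2::nat. ?c l * y (?s l)) \<in> ideal_pow A m 2" using ideal_zero[OF ideal_pow_ideal[OF R(7,8)]] by metis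
  moreover have "\<forall>l<2::nat. ?c l \<in> A" using a R(7) by (auto simp: subring_closed)
  ultimately have "?c 0 \<in> m" using indepD[OF I, of ?c 0] by simp
  then show False using local_not_one[OF R(2)] by simp
qed

context
  fixes A m :: "'a::field set" and y :: "nat => 'a" and d :: nat and q :: "'a set"
  assumes y: "regsys A m y d" and d: "0 < d" and q: "prime_in (blow A m (y 0)) q" "m \<subseteq> q"
begin

abbreviation (input) "tC \<equiv> blow A m (y 0)"
abbreviation (input) "tB \<equiv> loc_at tC q"
abbreviation (input) "tn \<equiv> mloc tC q"

lemma transform_facts:
  shows "local_ring tB tn" "subring tB" "tC \<subseteq> tB" "A \<subseteq> tB" "q \<subseteq> tn" "m \<subseteq> tn" "m \<subseteq> pid tB (y 0)" "tB = loc_mult tC (tC - q)"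
    "a \<in> m ==> a / y 0 \<in> tC"
proof -
  note R = regsysD[OF y] and F = blow_facts[OF y d]
  note U = prime_compl_mult[OF F(5) q(1)]
  show "local_ring tB tn" by (rule loc_at_local[OF F(5) q(1)])
  then show "subring tB" by (rule local_subring)
  show "tB = loc_mult tC (tC - q)" by (rule loc_at_eq)
  then show CB: "tC \<subseteq> tB" using loc_incl[OF F(5) U, of tC] by simp
  then show "A \<subseteq> tB" using F(6) by blast
  show "q \<subseteq> tn" unfolding mloc_eq by (rule loc_incl[OF F(5) U])
  then show "m \<subseteq> tn" using q(2) by blast
  show ax: "a / y 0 \<in> tC" if "a \<in> m" for a
    using that jpow_self[OF R(7,8), of 0] by (intro blow_memI[of a A m 1]) auto
  show "m \<subseteq> pid tB (y 0)"
  proof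
    fix a assume "a \<in> m"
    then have "a / y 0 * y 0 \<in> pid tB (y 0)" using ax CB by (intro pid_memI) blast
    then show "a \<in> pid tB (y 0)" using F(3) by simp
  qed
qed

text \<open>Away from \<open>y 0\<close> blowing up changes nothing: its powers are admissible
  denominators already over \<open>A\<close>.\<close>

lemma blow_loc_at:
  assumes P: "prime_in tC P" "y 0 \<notin> P" shows "loc_at tC P = loc_at A (P \<inter> A)"
proof
  note R = regsysD[OF y] and F = blow_facts[OF y d]
  show "loc_at A (P \<inter> A) \<subseteq> loc_at tC P" using F(6) unfolding loc_at_def by blast
  show "loc_at tC P \<subseteq> loc_at A (P \<inter> A)"
  proof
    fix z assume "z \<in> loc_at tC P"
    then obtain f g where fg: "f \<in> tC" "g \<in> tC" "g \<notin> P" "z = f / g" unfolding loc_at_def by blast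
    obtain a k where a: "a \<in> jpow A A m k" "f = a / y 0 ^ k" using fg(1) by (rule blow_memE)
    obtain b l where b: "b \<in> jpow A A m l" "g = b / y 0 ^ l" using fg(2) by (rule blow_memE)
    have ab: "a \<in> A" "b \<in> A" using ideal_sub[OF jpow_ideal[OF R(7) ideal_ring[OF R(7)] R(8)]] a b by auto
    have xk: "y 0 ^ i \<in> A" "y 0 ^ i \<in> tC" "y 0 ^ i \<notin> P" for i
      using subring_power[OF R(7) F(2)] F(6) prime_power[OF F(5) P(1) F(7)] P(2) by blast+
    have "b = g * y 0 ^ l" using b F(3) by simp
    then have "b \<notin> P" using prime_mult[OF P(1) fg(2) xk(2)[of l]] fg(3) xk(3) by blast
    then have "b * y 0 ^ k \<notin> P" using prime_mult[OF P(1) _ xk(2)[of k], of b] xk(3) ab F(6) by blast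
    moreover have "z = (a * y 0 ^ l) / (b * y 0 ^ k)" unfolding fg a b using F(3) by (simp add: field_simps)
    moreover have "a * y 0 ^ l \<in> A" "b * y 0 ^ k \<in> A" using ab xk R(7) by (auto simp: subring_mult)
    ultimately show "z \<in> loc_at A (P \<inter> A)" unfolding loc_at_def by blast
  qed
qed

lemma transform_loc_at:
  assumes P: "prime_in tB P" "y 0 \<notin> P" shows "loc_at tB P = loc_at A (P \<inter> A)"
proof -
  note F = blow_facts[OF y d]
  note U = prime_compl_mult[OF F(5) q(1)]
  have P': "prime_in (loc_mult tC (tC - q)) P" using P transform_facts(8) by simp
  have "loc_at tB P = loc_at tC (P \<inter> tC)" unfolding transform_facts(8) by (rule loc_at_loc(1)[OF F(5) U P'])
  also have "\<dots> = loc_at A (P \<inter> tC \<inter> A)" by (rule blow_loc_at[OF contr_prime(1)[OF F(5) U P']]) (use P in simp)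
  finally show ?thesis using F(6) by (simp add: Int_assoc Int_absorb1)
qed

lemma transform_order_valuation:
  assumes qf: "quotient_field_is_ambient A" shows "order_valuation_ring A m = loc_at tB (pid tB (y 0))"
proof -
  note F = blow_facts[OF y d]
  note U = prime_compl_mult[OF F(5) q(1)]
  have "pid tC (y 0) \<subseteq> q" using q F(1) by (intro pid_least prime_ideal) auto
  then have "pid tC (y 0) \<inter> (tC - q) = {}" by blast
  note L = loc_pid_Int[OF F(5) U pelD(3)[OF blow_x_prime[OF y d]] this]
  show ?thesis unfolding order_valuation_ring_eq[OF y d qf] transform_facts(8) loc_at_loc(1)[OF F(5) U L(2)] L(1) ..
qed

text \<open>Suppose a denominator \<open>h / y 0 ^ n\<close> outside \<open>q\<close> had
  \<open>h = b * y (Suc l)\<close>. The parameter has order one, so \<open>b / y 0 ^ (n - 1)\<close>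
  is in the blow-up, and its product with \<open>y (Suc l) / y 0\<close> would put the denominator
  into \<open>q\<close>.\<close>

lemma transform_subset_loc:
  assumes l: "Suc l < d" "y (Suc l) / y 0 \<in> q" shows "tB \<subseteq> loc_at A (pid A (y (Suc l)))"
proof
  note R = regsysD[OF y] and F = blow_facts[OF y d]
  let ?p = "y (Suc l)"
  note pel = regsys_pel[OF y l(1)]
  note pr = pelD(3)[OF pel] and iq = prime_ideal[OF q(1)]
  have xp: "y 0 ^ i \<in> A" "y 0 ^ i \<notin> pid A ?p" for i
    using subring_power[OF R(7) F(2)] prime_power[OF R(7) pr F(2)] regsys_not_dvd[OF y d l(1)] by auto
  fix z assume "z \<in> tB"
  then obtain f g where fg: "f \<in> tC" "g \<in> tC" "g \<notin> q" "z = f / g" unfolding loc_at_def by blast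
  obtain a k where a: "a \<in> jpow A A m k" "f = a / y 0 ^ k" using fg(1) by (rule blow_memE)
  obtain h n where h: "h \<in> jpow A A m n" "g = h / y 0 ^ n" using fg(2) by (rule blow_memE)
  have ah: "a \<in> A" "h \<in> A" using ideal_sub[OF jpow_ideal[OF R(7) ideal_ring[OF R(7)] R(8)]] a h by auto
  have hp: "h \<notin> pid A ?p"
  proof
    assume hp: "h \<in> pid A ?p"
    then obtain b where b: "b \<in> A" "h = b * ?p" by (rule pid_memE)
    have "n \<noteq> 0"
    proof
      assume "n = 0"
      then have "g \<in> pid A ?p" using hp h by simp
      also have "pid A ?p \<subseteq> m" using R(3)[OF l(1)] by (intro pid_least[OF R(8)])
      finally show False using q(2) fg(3) by blast
    qed
    then obtain k where n: "n = Suc k" by (cases n) auto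
    have "b \<in> jpow A A m k"
    proof (cases "b = 0")
      case True then show ?thesis using ideal_zero[OF jpow_ideal[OF R(7) ideal_ring[OF R(7)] R(8)]] by simp
    next
      case False
      note p0 = pelD(1,2)[OF pel]
      have o1: "\<not> 2 \<le> ord_fun A m ?p" using ord_fun_mem[OF y p0, of 2] regsys_not_pow2[OF y l(1)] by blast
      have "h \<noteq> 0" using False p0 b by simp
      then have "n \<le> ord_fun A m h" using ord_fun_mem[OF y ah(2), of n] h by (simp add: ideal_pow_eq_jpow)
      then have "k \<le> ord_fun A m b" using ord_fun_mult[OF y b(1) False p0] o1 unfolding b(2) n by simp
      then show ?thesis using ord_fun_mem[OF y b(1) False, of k] by (simp add: ideal_pow_eq_jpow)
    qed
    then have "b / y 0 ^ k \<in> tC" by (rule blow_memI) simp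
    then have "b / y 0 ^ k * (?p / y 0) \<in> q" using ideal_mult[OF iq] l(2) by blast
    then show False using fg(3) unfolding h(2) b(2) n by (simp add: mult.commute)
  qed
  have "h * y 0 ^ k \<notin> pid A ?p" using prime_mult[OF pr ah(2) xp(1)[of k]] hp xp(2) by blast
  moreover have "z = (a * y 0 ^ n) / (h * y 0 ^ k)" unfolding fg a h using F(3) by (simp add: field_simps)
  moreover have "a * y 0 ^ n \<in> A" "h * y 0 ^ k \<in> A" using ah xp R(7) by (auto simp: subring_mult)
  ultimately show "z \<in> loc_at A (pid A ?p)" unfolding loc_at_def by blast
qed

text \<open>A divisor and its strict transform have the same local ring; this carries a valuation
  ring from one stage to the next.\<close>

lemma transform_pid_loc:
  assumes l: "Suc l < d" "y (Suc l) / y 0 \<in> q" and p: "prime_in tB (pid tB (y (Suc l) / y 0))" "y 0 \<notin> pid tB (y (Suc l) / y 0)"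
  shows "loc_at tB (pid tB (y (Suc l) / y 0)) = loc_at A (pid A (y (Suc l)))"
proof -
  note R = regsysD[OF y] and F = blow_facts[OF y d]
  let ?p = "y (Suc l)" and ?P = "pid tB (y (Suc l) / y 0)"
  note pr = pelD(3)[OF regsys_pel[OF y l(1)]]
  have "?P \<inter> A = pid A ?p"
  proof
    have "?p \<in> ?P" using pid_memI(1)[of "y 0" tB "?p / y 0"] transform_facts(4) F(2,3) by auto
    moreover have "ideal_in A (?P \<inter> A)" by (rule subring_Int_ideal[OF R(7) transform_facts(4) prime_ideal[OF p(1)]])
    ultimately show "pid A ?p \<subseteq> ?P \<inter> A" using R(4)[OF l(1)] by (intro pid_least) auto
    show "?P \<inter> A \<subseteq> pid A ?p"
    proof
      fix a assume a: "a \<in> ?P \<inter> A"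
      then obtain b where b: "b \<in> tB" "a = b * (?p / y 0)" by (auto elim: pid_memE)
      then obtain c s where c: "c \<in> A" "s \<in> A" "s \<notin> pid A ?p" "b = c / s"
        using transform_subset_loc[OF l] unfolding loc_at_def by blast
      have "s \<noteq> 0" using c(3) prime_zero[OF pr] by auto
      then have "a * (y 0 * s) = c * ?p" unfolding b c using F(3) by (simp add: field_simps)
      then have "a * (y 0 * s) \<in> pid A ?p" using c(1) by (simp add: pid_memI)
      moreover have "y 0 * s \<notin> pid A ?p"
        using prime_mult[OF pr F(2) c(2)] c(3) regsys_not_dvd[OF y d l(1)] by auto
      ultimately show "a \<in> pid A ?p" using prime_mult[OF pr, of a "y 0 * s"] a c(2) F(2) R(7) by (auto simp: subring_mult)
    qed
  qed
  then show ?thesis using transform_loc_at[OF p] by simp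
qed

text \<open>A nontrivial relation modulo \<open>m\<^sup>2\<close>, divided by \<open>y 0\<close>, would give \<open>1 \<in> q\<close>.\<close>

lemma transform_indep:
  assumes p: "indep A m p r" "\<And>i. i < r ==> p i / y 0 \<in> q"
  shows "indep A m (\<lambda>i. case i of 0 => y 0 | Suc i => p i) (Suc r)"
  unfolding indep_def
proof (intro conjI allI impI)
  note R = regsysD[OF y] and F = blow_facts[OF y d]
  note iq = prime_ideal[OF q(1)]
  let ?p = "\<lambda>i. case i of 0 => y 0 | Suc i => p i"
  show "?p i \<in> m" if "i < Suc r" for i using that p(1) F(1) by (auto simp: indep_def split: nat.splits)
  fix c i assume c: "\<forall>i<Suc r. c i \<in> A" "(\<Sum>i<Suc r. c i * ?p i) \<in> ideal_pow A m 2" and i: "i < Suc r"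
  have s: "(\<Sum>i<Suc r. c i * ?p i) = c 0 * y 0 + (\<Sum>i<r. c (Suc i) * p i)" by (simp add: sum.lessThan_Suc_shift del: sum.lessThan_Suc)
  note i2 = ideal_pow_ideal[OF R(7,8), of 2]
  have "c 0 \<in> m"
  proof (rule ccontr)
    assume "c 0 \<notin> m"
    then have inv: "inverse (c 0) \<in> A" "c 0 \<noteq> 0" using local_unit[OF R(2)] c by auto
    let ?e = "c 0 * y 0 + (\<Sum>i<r. c (Suc i) * p i)"
    have e2: "?e \<in> ideal_pow A m 2" using c(2) unfolding s .
    have "?e / y 0 \<in> q"
    proof -
      have "?e / (y 0) ^ 2 \<in> tC" using e2 by (intro blow_memI[of ?e A m 2]) (auto simp: ideal_pow_eq_jpow)
      then have "?e / (y 0) ^ 2 * y 0 \<in> q" using ideal_mult[OF iq, of _ "y 0"] q(2) F(1) by blast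
      then show ?thesis using F(3) by (simp add: power2_eq_square)
    qed
    moreover have "(\<Sum>i<r. c (Suc i) * (p i / y 0)) \<in> q"
      using c(1) F(6) p(2) by (intro ideal_sum[OF iq] ideal_mult[OF iq]) auto
    moreover have "?e / y 0 - (\<Sum>i<r. c (Suc i) * (p i / y 0)) = c 0"
      using F(3) by (simp add: add_divide_distrib sum_divide_distrib)
    ultimately have "c 0 \<in> q" using ideal_diff[OF F(5) iq] by metis
    then have "inverse (c 0) * c 0 \<in> q" using inv(1) F(6) by (intro ideal_mult[OF iq]) auto
    then show False using inv(2) prime_not_one[OF q(1)] by simp
  qed
  then have "c 0 * y 0 \<in> ideal_pow A m 2" using ideal_pow2_mult[OF R(7,8) _ F(1)] by blast
  then have "(\<Sum>i<r. c (Suc i) * p i) \<in> ideal_pow A m 2"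
    using ideal_diff[OF R(7) i2 c(2)] unfolding s by force
  moreover have "\<forall>i<r. c (Suc i) \<in> A" using c(1) by simp
  ultimately have "c (Suc l) \<in> m" if "l < r" for l using indepD[OF p(1), of "\<lambda>i. c (Suc i)"] that by blast
  then show "c i \<in> m" using \<open>c 0 \<in> m\<close> i by (cases i) auto
qed

end

section \<open>Discrete valuation rings\<close>

lemma dvrE:
  assumes "dvr V"
  obtains v :: "'a::field => int" where "\<forall>x y. x \<noteq> 0 --> y \<noteq> 0 --> v (x / y) = v x - v y"
    "\<forall>x n. x \<noteq> 0 --> v (x ^ n) = int n * v x"
    "\<forall>x. x \<in> V \<longleftrightarrow> x = 0 \<or> 0 \<le> v x" "subring V"
proof -
  from assms obtain v :: "'a => int" where m: "\<And>x y. x \<noteq> 0 ==> y \<noteq> 0 ==> v (x * y) = v x + v y"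
    and a: "\<And>x y. x \<noteq> 0 ==> y \<noteq> 0 ==> x + y \<noteq> 0 ==> min (v x) (v y) \<le> v (x + y)"
    and V: "V = {x. x = 0 \<or> 0 \<le> v x}" unfolding dvr_def by blast
  have dv: "v (x / y) = v x - v y" if "x \<noteq> 0" "y \<noteq> 0" for x y using m[of "x / y" y] that by simp
  have v1: "v 1 = 0" using m[of 1 1] by simp
  have pw: "v (x ^ n) = int n * v x" if "x \<noteq> 0" for x n
    using that v1 by (induction n) (auto simp: m algebra_simps)
  have "v (- 1) = 0" using m[of "- 1" "- 1"] v1 by simp
  then have neg: "v (- x) = v x" if "x \<noteq> 0" for x using m[of "- 1" x] that by simp
  have "subring V" unfolding subring_def V
  proof (intro conjI ballI)
    fix x y assume "x \<in> {x. x = 0 \<or> 0 \<le> v x}" "y \<in> {x. x = 0 \<or> 0 \<le> v x}"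
    then show "x + y \<in> {x. x = 0 \<or> 0 \<le> v x}" "x * y \<in> {x. x = 0 \<or> 0 \<le> v x}"
      using a[of x y] m[of x y] by fastforce+
    show "- x \<in> {x. x = 0 \<or> 0 \<le> v x}" using neg[of x] \<open>x \<in> _\<close> by (cases "x = 0") auto
  qed (use v1 in auto)
  then show ?thesis using that[of v] dv pw V by simp
qed

lemma dvr_noetherian: assumes "dvr V" shows "noetherian V"
proof -
  obtain v where d: "\<forall>x y. x \<noteq> 0 --> y \<noteq> 0 --> v (x / y) = v x - v y"
    and "\<forall>x n. x \<noteq> 0 --> v (x ^ n) = int n * v x"
    and m: "\<forall>x. x \<in> V \<longleftrightarrow> x = 0 \<or> 0 \<le> v x" "subring V" by (rule dvrE[OF assms])
  note v = d[rule_format] m[rule_format]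
  show ?thesis
  proof (rule noetherianI[OF v(3)])
    fix I assume I: "ideal_in V I"
    show "\<exists>n y. (\<forall>i<n. y i \<in> I) \<and> I \<subseteq> igen V y n"
    proof (cases "I \<subseteq> {0}")
      case True then show ?thesis by (intro exI[of _ 0]) simp
    next
      case False
      then obtain c where c: "c \<in> I \<and> c \<noteq> 0" "\<And>z. z \<in> I \<and> z \<noteq> 0 ==> nat (v c) \<le> nat (v z)"
        using ex_has_least_nat[of "\<lambda>z. z \<in> I \<and> z \<noteq> 0" _ "\<lambda>z. nat (v z)"] by blast
      have "z \<in> pid V c" if z: "z \<in> I" for z
      proof (cases "z = 0")
        case True then show ?thesis using ideal_zero[OF pid_ideal[OF v(3)]] ideal_sub[OF I] c by blast
      next
        case False
        have "0 \<le> v c" "0 \<le> v z" using v(2) ideal_sub[OF I] c z False by auto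
        then have "z / c \<in> V" using v(1)[of z c] v(2) c z False by fastforce
        from pid_memI(1)[OF this, of c] show ?thesis using c by simp
      qed
      then show ?thesis using c by (intro exI[of _ 1] exI[of _ "\<lambda>_. c"]) (auto simp: pid_adj)
    qed
  qed
qed

text \<open>In a discrete valuation ring a power of any nonunit is divisible by a given nonzero
  element. So every element of \<open>Q\<close> has a power in \<open>P\<close>.\<close>

lemma dvr_loc_prime_eq:
  assumes sA: "subring A" and Q: "prime_in A Q" and V: "dvr (loc_at A Q)" and P: "prime_in A P" "P \<noteq> {0}" "P \<subseteq> Q"
  shows "P = Q"
proof
  show "Q \<subseteq> P"
  proof
    fix b assume b: "b \<in> Q"
    obtain v where v: "\<forall>x y. x \<noteq> 0 --> y \<noteq> 0 --> v (x / y) = v x - v y"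
      "\<forall>x n. x \<noteq> 0 --> v (x ^ n) = int n * v x"
      "\<forall>x. x \<in> loc_at A Q \<longleftrightarrow> x = 0 \<or> 0 \<le> v x" "subring (loc_at A Q)" by (rule dvrE[OF V])
    note v = v[rule_format]
    note U = prime_compl_mult[OF sA Q]
    have inc: "A \<subseteq> loc_at A Q" unfolding loc_at_eq by (rule loc_incl[OF sA U])
    have QA: "Q \<subseteq> A" "P \<subseteq> A" using ideal_subset[OF prime_ideal] Q P(1) by blast+
    obtain c where c: "c \<in> P" "c \<noteq> 0" using P(2) prime_zero[OF P(1)] by blast
    show "b \<in> P"
    proof (cases "b = 0")
      case True then show ?thesis using prime_zero[OF P(1)] by simp
    next
      case False
      have "0 \<le> v b" "0 \<le> v c" using v(3) inc QA b c False by (metis subsetD)+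
      have "v b \<noteq> 0"
      proof
        assume "v b = 0"
        then have "1 / b \<in> loc_at A Q" using v(1)[of 1 b] v(1)[of b b] v(3) False by (simp add: v(1)[of 1 1])
        then obtain a s where s: "a \<in> A" "s \<in> A" "s \<notin> Q" "1 / b = a / s" unfolding loc_at_def by blast
        have "s \<noteq> 0" using s(3) prime_zero[OF Q] by blast
        then have "s = a * b" using s(4) False by (simp add: field_simps)
        then show False using s ideal_mult[OF prime_ideal[OF Q] s(1) b] by simp
      qed
      then have "1 \<le> v b" using \<open>0 \<le> v b\<close> by simp
      then have "v c \<le> int (nat (v c)) * v b" using \<open>0 \<le> v c\<close> mult_left_mono[of 1 "v b" "v c"] by simp
      then have "b ^ nat (v c) / c \<in> loc_at A Q" using v(1)[of "b ^ nat (v c)" c] v(2,3) False c by simp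
      then obtain a s where s: "a \<in> A" "s \<in> A" "s \<notin> Q" "b ^ nat (v c) / c = a / s" unfolding loc_at_def by blast
      have "s \<noteq> 0" using s(3) prime_zero[OF Q] by blast
      then have "s * b ^ nat (v c) = a * c" using s(4) c by (simp add: field_simps)
      then have "s * b ^ nat (v c) \<in> P" using ideal_mult[OF prime_ideal[OF P(1)] s(1) c(1)] by simp
      then have "b ^ nat (v c) \<in> P"
        using prime_mult[OF P(1) s(2), of "b ^ nat (v c)"] s(3) P(3) subring_power[OF sA] b QA by blast
      then show ?thesis using prime_power[OF sA P(1)] b QA by blast
    qed
  qed
qed (rule P(3))

text \<open>Among the denominators of \<open>f\<close>, written as products of primes up to units,
  one with fewest factors is chosen; none of its primes divides the corresponding numerator.\<close>

lemma pel_separates: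
  assumes A: "noetherian A" and pr: "\<And>p. irreducible_in A p ==> pel A p" and qf: "quotient_field_is_ambient A" and f: "f \<notin> A"
  obtains p where "pel A p" "f \<notin> loc_at A (pid A p)"
proof -
  note sA = noeth_subring[OF A]
  let ?Q = "\<lambda>xs. (\<forall>p\<in>set xs. irreducible_in A p) \<and> (\<exists>a\<in>A. f * prod_list xs = a)"
  obtain a b where ab: "a \<in> A" "b \<in> A" "b \<noteq> 0" "f = a / b" using qf unfolding quotient_field_is_ambient_def by blast
  obtain u xs where u: "unit_in A u" "\<forall>p\<in>set xs. irreducible_in A p" "b = u * prod_list xs"
    using atomic_factorization[OF A ab(2,3)] by blast
  have "f * prod_list xs = a * inverse u" using ab u unit_inD(2)[OF u(1)] by (simp add: field_simps)
  then have "?Q xs" using u(2) ab(1) unit_inD(3)[OF u(1)] subring_mult[OF sA] by auto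
  then obtain ys where ys: "?Q ys" "\<And>zs. ?Q zs ==> length ys \<le> length zs"
    using ex_has_least_nat[of ?Q xs length] by blast
  have "ys \<noteq> []" using ys(1) f by auto
  then obtain p zs where p: "ys = p # zs" by (cases ys) auto
  have pel: "pel A p" using pr ys(1) p by simp
  have p0: "p \<noteq> 0" and pA: "p \<in> A" using pelD[OF pel] by auto
  let ?a = "f * prod_list ys"
  have aA: "?a \<in> A" using ys(1) by blast
  have ap: "?a \<notin> pid A p"
  proof
    assume "?a \<in> pid A p"
    then obtain c where "c \<in> A" "?a = c * p" by (rule pid_memE)
    then have "f * prod_list zs = c" using p0 p by (simp add: field_simps)
    then have "?Q zs" using \<open>c \<in> A\<close> ys(1) p by auto
    then show False using ys(2)[of zs] p by simp
  qed
  have "f \<notin> loc_at A (pid A p)"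
  proof
    assume "f \<in> loc_at A (pid A p)"
    then obtain c s where s: "c \<in> A" "s \<in> A" "s \<notin> pid A p" "f = c / s" unfolding loc_at_def by blast
    have "s \<noteq> 0" using s(3) ideal_zero[OF pid_ideal[OF sA pA]] by blast
    then have "?a * s = (c * prod_list zs) * p" using s(4) p by simp
    moreover have "prod_list zs \<in> A" using ys(1) p irreducibleD(1) by (intro subring_prod_list[OF sA]) auto
    ultimately have "?a * s \<in> pid A p" using s(1) sA by (simp add: pid_memI subring_mult)
    then show False using prime_mult[OF pelD(3)[OF pel] aA s(2)] ap s(3) by blast
  qed
  with pel show ?thesis by (rule that)
qed

lemma qf_mono: "quotient_field_is_ambient A ==> A \<subseteq> B ==> quotient_field_is_ambient B"
  unfolding quotient_field_is_ambient_def by blast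

section \<open>Sequences of local quadratic transforms\<close>

text \<open>The regular systems are chosen so that the first parameter \<open>y j 0\<close> is the
  element by which the j-th transform divides.\<close>

locale transform_sequence =
  fixes R m :: "nat => 'a::field set" and y :: "nat => nat => 'a" and e :: "nat => nat" and q :: "nat => 'a set"
  assumes y: "\<And>j. regsys (R j) (m j) (y j) (e j)" and e2: "\<And>j. 2 \<le> e j"
    and q: "\<And>j. prime_in (blow (R j) (m j) (y j 0)) (q j)" "\<And>j. m j \<subseteq> q j"
    and R_Suc: "\<And>j. R (Suc j) = loc_at (blow (R j) (m j) (y j 0)) (q j)"
    and m_Suc: "\<And>j. m (Suc j) = mloc (blow (R j) (m j) (y j 0)) (q j)"
    and qf: "quotient_field_is_ambient (R 0)"
begin

abbreviation "x j \<equiv> y j 0"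
abbreviation "V j \<equiv> order_valuation_ring (R j) (m j)"
abbreviation "S \<equiv> \<Union>j. R j"

text \<open>The equation on \<open>R j\<close> of the strict transform of the exceptional divisor
  created at stage \<open>k\<close>: every later transform divides it once by its own
  \<open>x\<close>.\<close>

definition p :: "nat => nat => 'a" where "p k j = x k / (\<Prod>i\<in>{k<..<j}. x i)"

text \<open>The strict transform is required to pass through all intermediate stages, which makes
  \<open>K_antimono\<close> immediate.\<close>

definition K :: "nat => nat set" where "K j = {k. k < j \<and> (\<forall>l. k < l \<and> l \<le> j --> p k l \<in> m l)}"

lemma e0: "0 < e j" using e2[of j] by simp

lemmas Rj = regsysD[OF y]
lemmas Bj = blow_facts[OF y e0]
lemmas Tj = transform_facts[OF y e0 q, folded R_Suc m_Suc]

lemma R_mono: "i \<le> j ==> R i \<subseteq> R j"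
  by (rule lift_Suc_mono_le[of R]) (rule Tj(4))

lemma m_mono: "i \<le> j ==> m i \<subseteq> m j"
  by (rule lift_Suc_mono_le[of m]) (rule Tj(6))

lemma m_sub: "m j \<subseteq> R j" using ideal_subset[OF Rj(8)] .

lemma qfR: "quotient_field_is_ambient (R j)"
  using qf_mono[OF qf R_mono[of 0 j]] by simp

lemma S_subring: "subring S"
  unfolding subring_def
proof (intro conjI ballI)
  fix a b assume "a \<in> S" "b \<in> S"
  then obtain i j where "a \<in> R i" "b \<in> R j" by blast
  then have ab: "a \<in> R (max i j)" "b \<in> R (max i j)" using R_mono[of i "max i j"] R_mono[of j "max i j"] by auto
  show "a + b \<in> S" "a * b \<in> S" "- a \<in> S"
    using subring_add[OF Rj(7) ab] subring_mult[OF Rj(7) ab] subring_uminus[OF Rj(7) ab(1)] by blast+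
qed (use subring_zero[OF Rj(7)[of 0]] subring_one[OF Rj(7)[of 0]] in blast)+

lemma p_Suc: "k < j ==> p k (Suc j) = p k j / x j"
proof -
  assume "k < j"
  then have "{k<..<Suc j} = insert j {k<..<j}" by auto
  then show ?thesis by (simp add: p_def)
qed

lemma p_self: "p k (Suc k) = x k"
proof -
  have "{k<..<Suc k} = {}" by auto
  then show ?thesis by (simp add: p_def)
qed

lemma K_Suc: "K (Suc j) = insert j {k \<in> K j. p k (Suc j) \<in> m (Suc j)}"
proof -
  have "p j (Suc j) \<in> m (Suc j)" using Bj(1) Tj(6)[of j] by (auto simp: p_self)
  then show ?thesis by (auto simp: K_def le_Suc_eq less_Suc_eq)
qed

lemma K_less: "k \<in> K j ==> k < j" and K_mem: "k \<in> K j ==> p k j \<in> m j"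
  and K_antimono: "k \<in> K j ==> k < l ==> l \<le> j ==> k \<in> K l"
  by (auto simp: K_def)

lemma K_finite: "finite (K j)"
  by (rule finite_subset[of _ "{..<j}"]) (auto simp: K_def)

text \<open>\<open>K j\<close> indexes the order valuation rings containing \<open>R j\<close>; their centers on \<open>R j\<close> are
  generated by part of a regular system of parameters.\<close>

lemma K_params:
  "\<exists>z h. regsys (R j) (m j) z (e j) \<and> card (K j) \<le> e j \<and> bij_betw h {..<card (K j)} (K j) \<and>
     (\<forall>i<card (K j). z i = p (h i) j) \<and> (\<forall>k\<in>K j. V k = loc_at (R j) (pid (R j) (p k j)))"
proof (induction j)
  case 0
  have "K 0 = {}" by (auto simp: K_def)
  then show ?case using y[of 0] by (intro exI[of _ "y 0"] exI[of _ id]) (auto simp: bij_betw_def)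
next
  case (Suc j)
  then obtain z h where z: "regsys (R j) (m j) z (e j)" "card (K j) \<le> e j" "bij_betw h {..<card (K j)} (K j)"
    "\<And>i. i < card (K j) ==> z i = p (h i) j" "\<And>k. k \<in> K j ==> V k = loc_at (R j) (pid (R j) (p k j))" by blast
  let ?K = "{k \<in> K j. p k (Suc j) \<in> m (Suc j)}"
  have fK: "finite ?K" using K_finite by simp
  define r where "r = card ?K"
  obtain g where g: "bij_betw g {..<r} ?K" unfolding r_def using ex_bij_betw_nat_finite[OF fK] by (auto simp: atLeast0LessThan)
  have gK: "g i \<in> ?K" if "i < r" for i using bij_betwE[OF g] that by blast
  let ?s = "\<lambda>i. inv_into {..<card (K j)} h (g i)"
  have hs: "h (?s i) = g i" "?s i < card (K j)" if "i < r" for i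
    using bij_betw_inv_into_right[OF z(3)] bij_betwE[OF bij_betw_inv_into[OF z(3)]] gK[OF that] by auto
  have "inj_on ?s {..<r}"
    by (rule inj_onI) (metis hs(1) lessThan_iff bij_betw_imp_inj_on[OF g] inj_onD)
  then have ind: "indep (R j) (m j) (\<lambda>i. z (?s i)) r"
    using hs(2) z(2) by (intro indep_subfamily[OF Rj(7) regsys_indep[OF z(1)]]) fastforce+
  have zs: "z (?s i) = p (g i) j" if "i < r" for i using z(4)[OF hs(2)[OF that]] hs(1)[OF that] by simp
  note F = Bj[where j = j] and T = Tj[where j = j]
  have pq: "p (g i) j / x j \<in> q j" if i: "i < r" for i
  proof -
    have "p (g i) (Suc j) = p (g i) j / x j" using gK[OF i] K_less by (intro p_Suc) auto
    then have "p (g i) j / x j \<in> mloc (blow (R j) (m j) (x j)) (q j)" using gK[OF i] m_Suc by simp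
    moreover have "p (g i) j / x j \<in> blow (R j) (m j) (x j)" using gK[OF i] K_mem T(9) by blast
    ultimately show ?thesis
      using contr_loc_prime[OF F(5) prime_compl_mult[OF F(5) q(1)] q(1)] unfolding mloc_eq by blast
  qed
  \<comment> \<open>\<open>x j\<close> and the equations of the divisors that survive the next step
    are jointly independent. The given parameters can thus be replaced by a system \<open>w\<close>
    starting with them, to which \<open>transform_regsys\<close> applies.\<close>
  have "indep (R j) (m j) (\<lambda>i. case i of 0 => x j | Suc i => z (?s i)) (Suc r)"
    by (rule transform_indep[OF y e0 q ind]) (use pq zs in auto)
  from indep_extend[OF y this] obtain w where w: "Suc r \<le> e j" "regsys (R j) (m j) w (e j)"
    "\<And>i. i < Suc r ==> w i = (case i of 0 => x j | Suc i => z (?s i))" by blast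
  have w0: "w 0 = x j" and wS: "w (Suc i) = p (g i) j" if "i < r" for i using w(3)[of 0] w(3)[of "Suc i"] that zs by auto
  have w0: "w 0 = x j" using w(3)[of 0] by simp
  have qw: "prime_in (blow (R j) (m j) (w 0)) (q j)" using q w0 by simp
  have wq: "w (Suc l) / w 0 \<in> q j" if "l < r" for l using pq wS that w0 by simp
  have nB: "noetherian (loc_at (blow (R j) (m j) (w 0)) (q j))" using Rj(1)[of "Suc j"] R_Suc w0 by simp
  obtain v d where "regsys (loc_at (blow (R j) (m j) (w 0)) (q j)) (mloc (blow (R j) (m j) (w 0)) (q j)) v d"
    "r < d" "d \<le> e j" and v: "v 0 = w 0" "\<And>l. l < r ==> v (Suc l) = w (Suc l) / w 0"
    using transform_regsys[OF w(2) e0 qw q(2) nB _ wq] w(1) by (metis Suc_le_lessD)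
  then have v': "regsys (R (Suc j)) (m (Suc j)) v d" "r < d" using R_Suc m_Suc w0 by auto
  have d: "d = e (Suc j)" by (rule regsys_dim_unique[OF v'(1) y])
  have jK: "j \<notin> ?K" using K_less by blast
  then have cK: "card (K (Suc j)) = Suc r" unfolding K_Suc r_def using fK by simp
  define h' where "h' i = (case i of 0 => j | Suc i => g i)" for i
  have "bij_betw h' {..<Suc r} (K (Suc j))"
  proof -
    have "h' ` {..<Suc r} = insert j (g ` {..<r})" unfolding lessThan_Suc_eq_insert_0 by (auto simp: h'_def image_iff)
    then have im: "h' ` {..<Suc r} = K (Suc j)" unfolding K_Suc using bij_betw_imp_surj_on[OF g] by simp
    moreover have "inj_on h' {..<Suc r}" by (rule eq_card_imp_inj_on) (use im cK in auto)
    ultimately show ?thesis by (simp add: bij_betw_def)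
  qed
  moreover have vp: "v i = p (h' i) (Suc j)" if "i < Suc r" for i
  proof (cases i)
    case 0 then show ?thesis using v w0 by (simp add: h'_def p_self)
  next
    case (Suc l)
    then have "l < r" using that by simp
    then show ?thesis using v(2) wS w0 p_Suc[of "g l" j] gK[of l] K_less Suc by (simp add: h'_def)
  qed
  moreover have "V k = loc_at (R (Suc j)) (pid (R (Suc j)) (p k (Suc j)))" if k: "k \<in> K (Suc j)" for k
  proof (cases "k = j")
    case True
    then show ?thesis using transform_order_valuation[OF y[of j] e0 q qfR] R_Suc[of j] by (simp add: p_self)
  next
    case False
    then have "k \<in> ?K" using k K_Suc by blast
    then obtain l where l: "l < r" "k = g l" using bij_betw_imp_surj_on[OF g] by blast
    have kp: "p k (Suc j) = w (Suc l) / w 0" "p k (Suc j) = v (Suc l)" using v(2) l wS w0 p_Suc[of k j] K_less \<open>k \<in> ?K\<close> by auto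
    have ld: "Suc l < d" "Suc l < e j" using l v'(2) w(1) by auto
    have pr: "prime_in (R (Suc j)) (pid (R (Suc j)) (v (Suc l)))" using pelD(3)[OF regsys_pel[OF v'(1) ld(1)]] .
    have nd: "w 0 \<notin> pid (R (Suc j)) (v (Suc l))" using regsys_not_dvd[OF v'(1) _ ld(1), of 0] v(1) ld by simp
    have "loc_at (R (Suc j)) (pid (R (Suc j)) (w (Suc l) / w 0)) = loc_at (R j) (pid (R j) (w (Suc l)))"
      using transform_pid_loc[OF w(2) e0 qw q(2) ld(2) wq[OF l(1)]] pr nd v(2)[OF l(1)] R_Suc w0 by simp
    then show ?thesis using z(5)[of k] \<open>k \<in> ?K\<close> kp wS[OF l(1)] l by simp
  qed
  ultimately show ?case unfolding cK using v' d by (intro exI[of _ v] exI[of _ h']) auto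
qed

lemma K_card: "card (K j) \<le> e j" and K_V: "k \<in> K j ==> V k = loc_at (R j) (pid (R j) (p k j))"
  using K_params[of j] by auto

lemma K_pel: "k \<in> K j ==> pel (R j) (p k j)"
  using K_params[of j] regsys_pel unfolding bij_betw_def by (metis (no_types, lifting) imageE lessThan_iff order_less_le_trans)

text \<open>Dimension at least two enters here: \<open>x j = a * f\<close> with \<open>a\<close> a
  unit, as \<open>x j\<close> is not in the square of \<open>m j\<close>; so the second parameter
  would be a multiple of the first.\<close>

lemma pel_ne_maximal: assumes f: "pel (R j) f" shows "\<not> m j \<subseteq> pid (R j) f"
proof
  assume mf: "m j \<subseteq> pid (R j) f"
  have ed: "0 < e j" "1 < e j" using e2[of j] by auto
  have "f \<in> m j"
  proof (rule ccontr)
    assume "f \<notin> m j"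
    then have "unit_in (R j) f" using local_unit[OF Rj(2)] pelD(1)[OF f] by (auto simp: unit_in_def)
    then show False using pel_nonunit[OF f] by simp
  qed
  obtain a where a: "a \<in> R j" "x j = a * f" using mf Bj(1)[of j] by (auto elim: pid_memE)
  have "a \<notin> m j"
    using ideal_pow2_mult[OF Rj(7,8) _ \<open>f \<in> m j\<close>, of a] regsys_not_pow2[OF y ed(1)] a(2) by auto
  then have "unit_in (R j) a" using local_unit[OF Rj(2) a(1)] a(1) by (auto simp: unit_in_def)
  then have "pid (R j) (x j) = pid (R j) f" unfolding a(2) by (rule pid_unit[OF Rj(7)])
  then show False using regsys_not_dvd[OF y ed(2,1)] mf Rj(3)[OF ed(2)] by auto
qed

text \<open>An element of \<open>m j\<close> outside the prime is inverted in the localization but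
  never in \<open>S\<close>, so the inclusion is strict.\<close>

lemma loc_prime_element:
  assumes f: "pel (R j) f" and S: "S \<subseteq> loc_at (R j) (pid (R j) f)"
  shows "dvr (loc_at (R j) (pid (R j) f))" "S \<subset> loc_at (R j) (pid (R j) f)"
proof -
  show "dvr (loc_at (R j) (pid (R j) f))" by (rule pel_loc_dvr[OF Rj(1) f qfR])
  obtain a where a: "a \<in> m j" "a \<notin> pid (R j) f" using pel_ne_maximal[OF f] by blast
  have "1 / a \<in> loc_at (R j) (pid (R j) f)"
    unfolding loc_at_def using a m_sub[of j] subring_one[OF Rj(7)] by blast
  moreover have "1 / a \<notin> S"
  proof
    assume "1 / a \<in> S"
    then obtain i where "1 / a \<in> R i" by blast
    then have i: "inverse a \<in> R (max i j)" using R_mono[of i "max i j"] by (auto simp: inverse_eq_divide)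
    have am: "a \<in> m (max i j)" using a m_mono[of j "max i j"] by auto
    have "a = 0" by (rule local_nonunit[OF Rj(2) am i])
    then show False using a(2) prime_zero[OF pelD(3)[OF f]] by simp
  qed
  ultimately show "S \<subset> loc_at (R j) (pid (R j) f)" using S by blast
qed

lemma V_eq: "V k = loc_at (R (Suc k)) (pid (R (Suc k)) (x k))" and x_pel: "pel (R (Suc k)) (x k)"
  using K_V[of k "Suc k"] K_pel[of k "Suc k"] by (auto simp: K_Suc p_self)

text \<open>If the divisor \<open>k\<close> leaves at stage \<open>Suc j\<close>, then
  \<open>p k j / x j\<close> is a unit there, so \<open>R (Suc j)\<close> contains
  \<open>a / p k j\<close> for all \<open>a\<close> in \<open>m j\<close>. Inside \<open>V k\<close>
  this would make the whole of \<open>m j\<close> divisible by \<open>p k j\<close>.\<close>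

lemma survivor_iff: "S \<subseteq> V k \<longleftrightarrow> (\<forall>j>k. k \<in> K j)"
proof (intro iffI allI impI)
  assume k: "\<forall>j>k. k \<in> K j"
  have "R j \<subseteq> V k" if "k < j" for j
    unfolding K_V[OF k[rule_format, OF that]] loc_at_eq
    by (rule loc_incl[OF Rj(7) prime_compl_mult[OF Rj(7) pelD(3)[OF K_pel[OF k[rule_format, OF that]]]]])
  then have "R (max j (Suc k)) \<subseteq> V k" for j by simp
  then have "R j \<subseteq> V k" for j using R_mono[of j "max j (Suc k)"] by (meson max.cobounded1 order_trans)
  then show "S \<subseteq> V k" by blast
next
  fix j assume S: "S \<subseteq> V k" and "k < j"
  from this(2) show "k \<in> K j"
  proof (induction j)
    case (Suc j)
    show ?case
    proof (cases "k = j")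
      case True then show ?thesis by (simp add: K_Suc)
    next
      case False
      then have kK: "k \<in> K j" using Suc by simp
      let ?p = "p k j"
      note pel = K_pel[OF kK]
      have pR: "?p / x j \<in> R (Suc j)" using Tj(9)[OF K_mem[OF kK]] Tj(3)[where j = j] by blast
      have "?p / x j \<in> m (Suc j)"
      proof (rule ccontr)
        assume "?p / x j \<notin> m (Suc j)"
        then have "inverse (?p / x j) \<in> R (Suc j)" using local_unit(1)[OF Rj(2) pR] by blast
        then have xp: "x j / ?p \<in> R (Suc j)" by simp
        have "m j \<subseteq> pid (R j) ?p"
        proof
          fix a assume a: "a \<in> m j"
          then have "a / x j \<in> R (Suc j)" using Tj(9)[OF a] Tj(3)[where j = j] by blast
          from subring_mult[OF Rj(7) this xp] have "a / ?p \<in> R (Suc j)" using Bj(3)[of j] by simp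
          then have "a / ?p \<in> loc_at (R j) (pid (R j) ?p)" using S K_V[OF kK] by blast
          then obtain b c where bc: "b \<in> R j" "c \<in> R j" "c \<notin> pid (R j) ?p" "a / ?p = b / c" unfolding loc_at_def by blast
          have "c \<noteq> 0" using bc(3) prime_zero[OF pelD(3)[OF pel]] by auto
          then have "a * c = b * ?p" using bc(4) pelD(2)[OF pel] by (simp add: field_simps)
          then have "a * c \<in> pid (R j) ?p" using bc(1) by (simp add: pid_memI)
          then show "a \<in> pid (R j) ?p" using prime_mult[OF pelD(3)[OF pel] _ bc(2), of a] bc(3) a m_sub[of j] by blast
        qed
        then show False using pel_ne_maximal[OF pel] by simp
      qed
      then show ?thesis using kK p_Suc[of k j] K_less[OF kK] by (simp add: K_Suc)
    qed
  qed simp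
qed

lemma e_mono: "e j \<le> e 0"
proof (induction j)
  case (Suc j)
  have "noetherian (loc_at (blow (R j) (m j) (x j)) (q j))" using Rj(1)[of "Suc j"] R_Suc by simp
  from transform_regsys[OF y e0 q this e0] obtain v d where
    "regsys (R (Suc j)) (m (Suc j)) v d" "d \<le> e j" unfolding R_Suc m_Suc by blast
  then show ?case using regsys_dim_unique[OF _ y, of "Suc j" v d] Suc by simp
qed simp

lemma survivors_card: "finite {k. S \<subseteq> V k}" "card {k. S \<subseteq> V k} \<le> e 0 - 1"
proof -
  have *: "card W \<le> e 0 - 1" if W: "finite W" "W \<subseteq> {k. S \<subseteq> V k}" for W
  proof -
    obtain j where j: "\<forall>k\<in>W. k < j" using finite_nat_set_iff_bounded W(1) by blast
    have "W \<subseteq> K (Suc j)"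
    proof
      fix k assume "k \<in> W"
      then have "k < Suc j" "\<forall>j>k. k \<in> K j" using j W(2) survivor_iff by fastforce+
      then show "k \<in> K (Suc j)" by blast
    qed
    \<comment> \<open>The newest index \<open>j\<close> always belongs to \<open>K (Suc j)\<close>
      and is not in \<open>W\<close>; this is the one in \<open>e 0 - 1\<close>.\<close>
    then have "insert j W \<subseteq> K (Suc j)" by (simp add: K_Suc)
    then have "card (insert j W) \<le> card (K (Suc j))" using K_finite by (rule card_mono[rotated])
    then show ?thesis using W(1) j K_card[of "Suc j"] e_mono[of "Suc j"] by auto
  qed
  show fin: "finite {k. S \<subseteq> V k}"
  proof (rule ccontr)
    assume "infinite {k. S \<subseteq> V k}"
    then obtain W where "W \<subseteq> {k. S \<subseteq> V k}" "finite W" "card W = e 0" using infinite_arbitrarily_large by metis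
    then show False using *[of W] e0[of 0] by simp
  qed
  then show "card {k. S \<subseteq> V k} \<le> e 0 - 1" using * by blast
qed

text \<open>On \<open>R j\<close> the zero set of \<open>x i\<close> is covered by the strict
  transforms of the divisors created from stage \<open>i\<close> on. A prime avoiding
  \<open>x j\<close> is traced back to \<open>R j\<close>, and the equation found there can be
  divided by \<open>x j\<close>.\<close>

lemma prime_contains_p:
  "prime_in (R j) Q ==> x i \<in> Q ==> i < j ==> \<exists>k\<in>K j. i \<le> k \<and> p k j \<in> Q"
proof (induction j arbitrary: Q)
  case (Suc j)
  note Q = Suc.prems
  show ?case
  proof (cases "x j \<in> Q")
    case True
    then show ?thesis using Q(3) by (intro bexI[of _ j]) (auto simp: K_Suc p_self)
  next
    case False
    then have ij: "i < j" using Q by (cases "i = j") auto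
    have xR: "x i \<in> R j" using Bj(2)[of i] R_mono[of i j] ij by auto
    have "\<exists>k\<in>K j. i \<le> k \<and> p k j \<in> Q \<inter> R j"
      by (rule Suc.IH[OF subring_Int_prime[OF Rj(7) Tj(4) Q(1)] _ ij]) (use Q(2) xR in blast)
    then obtain k where k: "k \<in> K j" "i \<le> k" "p k j \<in> Q" by blast
    have kS: "p k (Suc j) = p k j / x j" by (rule p_Suc[OF K_less[OF k(1)]])
    have pR: "p k j / x j \<in> R (Suc j)" using Tj(9)[OF K_mem[OF k(1)]] Tj(3)[where j = j] by blast
    have "p k j / x j * x j \<in> Q" using k(3) Bj(3)[of j] by simp
    then have "p k j / x j \<in> Q" using prime_mult[OF Q(1) pR, of "x j"] False Bj(2)[of j] Tj(4)[where j = j] by blast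
    moreover have "Q \<subseteq> m (Suc j)" by (rule local_max[OF Rj(2) Q(1)])
    ultimately show ?thesis using k kS by (intro bexI[of _ k]) (auto simp: K_Suc)
  qed
qed simp

text \<open>If \<open>a\<close> had no power in \<open>x i S\<close>, some \<open>p k j\<close> with \<open>k \<ge> i\<close> would fail to divide \<open>a\<close> for every
  large \<open>j\<close>; these \<open>k\<close> form a decreasing sequence of finite sets, so one of them survives.\<close>

lemma x_radical: "\<exists>i1. \<forall>i\<ge>i1. \<forall>a\<in>(\<Union>j. m j). \<exists>n. \<exists>s\<in>S. a ^ n = x i * s"
proof -
  obtain i1 where i1: "\<forall>k\<in>{k. S \<subseteq> V k}. k < i1" using finite_nat_set_iff_bounded survivors_card(1) by blast
  have "\<exists>n. \<exists>s\<in>S. a ^ n = x i * s" if i: "i1 \<le> i" and a: "a \<in> (\<Union>j. m j)" for i a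
  proof -
    obtain j1 where j1: "a \<in> m j1" using a by blast
    define j0 where "j0 = max j1 (Suc i)"
    have aj: "a \<in> m j" if "j0 \<le> j" for j using j1 m_mono[of j1 j] that by (auto simp: j0_def)
    define L where "L j = {k \<in> K j. i \<le> k \<and> a \<notin> pid (R j) (p k j)}" for j
    have LS: "L (Suc j) \<subseteq> L j" if "j0 \<le> j" for j
    proof
      fix k assume "k \<in> L (Suc j)"
      then have k: "k \<in> K (Suc j)" "i \<le> k" "a \<notin> pid (R (Suc j)) (p k (Suc j))" by (auto simp: L_def)
      have "k \<noteq> j" using k(3) Tj(7)[where j = j] aj[OF that] by (auto simp: p_self)
      then have kj: "k \<in> K j" "p k (Suc j) \<in> m (Suc j)" using k(1) K_Suc by auto
      have "a \<notin> pid (R j) (p k j)"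
      proof
        assume "a \<in> pid (R j) (p k j)"
        then obtain b where b: "b \<in> R j" "a = b * p k j" by (rule pid_memE)
        then have "a = b * x j * p k (Suc j)" using p_Suc[OF K_less[OF kj(1)]] Bj(3)[of j] by simp
        moreover have "b * x j \<in> R (Suc j)" using b(1) Bj(2)[of j] Tj(4)[where j = j] Rj(7) by (auto simp: subring_mult)
        ultimately show False using k(3) by (simp add: pid_memI)
      qed
      then show "k \<in> L j" using kj k by (simp add: L_def)
    qed
    have Lmono: "L j \<subseteq> L l" if "j0 \<le> l" "l \<le> j" for l j
      using that(2)
    proof (induction rule: dec_induct)
      case (step n) then show ?case using LS[of n] that(1) by auto
    qed simp
    have "\<exists>j\<ge>j0. L j = {}"
    proof (rule ccontr)
      assume no: "\<not> ?thesis"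
      have fin: "finite (L j0)" using K_finite by (simp add: L_def)
      have "\<exists>k\<in>L j0. \<forall>j\<ge>j0. k \<in> L j"
      proof (rule ccontr)
        assume "\<not> ?thesis"
        then obtain f where f: "\<forall>k\<in>L j0. j0 \<le> f k \<and> k \<notin> L (f k)" by metis
        let ?J = "Max (insert j0 (f ` L j0))"
        have J: "j0 \<le> ?J" "\<forall>k\<in>L j0. f k \<le> ?J" using fin by auto
        have "k \<notin> L ?J" if "k \<in> L j0" for k using f J Lmono[of "f k" ?J] that by blast
        then have "L ?J = {}" using Lmono[OF order_refl J(1)] by blast
        then show False using no J(1) by blast
      qed
      then obtain k where k: "\<And>j. j0 \<le> j ==> k \<in> L j" by blast
      have "k \<in> K j" if "k < j" for j
        using K_antimono[of k "max j j0" j] k[of "max j j0"] that by (simp add: L_def)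
      then have "S \<subseteq> V k" using survivor_iff by blast
      moreover have "i \<le> k" using k[of j0] by (simp add: L_def)
      ultimately show False using i1 i by fastforce
    qed
    then obtain j where j: "j0 \<le> j" "L j = {}" by blast
    have ij: "i < j" using j(1) by (simp add: j0_def)
    have xR: "x i \<in> R j" using Bj(2)[of i] R_mono[of i j] ij by auto
    have aR: "a \<in> R j" using aj[OF j(1)] m_sub by blast
    \<comment> \<open>With \<open>L j\<close> empty, every prime over \<open>x i\<close> contains
      some \<open>p k j\<close> that divides \<open>a\<close>, so \<open>a\<close> lies in all of
      them.\<close>
    have "\<exists>n. a ^ n \<in> pid (R j) (x i)"
    proof (rule ccontr)
      assume no: "\<nexists>n. a ^ n \<in> pid (R j) (x i)"
      obtain Q where Q: "prime_in (R j) Q" "pid (R j) (x i) \<subseteq> Q" "a \<notin> Q"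
        using prime_avoiding_powers[OF Rj(1) pid_ideal[OF Rj(7) xR] aR] no by blast
      then obtain k where k: "k \<in> K j" "i \<le> k" "p k j \<in> Q"
        using prime_contains_p[OF Q(1) _ ij] pid_mem[OF Rj(7), of "x i" j] by blast
      then have "a \<in> pid (R j) (p k j)" using j(2) by (auto simp: L_def)
      then show False using pid_least[OF prime_ideal[OF Q(1)] k(3)] Q(3) by blast
    qed
    then obtain n b where "b \<in> R j" "a ^ n = b * x i" unfolding pid_def by blast
    then have "b \<in> S" "a ^ n = x i * b" by (auto simp: mult.commute)
    then show ?thesis by blast
  qed
  then show ?thesis by blast
qed

section \<open>The ring obtained by inverting a late parameter\<close>

context
  fixes i1 :: nat
  assumes x_primary: "\<forall>i\<ge>i1. \<forall>a\<in>(\<Union>j. m j). \<exists>n. \<exists>s\<in>S. a ^ n = x i * s"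
begin

lemmas i1 = x_primary[rule_format]

abbreviation "T0 \<equiv> invert_elem S (x i1)"

lemma invert_elem_subring: assumes z: "z \<in> S" "z \<noteq> 0" shows "subring (invert_elem S z)"
proof -
  have "mult_closed_in S (range (\<lambda>k. z ^ k))"
    unfolding mult_closed_in_def using z subring_power[OF S_subring z(1)]
    by (auto simp: power_add[symmetric] intro!: range_eqI[of _ _ 0])
  from loc_subring[OF S_subring this] have "subring (loc_mult S (range (\<lambda>k. z ^ k)))" .
  moreover have "loc_mult S (range (\<lambda>k. z ^ k)) = invert_elem S z" unfolding loc_mult_def invert_elem_def by blast
  ultimately show ?thesis by simp
qed

lemma invert_elem_le:
  assumes z: "z \<noteq> 0" "a \<noteq> 0" "s \<in> S" "a ^ n = z * s" shows "invert_elem S z \<subseteq> invert_elem S a"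
proof
  fix w assume "w \<in> invert_elem S z"
  then obtain t k where t: "t \<in> S" "w = t / z ^ k" unfolding invert_elem_def by blast
  have "s \<noteq> 0" using z by (metis mult_zero_right power_not_zero)
  have "t * s ^ k \<in> S" using t(1) z(3) S_subring by (intro subring_mult subring_power)
  moreover have "w = (t * s ^ k) / a ^ (n * k)"
    unfolding t(2) power_mult z(4) power_mult_distrib using z(1) \<open>s \<noteq> 0\<close> by simp
  ultimately show "w \<in> invert_elem S a" unfolding invert_elem_def by blast
qed

lemma xS: "x i \<in> S" using Bj(2) by blast

lemma T0_eq: assumes i: "i1 \<le> i" shows "invert_elem S (x i) = T0"
proof
  have xm: "x l \<in> (\<Union>j. m j)" for l using Bj(1) by blast
  show "invert_elem S (x i) \<subseteq> T0" using i1[OF i xm[of i1]] invert_elem_le[OF Bj(3) Bj(3)] by blast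
  show "T0 \<subseteq> invert_elem S (x i)" using i1[OF order_refl xm[of i]] invert_elem_le[OF Bj(3) Bj(3)] by blast
qed

lemma T0_primary:
  assumes z: "z \<in> (\<Union>j. m j)" "primary_to S (\<Union>j. m j) {z * s | s. s \<in> S}" shows "invert_elem S z = T0"
proof
  have xm: "x i1 \<in> (\<Union>j. m j)" using Bj(1) by blast
  then obtain k where "x i1 ^ k \<in> {z * s | s. s \<in> S}" using z(2) unfolding primary_to_def radical_in_def by blast
  then obtain s where s: "s \<in> S" "x i1 ^ k = z * s" by blast
  have z0: "z \<noteq> 0" using s(2) Bj(3)[of i1] by (metis mult_zero_left power_not_zero)
  show "invert_elem S z \<subseteq> T0" by (rule invert_elem_le[OF z0 Bj(3) s])
  show "T0 \<subseteq> invert_elem S z" using i1[OF order_refl z(1)] invert_elem_le[OF Bj(3) z0] by blast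
qed

lemma T0_subring: "subring T0" by (rule invert_elem_subring[OF xS Bj(3)])

lemma S_T0: "S \<subseteq> T0"
  unfolding invert_elem_def by (intro subsetI CollectI exI[of _ "_"] exI[of _ 0]) auto

lemma R_T0: "R j \<subseteq> T0" using S_T0 by blast

lemma T0_inverse: assumes "i1 \<le> i" shows "inverse (x i) \<in> T0"
proof -
  have "1 / x i ^ 1 \<in> invert_elem S (x i)" unfolding invert_elem_def using subring_one[OF S_subring] by blast
  then show ?thesis using T0_eq[OF assms] by (simp add: inverse_eq_divide)
qed

lemma S_psubset_T0: "S \<subset> T0"
proof -
  have "inverse (x i1) \<notin> S"
  proof
    assume "inverse (x i1) \<in> S"
    then obtain j where "inverse (x i1) \<in> R j" by blast
    then have i: "inverse (x i1) \<in> R (max i1 j)" using R_mono[of j "max i1 j"] by auto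
    have xm: "x i1 \<in> m (max i1 j)" using Bj(1) m_mono[of i1 "max i1 j"] by auto
    show False using local_nonunit[OF Rj(2) xm i] Bj(3) by simp
  qed
  then show ?thesis using S_T0 T0_inverse[of i1] by blast
qed

definition TU :: "nat => 'a set" where "TU i = {u \<in> R i. u \<noteq> 0 \<and> inverse u \<in> T0}"

lemma TU_mult: "mult_closed_in (R i) (TU i)"
  unfolding mult_closed_in_def TU_def
  using subring_one[OF Rj(7)] subring_one[OF T0_subring] subring_mult[OF Rj(7)] subring_mult[OF T0_subring] by auto

text \<open>By induction \<open>?L\<close> absorbs every later \<open>R j\<close>: the transforms
  adjoin quotients by some \<open>x j\<close> and by elements outside \<open>q j\<close>, all of
  which have inverses in \<open>T0\<close>. An element of \<open>?L\<close> with inverse in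
  \<open>T0\<close> is already a unit of \<open>?L\<close>, since its numerator belongs to
  \<open>TU i\<close>.\<close>

lemma T0_loc: assumes i: "i1 \<le> i" shows "T0 = loc_mult (R i) (TU i)"
proof
  let ?L = "loc_mult (R i) (TU i)"
  note sL = loc_subring[OF Rj(7) TU_mult[of i]] and inc = loc_incl[OF Rj(7) TU_mult[of i], of "R i"]
  show "?L \<subseteq> T0"
  proof
    fix z assume "z \<in> ?L"
    then obtain a u where "a \<in> R i" "u \<in> TU i" "z = a * inverse u" unfolding loc_mult_def by (auto simp: divide_inverse)
    then show "z \<in> T0" using subring_mult[OF T0_subring] R_T0[of i] by (auto simp: TU_def)
  qed
  have inv: "inverse c \<in> ?L" if c: "c \<in> ?L" "c \<noteq> 0" "inverse c \<in> T0" for c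
  proof -
    obtain g u where g: "g \<in> R i" "u \<in> TU i" "c = g / u" using c(1) unfolding loc_mult_def by blast
    have u: "u \<in> R i" "u \<noteq> 0" "inverse u \<in> T0" using g(2) by (auto simp: TU_def)
    have "g \<noteq> 0" using c(2) g(3) by auto
    have "inverse g = inverse c * inverse u" using g(3) u by (simp add: inverse_eq_divide)
    then have "inverse g \<in> T0" using subring_mult[OF T0_subring c(3) u(3)] by simp
    then have "g \<in> TU i" using g(1) \<open>g \<noteq> 0\<close> by (simp add: TU_def)
    then show ?thesis by (rule loc_memI[OF u(1)]) (simp add: g(3))
  qed
  have RL: "R j \<subseteq> ?L" if "i \<le> j" for j
    using that
  proof (induction rule: dec_induct)
    case base then show ?case by (rule inc)
  next
    case (step j)
    have xj: "x j \<in> ?L" "inverse (x j) \<in> ?L"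
      using inv[of "x j"] Bj(2,3)[of j] T0_inverse[of j] step i by auto
    have CL: "blow (R j) (m j) (x j) \<subseteq> ?L"
    proof
      fix z assume "z \<in> blow (R j) (m j) (x j)"
      then obtain a k where a: "a \<in> jpow (R j) (R j) (m j) k" "z = a / x j ^ k" by (rule blow_memE)
      have "a \<in> R j" using ideal_sub[OF jpow_ideal[OF Rj(7) ideal_ring[OF Rj(7)] Rj(8)] a(1)] .
      then have "a * inverse (x j) ^ k \<in> ?L" using step.IH xj(2) sL by (intro subring_mult subring_power) auto
      then show "z \<in> ?L" using a(2) by (simp add: divide_inverse power_inverse)
    qed
    show ?case
    proof
      fix z assume z: "z \<in> R (Suc j)"
      then obtain f g where fg: "f \<in> blow (R j) (m j) (x j)" "g \<in> blow (R j) (m j) (x j)" "g \<notin> q j" "z = f / g"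
        unfolding R_Suc loc_at_def by blast
      have "g \<noteq> 0" using fg(3) prime_zero[OF q(1)] by metis
      have "1 / g \<in> R (Suc j)" unfolding R_Suc loc_at_def using fg subring_one[OF Bj(5)] by blast
      then have "inverse g \<in> T0" using R_T0[of "Suc j"] by (auto simp: inverse_eq_divide)
      then have "inverse g \<in> ?L" using inv[of g] fg(2) CL \<open>g \<noteq> 0\<close> by blast
      then show "z \<in> ?L" using subring_mult[OF sL, of f "inverse g"] fg CL by (auto simp: divide_inverse)
    qed
  qed
  show "T0 \<subseteq> ?L"
  proof
    fix z assume "z \<in> T0"
    then have "z \<in> invert_elem S (x i)" using T0_eq[OF i] by simp
    then obtain s k where s: "s \<in> S" "z = s / x i ^ k" unfolding invert_elem_def by blast
    then obtain j where "s \<in> R j" by blast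
    then have "s \<in> ?L" using R_mono[of j "max i j"] RL[of "max i j"] by auto
    moreover have "inverse (x i) \<in> ?L" using inv[of "x i"] inc Bj(2,3)[of i] T0_inverse[OF i] by auto
    ultimately have "s * inverse (x i) ^ k \<in> ?L" using sL by (intro subring_mult subring_power)
    then show "z \<in> ?L" using s(2) by (simp add: divide_inverse power_inverse)
  qed
qed

lemmas T0_props = localization_noetherian_ufd_regular[OF y[of i1] TU_mult[of i1], folded T0_loc[OF order_refl]]

text \<open>Writing an element of \<open>B - S\<close> as \<open>a / b\<close> and dividing \<open>a\<close> and \<open>b\<close> by \<open>x i, x (i + 1), \<dots>\<close> as long
  as both stay in the maximal ideals, one either finds a multiple of some \<open>x j\<close> that is a unit of \<open>B\<close>, or an
  ascending chain of principal ideals of \<open>B\<close>.\<close>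

lemma T0_subset_noetherian: assumes B: "noetherian B" and SB: "S \<subset> B" shows "T0 \<subseteq> B"
proof -
  note sB = noeth_subring[OF B]
  have RB: "R j \<subseteq> B" for j using SB by blast
  have "\<exists>j\<ge>i1. inverse (x j) \<in> B"
  proof -
    obtain f where f: "f \<in> B" "f \<notin> S" using SB by blast
    obtain a b where ab: "a \<in> R i1" "b \<in> R i1" "b \<noteq> 0" "f = a / b"
      using qfR[of i1] unfolding quotient_field_is_ambient_def by blast
    have "a \<noteq> 0" using ab f subring_zero[OF S_subring] by auto
    \<comment> \<open>\<open>c z n\<close> is \<open>z\<close> divided by the first \<open>n\<close>
      of the elements \<open>x i1, x (i1 + 1), ...\<close>.\<close>
    define X where "X n = (\<Prod>l<n. x (i1 + l))" for n
    have X0: "X n \<noteq> 0" for n using Bj(3) by (simp add: X_def)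
    define c where "c z n = z / X n" for z n
    have c_Suc: "c z (Suc n) = c z n / x (i1 + n)" for z n by (simp add: c_def X_def)
    have c0: "c z 0 = z" for z by (simp add: c_def X_def)
    have nxt: "c z (Suc n) \<in> R (i1 + Suc n)" if "c z n \<in> m (i1 + n)" for z n
      using Tj(9)[OF that] Tj(3)[where j = "i1 + n"] by (auto simp: c_Suc)
    show ?thesis
    proof (cases "\<forall>n. c b n \<in> m (i1 + n)")
      case True
      define I where "I n = pid B (c b n)" for n
      have cB: "c b n \<in> B" for n using True m_sub RB by blast
      have cx: "c b n = x (i1 + n) * c b (Suc n)" for n using Bj(3) by (simp add: c_Suc)
      have "I n \<subseteq> I (Suc n)" for n
      proof -
        have "c b n \<in> pid B (c b (Suc n))" unfolding cx[of n] using Bj(2) RB by (intro pid_memI) blast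
        then show ?thesis unfolding I_def by (intro pid_least[OF pid_ideal[OF sB cB]])
      qed
      then obtain n where n: "\<forall>i\<ge>n. I i = I n"
        using noeth_acc[OF B, of I] pid_ideal[OF sB cB] unfolding I_def by blast
      have "I (Suc n) = I n" using n[rule_format, of "Suc n"] by simp
      then have "c b (Suc n) \<in> pid B (c b n)" using pid_mem[OF sB] unfolding I_def by blast
      then obtain r where r: "r \<in> B" "c b (Suc n) = r * c b n" by (rule pid_memE)
      moreover have "c b (Suc n) \<noteq> 0" using ab(3) X0 by (simp add: c_def)
      ultimately have "r * x (i1 + n) = 1" using cx[of n] by (simp add: mult.assoc)
      then have "inverse (x (i1 + n)) = r" using Bj(3)[of "i1 + n"] by (simp add: field_simps)
      then show ?thesis using r(1) by (intro exI[of _ "i1 + n"]) simp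
    next
      case False
      then have "\<exists>n. \<not> (c a n \<in> m (i1 + n) \<and> c b n \<in> m (i1 + n))" by blast
      then obtain n where n: "\<not> (c a n \<in> m (i1 + n) \<and> c b n \<in> m (i1 + n))"
        "\<And>k. k < n ==> c a k \<in> m (i1 + k) \<and> c b k \<in> m (i1 + k)"
        using exists_least_iff[of "\<lambda>n. \<not> (c a n \<in> m (i1 + n) \<and> c b n \<in> m (i1 + n))"] by blast
      let ?j = "i1 + n"
      have cR: "c a n \<in> R ?j" "c b n \<in> R ?j" using n(2)[of "n - 1"] nxt ab(1,2) c0 by (cases n; auto)+
      have fc: "f = c a n / c b n" unfolding c_def ab(4) using X0 by simp
      have nz: "c a n \<noteq> 0" "c b n \<noteq> 0" using \<open>a \<noteq> 0\<close> ab(3) X0 by (auto simp: c_def)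
      have bm: "c b n \<in> m ?j"
      proof (rule ccontr)
        assume "c b n \<notin> m ?j"
        then have "inverse (c b n) \<in> R ?j" by (rule local_unit(1)[OF Rj(2) cR(2)])
        from subring_mult[OF Rj(7) cR(1) this] have "f \<in> R ?j" by (simp add: fc divide_inverse)
        then show False using f(2) by blast
      qed
      \<comment> \<open>At the first failure \<open>c a n\<close> is a unit of \<open>R ?j\<close>
        while \<open>c b n\<close> can still be divided by \<open>x ?j\<close>. Multiplying that
        quotient by the inverse of \<open>c a n\<close> and by \<open>f\<close> gives the inverse of
        \<open>x ?j\<close>.\<close>
      then have "c a n \<notin> m ?j" using n(1) by simp
      then have "inverse (c a n) \<in> B" using local_unit(1)[OF Rj(2) cR(1)] RB by blast
      moreover have "c b (Suc n) \<in> B" using nxt[OF bm] RB by blast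
      ultimately have "c b (Suc n) * inverse (c a n) * f \<in> B" using f(1) sB by (intro subring_mult)
      moreover have "c b (Suc n) * inverse (c a n) * f = inverse (x ?j)"
        using nz Bj(3)[of ?j] by (simp add: fc c_Suc field_simps)
      ultimately show ?thesis by (intro exI[of _ ?j]) simp
    qed
  qed
  then obtain j where j: "i1 \<le> j" "inverse (x j) \<in> B" by blast
  show ?thesis
  proof
    fix z assume "z \<in> T0"
    then have "z \<in> invert_elem S (x j)" using T0_eq[OF j(1)] by simp
    then obtain s k where "s \<in> S" "z = s / x j ^ k" unfolding invert_elem_def by blast
    then show "z \<in> B" using subring_mult[OF sB _ subring_power[OF sB j(2)], of s k] SB by (auto simp: divide_inverse power_inverse)
  qed
qed

lemma T0_separate:
  assumes f: "f \<notin> T0"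
  obtains P where "pel T0 P" "f \<notin> loc_at T0 (pid T0 P)" "dvr (loc_at T0 (pid T0 P))" "T0 \<subseteq> loc_at T0 (pid T0 P)"
proof -
  have qfT: "quotient_field_is_ambient T0" by (rule qf_mono[OF qf R_T0])
  obtain P where P: "pel T0 P" "f \<notin> loc_at T0 (pid T0 P)" by (rule pel_separates[OF T0_props(1,2) qfT f])
  moreover have "dvr (loc_at T0 (pid T0 P))" by (rule pel_loc_dvr[OF T0_props(1) P(1) qfT])
  moreover have "T0 \<subseteq> loc_at T0 (pid T0 P)"
    unfolding loc_at_eq by (rule loc_incl[OF T0_subring prime_compl_mult[OF T0_subring pelD(3)[OF P(1)]]])
  ultimately show ?thesis by (rule that)
qed

lemma Inter_dvr_eq: "\<Inter>{W. dvr W \<and> S \<subset> W} = T0"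
proof
  show "\<Inter>{W. dvr W \<and> S \<subset> W} \<subseteq> T0"
  proof
    fix f assume f: "f \<in> \<Inter>{W. dvr W \<and> S \<subset> W}"
    show "f \<in> T0"
    proof (rule ccontr)
      assume "f \<notin> T0"
      then obtain P where P: "f \<notin> loc_at T0 (pid T0 P)" "dvr (loc_at T0 (pid T0 P))" "T0 \<subseteq> loc_at T0 (pid T0 P)"
        using T0_separate by blast
      then have "S \<subset> loc_at T0 (pid T0 P)" using S_psubset_T0 by blast
      then show False using f P by blast
    qed
  qed
  show "T0 \<subseteq> \<Inter>{W. dvr W \<and> S \<subset> W}" using T0_subset_noetherian dvr_noetherian by blast
qed

text \<open>Descends along the sequence to the last \<open>j\<close> with \<open>x j \<in> Q\<close>.\<close>

lemma loc_at_descend: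
  "prime_in (R i) Q ==> dvr (loc_at (R i) Q) ==>
    (\<exists>l. loc_at (R i) Q = V l) \<or> loc_at (R i) Q = loc_at (R 0) (Q \<inter> R 0)"
proof (induction i arbitrary: Q)
  case 0
  then show ?case using ideal_subset[OF prime_ideal] by (metis Int_absorb2)
next
  case (Suc i)
  note Q = Suc.prems
  show ?case
  proof (cases "x i \<in> Q")
    case True
    \<comment> \<open>The nonzero prime generated by \<open>x i\<close> lies in \<open>Q\<close>,
      whose local ring is a discrete valuation ring, so the two primes coincide.\<close>
    have "pid (R (Suc i)) (x i) \<noteq> {0}" using pid_mem[OF Rj(7), of "x i" "Suc i"] Bj(3)[of i] by auto
    then have "pid (R (Suc i)) (x i) = Q"
      using dvr_loc_prime_eq[OF Rj(7) Q pelD(3)[OF x_pel]] pid_least[OF prime_ideal[OF Q(1)] True] by blast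
    then show ?thesis using V_eq by blast
  next
    case False
    have "loc_at (R (Suc i)) Q = loc_at (R i) (Q \<inter> R i)"
      using transform_loc_at[OF y[of i] e0 q] Q(1) False unfolding R_Suc by blast
    moreover have "prime_in (R i) (Q \<inter> R i)" by (rule subring_Int_prime[OF Rj(7) Tj(4) Q(1)])
    moreover have "Q \<inter> R i \<inter> R 0 = Q \<inter> R 0" using R_mono[of 0 i] by auto
    ultimately show ?thesis using Suc.IH[of "Q \<inter> R i"] Q(2) by simp
  qed
qed

text \<open>A nonzero element of \<open>P\<close> has an irreducible factor in \<open>P\<close>,
  which is prime by factoriality; height one leaves no room between its ideal and
  \<open>P\<close>.\<close>

lemma height_one_pel:
  assumes P: "height_one_prime (R 0) P" obtains f where "pel (R 0) f" "P = pid (R 0) f"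
proof -
  have pr: "prime_in (R 0) P" using P by (simp add: height_one_prime_def)
  obtain C where "\<forall>i\<le>1. prime_in (R 0) (C i)" "\<forall>i<1. C i \<subset> C (Suc i)" and C1: "C 1 = P"
    using P unfolding height_one_prime_def prime_chain_to_def by blast
  then have C: "prime_in (R 0) (C 0)" "C 0 \<subset> P" by auto
  then obtain g where g: "g \<in> P" "g \<noteq> 0" using prime_zero[OF C(1)] by blast
  have gR: "g \<in> R 0" using ideal_sub[OF prime_ideal[OF pr] g(1)] .
  obtain u xs where u: "unit_in (R 0) u" "\<forall>p\<in>set xs. irreducible_in (R 0) p" "g = u * prod_list xs"
    using atomic_factorization[OF Rj(1) gR g(2)] by blast
  have "inverse u * g \<in> P" using ideal_mult[OF prime_ideal[OF pr] unit_inD(3)[OF u(1)] g(1)] .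
  then have pl: "prod_list xs \<in> P" using u(3) unit_inD(2)[OF u(1)] by (simp add: mult.assoc[symmetric])
  have "\<exists>f\<in>set xs. f \<in> P" using pl u(2)
  proof (induction xs)
    case Nil then show ?case using prime_not_one[OF pr] by simp
  next
    case (Cons a xs)
    have "prod_list xs \<in> R 0" using Cons.prems(2) irreducibleD(1) by (intro subring_prod_list[OF Rj(7)]) auto
    then show ?case using prime_mult[OF pr, of a "prod_list xs"] Cons irreducibleD(1) by auto
  qed
  then obtain f where f: "f \<in> P" "pel (R 0) f" using regular_local_factorial[OF y] u(2) by blast
  have "pid (R 0) f = P"
  proof (rule ccontr)
    assume "pid (R 0) f \<noteq> P"
    then have less: "pid (R 0) f \<subset> P" using pid_least[OF prime_ideal[OF pr] f(1)] by blast
    have "{0} \<subset> pid (R 0) f" using pid_mem[OF Rj(7), of f 0] pelD(2)[OF f(2)] prime_zero[OF pelD(3)[OF f(2)]] by auto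
    then have "prime_chain_to (R 0) P 2"
      unfolding prime_chain_to_def using less pr pelD(3)[OF f(2)] prime_zero_ideal[OF Rj(7), of 0]
      by (intro exI[of _ "\<lambda>i. if i = 0 then {0} else if i = 1 then pid (R 0) f else P"]) (auto simp: le_Suc_eq less_Suc_eq numeral_2_eq_2)
    then show False using P by (simp add: height_one_prime_def)
  qed
  with f(2) show ?thesis using that by blast
qed

lemma T0_eq_Inter:
  "T0 = \<Inter>({loc_at (R 0) P | P. height_one_prime (R 0) P \<and> S \<subseteq> loc_at (R 0) P} \<union> {V i | i. S \<subseteq> V i})" (is "_ = \<Inter>?X")
proof (intro equalityI subsetI)
  fix z assume z: "z \<in> T0"
  have zW: "z \<in> W" if "dvr W \<and> S \<subset> W" for W using T0_subset_noetherian[OF dvr_noetherian] that z by blast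
  have hP: "dvr (loc_at (R 0) P) \<and> S \<subset> loc_at (R 0) P" if P: "height_one_prime (R 0) P" "S \<subseteq> loc_at (R 0) P" for P
  proof -
    obtain f where "pel (R 0) f" "P = pid (R 0) f" by (rule height_one_pel[OF P(1)])
    then show ?thesis using loc_prime_element[of 0 f] P(2) by blast
  qed
  have hV: "dvr (V i) \<and> S \<subset> V i" if "S \<subseteq> V i" for i
    unfolding V_eq[of i] using loc_prime_element[OF x_pel that[unfolded V_eq[of i]]] by (intro conjI)
  show "z \<in> \<Inter>?X"
  proof (rule InterI)
    fix W assume "W \<in> ?X"
    then consider P where "W = loc_at (R 0) P" "height_one_prime (R 0) P" "S \<subseteq> loc_at (R 0) P"
      | i where "W = V i" "S \<subseteq> V i" by blast
    then show "z \<in> W"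
    proof cases
      case 1 then show ?thesis using zW[OF hP] by simp
    next
      case 2 then show ?thesis using zW[OF hV] by simp
    qed
  qed
next
  fix f assume f: "f \<in> \<Inter>?X"
  show "f \<in> T0"
  proof (rule ccontr)
    assume "f \<notin> T0"
    then obtain P where P: "pel T0 P" "f \<notin> loc_at T0 (pid T0 P)" "dvr (loc_at T0 (pid T0 P))" "T0 \<subseteq> loc_at T0 (pid T0 P)"
      by (rule T0_separate)
    let ?W = "loc_at T0 (pid T0 P)" and ?Q = "pid T0 P \<inter> R i1"
    have pr: "prime_in (loc_mult (R i1) (TU i1)) (pid T0 P)" using pelD(3)[OF P(1)] T0_loc[OF order_refl] by simp
    have W: "?W = loc_at (R i1) ?Q" using loc_at_loc(1)[OF Rj(7) TU_mult pr] T0_loc[OF order_refl] by simp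
    have Q: "prime_in (R i1) ?Q" using contr_prime(1)[OF Rj(7) TU_mult pr] .
    have SW: "S \<subseteq> ?W" using S_T0 P(4) by blast
    \<comment> \<open>Traced down the sequence, the separating valuation ring is either one of the
      \<open>V l\<close> or the local ring of its center on \<open>R 0\<close>, which is then shown
      to have height one.\<close>
    consider l where "?W = V l" | "?W = loc_at (R 0) (?Q \<inter> R 0)"
      using loc_at_descend[OF Q] P(3) unfolding W by blast
    then show False
    proof cases
      case 1 then show ?thesis using f SW P(2) by blast
    next
      case 2
      let ?P = "?Q \<inter> R 0"
      have pP: "prime_in (R 0) ?P" by (rule subring_Int_prime[OF Rj(7) R_mono[OF le0] Q])
      have eq: "P' = ?P" if "prime_in (R 0) P'" "P' \<noteq> {0}" "P' \<subseteq> ?P" for P'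
        using dvr_loc_prime_eq[OF Rj(7) pP _ that] P(3) 2 by simp
      \<comment> \<open>Otherwise \<open>?W\<close> would be the whole field and could not omit
        \<open>f\<close>.\<close>
      have "?P \<noteq> {0}"
      proof
        assume "?P = {0}"
        then have W0: "?W = loc_at (R 0) {0}" using 2 by simp
        obtain a b where "a \<in> R 0" "b \<in> R 0" "b \<noteq> 0" "f = a / b" using qf unfolding quotient_field_is_ambient_def by blast
        then have "f \<in> loc_at (R 0) {0}" unfolding loc_at_def by blast
        then show False using P(2) W0 by simp
      qed
      then have "{0} \<subset> ?P" using prime_zero[OF pP] by blast
      then have "prime_chain_to (R 0) ?P 1"
        unfolding prime_chain_to_def using pP prime_zero_ideal[OF Rj(7), of 0]
        by (intro exI[of _ "\<lambda>i. if i = 0 then {0} else ?P"]) auto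
      moreover have "\<not> prime_chain_to (R 0) ?P 2"
      proof
        assume "prime_chain_to (R 0) ?P 2"
        then obtain C where C: "\<forall>i\<le>2. prime_in (R 0) (C i)" "\<forall>i<2. C i \<subset> C (Suc i)" "C 2 = ?P"
          unfolding prime_chain_to_def by blast
        have c: "C 0 \<subset> C 1" "C 1 \<subset> ?P" "prime_in (R 0) (C 0)" "prime_in (R 0) (C 1)"
          using C(1)[rule_format, of 0] C(1)[rule_format, of 1] C(2)[rule_format, of 0] C(2)[rule_format, of 1] C(3)
          by (auto simp: numeral_2_eq_2)
        have "0 \<in> C 0" by (rule prime_zero[OF c(3)])
        then have "C 1 \<noteq> {0}" using c(1) by auto
        then show False using eq[OF c(4)] c(2) by blast
      qed
      ultimately have "height_one_prime (R 0) ?P" using pP by (simp add: height_one_prime_def)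
      moreover have "S \<subseteq> loc_at (R 0) ?P" using SW unfolding 2 .
      ultimately have "f \<in> loc_at (R 0) ?P" using f by blast
      then show False using P(2) unfolding 2 by blast
    qed
  qed
qed

end

end

theorem theorem4p1:
  fixes R :: "nat \<Rightarrow> 'a::field set" and m :: "nat \<Rightarrow> 'a set"
    and S N T :: "'a set" and d :: nat
  assumes RLR: "\<forall>i. \<exists>e. 2 \<le> e \<and> regular_local_dim (R i) (m i) e"
    and dimR: "regular_local_dim (R 0) (m 0) d"
    and qf: "quotient_field_is_ambient (R 0)"
    and lqt: "\<forall>i. local_quadratic_transform (R i) (m i) (R (Suc i))"
    and strict: "\<forall>i. R i \<subset> R (Suc i)"
    and S_def: "S = (\<Union>i. R i)"
    and N_def: "N = (\<Union>i. m i)"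
    and T_def: "T = \<Inter>{V. dvr V \<and> S \<subset> V}"
  shows
    "(\<forall>x\<in>N. primary_to S N {x * s | s. s \<in> S} \<longrightarrow> T = invert_elem S x)
     \<and> (\<exists>i0. \<forall>i\<ge>i0. is_localization_of T (R i))
     \<and> ufd T
     \<and> T = \<Inter>({loc_at (R 0) P | P. height_one_prime (R 0) P \<and> S \<subseteq> loc_at (R 0) P}
              \<union> {order_valuation_ring (R i) (m i) | i. S \<subseteq> order_valuation_ring (R i) (m i)})
     \<and> finite {order_valuation_ring (R i) (m i) | i. S \<subseteq> order_valuation_ring (R i) (m i)}
     \<and> card {order_valuation_ring (R i) (m i) | i. S \<subseteq> order_valuation_ring (R i) (m i)} \<le> d - 1
     \<and> noetherian T \<and> regular_ring T
     \<and> S \<subset> T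
     \<and> (\<forall>B. noetherian B \<and> S \<subset> B \<longrightarrow> T \<subseteq> B)"
proof -
  \<comment> \<open>Each transform is normalized: its defining element lies outside the square of
    \<open>m i\<close>, so it starts a regular system. The two descriptions of the maximal ideal of
    \<open>R (Suc i)\<close> agree since a local ring has only one.\<close>
  have "\<exists>y e q. regsys (R i) (m i) y e \<and> 2 \<le> e \<and> prime_in (blow (R i) (m i) (y 0)) q \<and> m i \<subseteq> q \<and>
     R (Suc i) = loc_at (blow (R i) (m i) (y 0)) q \<and> m (Suc i) = mloc (blow (R i) (m i) (y 0)) q" for i
  proof -
    obtain e where e: "2 \<le> e" "regular_local_dim (R i) (m i) e" using RLR by blast
    obtain z where z: "regsys (R i) (m i) z e" by (rule regular_local_regsys[OF e(2)])
    note D = regsysD[OF z]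
    obtain x q where x: "x \<in> m i" "x \<notin> ideal_pow (R i) (m i) 2" "prime_in (blowup_ring (R i) (m i) x) q"
      "m i \<subseteq> q" "R (Suc i) = loc_at (blowup_ring (R i) (m i) x) q"
      using lqt unfolding local_quadratic_transform_def by blast
    have "x \<noteq> 0" using x(2) ideal_zero[OF ideal_pow_ideal[OF D(7,8)]] by blast
    then have b: "blowup_ring (R i) (m i) x = blow (R i) (m i) x" by (rule blowup_ring_eq_blow[OF D(7,8) x(1)])
    obtain y where y: "regsys (R i) (m i) y e" "y 0 = x" "0 < e" by (rule regsys_first[OF z x(1,2)])
    have "local_ring (R (Suc i)) (mloc (blow (R i) (m i) x) q)"
      unfolding x(5) b by (rule loc_at_local) (use x(3) b blow_facts(5)[OF y(1,3)] y(2) in auto)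
    moreover have "local_ring (R (Suc i)) (m (Suc i))" using RLR unfolding regular_local_dim_def by blast
    ultimately have "m (Suc i) = mloc (blow (R i) (m i) x) q" unfolding local_ring_def by blast
    then show ?thesis using y x e b by (intro exI[of _ y] exI[of _ e] exI[of _ q]) simp
  qed
  then obtain y e q where Y: "\<And>i. regsys (R i) (m i) (y i) (e i)" "\<And>i. 2 \<le> e i"
    "\<And>i. prime_in (blow (R i) (m i) (y i 0)) (q i)" "\<And>i. m i \<subseteq> q i"
    "\<And>i. R (Suc i) = loc_at (blow (R i) (m i) (y i 0)) (q i)"
    "\<And>i. m (Suc i) = mloc (blow (R i) (m i) (y i 0)) (q i)" by metis
  obtain z where "regsys (R 0) (m 0) z d" by (rule regular_local_regsys[OF dimR])
  then have d: "e 0 = d" by (rule regsys_dim_unique[OF Y(1)])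
  interpret L: transform_sequence R m y e q by unfold_locales (fact Y qf)+
  obtain i1 where i1: "\<forall>i\<ge>i1. \<forall>a\<in>\<Union>j. m j. \<exists>n. \<exists>s\<in>\<Union>j. R j. a ^ n = y i 0 * s"
    by (rule exE[OF L.x_radical])
  have T: "T = invert_elem S (y i1 0)" unfolding T_def S_def by (rule L.Inter_dvr_eq[OF i1])
  let ?W = "{order_valuation_ring (R i) (m i) | i. S \<subseteq> order_valuation_ring (R i) (m i)}"
  \<comment> \<open>The bound was proved for the indices; passing to the rings themselves can only
    lower the number.\<close>
  have W: "?W = (\<lambda>i. order_valuation_ring (R i) (m i)) ` {i. S \<subseteq> order_valuation_ring (R i) (m i)}" by blast
  note sc = L.survivors_card[folded S_def]
  show ?thesis
  proof (intro conjI ballI allI impI)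
    show "T = invert_elem S x" if "x \<in> N" "primary_to S N {x * s | s. s \<in> S}" for x
      using L.T0_primary[OF i1, where z = x] that unfolding T S_def N_def by simp
    show "\<exists>i0. \<forall>i\<ge>i0. is_localization_of T (R i)"
      unfolding is_localization_of_def T S_def
      using L.TU_mult[OF i1] L.T0_loc[OF i1] by blast
    show "noetherian T" "ufd T" "regular_ring T" using L.T0_props(1,3,4)[OF i1, folded S_def, folded T] .
    show "T = \<Inter>({loc_at (R 0) P | P. height_one_prime (R 0) P \<and> S \<subseteq> loc_at (R 0) P} \<union> ?W)"
      by (rule L.T0_eq_Inter[OF i1, folded S_def, folded T])
    show "finite ?W" unfolding W by (rule finite_imageI[OF sc(1)])
    show "card ?W \<le> d - 1" unfolding W using card_image_le[OF sc(1)] sc(2) d by (metis order_trans)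
    show "S \<subset> T" by (rule L.S_psubset_T0[OF i1, folded S_def, folded T])
    show "T \<subseteq> B" if "noetherian B \<and> S \<subset> B" for B
      using L.T0_subset_noetherian[OF i1, folded S_def, folded T, of B] that by simp
  qed
qed

end
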